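(* Let $q\ge 0$, $\mathbf d=(d_0,\ldots,d_{q+1})$ with $d_0=d$ and $d_{q+1}=1$, $\mathbf t=(t_0,\ldots,t_q)$ with $1\le t_i\le d_i$, $\boldsymbol\beta=(\beta_0,\ldots,\beta_q)\in(0,\infty)^{q+1}$ and $K>0$. Consider the $d$-variate nonparametric regression model $Y_i=f_0(\mathbf X_i)+\varepsilon_i$, $i=1,\ldots,n$, with $n\geq 2$ and $f_0$ in the composition class $\mathcal G(q,\mathbf d,\mathbf t,\boldsymbol\beta,K)$. Put $$\beta_i^*:=\beta_i\prod_{\ell=i+1}^q(\beta_\ell\wedge 1),\qquad \phi_n:=\max_{i=0,\ldots,q} n^{-\frac{2\beta_i^*}{2\beta_i^*+t_i}}.$$ Let $\widehat f_n$ be an estimator taking values in the network class $\mathcal F(L,(p_i)_{i=0,\ldots,L+1},s,F)$ (with $p_0=d$, $p_{L+1}=1$), where $L$, $(p_i)_i$, $s$ may depend on $n$, satisfying (i) $F\ge\max(K,1)$, (ii) $\sum_{i=0}^q\log_2(4t_i\vee 4\beta_i)\log_2 n\le L\lesssim n\phi_n$, (iii) $n\phi_n\lesssim\min_{i=1,\ldots,L}p_i$, (iv) $s\asymp n\phi_n\log n$. Then there exist constants $C,C'>0$ depending only on $q,\mathbf d,\mathbf t,\boldsymbol\beta,F$ (and on the implied constants in (ii)-(iv)), such that if $\Delta_n(\widehat f_n,f_0)\le C\phi_nL\log^2 n$, then $$R(\widehat f_n,f_0)\le C'\phi_nL\log^2 n,$$ and if $\Delta_n(\widehat f_n,f_0)\ge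 C\phi_nL\log^2 n$, then $$\frac1{C'}\Delta_n(\widehat f_n,f_0)\le R(\widehat f_n,f_0)\le C'\Delta_n(\widehat f_n,f_0).$$
   Context: Regression model: $\mathbf X_1,\ldots,\mathbf X_n\in[0,1]^d$ are i.i.d. random vectors, $\varepsilon_1,\ldots,\varepsilon_n$ are i.i.d. standard normal and independent of $(\mathbf X_i)_i$, and $Y_i=f_0(\mathbf X_i)+\varepsilon_i$ with $f_0:[0,1]^d\to\mathbb R$. $E_{f_0}$ denotes expectation when the regression function is $f_0$. Networks: $\sigma(x)=\max(x,0)$, and for $\mathbf v\in\mathbb R^r$, $\sigma_{\mathbf v}(y_1,\ldots,y_r)=(\sigma(y_1-v_1),\ldots,\sigma(y_r-v_r))^\top$. For a positive integer $L$ and width vector $\mathbf p=(p_0,\ldots,p_{L+1})$ of positive integers, a network with architecture $(L,\mathbf p)$ is a function $f:\mathbb R^{p_0}\to\mathbb R^{p_{L+1}}$, $f(\mathbf x)=W_L\sigma_{\mathbf v_L}W_{L-1}\sigma_{\mathbf v_{L-1}}\cdots W_1\sigma_{\mathbf v_1}W_0\mathbf x$, with $W_i$ a $p_{i+1}\times p_i$ matrix and $\mathbf v_i\in\mathbb R^{p_i}$. With $\|W\|_\infty$ the maximum absolute entry, $\|W\|_0$, $|\mathbf v|_0$ the numbers of nonzero entries, and $\mathbf v_0:=0$, $\mathcal F(L,\mathbf p)$ is the set of such $f$ with $\max_{j=0,\ldots,L}\|W_j\|_\infty\vee|\mathbf v_j|_\infty\le1$, and $\mathcal F(L,\mathbf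 p,s,F)$ is the set of $f\in\mathcal F(L,\mathbf p)$ with $\sum_{j=0}^L(\|W_j\|_0+|\mathbf v_j|_0)\le s$ and $\sup_{\mathbf x\in[0,1]^{p_0}}|f(\mathbf x)|_\infty\le F$. Risk quantities: for an estimator $\widehat f_n$ (a function of the data) with values in $\mathcal F(L,\mathbf p,s,F)$, $$\Delta_n(\widehat f_n,f_0):=E_{f_0}\Big[\frac1n\sum_{i=1}^n(Y_i-\widehat f_n(\mathbf X_i))^2-\inf_{f\in\mathcal F(L,\mathbf p,s,F)}\frac1n\sum_{i=1}^n(Y_i-f(\mathbf X_i))^2\Big],$$ $$R(\widehat f_n,f_0):=E_{f_0}\big[(\widehat f_n(\mathbf X)-f_0(\mathbf X))^2\big],$$ where $\mathbf X$ has the distribution of $\mathbf X_1$ and is independent of the sample. Hölder balls: $\lfloor\beta\rfloor$ denotes the largest integer strictly smaller than $\beta$. For $D\subset\mathbb R^r$, $\mathcal C_r^\beta(D,K)$ is the set of $f:D\to\mathbb R$ with $$\sum_{\boldsymbol\alpha:|\boldsymbol\alpha|<\beta}\|\partial^{\boldsymbol\alpha}f\|_\infty+\sum_{\boldsymbol\alpha:|\boldsymbol\alpha|=\lfloor\beta\rfloor}\ \sup_{\mathbf x\ne\mathbf y\in D}\frac{|\partial^{\boldsymbol\alpha}f(\mathbf x)-\partial^{\boldsymbol\alpha}f(\mathbf y)|}{|\mathbf x-\mathbf y|_\infty^{\beta-\lfloor\beta\rfloor}}\le K,$$ with multi-indices $\boldsymbol\alpha$ of nonnegative integers and $|\boldsymbol\alpha|=|\boldsymbol\alpha|_1$.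 Composition class: $\mathcal G(q,\mathbf d,\mathbf t,\boldsymbol\beta,K)$ is the set of $f=g_q\circ\cdots\circ g_0$ with $g_i=(g_{ij})_{j=1,\ldots,d_{i+1}}:[a_i,b_i]^{d_i}\to[a_{i+1},b_{i+1}]^{d_{i+1}}$ for some $|a_i|,|b_i|\le K$ (with $a_0=0,b_0=1$), where each $g_{ij}$ depends on at most $t_i$ of its $d_i$ arguments and, as a $t_i$-variate function, $g_{ij}\in\mathcal C_{t_i}^{\beta_i}([a_i,b_i]^{t_i},K)$. Notation: $a_n\lesssim b_n$ means $a_n\le \mathrm{const}\cdot b_n$ for all $n$ with a constant independent of $n$; $a_n\asymp b_n$ means $a_n\lesssim b_n$ and $b_n\lesssim a_n$; $x\wedge y=\min$, $x\vee y=\max$. *)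

theory Defs
  imports "HOL-Probability.Probability"
begin

text \<open>Vectors in \<open>R^r\<close> are functions \<open>nat \<Rightarrow> real\<close> whose components are those with index \<open>< r\<close>;
  they are extensional, i.e. elements of \<open>{..<r} \<rightarrow>\<^sub>E UNIV\<close>. Matrices are indexed from 0 likewise.\<close>

definition sup_norm :: "nat \<Rightarrow> (nat \<Rightarrow> real) \<Rightarrow> real" where
  "sup_norm r x = (MAX i\<in>{..<r}. \<bar>x i\<bar>)"

definition cube :: "nat \<Rightarrow> real \<Rightarrow> real \<Rightarrow> (nat \<Rightarrow> real) set" where
  "cube r a b = ({..<r} \<rightarrow>\<^sub>E {a..b})"


subsection \<open>Sparse ReLU networks\<close>

definition mat_sup_norm :: "nat \<Rightarrow> nat \<Rightarrow> (nat \<Rightarrow> nat \<Rightarrow> real) \<Rightarrow> real" where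
  "mat_sup_norm m n W = (MAX (i, j)\<in>{..<m} \<times> {..<n}. \<bar>W i j\<bar>)"

definition mat_nnz :: "nat \<Rightarrow> nat \<Rightarrow> (nat \<Rightarrow> nat \<Rightarrow> real) \<Rightarrow> nat" where
  "mat_nnz m n W = card {(i, j). i < m \<and> j < n \<and> W i j \<noteq> 0}"

definition vec_nnz :: "nat \<Rightarrow> (nat \<Rightarrow> real) \<Rightarrow> nat" where
  "vec_nnz r v = card {i. i < r \<and> v i \<noteq> 0}"

definition mat_vec :: "nat \<Rightarrow> nat \<Rightarrow> (nat \<Rightarrow> nat \<Rightarrow> real) \<Rightarrow> (nat \<Rightarrow> real) \<Rightarrow> nat \<Rightarrow> real" where
  "mat_vec m n W x = (\<lambda>i\<in>{..<m}. \<Sum>j<n. W i j * x j)"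

definition shifted_relu :: "nat \<Rightarrow> (nat \<Rightarrow> real) \<Rightarrow> (nat \<Rightarrow> real) \<Rightarrow> nat \<Rightarrow> real" where
  "shifted_relu r v y = (\<lambda>i\<in>{..<r}. max (y i - v i) 0)"

primrec network ::
  "(nat \<Rightarrow> nat) \<Rightarrow> (nat \<Rightarrow> nat \<Rightarrow> nat \<Rightarrow> real) \<Rightarrow> (nat \<Rightarrow> nat \<Rightarrow> real) \<Rightarrow> nat
    \<Rightarrow> (nat \<Rightarrow> real) \<Rightarrow> nat \<Rightarrow> real" where
  "network p W v 0 x = mat_vec (p 1) (p 0) (W 0) x"
| "network p W v (Suc k) x =
     mat_vec (p (k + 2)) (p (k + 1)) (W (k + 1))
       (shifted_relu (p (k + 1)) (v (k + 1)) (network p W v k x))"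

text \<open>The entry bound and the sparsity bound refer to the same parametrisation \<open>(W, v)\<close> of \<open>f\<close>.\<close>

definition network_class ::
  "nat \<Rightarrow> (nat \<Rightarrow> nat) \<Rightarrow> real \<Rightarrow> real \<Rightarrow> ((nat \<Rightarrow> real) \<Rightarrow> nat \<Rightarrow> real) set" where
  "network_class L p s F = {f. \<exists>W v.
     f = network p W v L \<and> v 0 = (\<lambda>_. 0) \<and>
     (\<forall>j\<le>L. max (mat_sup_norm (p (j + 1)) (p j) (W j)) (sup_norm (p j) (v j)) \<le> 1) \<and>
     real (\<Sum>j\<le>L. mat_nnz (p (j + 1)) (p j) (W j) + vec_nnz (p j) (v j)) \<le> s \<and>
     (\<forall>x\<in>cube (p 0) 0 1. sup_norm (p (L + 1)) (f x) \<le> F)}"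


subsection \<open>Hoelder balls and compositions\<close>

text \<open>The largest integer strictly smaller than \<open>\<beta>\<close>, for \<open>\<beta> > 0\<close>.\<close>

definition sfloor :: "real \<Rightarrow> nat" where
  "sfloor \<beta> = nat (\<lceil>\<beta>\<rceil> - 1)"

definition multi_indices :: "nat \<Rightarrow> (nat \<Rightarrow> nat) set" where
  "multi_indices r = {\<alpha>. \<forall>i\<ge>r. \<alpha> i = 0}"

definition order_mi :: "nat \<Rightarrow> (nat \<Rightarrow> nat) \<Rightarrow> nat" where
  "order_mi r \<alpha> = (\<Sum>i<r. \<alpha> i)"

text \<open>\<open>u \<alpha>\<close> is the partial derivative of \<open>f\<close> with multi-index \<open>\<alpha>\<close> on the cube, for all orders up to
  \<open>m\<close>; derivatives at the faces are one-sided. Since \<open>u\<close> is indexed by multi-indices, mixed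
  derivatives exist in every order of differentiation and do not depend on it. For \<open>a < b\<close> the
  functions \<open>u \<alpha>\<close> are determined by \<open>f\<close> on the cube.\<close>

definition partial_derivs ::
  "nat \<Rightarrow> real \<Rightarrow> real \<Rightarrow> nat \<Rightarrow> ((nat \<Rightarrow> real) \<Rightarrow> real)
    \<Rightarrow> ((nat \<Rightarrow> nat) \<Rightarrow> (nat \<Rightarrow> real) \<Rightarrow> real) \<Rightarrow> bool" where
  "partial_derivs r a b m f u \<longleftrightarrow>
     (\<forall>x\<in>cube r a b. u (\<lambda>_. 0) x = f x) \<and>
     (\<forall>\<alpha>\<in>multi_indices r. order_mi r \<alpha> < m \<longrightarrow>
        (\<forall>i<r. \<forall>x\<in>cube r a b.
           ((\<lambda>y. u \<alpha> (x(i := y))) has_real_derivative u (\<alpha>(i := Suc (\<alpha> i))) x)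
             (at (x i) within {a..b})))"

text \<open>Suprema are taken in \<open>ennreal\<close>, so that unbounded derivatives or quotients give \<open>\<infinity>\<close>.\<close>

definition holder_ball ::
  "nat \<Rightarrow> real \<Rightarrow> real \<Rightarrow> real \<Rightarrow> real \<Rightarrow> ((nat \<Rightarrow> real) \<Rightarrow> real) set" where
  "holder_ball r \<beta> a b K = {f. \<exists>u. partial_derivs r a b (sfloor \<beta>) f u \<and>
     (\<Sum>\<alpha> | \<alpha> \<in> multi_indices r \<and> real (order_mi r \<alpha>) < \<beta>.
        SUP x\<in>cube r a b. ennreal \<bar>u \<alpha> x\<bar>) +
     (\<Sum>\<alpha> | \<alpha> \<in> multi_indices r \<and> order_mi r \<alpha> = sfloor \<beta>.
        SUP (x, y)\<in>{(x, y). x \<in> cube r a b \<and> y \<in> cube r a b \<and> x \<noteq> y}.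
          ennreal (\<bar>u \<alpha> x - u \<alpha> y\<bar> / sup_norm r (\<lambda>k. x k - y k) powr (\<beta> - real (sfloor \<beta>))))
     \<le> ennreal K}"

primrec compose_upto :: "(nat \<Rightarrow> 'a \<Rightarrow> 'a) \<Rightarrow> nat \<Rightarrow> 'a \<Rightarrow> 'a" where
  "compose_upto g 0 = g 0"
| "compose_upto g (Suc k) = g (Suc k) \<circ> compose_upto g k"

text \<open>The domain \<open>[a 0, b 0] = [0, 1]\<close> is fixed; only the later intervals are constrained by \<open>K\<close>.
  The injection \<open>\<iota>\<close> selects the \<open>t i\<close> arguments on which the component \<open>g i _ j\<close> depends. As
  \<open>d (q + 1) = 1\<close>, the value of the composition is its component 0.\<close>

definition composition_class ::
  "nat \<Rightarrow> (nat \<Rightarrow> nat) \<Rightarrow> (nat \<Rightarrow> nat) \<Rightarrow> (nat \<Rightarrow> real) \<Rightarrow> real \<Rightarrow> ((nat \<Rightarrow> real) \<Rightarrow> real) set" where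
  "composition_class q d t \<beta> K = {f. \<exists>a b g.
     a 0 = 0 \<and> b 0 = 1 \<and>
     (\<forall>i\<in>{1..q + 1}. \<bar>a i\<bar> \<le> K \<and> \<bar>b i\<bar> \<le> K) \<and>
     (\<forall>i\<le>q. g i \<in> cube (d i) (a i) (b i) \<rightarrow> cube (d (i + 1)) (a (i + 1)) (b (i + 1))) \<and>
     (\<forall>i\<le>q. \<forall>j<d (i + 1). \<exists>\<iota> h.
        inj_on \<iota> {..<t i} \<and> \<iota> ` {..<t i} \<subseteq> {..<d i} \<and>
        h \<in> holder_ball (t i) (\<beta> i) (a i) (b i) K \<and>
        (\<forall>x\<in>cube (d i) (a i) (b i). g i x j = h (\<lambda>k\<in>{..<t i}. x (\<iota> k)))) \<and>
     (\<forall>x\<in>cube (d 0) 0 1. f x = compose_upto g q x 0)}"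

definition beta_star :: "nat \<Rightarrow> (nat \<Rightarrow> real) \<Rightarrow> nat \<Rightarrow> real" where
  "beta_star q \<beta> i = \<beta> i * (\<Prod>l\<in>{i + 1..q}. min (\<beta> l) 1)"

definition rate :: "nat \<Rightarrow> (nat \<Rightarrow> nat) \<Rightarrow> (nat \<Rightarrow> real) \<Rightarrow> nat \<Rightarrow> real" where
  "rate q t \<beta> n =
     (MAX i\<in>{..q}. real n powr (- (2 * beta_star q \<beta> i) / (2 * beta_star q \<beta> i + real (t i))))"


subsection \<open>Regression model, estimators and risks\<close>

text \<open>The underlying set of \<open>cube_space d\<close> is \<open>cube d 0 1\<close>.\<close>

definition cube_space :: "nat \<Rightarrow> (nat \<Rightarrow> real) measure" where
  "cube_space d = (\<Pi>\<^sub>M i\<in>{..<d}. restrict_space borel {0..1})"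

definition design_law :: "nat \<Rightarrow> (nat \<Rightarrow> real) measure \<Rightarrow> bool" where
  "design_law d P \<longleftrightarrow> prob_space P \<and> sets P = sets (cube_space d)"

definition std_normal :: "real measure" where
  "std_normal = density lborel (\<lambda>x. ennreal (std_normal_density x))"

type_synonym sample = "nat \<Rightarrow> (nat \<Rightarrow> real) \<times> real"

definition sample_space :: "nat \<Rightarrow> nat \<Rightarrow> sample measure" where
  "sample_space d n = (\<Pi>\<^sub>M i\<in>{..<n}. cube_space d \<Otimes>\<^sub>M borel)"

definition observation_law ::
  "nat \<Rightarrow> (nat \<Rightarrow> real) measure \<Rightarrow> ((nat \<Rightarrow> real) \<Rightarrow> real) \<Rightarrow> ((nat \<Rightarrow> real) \<times> real) measure" where
  "observation_law d P f0 =
     distr (P \<Otimes>\<^sub>M std_normal) (cube_space d \<Otimes>\<^sub>M borel) (\<lambda>(x, e). (x, f0 x + e))"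

text \<open>The joint law of the sample \<open>(X_i, Y_i)\<close>, \<open>i < n\<close>. All risks depend on the random variables
  only through this law, so expectations are taken directly with respect to it; the lemma
  \<open>distr_sample\<close> below shows that every regression model on a probability space has this law.\<close>

definition sample_law ::
  "nat \<Rightarrow> (nat \<Rightarrow> real) measure \<Rightarrow> ((nat \<Rightarrow> real) \<Rightarrow> real) \<Rightarrow> nat \<Rightarrow> sample measure" where
  "sample_law d P f0 n = (\<Pi>\<^sub>M i\<in>{..<n}. observation_law d P f0)"

text \<open>Joint measurability makes \<open>fhat z x 0\<close> a random variable when the sample \<open>z\<close> and the
  point \<open>x\<close> are random. Networks are real-valued here, with value in component 0.\<close>

definition estimator ::
  "nat \<Rightarrow> nat \<Rightarrow> ((nat \<Rightarrow> real) \<Rightarrow> nat \<Rightarrow> real) set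
    \<Rightarrow> (sample \<Rightarrow> (nat \<Rightarrow> real) \<Rightarrow> nat \<Rightarrow> real) \<Rightarrow> bool" where
  "estimator d n \<F> fhat \<longleftrightarrow>
     (\<forall>z\<in>space (sample_space d n). fhat z \<in> \<F>) \<and>
     (\<lambda>(z, x). fhat z x 0) \<in> borel_measurable (sample_space d n \<Otimes>\<^sub>M cube_space d)"

definition empirical_risk :: "nat \<Rightarrow> sample \<Rightarrow> ((nat \<Rightarrow> real) \<Rightarrow> nat \<Rightarrow> real) \<Rightarrow> real" where
  "empirical_risk n z f = 1 / real n * (\<Sum>i<n. (snd (z i) - f (fst (z i)) 0)\<^sup>2)"

definition delta_risk ::
  "nat \<Rightarrow> (nat \<Rightarrow> real) measure \<Rightarrow> ((nat \<Rightarrow> real) \<Rightarrow> nat \<Rightarrow> real) set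
    \<Rightarrow> nat \<Rightarrow> (sample \<Rightarrow> (nat \<Rightarrow> real) \<Rightarrow> nat \<Rightarrow> real) \<Rightarrow> ((nat \<Rightarrow> real) \<Rightarrow> real) \<Rightarrow> real" where
  "delta_risk d P \<F> n fhat f0 =
     (\<integral>z. (empirical_risk n z (fhat z) - (INF f\<in>\<F>. empirical_risk n z f)) \<partial>sample_law d P f0 n)"

definition prediction_risk ::
  "nat \<Rightarrow> (nat \<Rightarrow> real) measure \<Rightarrow> nat \<Rightarrow> (sample \<Rightarrow> (nat \<Rightarrow> real) \<Rightarrow> nat \<Rightarrow> real)
    \<Rightarrow> ((nat \<Rightarrow> real) \<Rightarrow> real) \<Rightarrow> real" where
  "prediction_risk d P n fhat f0 =
     (\<integral>(z, x). (fhat z x 0 - f0 x)\<^sup>2 \<partial>(sample_law d P f0 n \<Otimes>\<^sub>M P))"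

lemma space_cube_space: "space (cube_space d) = cube d 0 1"
  by (simp add: cube_space_def cube_def space_PiM)

lemma prob_space_std_normal: "prob_space std_normal"
  unfolding std_normal_def by (rule prob_space_normal_density) simp

lemma sets_std_normal [measurable_cong]: "sets std_normal = sets borel"
  by (simp add: std_normal_def)

lemma PiM_pair_eq_distr:
  assumes I: "finite I" and P: "prob_space P" and N: "prob_space N"
  shows "(\<Pi>\<^sub>M i\<in>I. P \<Otimes>\<^sub>M N) =
    distr ((\<Pi>\<^sub>M i\<in>I. P) \<Otimes>\<^sub>M (\<Pi>\<^sub>M i\<in>I. N)) (\<Pi>\<^sub>M i\<in>I. P \<Otimes>\<^sub>M N) (\<lambda>(x, e). \<lambda>i\<in>I. (x i, e i))"
proof -
  interpret P: prob_space P by fact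
  interpret N: prob_space N by fact
  interpret PN: pair_prob_space P N ..
  interpret PI: product_prob_space "\<lambda>_. P" I by unfold_locales
  interpret NI: product_prob_space "\<lambda>_. N" I by unfold_locales
  interpret PNI: product_prob_space "\<lambda>_. P \<Otimes>\<^sub>M N" I by unfold_locales
  have PiN: "sigma_finite_measure (\<Pi>\<^sub>M i\<in>I. N)"
    by (intro prob_space_imp_sigma_finite prob_space_PiM N)
  let ?D = "distr ((\<Pi>\<^sub>M i\<in>I. P) \<Otimes>\<^sub>M (\<Pi>\<^sub>M i\<in>I. N)) (\<Pi>\<^sub>M i\<in>I. P \<Otimes>\<^sub>M N) (\<lambda>(x, e). \<lambda>i\<in>I. (x i, e i))"
  have zip: "(\<lambda>(x, e). \<lambda>i\<in>I. (x i, e i))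
      \<in> (\<Pi>\<^sub>M i\<in>I. P) \<Otimes>\<^sub>M (\<Pi>\<^sub>M i\<in>I. N) \<rightarrow>\<^sub>M (\<Pi>\<^sub>M i\<in>I. P \<Otimes>\<^sub>M N)"
    by measurable
  have "?D = (\<Pi>\<^sub>M i\<in>I. P \<Otimes>\<^sub>M N)"
  proof (rule PNI.PiM_eqI[OF I])
    fix A assume A: "\<And>i. i \<in> I \<Longrightarrow> A i \<in> sets (P \<Otimes>\<^sub>M N)"
    note A' [measurable] = A
    have "emeasure ?D (Pi\<^sub>E I A) = (\<integral>\<^sup>+z. indicator (Pi\<^sub>E I A) z \<partial>?D)"
      using A I by (intro nn_integral_indicator[symmetric]) (auto intro!: sets_PiM_I_finite)
    also have "\<dots> = (\<integral>\<^sup>+w. indicator (Pi\<^sub>E I A) ((\<lambda>(x, e). \<lambda>i\<in>I. (x i, e i)) w)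
        \<partial>((\<Pi>\<^sub>M i\<in>I. P) \<Otimes>\<^sub>M (\<Pi>\<^sub>M i\<in>I. N)))"
      using A I zip by (intro nn_integral_distr) (auto intro!: sets_PiM_I_finite borel_measurable_indicator)
    also have "\<dots> = (\<integral>\<^sup>+w. (\<Prod>i\<in>I. indicator (A i) (fst w i, snd w i))
        \<partial>((\<Pi>\<^sub>M i\<in>I. P) \<Otimes>\<^sub>M (\<Pi>\<^sub>M i\<in>I. N)))"
      using I by (intro nn_integral_cong) (auto simp: indicator_def PiE_iff split: if_splits)
    also have "\<dots> = (\<integral>\<^sup>+x. \<integral>\<^sup>+e. (\<Prod>i\<in>I. indicator (A i) (x i, e i)) \<partial>(\<Pi>\<^sub>M i\<in>I. N) \<partial>(\<Pi>\<^sub>M i\<in>I. P))"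
      by (subst sigma_finite_measure.nn_integral_fst[OF PiN, symmetric]) (auto intro!: borel_measurable_prod_ennreal)
    also have "\<dots> = (\<integral>\<^sup>+x. (\<Prod>i\<in>I. \<integral>\<^sup>+e. indicator (A i) (x i, e) \<partial>N) \<partial>(\<Pi>\<^sub>M i\<in>I. P))"
      using I A by (intro nn_integral_cong NI.product_nn_integral_prod) (auto simp: space_PiM PiE_iff)
    also have "\<dots> = (\<Prod>i\<in>I. \<integral>\<^sup>+x. \<integral>\<^sup>+e. indicator (A i) (x, e) \<partial>N \<partial>P)"
      using I by (intro PI.product_nn_integral_prod) auto
    also have "\<dots> = (\<Prod>i\<in>I. emeasure (P \<Otimes>\<^sub>M N) (A i))"
      using A by (intro prod.cong refl) (simp add: N.nn_integral_fst)
    finally show "emeasure ?D (Pi\<^sub>E I A) = (\<Prod>i\<in>I. emeasure (P \<Otimes>\<^sub>M N) (A i))" .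
  qed simp
  then show ?thesis by simp
qed

text \<open>Independence of the design vector and the noise vector is stated as equality of the joint law
  with the product law, because \<open>indep_var\<close> requires both variables to have the same type.\<close>

lemma (in prob_space) distr_sample:
  fixes X :: "nat \<Rightarrow> 'a \<Rightarrow> nat \<Rightarrow> real" and \<epsilon> :: "nat \<Rightarrow> 'a \<Rightarrow> real"
  assumes n: "n > 0"
    and X: "indep_vars (\<lambda>_. cube_space d) X {..<n}"
      "\<And>i. i < n \<Longrightarrow> distr M (cube_space d) (X i) = P"
    and \<epsilon>: "indep_vars (\<lambda>_. borel) \<epsilon> {..<n}"
      "\<And>i. i < n \<Longrightarrow> distributed M lborel (\<epsilon> i) (\<lambda>x. ennreal (std_normal_density x))"
    and X\<epsilon>: "distr M ((\<Pi>\<^sub>M i\<in>{..<n}. cube_space d) \<Otimes>\<^sub>M (\<Pi>\<^sub>M i\<in>{..<n}. borel))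
        (\<lambda>\<omega>. (\<lambda>i\<in>{..<n}. X i \<omega>, \<lambda>i\<in>{..<n}. \<epsilon> i \<omega>)) =
      distr M (\<Pi>\<^sub>M i\<in>{..<n}. cube_space d) (\<lambda>\<omega>. \<lambda>i\<in>{..<n}. X i \<omega>) \<Otimes>\<^sub>M
      distr M (\<Pi>\<^sub>M i\<in>{..<n}. borel) (\<lambda>\<omega>. \<lambda>i\<in>{..<n}. \<epsilon> i \<omega>)"
    and f0: "f0 \<in> borel_measurable (cube_space d)"
  shows "distr M (sample_space d n) (\<lambda>\<omega>. \<lambda>i\<in>{..<n}. (X i \<omega>, f0 (X i \<omega>) + \<epsilon> i \<omega>)) =
    sample_law d P f0 n"
proof -
  let ?I = "{..<n}"
  note f0 [measurable]
  have rvX: "i < n \<Longrightarrow> X i \<in> M \<rightarrow>\<^sub>M cube_space d" and rv\<epsilon>: "i < n \<Longrightarrow> \<epsilon> i \<in> M \<rightarrow>\<^sub>M borel" for i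
    using X(1) \<epsilon>(1) by (auto simp: indep_vars_def)
  have P: "prob_space P" using prob_space_distr[OF rvX[OF n]] X(2)[OF n] by simp
  have setsP [measurable_cong]: "sets P = sets (cube_space d)" using X(2)[OF n] by auto
  interpret N: prob_space std_normal by (rule prob_space_std_normal)
  interpret P: prob_space P by (rule P)
  interpret PN: pair_prob_space P std_normal ..
  have law\<epsilon>: "distr M borel (\<epsilon> i) = std_normal" if "i < n" for i
    using \<epsilon>(2)[OF that] unfolding distributed_def std_normal_def
    by (metis distr_cong sets_lborel)
  have vX: "distr M (\<Pi>\<^sub>M i\<in>?I. cube_space d) (\<lambda>\<omega>. \<lambda>i\<in>?I. X i \<omega>) = (\<Pi>\<^sub>M i\<in>?I. P)"
    using X n rvX by (subst (asm) indep_vars_iff_distr_eq_PiM') (auto intro!: PiM_cong)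
  have v\<epsilon>: "distr M (\<Pi>\<^sub>M i\<in>?I. borel) (\<lambda>\<omega>. \<lambda>i\<in>?I. \<epsilon> i \<omega>) = (\<Pi>\<^sub>M i\<in>?I. std_normal)"
    using \<epsilon> n rv\<epsilon> law\<epsilon> by (subst (asm) indep_vars_iff_distr_eq_PiM') (auto intro!: PiM_cong)
  let ?h = "\<lambda>(x, e). (x, f0 x + e)"
  let ?zip = "\<lambda>(x, e). \<lambda>i\<in>?I. (x i, e i)"
  let ?map = "\<lambda>z. \<lambda>i\<in>?I. ?h (z i)"
  have h: "?h \<in> P \<Otimes>\<^sub>M std_normal \<rightarrow>\<^sub>M cube_space d \<Otimes>\<^sub>M borel"
    by measurable
  have mrv: "(\<lambda>\<omega>. \<lambda>i\<in>?I. X i \<omega>) \<in> M \<rightarrow>\<^sub>M (\<Pi>\<^sub>M i\<in>?I. cube_space d)"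
    "(\<lambda>\<omega>. \<lambda>i\<in>?I. \<epsilon> i \<omega>) \<in> M \<rightarrow>\<^sub>M (\<Pi>\<^sub>M i\<in>?I. borel)"
    using rvX rv\<epsilon> by (auto intro!: measurable_restrict)
  have pair: "distr M ((\<Pi>\<^sub>M i\<in>?I. cube_space d) \<Otimes>\<^sub>M (\<Pi>\<^sub>M i\<in>?I. borel))
      (\<lambda>\<omega>. (\<lambda>i\<in>?I. X i \<omega>, \<lambda>i\<in>?I. \<epsilon> i \<omega>)) = (\<Pi>\<^sub>M i\<in>?I. P) \<Otimes>\<^sub>M (\<Pi>\<^sub>M i\<in>?I. std_normal)"
    using X\<epsilon> by (simp add: vX v\<epsilon>)
  have map: "?map \<in> (\<Pi>\<^sub>M i\<in>?I. P \<Otimes>\<^sub>M std_normal) \<rightarrow>\<^sub>M sample_space d n"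
    unfolding sample_space_def
  proof (rule measurable_restrict)
    fix i assume "i \<in> ?I"
    then have "(\<lambda>z. z i) \<in> (\<Pi>\<^sub>M i\<in>?I. P \<Otimes>\<^sub>M std_normal) \<rightarrow>\<^sub>M P \<Otimes>\<^sub>M std_normal"
      by (rule measurable_component_singleton)
    from measurable_compose[OF this h]
    show "(\<lambda>z. ?h (z i)) \<in> (\<Pi>\<^sub>M i\<in>?I. P \<Otimes>\<^sub>M std_normal) \<rightarrow>\<^sub>M cube_space d \<Otimes>\<^sub>M borel" .
  qed
  have zip: "?zip \<in> (\<Pi>\<^sub>M i\<in>?I. P) \<Otimes>\<^sub>M (\<Pi>\<^sub>M i\<in>?I. std_normal) \<rightarrow>\<^sub>M (\<Pi>\<^sub>M i\<in>?I. P \<Otimes>\<^sub>M std_normal)"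
    by measurable
  have s: "sets ((\<Pi>\<^sub>M i\<in>?I. P) \<Otimes>\<^sub>M (\<Pi>\<^sub>M i\<in>?I. std_normal))
      = sets ((\<Pi>\<^sub>M i\<in>?I. cube_space d) \<Otimes>\<^sub>M (\<Pi>\<^sub>M i\<in>?I. borel))"
    by (intro sets_pair_measure_cong sets_PiM_cong refl setsP sets_std_normal)
  have "sample_law d P f0 n = distr (\<Pi>\<^sub>M i\<in>?I. P \<Otimes>\<^sub>M std_normal) (sample_space d n) ?map"
  proof -
    have O: "prob_space (observation_law d P f0)"
      unfolding observation_law_def using h by (rule PN.prob_space_distr)
    have so: "sets (observation_law d P f0) = sets (cube_space d \<Otimes>\<^sub>M borel)"
      by (simp add: observation_law_def)
    have h': "?h \<in> P \<Otimes>\<^sub>M std_normal \<rightarrow>\<^sub>M observation_law d P f0"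
      using h by (simp add: measurable_cong_sets[OF refl so])
    have "distr (\<Pi>\<^sub>M i\<in>?I. P \<Otimes>\<^sub>M std_normal) (\<Pi>\<^sub>M i\<in>?I. observation_law d P f0) (compose ?I ?h) =
        (\<Pi>\<^sub>M i\<in>?I. distr (P \<Otimes>\<^sub>M std_normal) (observation_law d P f0) ?h)"
      using O h' by (intro distr_PiM_finite_prob_space') (auto intro: PN.prob_space_axioms)
    also have "distr (P \<Otimes>\<^sub>M std_normal) (observation_law d P f0) ?h = observation_law d P f0"
      unfolding observation_law_def by (intro distr_cong) simp_all
    finally show ?thesis
      unfolding sample_law_def sample_space_def
      by (subst eq_commute, elim subst)
        (intro distr_cong refl sets_PiM_cong, auto simp: compose_def so)
  qed
  also have "\<dots> = distr ((\<Pi>\<^sub>M i\<in>?I. P) \<Otimes>\<^sub>M (\<Pi>\<^sub>M i\<in>?I. std_normal)) (sample_space d n) (?map \<circ> ?zip)"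
    by (subst PiM_pair_eq_distr[OF _ P N.prob_space_axioms]) (simp_all add: distr_distr[OF map zip])
  also have "\<dots> = distr M (sample_space d n)
      ((?map \<circ> ?zip) \<circ> (\<lambda>\<omega>. (\<lambda>i\<in>?I. X i \<omega>, \<lambda>i\<in>?I. \<epsilon> i \<omega>)))"
    using measurable_comp[OF zip map] mrv
    by (subst pair[symmetric], intro distr_distr) (auto simp: measurable_cong_sets[OF s refl])
  also have "\<dots> = distr M (sample_space d n) (\<lambda>\<omega>. \<lambda>i\<in>?I. (X i \<omega>, f0 (X i \<omega>) + \<epsilon> i \<omega>))"
    by (intro distr_cong refl) (auto simp: comp_def)
  finally show ?thesis by simp
qed

end

(* Risk and optimisation error are compared on a finite net of the network class. The noise term and
   the differences between empirical and population distance to f0 are compensated by small multiples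
   of these distances; the exponential moments of the compensated processes are at most 1, so their
   maxima over the net have expectation at most ln N. This gives, up to O((ln N) / n),
     R <= 16 Delta + 24 |f - f0|^2  for every f in the class,  and  Delta <= 12 R.
   A network with s nonzero parameters has at most s relevant nodes per layer, hence ln N is at most a
   constant times s L ln n, which is n r for the rate r = phi_n L (ln n)^2.
   For the approximation error of the class, each g_ij is replaced by local Taylor polynomials blended with the
   nodal hats of a Kuhn triangulation. The blend is a sum of constantly many products of a monomial
   with a piecewise linear function, and products reduce to squares, x^2 being interpolated in base W. This
   needs a depth independent of n and O(W^(2 t_i)) parameters for an error O(W^(-2 beta_i)). With
   W^(2 t_i) of the order n phi_n the composition has squared error O(phi_n). *)

theory Submission
  imports Defs
begin

section \<open>ReLU circuits\<close>

text \<open>The implied constants in the architecture conditions are arbitrary, so the approximating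
  network has to fit whatever the fixed factors are. A depth that does not grow with
  \<open>n\<close> makes this possible: the lower bound on \<open>L\<close> exceeds it for large
  \<open>n\<close>, the width condition only asks for a small multiple of
  \<open>n * \<phi> n\<close>, since the grid sizes \<open>W\<close> may be scaled down, and the
  logarithm in the sparsity pays for all constant factors and for carrying the result through
  surplus layers. The finitely many small \<open>n\<close> are left to the zero network. Dyadic
  squaring would need a depth of order \<open>ln n\<close>; base \<open>W\<close> trades this for
  width. Weights bounded by 1 are the other obstacle. Circuits with free weights, priced by their
  size, separate the analysis from this bookkeeping, which is done once, in the translation to
  networks. Finally, measurability is not built into the composition class, and the infimum in
  \<open>delta_risk\<close> ranges over an uncountable set. The first point is settled by the
  approximation itself, the second by the finite nets.\<close>

definition relu_unit :: "('a \<Rightarrow> real) set \<Rightarrow> ('a \<Rightarrow> real) \<Rightarrow> real \<Rightarrow> bool" where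
  "relu_unit G h c \<longleftrightarrow> (\<exists>A a b. A \<subseteq> G \<and> finite A \<and> h = (\<lambda>x. max 0 ((\<Sum>g\<in>A. a g * g x) - b)) \<and>
     1 + (\<Sum>g\<in>A. 1 + \<bar>a g\<bar>) + \<bar>b\<bar> \<le> c)"

text \<open>Layers are cumulative, and a unit costs the sum of its absolute weights, because a weight \<open>a\<close> is
  later realised by \<open>\<lceil>\<bar>a\<bar>\<rceil>\<close> copies of its input, each with a weight in \<open>[-1, 1]\<close>. The depth \<open>k\<close> is
  independent of the sample size in all applications, only the cost \<open>s\<close> grows.\<close>

primrec circuit :: "('a \<Rightarrow> real) set \<Rightarrow> nat \<Rightarrow> real \<Rightarrow> ('a \<Rightarrow> real) set \<Rightarrow> bool" where
  "circuit B 0 s H \<longleftrightarrow> H \<subseteq> B \<and> 0 \<le> s"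
| "circuit B (Suc k) s H \<longleftrightarrow> (\<exists>G s' c. circuit B k s' G \<and> finite (H - G) \<and>
     (\<forall>h. 0 \<le> c h) \<and> (\<forall>h\<in>H - G. relu_unit G h (c h)) \<and> s' + (\<Sum>h\<in>H - G. c h) \<le> s)"

lemma relu_unit_mono: "relu_unit G h c \<Longrightarrow> G \<subseteq> G' \<Longrightarrow> c \<le> c' \<Longrightarrow> relu_unit G' h c'"
  unfolding relu_unit_def by (elim exE conjE, intro exI conjI, erule (1) order_trans, assumption+, erule (1) order_trans)

lemma circuit_mono:
  assumes "circuit B k s H" "H' \<subseteq> H" "B \<subseteq> B'" "s \<le> s'"
  shows "circuit B' k s' H'"
  using assms
proof (induction k arbitrary: s H H' s')
  case (Suc k)
  then obtain G s1 c where 1: "circuit B k s1 G" "finite (H - G)" "\<forall>h. 0 \<le> c h"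
    "\<forall>h\<in>H - G. relu_unit G h (c h)" "s1 + (\<Sum>h\<in>H - G. c h) \<le> s" by auto
  have "(\<Sum>h\<in>H' - G. c h) \<le> (\<Sum>h\<in>H - G. c h)"
    using 1 Suc.prems by (intro sum_mono2) auto
  moreover have "circuit B' k s1 G" using Suc.IH[OF 1(1)] Suc.prems by auto
  ultimately show ?case using 1 Suc.prems
    by (auto intro!: exI[of _ G] exI[of _ s1] exI[of _ c] intro: finite_subset[of "H' - G" "H - G"])
qed auto

lemma circuit_Suc: "circuit B k s H \<Longrightarrow> circuit B (Suc k) s H"
  by (auto intro!: exI[of _ H] exI[of _ s] exI[of _ "\<lambda>_. 0"])

lemma circuit_depth:
  assumes "circuit B k s H" "k \<le> k'"
  shows "circuit B k' s H"
  using assms(2,1) by (induction k' rule: dec_induct) (auto intro: circuit_Suc simp del: circuit.simps)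

lemma circuit_weaken:
  "circuit B k s H \<Longrightarrow> k \<le> k' \<Longrightarrow> s \<le> s' \<Longrightarrow> H' \<subseteq> H \<Longrightarrow> B \<subseteq> B' \<Longrightarrow> circuit B' k' s' H'"
  using circuit_mono circuit_depth by meson

lemma circuit_base: "H \<subseteq> B \<Longrightarrow> 0 \<le> s \<Longrightarrow> circuit B k s H"
  by (rule circuit_depth[of _ 0]) auto

text \<open>The circuits are merged layer by layer. A function that either of them already has in
  its lower layers is not built again, so overlaps only lower the cost.\<close>

lemma circuit_Un:
  assumes "circuit B k s1 H1" "circuit B k s2 H2"
  shows "circuit B k (s1 + s2) (H1 \<union> H2)"
  using assms
proof (induction k arbitrary: s1 s2 H1 H2)
  case (Suc k)
  from Suc.prems(1) obtain G1 t1 c1 where 1: "circuit B k t1 G1" "finite (H1 - G1)" "\<forall>h. 0 \<le> c1 h"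
    "\<forall>h\<in>H1 - G1. relu_unit G1 h (c1 h)" "t1 + (\<Sum>h\<in>H1 - G1. c1 h) \<le> s1" by auto
  from Suc.prems(2) obtain G2 t2 c2 where 2: "circuit B k t2 G2" "finite (H2 - G2)" "\<forall>h. 0 \<le> c2 h"
    "\<forall>h\<in>H2 - G2. relu_unit G2 h (c2 h)" "t2 + (\<Sum>h\<in>H2 - G2. c2 h) \<le> s2" by auto
  let ?G = "G1 \<union> G2" let ?D = "(H1 \<union> H2) - ?G"
  let ?c = "\<lambda>h. if h \<in> H1 - G1 then c1 h else c2 h"
  have fin: "finite ?D" using 1(2) 2(2) by (rule_tac finite_subset[of _ "(H1 - G1) \<union> (H2 - G2)"]) auto
  have "(\<Sum>h\<in>?D. ?c h) \<le> (\<Sum>h\<in>(H1 - G1) \<union> ((H2 - G2) - (H1 - G1)). ?c h)"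
    using 1(2) 2(2) by (intro sum_mono2) (auto simp: 1(3) 2(3))
  also have "\<dots> = (\<Sum>h\<in>H1 - G1. ?c h) + (\<Sum>h\<in>(H2 - G2) - (H1 - G1). ?c h)"
    using 1 2 by (intro sum.union_disjoint) auto
  also have "(\<Sum>h\<in>H1 - G1. ?c h) = (\<Sum>h\<in>H1 - G1. c1 h)" by (intro sum.cong) auto
  also have "(\<Sum>h\<in>(H2 - G2) - (H1 - G1). ?c h) = (\<Sum>h\<in>(H2 - G2) - (H1 - G1). c2 h)"
    by (intro sum.cong) auto
  also have "\<dots> \<le> (\<Sum>h\<in>H2 - G2. c2 h)"
    using 2(2,3) by (intro sum_mono2) auto
  finally have s: "(\<Sum>h\<in>?D. ?c h) \<le> (\<Sum>h\<in>H1 - G1. c1 h) + (\<Sum>h\<in>H2 - G2. c2 h)" by simp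
  have u: "\<forall>h\<in>?D. relu_unit ?G h (?c h)"
  proof
    fix h assume "h \<in> ?D"
    then show "relu_unit ?G h (?c h)"
      using 1(4) 2(4) relu_unit_mono[of G1 h "c1 h" ?G "c1 h"] relu_unit_mono[of G2 h "c2 h" ?G "c2 h"] by auto
  qed
  show ?case unfolding circuit.simps
    using Suc.IH[OF 1(1) 2(1)] fin u s 1(3,5) 2(3,5)
    by (intro exI[of _ ?G] exI[of _ "t1 + t2"] exI[of _ ?c]) auto
qed auto

lemma circuit_UN:
  assumes "finite I" "\<And>i. i \<in> I \<Longrightarrow> circuit B k (s i) (H i)"
  shows "circuit B k (\<Sum>i\<in>I. s i) (\<Union>i\<in>I. H i)"
  using assms by (induction I) (auto simp del: circuit.simps intro: circuit_base circuit_Un)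

lemma circuit_trans:
  assumes "circuit B k s G" "circuit G k' s' H"
  shows "circuit B (k + k') (s + s') H"
  using assms(2)
proof (induction k' arbitrary: s' H)
  case 0 then show ?case using assms(1) by (auto intro: circuit_mono)
next
  case (Suc k')
  then obtain G' t c where 1: "circuit G k' t G'" "finite (H - G')" "\<forall>h. 0 \<le> c h"
    "\<forall>h\<in>H - G'. relu_unit G' h (c h)" "t + (\<Sum>h\<in>H - G'. c h) \<le> s'" by auto
  then show ?case using Suc.IH[OF 1(1)]
    by (auto intro!: exI[of _ G'] exI[of _ "s + t"] exI[of _ c])
qed

text \<open>Layers are cumulative, so \<open>B\<close> and \<open>G\<close> remain available at cost
  0 while the second circuit runs. This chains constructions that reuse earlier values.\<close>

lemma circuit_extend:
  assumes "circuit B k s G" "circuit (B \<union> G) k' s' H"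
  shows "circuit B (k + k') (s + s') (H \<union> G)"
proof -
  have "circuit B k s (B \<union> G)" using circuit_Un[OF circuit_base[OF subset_refl] assms(1), of 0] by simp
  from circuit_trans[OF this, of k' s' "H \<union> G"] circuit_Un[OF assms(2) circuit_base[of G "B \<union> G" 0]]
  show ?thesis by auto
qed

lemma circuit_unit:
  assumes "finite A" "A \<subseteq> B" "1 + (\<Sum>g\<in>A. 1 + \<bar>a g\<bar>) + \<bar>b\<bar> \<le> s"
  shows "circuit B 1 s {\<lambda>x. max 0 ((\<Sum>g\<in>A. a g * g x) - b)}"
proof -
  have "0 \<le> s" using assms(3) sum_nonneg[of A "\<lambda>g. 1 + \<bar>a g\<bar>"] by force
  have u: "relu_unit B (\<lambda>x. max 0 ((\<Sum>g\<in>A. a g * g x) - b)) s" (is "relu_unit B ?h s")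
    unfolding relu_unit_def using assms by blast
  have "(\<Sum>h\<in>{?h} - B. s) \<le> (\<Sum>h\<in>{?h}. s)" using \<open>0 \<le> s\<close> by (intro sum_mono2) auto
  then have "circuit B (Suc 0) s {?h}" unfolding circuit.simps using u \<open>0 \<le> s\<close>
    by (intro exI[of _ B] exI[of _ 0] exI[of _ "\<lambda>_. s"]) auto
  then show ?thesis by simp
qed

text \<open>Families avoid case distinctions on coinciding functions: equal members only lower the cost.\<close>

lemma circuit_lincomb:
  assumes "finite I" "\<And>i. i \<in> I \<Longrightarrow> f i \<in> B" "1 + (\<Sum>i\<in>I. 1 + \<bar>a i\<bar>) + \<bar>b\<bar> \<le> s"
  shows "circuit B 1 s {\<lambda>x. max 0 ((\<Sum>i\<in>I. a i * f i x) - b)}"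
proof -
  define a' where "a' g = (\<Sum>i\<in>{i\<in>I. f i = g}. a i)" for g
  have eq: "(\<Sum>g\<in>f ` I. a' g * g x) = (\<Sum>i\<in>I. a i * f i x)" for x
  proof -
    have "(\<Sum>i\<in>I. a i * f i x) = (\<Sum>g\<in>f ` I. \<Sum>i\<in>{i\<in>I. f i = g}. a i * f i x)"
      using assms(1) by (rule sum.image_gen)
    also have "\<dots> = (\<Sum>g\<in>f ` I. a' g * g x)" unfolding a'_def sum_distrib_right
      by (intro sum.cong) auto
    finally show ?thesis by simp
  qed
  have "(\<Sum>g\<in>f ` I. 1 + \<bar>a' g\<bar>) \<le> (\<Sum>g\<in>f ` I. \<Sum>i\<in>{i\<in>I. f i = g}. 1 + \<bar>a i\<bar>)"
  proof (intro sum_mono)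
    fix g assume "g \<in> f ` I"
    then have "1 \<le> card {i\<in>I. f i = g}" using assms(1) by (auto simp: Suc_le_eq card_gt_0_iff)
    moreover have "\<bar>a' g\<bar> \<le> (\<Sum>i\<in>{i\<in>I. f i = g}. \<bar>a i\<bar>)" unfolding a'_def by (rule sum_abs)
    ultimately show "1 + \<bar>a' g\<bar> \<le> (\<Sum>i\<in>{i\<in>I. f i = g}. 1 + \<bar>a i\<bar>)" by (simp add: sum.distrib)
  qed
  also have "\<dots> = (\<Sum>i\<in>I. 1 + \<bar>a i\<bar>)" using sum.image_gen[OF assms(1), of "\<lambda>i. 1 + \<bar>a i\<bar>" f] by simp
  finally have "1 + (\<Sum>g\<in>f ` I. 1 + \<bar>a' g\<bar>) + \<bar>b\<bar> \<le> s" using assms(3) by simp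
  from circuit_unit[OF _ _ this, of B] assms(1,2) show ?thesis by (auto simp: eq simp del: circuit.simps One_nat_def)
qed

text \<open>Every unit costs at least 1, so the cost also bounds the number of computed functions.
  This later turns cost into network width.\<close>

lemma circuit_finite: "circuit B k s H \<Longrightarrow> finite (H - B) \<and> real (card (H - B)) \<le> s"
proof (induction k arbitrary: s H)
  case (Suc k)
  then obtain G t c where 1: "circuit B k t G" "finite (H - G)" "\<forall>h. 0 \<le> c h"
    "\<forall>h\<in>H - G. relu_unit G h (c h)" "t + (\<Sum>h\<in>H - G. c h) \<le> s" by auto
  have sub: "H - B \<subseteq> (G - B) \<union> (H - G)" by auto
  have "card (H - B) \<le> card (G - B) + card (H - G)"
    using Suc.IH[OF 1(1)] 1(2) card_mono[OF _ sub] card_Un_le[of "G - B" "H - G"] by (meson finite_UnI le_trans)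
  moreover have "real (card (H - G)) \<le> (\<Sum>h\<in>H - G. c h)"
  proof -
    have "1 \<le> c h" if hh: "h \<in> H - G" for h
    proof -
      obtain A :: "('a \<Rightarrow> real) set" and a b where "1 + (\<Sum>g\<in>A. 1 + \<bar>a g\<bar>) + \<bar>b\<bar> \<le> c h"
        using 1(4) hh unfolding relu_unit_def by blast
      moreover have "0 \<le> (\<Sum>g\<in>A. 1 + \<bar>a g\<bar>)" by (intro sum_nonneg) (auto)
      ultimately show ?thesis by linarith
    qed
    then show ?thesis using sum_mono[of "H - G" "\<lambda>_. 1" c] by simp
  qed
  ultimately show ?case using Suc.IH[OF 1(1)] 1(2,5) sub by (auto intro: finite_subset)
qed (auto simp: Diff_eq_empty_iff[THEN iffD2])

text \<open>A ReLU passes nonnegative functions unchanged, so circuit values can be carried through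
  further network layers.\<close>

lemma circuit_nonneg:
  assumes "circuit B k s H" "\<And>g x. g \<in> B \<Longrightarrow> 0 \<le> g x" "h \<in> H"
  shows "0 \<le> h x"
  using assms(1,3)
proof (induction k arbitrary: s H h)
  case 0 then show ?case using assms(2) by auto
next
  case (Suc k)
  then obtain G s' c where "circuit B k s' G" "\<forall>h\<in>H - G. relu_unit G h (c h)" by auto
  then show ?case using Suc.IH[of s' G h] Suc.prems(2)
    by (cases "h \<in> G") (auto simp: relu_unit_def dest!: bspec[of _ _ h])
qed

text \<open>Needed for limits of circuits, which give the measurability of the functions in the
  composition class.\<close>

lemma circuit_measurable:
  assumes "circuit B k s H" "\<And>g. g \<in> B \<Longrightarrow> g \<in> borel_measurable M" "h \<in> H"
  shows "h \<in> borel_measurable M"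
  using assms(1,3)
proof (induction k arbitrary: s H h)
  case 0 then show ?case using assms(2) by auto
next
  case (Suc k)
  then obtain G s' c where G: "circuit B k s' G" "\<forall>h\<in>H - G. relu_unit G h (c h)" by auto
  note IH = Suc.IH[OF G(1)]
  show ?case
  proof (cases "h \<in> G")
    case False
    then obtain A a b where "A \<subseteq> G" "h = (\<lambda>x. max 0 ((\<Sum>g\<in>A. a g * g x) - b))"
      using G(2) Suc.prems(2) unfolding relu_unit_def by blast
    moreover have "(\<lambda>x. max 0 ((\<Sum>g\<in>A. a g * g x) - b)) \<in> borel_measurable M"
      using IH \<open>A \<subseteq> G\<close> by (intro borel_measurable_max borel_measurable_diff borel_measurable_sum
          borel_measurable_times borel_measurable_const) auto
    ultimately show ?thesis by simp
  qed (use IH in auto)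
qed

declare circuit.simps [simp del]

section \<open>Piecewise linear interpolation, products and monomials\<close>

lemma circuit_lin3:
  assumes "f \<in> B" "g \<in> B" "h \<in> B" "4 + \<bar>a\<bar> + \<bar>b\<bar> + \<bar>c\<bar> + \<bar>e\<bar> \<le> s"
  shows "circuit B 1 s {\<lambda>x. max 0 (a * f x + b * g x + c * h x - e)}"
proof -
  let ?f = "\<lambda>i::nat. if i = 0 then f else if i = 1 then g else h"
  let ?a = "\<lambda>i::nat. if i = 0 then a else if i = 1 then b else c"
  have "circuit B 1 s {\<lambda>x. max 0 ((\<Sum>i\<in>{0,1,2}. ?a i * ?f i x) - e)}"
    by (rule circuit_lincomb) (use assms in auto)
  also have "(\<lambda>x. (\<Sum>i\<in>{0,1,2}. ?a i * ?f i x)) = (\<lambda>x. a * f x + b * g x + c * h x)"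
    by (simp add: fun_eq_iff)
  finally show ?thesis .
qed

lemma circuit_insert:
  assumes "circuit B k s G" "circuit (B \<union> G) k' s' {h}"
  shows "circuit B (k + k') (s + s') (insert h G)"
  using circuit_extend[OF assms] by simp

text \<open>With S the affine form, \<open>min l (max 0 S) = max 0 (l - max 0 (l - S))\<close> for
  \<open>0 \<le> l\<close>, hence two layers. Clamping to the range of the target never increases
  the error.\<close>

lemma circuit_clamp:
  assumes "finite I" "\<And>i. i \<in> I \<Longrightarrow> f i \<in> B" "0 \<le> l" "l \<le> 1" "6 + (\<Sum>i\<in>I. 1 + \<bar>a i\<bar>) + \<bar>b\<bar> \<le> s"
  shows "circuit B 2 s {\<lambda>x. min l (max 0 ((\<Sum>i\<in>I. a i * f i x) - b))}"
proof -
  let ?h = "\<lambda>x. max 0 ((\<Sum>i\<in>I. - a i * f i x) - (- b - l))"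
  have 1: "circuit B 1 (s - 4) {?h}"
    by (rule circuit_lincomb) (use assms in auto)
  have "circuit {?h} 1 4 {\<lambda>x. max 0 ((\<Sum>i\<in>{()}. - 1 * ?h x) - (- l))}"
    by (rule circuit_lincomb) (use assms in auto)
  also have "(\<lambda>x. max 0 ((\<Sum>i\<in>{()}. - 1 * ?h x) - (- l))) = (\<lambda>x. min l (max 0 ((\<Sum>i\<in>I. a i * f i x) - b)))"
    using assms by (intro ext) (auto simp: sum_negf)
  finally have "circuit {?h} 1 4 {\<lambda>x. min l (max 0 ((\<Sum>i\<in>I. a i * f i x) - b))}" .
  from circuit_trans[OF 1 this] show ?thesis by (rule circuit_weaken) auto
qed

section \<open>Nodal hats of the Kuhn triangulation\<close>

primrec running_max :: "(nat \<Rightarrow> real) \<Rightarrow> nat \<Rightarrow> real" where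
  "running_max w 0 = 0"
| "running_max w (Suc j) = max (running_max w j) (w j)"

lemma running_max_nonneg: "0 \<le> running_max w j"
  by (induction j) auto

lemma running_max_ge: "i < j \<Longrightarrow> w i \<le> running_max w j"
  by (induction j) (auto simp: less_Suc_eq)

lemma running_max_le_iff: "running_max w j \<le> c \<longleftrightarrow> 0 \<le> c \<and> (\<forall>i<j. w i \<le> c)"
  by (induction j) (auto simp: less_Suc_eq)

text \<open>Since \<open>max P w = P + max 0 (w - P)\<close> and the running maximum P is
  nonnegative, each further argument takes two units.\<close>

lemma circuit_running_max:
  assumes "\<And>j. j < t \<Longrightarrow> y j \<in> B" "\<And>j. j < t \<Longrightarrow> \<bar>b j\<bar> \<le> 1" "\<bar>a\<bar> \<le> 1"
  shows "circuit B (1 + 2 * t) (1 + 16 * real t) {\<lambda>x. running_max (\<lambda>j. a * y j x - b j) t}"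
  using assms
proof (induction t)
  case 0
  have "circuit B 1 1 {\<lambda>x. max 0 ((\<Sum>i\<in>({}::nat set). 0 * (\<lambda>_. 0) x) - 0)}"
    by (rule circuit_lincomb) auto
  then show ?case by simp
next
  case (Suc t)
  let ?P = "\<lambda>x. running_max (\<lambda>j. a * y j x - b j) t"
  let ?d = "\<lambda>x. max 0 (a * y t x + - 1 * ?P x + 0 * y t x - b t)"
  have 1: "circuit B (1 + 2 * t) (1 + 16 * real t) {?P}" using Suc by auto
  have 2: "circuit (B \<union> {?P}) 1 8 {?d}"
    using Suc.prems(1)[of t] Suc.prems(2)[of t] Suc.prems(3) by (intro circuit_lin3) auto
  have 3: "circuit (B \<union> {?d, ?P}) 1 8 {\<lambda>x. max 0 (1 * ?P x + 1 * ?d x + 0 * ?P x - 0)}"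
    by (intro circuit_lin3) auto
  have 4: "(\<lambda>x. max 0 (1 * ?P x + 1 * ?d x + 0 * ?P x - 0)) = (\<lambda>x. running_max (\<lambda>j. a * y j x - b j) (Suc t))"
  proof
    fix x show "max 0 (1 * ?P x + 1 * ?d x + 0 * ?P x - 0) = running_max (\<lambda>j. a * y j x - b j) (Suc t)"
      using running_max_nonneg[of "\<lambda>j. a * y j x - b j" t] by (auto simp: max_def)
  qed
  have "circuit B (1 + 2 * t + 1 + 1) (1 + 16 * real t + 8 + 8)
      {\<lambda>x. running_max (\<lambda>j. a * y j x - b j) (Suc t), ?d, ?P}"
    using circuit_insert[OF circuit_insert[OF 1 2] 3] unfolding 4 .
  then show ?case by (rule circuit_weaken) auto
qed


text \<open>Nodal basis of the Kuhn triangulation of the grid of mesh \<open>1 / M\<close>, scaled by \<open>1 / M\<close>. Its value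
  is the length of the set of \<open>\<theta> \<in> [0, 1 / M)\<close> for which rounding \<open>y + \<theta>\<close> down to the grid gives
  the node \<open>l\<close>; this makes the partition of unity evident.\<close>

definition kuhn_hat :: "nat \<Rightarrow> nat \<Rightarrow> (nat \<Rightarrow> nat) \<Rightarrow> (nat \<Rightarrow> real) \<Rightarrow> real" where
  "kuhn_hat t M l y = max 0 (1 / real M - running_max (\<lambda>j. 1 * y j - real (l j) / real M) t
     - running_max (\<lambda>j. - 1 * y j - - (real (l j) / real M)) t)"

lemma emeasure_lborel_Ico_finite: "emeasure lborel {a..<b::real} \<noteq> \<infinity>"
  by (cases "a \<le> b") auto

lemma kuhn_hat_nonneg: "0 \<le> kuhn_hat t M l y"
  by (simp add: kuhn_hat_def)

text \<open>Both running maxima are nonnegative, and their sum stays below 1/M where the hat is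
  positive. Each coordinate difference, with either sign, is bounded by one of them.\<close>

lemma kuhn_hat_support:
  assumes "kuhn_hat t M l y \<noteq> 0" "j < t"
  shows "\<bar>y j - real (l j) / real M\<bar> \<le> 1 / real M"
  using assms(1) running_max_ge[OF assms(2), of "\<lambda>j. 1 * y j - real (l j) / real M"]
    running_max_ge[OF assms(2), of "\<lambda>j. - 1 * y j - - (real (l j) / real M)"]
    running_max_nonneg[of "\<lambda>j. 1 * y j - real (l j) / real M" t]
    running_max_nonneg[of "\<lambda>j. - 1 * y j - - (real (l j) / real M)" t]
  unfolding kuhn_hat_def by (auto simp: max_def abs_le_iff split: if_splits)

definition kuhn_nodes :: "nat \<Rightarrow> nat \<Rightarrow> (nat \<Rightarrow> nat) set" where
  "kuhn_nodes t M = ({..<t} \<rightarrow>\<^sub>E {..M})"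

lemma finite_kuhn_nodes: "finite (kuhn_nodes t M)"
  by (auto simp: kuhn_nodes_def intro: finite_PiE)

lemma card_kuhn_nodes: "card (kuhn_nodes t M) = (M + 1) ^ t"
  by (simp add: kuhn_nodes_def card_PiE)

text \<open>For fixed \<open>y\<close> and every shift \<theta> in [0, 1/M) exactly one node is the
  rounding of y + \<theta>, so the sets \<open>S l\<close> partition that interval.\<close>

lemma sum_kuhn_hat:
  assumes M: "0 < M" and y: "\<And>j. j < t \<Longrightarrow> 0 \<le> y j \<and> y j \<le> 1"
  shows "(\<Sum>l\<in>kuhn_nodes t M. kuhn_hat t M l y) = 1 / real M"
proof -
  define S where "S l = {\<theta>. 0 \<le> \<theta> \<and> \<theta> < 1 / real M \<and>
      (\<forall>j<t. real (l j) / real M \<le> y j + \<theta> \<and> y j + \<theta> < (real (l j) + 1) / real M)}" for l :: "nat \<Rightarrow> nat"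
  have S_eq: "S l = {running_max (\<lambda>j. - 1 * y j - - (real (l j) / real M)) t..<
      1 / real M - running_max (\<lambda>j. 1 * y j - real (l j) / real M) t}" for l
  proof -
    have "\<theta> < 1 / real M - running_max (\<lambda>j. 1 * y j - real (l j) / real M) t \<longleftrightarrow>
       \<theta> < 1 / real M \<and> (\<forall>j<t. y j + \<theta> < (real (l j) + 1) / real M)" for \<theta>
    proof -
      have "r < c \<longleftrightarrow> 0 < c \<and> (\<forall>j<t. w j < c)" if "r = running_max w t" for w r c
        unfolding that by (induction t) (auto simp: less_Suc_eq)
      from this[OF refl, of "\<lambda>j. 1 * y j - real (l j) / real M" "1 / real M - \<theta>"]
      show ?thesis by (auto simp: add_divide_distrib algebra_simps)
    qed
    moreover have "running_max (\<lambda>j. - 1 * y j - - (real (l j) / real M)) t \<le> \<theta> \<longleftrightarrow>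
       0 \<le> \<theta> \<and> (\<forall>j<t. real (l j) / real M \<le> y j + \<theta>)" for \<theta>
      by (auto simp: running_max_le_iff algebra_simps)
    ultimately show ?thesis unfolding S_def by (auto simp: set_eq_iff)
  qed
  \<comment> \<open>If the end points come in reverse order, the interval is empty, and the outer
    \<open>max 0\<close> of the hat gives the same value 0.\<close>
  have meas: "measure lborel (S l) = kuhn_hat t M l y" for l
    unfolding S_eq kuhn_hat_def by (auto simp: max_def measure_def)
  have "(\<Sum>l\<in>kuhn_nodes t M. kuhn_hat t M l y) = measure lborel (\<Union>l\<in>kuhn_nodes t M. S l)"
    unfolding meas[symmetric]
  proof (rule measure_finite_Union[symmetric])
    show "disjoint_family_on S (kuhn_nodes t M)"
      unfolding disjoint_family_on_def
    proof (intro ballI impI)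
      fix l l' assume l: "l \<in> kuhn_nodes t M" "l' \<in> kuhn_nodes t M" "l \<noteq> l'"
      then obtain j where j: "j < t" "l j \<noteq> l' j"
        unfolding kuhn_nodes_def by (metis PiE_ext lessThan_iff)
      have "l j = l' j" if "\<theta> \<in> S l" "\<theta> \<in> S l'" for \<theta>
      proof -
        have "real (l j) / real M < (real (l' j) + 1) / real M" "real (l' j) / real M < (real (l j) + 1) / real M"
          using that j(1) unfolding S_def by force+
        then show ?thesis using M by (simp add: divide_less_cancel)
      qed
      then show "S l \<inter> S l' = {}" using j by auto
    qed
  qed (use emeasure_lborel_Ico_finite in \<open>auto simp: finite_kuhn_nodes S_eq\<close>)
  also have "(\<Union>l\<in>kuhn_nodes t M. S l) = {0..<1 / real M}"
  proof
    show "{0..<1 / real M} \<subseteq> (\<Union>l\<in>kuhn_nodes t M. S l)"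
    proof
      fix \<theta> assume th: "\<theta> \<in> {0..<1 / real M}"
      define l where "l = (\<lambda>j\<in>{..<t}. nat \<lfloor>real M * (y j + \<theta>)\<rfloor>)"
      \<comment> \<open>\<open>y j \<le> 1\<close> and \<theta> < 1/M keep the rounded index at most
        \<open>M\<close>; this is why the nodes run up to and including \<open>M\<close>.\<close>
      have b: "0 \<le> real M * (y j + \<theta>)" "real M * (y j + \<theta>) < real M + 1" if "j < t" for j
      proof -
        have "real M * \<theta> < 1" using th M by (simp add: field_simps)
        moreover have "real M * y j \<le> real M * 1" using y[OF that] by (intro mult_left_mono) auto
        ultimately show "real M * (y j + \<theta>) < real M + 1" by (simp add: distrib_left)
        show "0 \<le> real M * (y j + \<theta>)" using y[OF that] th by simp
      qed
      have "l \<in> kuhn_nodes t M" unfolding kuhn_nodes_def l_def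
        using b by (auto simp: nat_le_iff floor_le_iff)
      moreover have "\<theta> \<in> S l" unfolding S_def
      proof (intro CollectI conjI allI impI)
        fix j assume j: "j < t"
        have "real (l j) \<le> real M * (y j + \<theta>)" "real M * (y j + \<theta>) < real (l j) + 1"
          using b[OF j] j by (auto simp: l_def)
        then show "real (l j) / real M \<le> y j + \<theta>" "y j + \<theta> < (real (l j) + 1) / real M"
          using M by (auto simp: field_simps)
      qed (use th in auto)
      ultimately show "\<theta> \<in> (\<Union>l\<in>kuhn_nodes t M. S l)" by auto
    qed
  qed (auto simp: S_def)
  also have "measure lborel {0..<1 / real M} = 1 / real M" by simp
  finally show ?thesis .
qed

text \<open>The node coordinates and 1/M are at most 1 and enter only as biases, so the price of one
  hat depends on \<open>t\<close> but not on \<open>M\<close>.\<close>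

lemma circuit_kuhn_hat:
  assumes "\<And>j. j < t \<Longrightarrow> y j \<in> B" "0 < M" "l \<in> kuhn_nodes t M"
  shows "circuit B (3 + 4 * t) (10 + 32 * real t) {\<lambda>x. kuhn_hat t M l (\<lambda>j. y j x)}"
proof -
  have l: "\<bar>real (l j) / real M\<bar> \<le> 1" if "j < t" for j
    using assms(2,3) that by (auto simp: kuhn_nodes_def field_simps)
  let ?P = "\<lambda>x. running_max (\<lambda>j. 1 * y j x - real (l j) / real M) t"
  let ?Q = "\<lambda>x. running_max (\<lambda>j. - 1 * y j x - - (real (l j) / real M)) t"
  have P: "circuit B (1 + 2 * t) (1 + 16 * real t) {?P}"
    using assms(1) l by (intro circuit_running_max) auto
  have Q: "circuit (B \<union> {?P}) (1 + 2 * t) (1 + 16 * real t) {?Q}"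
    using assms(1) l by (intro circuit_running_max) auto
  have "\<bar>1 / real M\<bar> \<le> 1" using assms(2) by simp
  then have "circuit (B \<union> {?Q, ?P}) 1 8 {\<lambda>x. max 0 (- 1 * ?P x + - 1 * ?Q x + 0 * ?P x - - (1 / real M))}"
    by (intro circuit_lin3) auto
  from circuit_insert[OF circuit_insert[OF P Q] this]
  have "circuit B (1 + 2 * t + (1 + 2 * t) + 1) (1 + 16 * real t + (1 + 16 * real t) + 8)
     {\<lambda>x. max 0 (- 1 * ?P x + - 1 * ?Q x + 0 * ?P x - - (1 / real M))}"
    by (rule circuit_weaken) auto
  also have "(\<lambda>x. max 0 (- 1 * ?P x + - 1 * ?Q x + 0 * ?P x - - (1 / real M))) = (\<lambda>x. kuhn_hat t M l (\<lambda>j. y j x))"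
    by (auto simp: kuhn_hat_def)
  finally show ?thesis by (rule circuit_weaken) auto
qed

text \<open>For \<open>y \<in> [0, W]\<close> with fractional part \<open>f\<close>, \<open>sq_interp W y\<close> is the piecewise linear interpolation
  of \<open>y\<^sup>2\<close> at the integers, \<open>zigzag W y\<close> is \<open>f\<close> or \<open>1 - f\<close>, and the interpolation error is \<open>f - f\<^sup>2\<close>. So
  the square of \<open>y\<close> is reduced to the square of \<open>zigzag W y \<in> [0, 1]\<close>.\<close>

definition sq_interp :: "nat \<Rightarrow> real \<Rightarrow> real" where
  "sq_interp W y = y + (\<Sum>k\<in>{1..<W}. 2 * max 0 (y - real k))"

definition zigzag :: "nat \<Rightarrow> real \<Rightarrow> real" where
  "zigzag W y = y + (\<Sum>k\<in>{1..<W}. 2 * (-1) ^ k * max 0 (y - real k))"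

text \<open>The right side is the chord of the square through m and m + 1. It is valid on all of [m,
  \<infinity>), as the sum for \<open>Suc m\<close> has no kink beyond m.\<close>

lemma sq_interp_above: "real m \<le> y \<Longrightarrow> sq_interp (Suc m) y = (2 * real m + 1) * y - real m * (real m + 1)"
proof (induction m)
  case (Suc m)
  then have "sq_interp (Suc (Suc m)) y = sq_interp (Suc m) y + 2 * max 0 (y - real (Suc m))"
    by (simp add: sq_interp_def)
  then show ?case using Suc by (simp add: algebra_simps)
qed (simp add: sq_interp_def)

text \<open>Each kink flips the slope between 1 and -1, so beyond the last one only its parity
  matters.\<close>

lemma zigzag_above: "real m \<le> y \<Longrightarrow> zigzag (Suc m) y = (if even m then y - real m else real m + 1 - y)"
proof (induction m)
  case (Suc m)
  then have "zigzag (Suc (Suc m)) y = zigzag (Suc m) y + 2 * (-1) ^ Suc m * max 0 (y - real (Suc m))"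
    by (simp add: zigzag_def)
  then show ?case using Suc by (auto simp: algebra_simps)
qed (simp add: zigzag_def)

lemma sq_interp_below: "m \<le> n \<Longrightarrow> 1 \<le> m \<Longrightarrow> y \<le> real m \<Longrightarrow> sq_interp n y = sq_interp m y"
  unfolding sq_interp_def by (intro arg_cong2[of _ _ _ _ "(+)"] refl sum.mono_neutral_right) auto

lemma zigzag_below: "m \<le> n \<Longrightarrow> 1 \<le> m \<Longrightarrow> y \<le> real m \<Longrightarrow> zigzag n y = zigzag m y"
  unfolding zigzag_def by (intro arg_cong2[of _ _ _ _ "(+)"] refl sum.mono_neutral_right) auto

text \<open>On [m, m + 1] put f = y - m. The chord exceeds the square by f - f^2, which is unchanged
  when f is replaced by 1 - f, so the alternating direction of the zigzag does no harm.\<close>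

lemma square_reduction:
  assumes "1 \<le> W" "0 \<le> y" "y \<le> real W"
  shows "y\<^sup>2 = sq_interp W y - zigzag W y + (zigzag W y)\<^sup>2" "0 \<le> zigzag W y" "zigzag W y \<le> 1"
proof -
  \<comment> \<open>At the right end \<open>y = real W\<close> the floor would point one past the
    last interval.\<close>
  define m where "m = (if y = real W then W - 1 else nat \<lfloor>y\<rfloor>)"
  have m: "real m \<le> y" "y \<le> real (Suc m)" "Suc m \<le> W"
    using assms by (auto simp: m_def of_nat_diff) linarith+
  have z: "zigzag W y = (if even m then y - real m else real m + 1 - y)"
    "sq_interp W y = (2 * real m + 1) * y - real m * (real m + 1)"
    using zigzag_below[OF m(3) _ m(2)] zigzag_above[OF m(1)] sq_interp_below[OF m(3) _ m(2)] sq_interp_above[OF m(1)] by auto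
  show "y\<^sup>2 = sq_interp W y - zigzag W y + (zigzag W y)\<^sup>2"
    unfolding z by (auto simp: power2_eq_square algebra_simps)
  show "0 \<le> zigzag W y" "zigzag W y \<le> 1" unfolding z using m by auto
qed

section \<open>Squares, products and monomials as circuits\<close>

lemma abs_max_0_le: "0 \<le> c \<Longrightarrow> \<bar>max 0 b - c\<bar> \<le> \<bar>b - c\<bar>" for b c :: real
  by auto

text \<open>In one round y = W u, and u^2 equals (\<open>sq_interp W y\<close> - z + z^2) / W^2 with
  z the zigzag value in [0, 1], so the error of the next round is divided by W^2. A round costs of
  order W^2 because the W shifted units carry biases up to W. For R = 0 the function u stands for
  its own square, with error at most 1.\<close>

lemma circuit_square:
  fixes u :: "'a \<Rightarrow> real"
  assumes W: "1 \<le> W" and u: "\<And>x. 0 \<le> u x \<and> u x \<le> 1"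
  shows "\<exists>v. circuit {u} (4 * R) (30 * real R * real W ^ 2) {v} \<and> (\<forall>x. \<bar>v x - (u x)\<^sup>2\<bar> \<le> (1 / real W ^ 2) ^ R)"
  using u
proof (induction R arbitrary: u)
  case 0
  have "\<bar>u x - (u x)\<^sup>2\<bar> \<le> 1" for x
    using 0[of x] mult_left_le[of "u x" "u x"] zero_le_power2[of "u x"] unfolding power2_eq_square abs_le_iff by linarith
  then show ?case by (intro exI[of _ u]) (auto intro: circuit_base)
next
  case (Suc R)
  define y where "y = (\<lambda>x. max 0 ((\<Sum>i\<in>{()}. real W * u x) - 0))"
  define r where "r k = (\<lambda>x. max 0 ((\<Sum>i\<in>{()}. 1 * y x) - real k))" for k
  \<comment> \<open>Since y is nonnegative, \<open>r 0\<close> equals y, and the entry k = 0 is the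
    linear term of the zigzag.\<close>
  define z where "z = (\<lambda>x. max 0 ((\<Sum>k\<in>{0..<W}. (if k = 0 then 1 else 2 * (-1) ^ k) * r k x) - 0))"
  have y: "y x = real W * u x" "0 \<le> y x" "y x \<le> real W" for x
    using Suc.prems[of x] W by (auto simp: y_def mult_left_le)
  have r: "r k x = max 0 (y x - real k)" for k x by (simp add: r_def)
  have W0: "{0..<W} = insert 0 {1..<W}" using W by auto
  have z: "z x = zigzag W (y x)" for x
  proof -
    have "(\<Sum>k\<in>{1..<W}. (if k = 0 then 1 else 2 * (-1) ^ k) * r k x) = (\<Sum>k\<in>{1..<W}. 2 * (-1) ^ k * max 0 (y x - real k))"
      by (intro sum.cong) (auto simp: r)
    then have "(\<Sum>k\<in>{0..<W}. (if k = 0 then 1 else 2 * (-1) ^ k) * r k x) = zigzag W (y x)"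
      unfolding W0 zigzag_def using y[of x] by (simp add: r)
    then show ?thesis using square_reduction(2)[OF W y(2,3)] by (simp add: z_def)
  qed
  have z01: "0 \<le> z x \<and> z x \<le> 1" for x
    using square_reduction(2,3)[OF W y(2,3)] z by auto
  obtain q where q: "circuit {z} (4 * R) (30 * real R * real W ^ 2) {q}" "\<forall>x. \<bar>q x - (z x)\<^sup>2\<bar> \<le> (1 / real W ^ 2) ^ R"
    using Suc.IH[of z] z01 by blast
  \<comment> \<open>One family holds all inputs of the last unit: indices below W are the shifted
    units, W is z with sign -1, and W + 1 is the recursive square q.\<close>
  define v where "v = (\<lambda>x. max 0 ((\<Sum>k\<in>{..W + 1}. (if k = 0 then 1 else if k < W then 2 else if k = W then -1 else 1) / real W ^ 2
    * (if k < W then r k else if k = W then z else q) x) - 0))"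
  have v: "v x = max 0 ((sq_interp W (y x) - z x + q x) / real W ^ 2)" for x
  proof -
    have "{..W + 1} = insert 0 {1..<W} \<union> {W, W + 1}" using W by auto
    then have "(\<Sum>k\<in>{..W + 1}. (if k = 0 then 1 else if k < W then 2 else if k = W then -1 else 1) / real W ^ 2
        * (if k < W then r k else if k = W then z else q) x)
      = (\<Sum>k\<in>insert 0 {1..<W}. (if k = 0 then 1 else if k < W then 2 else if k = W then -1 else 1) / real W ^ 2
        * (if k < W then r k else if k = W then z else q) x) - z x / real W ^ 2 + q x / real W ^ 2"
      using W by simp
    also have "(\<Sum>k\<in>insert 0 {1..<W}. (if k = 0 then 1 else if k < W then 2 else if k = W then -1 else 1) / real W ^ 2
        * (if k < W then r k else if k = W then z else q) x) = (\<Sum>k\<in>insert 0 {1..<W}. (if k = 0 then 1 else 2) * r k x / real W ^ 2)"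
      using W by (intro sum.cong) auto
    also have "\<dots> = sq_interp W (y x) / real W ^ 2"
    proof -
      have "(\<Sum>k\<in>insert 0 {1..<W}. (if k = 0 then 1 else 2) * r k x) = y x + (\<Sum>k\<in>{1..<W}. 2 * max 0 (y x - real k))"
        using y[of x] by (simp add: r)
      then show ?thesis unfolding sq_interp_def sum_divide_distrib[symmetric] by simp
    qed
    finally show ?thesis unfolding v_def by (simp add: diff_divide_distrib add_divide_distrib)
  qed
  have W2: "real W \<le> real W ^ 2" "1 \<le> real W ^ 2" using W by (auto simp: self_le_power)
  have c1: "circuit {u} 1 (2 + real W) {y}"
    unfolding y_def by (rule circuit_lincomb) auto
  have "circuit {y} 1 (\<Sum>k\<in>{..<W}. 3 + real W) (\<Union>k\<in>{..<W}. {r k})"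
    unfolding r_def by (intro circuit_UN circuit_lincomb) auto
  then have c2: "circuit {u} (1 + 1) ((2 + real W) + real W * (3 + real W)) (r ` {..<W})"
    using circuit_trans[OF c1, of 1 "real W * (3 + real W)" "r ` {..<W}"] by (simp add: UNION_singleton_eq_range)
  have "circuit (r ` {..<W}) 1 (1 + 3 * real W) {z}" unfolding z_def
  proof (rule circuit_lincomb)
    have "(\<Sum>k\<in>{0..<W}. 1 + \<bar>if k = 0 then 1 else 2 * (-1) ^ k :: real\<bar>) \<le> (\<Sum>k\<in>{0..<W}. 3)"
      by (intro sum_mono) (auto simp: abs_mult)
    then show "1 + (\<Sum>k\<in>{0..<W}. 1 + \<bar>if k = 0 then 1 else 2 * (-1) ^ k :: real\<bar>) + \<bar>0\<bar> \<le> 1 + 3 * real W" by simp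
  qed auto
  from circuit_extend[OF c2 circuit_weaken[OF this order_refl order_refl order_refl, of "{u} \<union> r ` {..<W}"]]
  have c3: "circuit {u} (1 + 1 + 1) ((2 + real W) + real W * (3 + real W) + (1 + 3 * real W)) ({z} \<union> r ` {..<W})" by auto
  from circuit_extend[OF this circuit_weaken[OF q(1) order_refl order_refl order_refl, of "{u} \<union> ({z} \<union> r ` {..<W})"]]
  have c4: "circuit {u} (1 + 1 + 1 + 4 * R) ((2 + real W) + real W * (3 + real W) + (1 + 3 * real W) + 30 * real R * real W ^ 2)
     ({q} \<union> ({z} \<union> r ` {..<W}))" by auto
  have "circuit ({q} \<union> ({z} \<union> r ` {..<W})) 1 (1 + 3 * (real W + 2)) {v}" unfolding v_def
  proof (rule circuit_lincomb)
    have "(\<Sum>k\<in>{..W + 1}. 1 + \<bar>(if k = 0 then 1 else if k < W then 2 else if k = W then -1 else 1) / real W ^ 2\<bar>) \<le> (\<Sum>k\<in>{..W + 1}. 3)"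
    proof (intro sum_mono)
      fix k
      have "\<bar>if k = 0 then 1 else if k < W then 2 else if k = W then -1 else 1 :: real\<bar> \<le> 2 * real W ^ 2" using W2 by auto
      then show "1 + \<bar>(if k = 0 then 1 else if k < W then 2 else if k = W then -1 else 1) / real W ^ 2\<bar> \<le> 3"
        using W by (simp add: abs_divide divide_le_eq)
    qed
    then show "1 + (\<Sum>k\<in>{..W + 1}. 1 + \<bar>(if k = 0 then 1 else if k < W then 2 else if k = W then -1 else 1) / real W ^ 2\<bar>) + \<bar>0\<bar>
       \<le> 1 + 3 * (real W + 2)" by simp
  qed auto
  from circuit_trans[OF c4 this]
  have "circuit {u} (4 * Suc R) (30 * real (Suc R) * real W ^ 2) {v}"
    by (rule circuit_weaken) (use W2 in \<open>auto simp: algebra_simps power2_eq_square\<close>)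
  moreover have "\<bar>v x - (u x)\<^sup>2\<bar> \<le> (1 / real W ^ 2) ^ Suc R" for x
  proof -
    have "(u x)\<^sup>2 = (y x)\<^sup>2 / real W ^ 2" using W by (simp add: y power_mult_distrib)
    also have "\<dots> = (sq_interp W (y x) - z x + (z x)\<^sup>2) / real W ^ 2"
      using square_reduction(1)[OF W y(2,3)] z by simp
    finally have ux: "(u x)\<^sup>2 = (sq_interp W (y x) - z x + (z x)\<^sup>2) / real W ^ 2" .
    have "\<bar>v x - (u x)\<^sup>2\<bar> \<le> \<bar>(sq_interp W (y x) - z x + q x) / real W ^ 2 - (u x)\<^sup>2\<bar>"
      unfolding v by (rule abs_max_0_le) simp
    also have "\<dots> = \<bar>q x - (z x)\<^sup>2\<bar> / real W ^ 2"
      unfolding ux diff_divide_distrib[symmetric] by (simp add: abs_divide)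
    also have "\<dots> \<le> (1 / real W ^ 2) ^ R / real W ^ 2" using q(2) by (intro divide_right_mono) auto
    finally show ?thesis by simp
  qed
  ultimately show ?case by blast
qed

text \<open>Polarisation: u w = 2 m^2 - u^2/2 - w^2/2 with the midpoint m = (u + w)/2, which again
  lies in [0, 1]. The three square errors enter with weights 2, 1/2 and 1/2, hence the factor
  3.\<close>

lemma circuit_product:
  fixes u w :: "'a \<Rightarrow> real"
  assumes W: "1 \<le> W" and u: "\<And>x. 0 \<le> u x \<and> u x \<le> 1" and w: "\<And>x. 0 \<le> w x \<and> w x \<le> 1"
  shows "\<exists>v. circuit {u, w} (4 * R + 3) ((90 * real R + 30) * real W ^ 2) {v} \<and>
     (\<forall>x. 0 \<le> v x \<and> v x \<le> 1 \<and> \<bar>v x - u x * w x\<bar> \<le> 3 * (1 / real W ^ 2) ^ R)"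
proof -
  define m where "m = (\<lambda>x. max 0 (1/2 * u x + 1/2 * w x + 0 * u x - 0))"
  have m: "m x = (u x + w x) / 2" for x using u[of x] w[of x] by (simp add: m_def)
  have m01: "0 \<le> m x \<and> m x \<le> 1" for x using u[of x] w[of x] by (simp add: m)
  let ?e = "(1 / real W ^ 2) ^ R" and ?s = "30 * real R * real W ^ 2"
  obtain a where a: "circuit {u} (4 * R) ?s {a}" "\<forall>x. \<bar>a x - (u x)\<^sup>2\<bar> \<le> ?e"
    using circuit_square[of W u R] W u by blast
  obtain b where b: "circuit {w} (4 * R) ?s {b}" "\<forall>x. \<bar>b x - (w x)\<^sup>2\<bar> \<le> ?e"
    using circuit_square[of W w R] W w by blast
  obtain c where c: "circuit {m} (4 * R) ?s {c}" "\<forall>x. \<bar>c x - (m x)\<^sup>2\<bar> \<le> ?e"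
    using circuit_square[of W m R] W m01 by blast
  define v where "v = (\<lambda>x. min 1 (max 0 ((\<Sum>i\<in>{0,1,2::nat}. (if i = 0 then 2 else -1/2) * (if i = 0 then c else if i = 1 then a else b) x) - 0)))"
  have v: "v x = min 1 (max 0 (2 * c x - a x / 2 - b x / 2))" for x by (simp add: v_def algebra_simps)
  have m1: "circuit {u, w} 1 5 {m}" unfolding m_def by (rule circuit_lin3) auto
  have "circuit {u, w, m} (4 * R) (?s + ?s + ?s) ({a} \<union> {b} \<union> {c})"
    by (intro circuit_Un; rule circuit_weaken[OF a(1)] circuit_weaken[OF b(1)] circuit_weaken[OF c(1)]; auto)
  then have "circuit ({u, w} \<union> {m}) (4 * R) (3 * ?s) {a, b, c}" by (rule circuit_weaken) auto
  from circuit_extend[OF m1 this]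
  have "circuit {u, w} (1 + 4 * R) (5 + 3 * ?s) {a, b, c}" by (rule circuit_weaken) auto
  moreover have "circuit {a, b, c} 2 12 {v}" unfolding v_def
    by (rule circuit_clamp) auto
  ultimately have "circuit {u, w} (1 + 4 * R + 2) (5 + 3 * ?s + 12) {v}" by (rule circuit_trans)
  moreover have "1 \<le> real W ^ 2" using W by simp
  ultimately have "circuit {u, w} (4 * R + 3) ((90 * real R + 30) * real W ^ 2) {v}"
    by (elim circuit_weaken) (auto simp: algebra_simps)
  moreover have "\<bar>v x - u x * w x\<bar> \<le> 3 * ?e" for x
  proof -
    have uw: "u x * w x = 2 * (m x)\<^sup>2 - (u x)\<^sup>2 / 2 - (w x)\<^sup>2 / 2" unfolding m by (simp add: power2_eq_square field_simps)
    have "0 \<le> u x * w x" "u x * w x \<le> 1" using u[of x] w[of x] by (auto intro: mult_le_one)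
    then have "\<bar>v x - u x * w x\<bar> \<le> \<bar>(2 * c x - a x / 2 - b x / 2) - u x * w x\<bar>" unfolding v by auto
    also have "\<dots>
       \<le> 2 * \<bar>c x - (m x)\<^sup>2\<bar> + \<bar>a x - (u x)\<^sup>2\<bar> / 2 + \<bar>b x - (w x)\<^sup>2\<bar> / 2"
      unfolding uw using abs_ge_self[of "c x - (m x)\<^sup>2"] abs_ge_minus_self[of "c x - (m x)\<^sup>2"] abs_ge_self[of "a x - (u x)\<^sup>2"]
        abs_ge_minus_self[of "a x - (u x)\<^sup>2"] abs_ge_self[of "b x - (w x)\<^sup>2"] abs_ge_minus_self[of "b x - (w x)\<^sup>2"]
      by (intro abs_leI) (simp_all add: field_simps)
    also have "\<dots> \<le> 2 * ?e + ?e / 2 + ?e / 2" using a(2) b(2) c(2) by (intro add_mono divide_right_mono mult_left_mono) auto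
    finally show ?thesis by simp
  qed
  moreover have "0 \<le> v x" "v x \<le> 1" for x unfolding v by auto
  ultimately show ?thesis by blast
qed

text \<open>One factor is multiplied on at a time. As all factors and intermediate values lie in
  [0, 1], earlier errors are not amplified, and one product error is added per factor.\<close>

lemma circuit_monomial:
  fixes y :: "nat \<Rightarrow> 'a \<Rightarrow> real"
  assumes W: "1 \<le> W" and y: "\<And>j x. j < t \<Longrightarrow> 0 \<le> y j x \<and> y j x \<le> 1" and js: "set js \<subseteq> {..<t}"
  shows "\<exists>v. circuit (y ` {..<t}) (1 + length js * (4 * R + 3)) (2 + real (length js) * (90 * real R + 30) * real W ^ 2) {v} \<and>
     (\<forall>x. 0 \<le> v x \<and> v x \<le> 1 \<and> \<bar>v x - (\<Prod>j\<leftarrow>js. y j x)\<bar> \<le> 3 * real (length js) * (1 / real W ^ 2) ^ R)"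
  using js
proof (induction js)
  case Nil
  \<comment> \<open>The empty product is a unit without inputs and with bias -1.\<close>
  have "circuit (y ` {..<t}) 1 2 {\<lambda>x. max 0 ((\<Sum>i\<in>({} :: nat set). 0 * y i x) - - 1)}"
    by (rule circuit_lincomb) auto
  then show ?case by (intro exI[of _ "\<lambda>_. 1"]) simp
next
  case (Cons j js)
  let ?e = "(1 / real W ^ 2) ^ R"
  obtain v where v: "circuit (y ` {..<t}) (1 + length js * (4 * R + 3)) (2 + real (length js) * (90 * real R + 30) * real W ^ 2) {v}"
    "\<And>x. 0 \<le> v x \<and> v x \<le> 1" "\<And>x. \<bar>v x - (\<Prod>j\<leftarrow>js. y j x)\<bar> \<le> 3 * real (length js) * ?e"
    using Cons by auto
  have j: "j < t" using Cons by simp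
  obtain w where w: "circuit {v, y j} (4 * R + 3) ((90 * real R + 30) * real W ^ 2) {w}"
    "\<And>x. 0 \<le> w x \<and> w x \<le> 1" "\<And>x. \<bar>w x - v x * y j x\<bar> \<le> 3 * ?e"
    using circuit_product[of W v "y j" R] W v(2) y[OF j] by blast
  have "circuit (y ` {..<t}) (1 + length js * (4 * R + 3) + (4 * R + 3))
     (2 + real (length js) * (90 * real R + 30) * real W ^ 2 + (90 * real R + 30) * real W ^ 2) ({w} \<union> {v})"
    by (rule circuit_extend[OF v(1)], rule circuit_weaken[OF w(1)]) (use j in auto)
  then have "circuit (y ` {..<t}) (1 + length (j # js) * (4 * R + 3)) (2 + real (length (j # js)) * (90 * real R + 30) * real W ^ 2) {w}"
    by (rule circuit_weaken) (auto simp: algebra_simps)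
  moreover have "\<bar>w x - (\<Prod>j\<leftarrow>j # js. y j x)\<bar> \<le> 3 * real (length (j # js)) * ?e" for x
  proof -
    have "\<bar>w x - (\<Prod>j\<leftarrow>j # js. y j x)\<bar> \<le> \<bar>w x - v x * y j x\<bar> + \<bar>v x - (\<Prod>j\<leftarrow>js. y j x)\<bar> * y j x"
    proof -
      have "w x - (\<Prod>j\<leftarrow>j # js. y j x) = (w x - v x * y j x) + (v x - (\<Prod>j\<leftarrow>js. y j x)) * y j x" by (simp add: algebra_simps)
      then show ?thesis using abs_triangle_ineq[of "w x - v x * y j x" "(v x - (\<Prod>j\<leftarrow>js. y j x)) * y j x"] y[OF j, of x]
        by (simp add: abs_mult)
    qed
    also have "\<dots> \<le> 3 * ?e + (3 * real (length js) * ?e) * 1"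
      using v(3)[of x] w(3)[of x] y[OF j, of x] by (intro add_mono mult_mono) auto
    finally show ?thesis by (simp add: algebra_simps)
  qed
  ultimately show ?case using w(2) by blast
qed

section \<open>Blending local polynomials\<close>

lemma prod_list_replicate_concat:
  "(\<Prod>j\<leftarrow>concat (map (\<lambda>j. replicate (\<alpha> j) j) [0..<t]). f j) = (\<Prod>j<t. f j ^ \<alpha> j)" for f :: "nat \<Rightarrow> real"
  by (induction t) (auto simp: map_replicate_const mult.commute)

text \<open>Exponents are bounded in each coordinate separately, not by total degree, so that a sum
  over exponents splits off the last coordinate in the induction on the dimension.\<close>

definition box_indices :: "nat \<Rightarrow> nat \<Rightarrow> (nat \<Rightarrow> nat) set" where
  "box_indices t m = ({..<t} \<rightarrow>\<^sub>E {..m})"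

lemma finite_box_indices: "finite (box_indices t m)"
  by (auto simp: box_indices_def intro: finite_PiE)

text \<open>As the hats sum to \<open>1 / M\<close>, the blend of the local polynomials is the sum over the exponents of
  monomial times piecewise linear function. So the number of products is independent of \<open>M\<close>.\<close>

lemma kuhn_blend:
  fixes y :: "nat \<Rightarrow> real" and p :: "'b \<Rightarrow> real"
  assumes M: "0 < M" and y: "\<And>j. j < t \<Longrightarrow> 0 \<le> y j \<and> y j \<le> 1"
    and loc: "\<And>l. l \<in> kuhn_nodes t M \<Longrightarrow> (\<forall>j<t. \<bar>y j - real (l j) / real M\<bar> \<le> 1 / real M) \<Longrightarrow>
      \<bar>g - (\<Sum>\<alpha>\<in>A. c l \<alpha> * p \<alpha>)\<bar> \<le> \<epsilon>"
  shows "\<bar>(\<Sum>\<alpha>\<in>A. (real M * (\<Sum>l\<in>kuhn_nodes t M. c l \<alpha> * kuhn_hat t M l y)) * p \<alpha>) - g\<bar> \<le> \<epsilon>"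
proof -
  let ?N = "kuhn_nodes t M" and ?\<psi> = "\<lambda>l. real M * kuhn_hat t M l y"
  have one: "(\<Sum>l\<in>?N. ?\<psi> l) = 1" using sum_kuhn_hat[OF M y] M by (simp flip: sum_distrib_left)
  have "(\<Sum>\<alpha>\<in>A. (real M * (\<Sum>l\<in>?N. c l \<alpha> * kuhn_hat t M l y)) * p \<alpha>)
      = (\<Sum>\<alpha>\<in>A. \<Sum>l\<in>?N. ?\<psi> l * (c l \<alpha> * p \<alpha>))"
    by (auto simp: sum_distrib_left sum_distrib_right intro!: sum.cong)
  also have "\<dots> = (\<Sum>l\<in>?N. ?\<psi> l * (\<Sum>\<alpha>\<in>A. c l \<alpha> * p \<alpha>))"
    by (subst sum.swap) (simp add: sum_distrib_left)
  finally have "(\<Sum>\<alpha>\<in>A. (real M * (\<Sum>l\<in>?N. c l \<alpha> * kuhn_hat t M l y)) * p \<alpha>) - g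
      = (\<Sum>l\<in>?N. ?\<psi> l * ((\<Sum>\<alpha>\<in>A. c l \<alpha> * p \<alpha>) - g))"
    using one by (simp add: right_diff_distrib sum_subtractf flip: sum_distrib_right)
  also have "\<bar>\<dots>\<bar> \<le> (\<Sum>l\<in>?N. ?\<psi> l * \<epsilon>)"
  proof (rule order_trans[OF sum_abs sum_mono])
    fix l assume l: "l \<in> ?N"
    show "\<bar>?\<psi> l * ((\<Sum>\<alpha>\<in>A. c l \<alpha> * p \<alpha>) - g)\<bar> \<le> ?\<psi> l * \<epsilon>"
    proof (cases "kuhn_hat t M l y = 0")
      case False
      then have "\<bar>(\<Sum>\<alpha>\<in>A. c l \<alpha> * p \<alpha>) - g\<bar> \<le> \<epsilon>"
        using loc[OF l] kuhn_hat_support[OF False] by (simp add: abs_minus_commute)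
      then show ?thesis using kuhn_hat_nonneg[of t M l y] by (simp add: abs_mult mult_left_mono)
    qed simp
  qed
  also have "\<dots> = \<epsilon>" using one by (simp flip: sum_distrib_right)
  finally show ?thesis .
qed

text \<open>Depth \<open>k\<close> and constant \<open>C\<close> are chosen before \<open>W\<close>.
  The grid has mesh 1/W^2, hence at most 2^t W^(2t) nodes, and W^(2t) also dominates the price W^2
  of the multiplications because \<open>1 \<le> t\<close>. The error bound is stated for any value g
  near the local polynomials, since the target enters only pointwise.\<close>

lemma circuit_local_polynomials:
  fixes t m R :: nat and K1 :: real
  assumes t: "1 \<le> t" and K1: "0 < K1"
  shows "\<exists>k C. 0 < C \<and> (\<forall>W (y :: nat \<Rightarrow> 'a \<Rightarrow> real) (c :: (nat \<Rightarrow> nat) \<Rightarrow> (nat \<Rightarrow> nat) \<Rightarrow> real) \<rho>.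
    1 \<le> W \<longrightarrow> (\<forall>j<t. \<forall>x. 0 \<le> y j x \<and> y j x \<le> 1) \<longrightarrow> (\<forall>l \<alpha>. \<bar>c l \<alpha>\<bar> \<le> K1) \<longrightarrow> 0 \<le> \<rho> \<longrightarrow> \<rho> \<le> 1 \<longrightarrow>
    (\<exists>v. circuit (y ` {..<t}) k (C * real W ^ (2 * t)) {v} \<and> (\<forall>x. 0 \<le> v x \<and> v x \<le> \<rho>) \<and>
      (\<forall>x g \<epsilon>. 0 \<le> g \<longrightarrow> g \<le> \<rho> \<longrightarrow>
        (\<forall>l\<in>kuhn_nodes t (W ^ 2). (\<forall>j<t. \<bar>y j x - real (l j) / real (W ^ 2)\<bar> \<le> 1 / real (W ^ 2)) \<longrightarrow>
          \<bar>g - (\<Sum>\<alpha>\<in>box_indices t m. c l \<alpha> * (\<Prod>j<t. y j x ^ \<alpha> j))\<bar> \<le> \<epsilon>) \<longrightarrow>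
        \<bar>v x - g\<bar> \<le> \<epsilon> + C * (1 / real W ^ 2) ^ R)))"
proof -
  define \<Lambda> where "\<Lambda> = box_indices t m"
  have fin: "finite \<Lambda>" by (simp add: \<Lambda>_def finite_box_indices)
  define nA where "nA = real (card \<Lambda>)"
  define b where "b = 90 * real R + 30"
  define D where "D = real (t * m)"
  define C1 where "C1 = (10 + 32 * real t) * 2 ^ t + nA * (1 + 2 * 2 ^ t) + nA * 3 + nA * (2 + D * b) + nA * b + (6 + 2 * nA * (1 + 2 * K1))"
  \<comment> \<open>Per exponent: \<open>6 * K1\<close> is the product error times the weight
    \<open>2 * K1\<close>, and \<open>3 * K1 * D\<close> is the monomial error times the bound
    \<open>K1\<close> on the blended coefficient.\<close>
  define C2 where "C2 = nA * (6 * K1 + 3 * K1 * D)"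
  define k where "k = (5 + 4 * t) + (1 + t * m * (4 * R + 3)) + (4 * R + 3) + 2"
  have nonneg: "0 \<le> nA" "0 \<le> b" "0 \<le> D" "0 \<le> C2" "0 \<le> C1" using K1 by (auto simp: nA_def b_def D_def C2_def C1_def)
  show ?thesis
  proof (rule exI[of _ k], rule exI[of _ "C1 + C2 + 1"], intro conjI allI impI)
    show "0 < C1 + C2 + 1" using nonneg by simp
    fix W :: nat and y :: "nat \<Rightarrow> 'a \<Rightarrow> real" and c :: "(nat \<Rightarrow> nat) \<Rightarrow> (nat \<Rightarrow> nat) \<Rightarrow> real" and \<rho> :: real
    assume W: "1 \<le> W" and y: "\<forall>j<t. \<forall>x. 0 \<le> y j x \<and> y j x \<le> 1" and c: "\<forall>l \<alpha>. \<bar>c l \<alpha>\<bar> \<le> K1"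
      and \<rho>: "0 \<le> \<rho>" "\<rho> \<le> 1"
    define M where "M = W ^ 2"
    define V where "V = real W ^ (2 * t)"
    define e where "e = (1 / real W ^ 2) ^ R"
    have M: "0 < M" using W by (simp add: M_def)
    have V1: "1 \<le> V" using W by (simp add: V_def)
    have W2V: "real W ^ 2 \<le> V" unfolding V_def using W t by (intro power_increasing) auto
    have MV: "real M \<le> V" using W2V by (simp add: M_def)
    let ?N = "kuhn_nodes t M"
    have cardN: "real (card ?N) \<le> 2 ^ t * V"
    proof -
      have "real (card ?N) = (real M + 1) ^ t" by (simp add: card_kuhn_nodes add.commute)
      also have "\<dots> \<le> (2 * real M) ^ t" using M by (intro power_mono) auto
      also have "\<dots> = 2 ^ t * V" by (simp add: power_mult_distrib M_def V_def power_mult)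
      finally show ?thesis .
    qed
    have e0: "0 \<le> e" by (simp add: e_def)
    define \<psi> where "\<psi> l = (\<lambda>x. kuhn_hat t M l (\<lambda>j. y j x))" for l
    \<comment> \<open>Products are available only for factors in [0, 1], so the coefficients are
      moved there from [-K1, K1]; the shift is undone at the end.\<close>
    define c' where "c' l \<alpha> = (c l \<alpha> + K1) / (2 * K1)" for l \<alpha>
    have c': "0 \<le> c' l \<alpha>" "c' l \<alpha> \<le> 1" for l \<alpha>
    proof -
      have "\<bar>c l \<alpha>\<bar> \<le> K1" using c by blast
      then show "0 \<le> c' l \<alpha>" "c' l \<alpha> \<le> 1" using K1 by (auto simp: c'_def field_simps abs_le_iff)
    qed
    \<comment> \<open>Summation comes before the multiplication by M: scaling once per exponent
      costs about M, scaling inside the sum would cost up to M for every node.\<close>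
    define S where "S \<alpha> = (\<lambda>x. max 0 ((\<Sum>l\<in>?N. c' l \<alpha> * \<psi> l x) - 0))" for \<alpha>
    define A where "A \<alpha> = (\<lambda>x. max 0 ((\<Sum>i\<in>{()}. real M * S \<alpha> x) - 0))" for \<alpha>
    have \<psi>0: "0 \<le> \<psi> l x" for l x by (simp add: \<psi>_def kuhn_hat_nonneg)
    have \<psi>1: "(\<Sum>l\<in>?N. \<psi> l x) = 1 / real M" for x unfolding \<psi>_def by (rule sum_kuhn_hat[OF M]) (use y in auto)
    have S0: "S \<alpha> x = (\<Sum>l\<in>?N. c' l \<alpha> * \<psi> l x)" "0 \<le> S \<alpha> x" for \<alpha> x
    proof -
      have "0 \<le> (\<Sum>l\<in>?N. c' l \<alpha> * \<psi> l x)" by (intro sum_nonneg mult_nonneg_nonneg c' \<psi>0)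
      then show "S \<alpha> x = (\<Sum>l\<in>?N. c' l \<alpha> * \<psi> l x)" "0 \<le> S \<alpha> x" by (simp_all add: S_def)
    qed
    have S1: "S \<alpha> x \<le> 1 / real M" for \<alpha> x
    proof -
      have "(\<Sum>l\<in>?N. c' l \<alpha> * \<psi> l x) \<le> (\<Sum>l\<in>?N. \<psi> l x)"
        by (intro sum_mono mult_left_le_one_le c' \<psi>0)
      then show ?thesis by (simp add: S0(1) \<psi>1)
    qed
    have A0: "A \<alpha> x = real M * S \<alpha> x" for \<alpha> x using S0(2)[of \<alpha> x] by (simp add: A_def)
    have A01: "0 \<le> A \<alpha> x \<and> A \<alpha> x \<le> 1" for \<alpha> x
      using S0(2)[of \<alpha> x] S1[of \<alpha> x] M by (auto simp: A0 field_simps)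
    let ?B = "y ` {..<t}"
    have h1: "circuit ?B (3 + 4 * t) (\<Sum>l\<in>?N. 10 + 32 * real t) (\<Union>l\<in>?N. {\<psi> l})"
      unfolding \<psi>_def by (rule circuit_UN) (auto simp: finite_kuhn_nodes M intro: circuit_kuhn_hat)
    have h2: "circuit (\<Union>l\<in>?N. {\<psi> l}) 1 (\<Sum>\<alpha>\<in>\<Lambda>. 1 + 2 * (2 ^ t * V)) (\<Union>\<alpha>\<in>\<Lambda>. {S \<alpha>})"
    proof (rule circuit_UN[OF fin])
      fix \<alpha> assume "\<alpha> \<in> \<Lambda>"
      have "(\<Sum>l\<in>?N. 1 + \<bar>c' l \<alpha>\<bar>) \<le> (\<Sum>l\<in>?N. 2)" using c' by (intro sum_mono) auto
      also have "\<dots> \<le> 2 * (2 ^ t * V)" using cardN by simp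
      finally show "circuit (\<Union>l\<in>?N. {\<psi> l}) 1 (1 + 2 * (2 ^ t * V)) {S \<alpha>}"
        unfolding S_def by (intro circuit_lincomb) (auto simp: finite_kuhn_nodes)
    qed
    have h3: "circuit (\<Union>\<alpha>\<in>\<Lambda>. {S \<alpha>}) 1 (\<Sum>\<alpha>\<in>\<Lambda>. 2 + V) (\<Union>\<alpha>\<in>\<Lambda>. {A \<alpha>})"
      by (rule circuit_UN[OF fin], unfold A_def, rule circuit_lincomb) (use MV in auto)
    have hA: "circuit ?B (5 + 4 * t) ((10 + 32 * real t) * (2 ^ t * V) + nA * (1 + 2 * (2 ^ t * V)) + nA * (2 + V)) (A ` \<Lambda>)"
      by (rule circuit_weaken[OF circuit_trans[OF circuit_trans[OF h1 h2] h3]])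
        (use cardN in \<open>auto simp: nA_def mult.commute intro!: mult_right_mono\<close>)
    define js where "js \<alpha> = concat (map (\<lambda>j. replicate (\<alpha> j) j) [0..<t])" for \<alpha>
    have js: "set (js \<alpha>) \<subseteq> {..<t}" for \<alpha> by (auto simp: js_def)
    have len: "length (js \<alpha>) \<le> t * m" if "\<alpha> \<in> \<Lambda>" for \<alpha>
    proof -
      have "length (js \<alpha>) = (\<Sum>j<t. \<alpha> j)"
        by (simp add: js_def length_concat comp_def interv_sum_list_conv_sum_set_nat atLeast0LessThan)
      also have "\<dots> \<le> (\<Sum>j<t. m)" using that by (intro sum_mono) (auto simp: \<Lambda>_def box_indices_def PiE_iff)
      finally show ?thesis by simp
    qed
    define p where "p \<alpha> x = (\<Prod>j<t. y j x ^ \<alpha> j)" for \<alpha> x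
    have "\<forall>\<alpha>\<in>\<Lambda>. \<exists>\<mu>. circuit ?B (1 + t * m * (4 * R + 3)) (2 + D * b * V) {\<mu>} \<and>
      (\<forall>x. 0 \<le> \<mu> x \<and> \<mu> x \<le> 1 \<and> \<bar>\<mu> x - p \<alpha> x\<bar> \<le> 3 * D * e)"
    proof
      fix \<alpha> assume \<alpha>: "\<alpha> \<in> \<Lambda>"
      obtain v where v: "circuit ?B (1 + length (js \<alpha>) * (4 * R + 3)) (2 + real (length (js \<alpha>)) * b * real W ^ 2) {v}"
        "\<forall>x. 0 \<le> v x \<and> v x \<le> 1 \<and> \<bar>v x - (\<Prod>j\<leftarrow>js \<alpha>. y j x)\<bar> \<le> 3 * real (length (js \<alpha>)) * e"
        using circuit_monomial[OF W _ js, of y \<alpha> R] y unfolding b_def e_def by blast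
      have l: "real (length (js \<alpha>)) \<le> D" using len[OF \<alpha>] unfolding D_def by (simp only: of_nat_le_iff)
      have "real (length (js \<alpha>)) * b * real W ^ 2 \<le> D * b * V"
        using l W2V nonneg by (intro mult_mono) auto
      then have 1: "circuit ?B (1 + t * m * (4 * R + 3)) (2 + D * b * V) {v}"
        using len[OF \<alpha>] by (intro circuit_weaken[OF v(1)]) auto
      have 2: "3 * real (length (js \<alpha>)) * e \<le> 3 * D * e" using l e0 by (intro mult_mono) auto
      have 3: "(\<Prod>j\<leftarrow>js \<alpha>. y j x) = p \<alpha> x" for x
        unfolding js_def p_def by (rule prod_list_replicate_concat)
      have "0 \<le> v x \<and> v x \<le> 1 \<and> \<bar>v x - p \<alpha> x\<bar> \<le> 3 * D * e" for x
        using v(2)[rule_format, of x] 2 unfolding 3 by linarith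
      with 1 show "\<exists>\<mu>. circuit ?B (1 + t * m * (4 * R + 3)) (2 + D * b * V) {\<mu>} \<and>
        (\<forall>x. 0 \<le> \<mu> x \<and> \<mu> x \<le> 1 \<and> \<bar>\<mu> x - p \<alpha> x\<bar> \<le> 3 * D * e)" by blast
    qed
    then obtain \<mu> where \<mu>: "\<And>\<alpha>. \<alpha> \<in> \<Lambda> \<Longrightarrow> circuit ?B (1 + t * m * (4 * R + 3)) (2 + D * b * V) {\<mu> \<alpha>}"
      "\<And>\<alpha> x. \<alpha> \<in> \<Lambda> \<Longrightarrow> 0 \<le> \<mu> \<alpha> x \<and> \<mu> \<alpha> x \<le> 1" "\<And>\<alpha> x. \<alpha> \<in> \<Lambda> \<Longrightarrow> \<bar>\<mu> \<alpha> x - p \<alpha> x\<bar> \<le> 3 * D * e"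
      by metis
    have h\<mu>: "circuit ?B (1 + t * m * (4 * R + 3)) (\<Sum>\<alpha>\<in>\<Lambda>. 2 + D * b * V) (\<Union>\<alpha>\<in>\<Lambda>. {\<mu> \<alpha>})"
      by (rule circuit_UN[OF fin]) (rule \<mu>(1))
    have "\<forall>\<alpha>\<in>\<Lambda>. \<exists>\<pi>. circuit {A \<alpha>, \<mu> \<alpha>} (4 * R + 3) (b * V) {\<pi>} \<and> (\<forall>x. \<bar>\<pi> x - A \<alpha> x * \<mu> \<alpha> x\<bar> \<le> 3 * e)"
    proof
      fix \<alpha> assume \<alpha>: "\<alpha> \<in> \<Lambda>"
      have "b * real W ^ 2 \<le> b * V" using W2V nonneg by (intro mult_left_mono)
      then show "\<exists>\<pi>. circuit {A \<alpha>, \<mu> \<alpha>} (4 * R + 3) (b * V) {\<pi>} \<and> (\<forall>x. \<bar>\<pi> x - A \<alpha> x * \<mu> \<alpha> x\<bar> \<le> 3 * e)"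
        using circuit_product[of W "A \<alpha>" "\<mu> \<alpha>" R] W A01[of \<alpha>] \<mu>(2)[OF \<alpha>] unfolding b_def e_def
        by (meson circuit_weaken order_refl)
    qed
    then obtain \<pi> where \<pi>: "\<And>\<alpha>. \<alpha> \<in> \<Lambda> \<Longrightarrow> circuit {A \<alpha>, \<mu> \<alpha>} (4 * R + 3) (b * V) {\<pi> \<alpha>}"
      "\<And>\<alpha> x. \<alpha> \<in> \<Lambda> \<Longrightarrow> \<bar>\<pi> \<alpha> x - A \<alpha> x * \<mu> \<alpha> x\<bar> \<le> 3 * e"
      by metis
    have hAm: "circuit ?B ((5 + 4 * t) + (1 + t * m * (4 * R + 3)))
      (((10 + 32 * real t) * (2 ^ t * V) + nA * (1 + 2 * (2 ^ t * V)) + nA * (2 + V)) + nA * (2 + D * b * V)) (A ` \<Lambda> \<union> \<mu> ` \<Lambda>)"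
      by (rule circuit_Un[OF circuit_weaken[OF hA] circuit_weaken[OF h\<mu>]]) (auto simp: nA_def)
    have h\<pi>: "circuit (A ` \<Lambda> \<union> \<mu> ` \<Lambda>) (4 * R + 3) (\<Sum>\<alpha>\<in>\<Lambda>. b * V) (\<Union>\<alpha>\<in>\<Lambda>. {\<pi> \<alpha>})"
      by (rule circuit_UN[OF fin]) (rule circuit_weaken[OF \<pi>(1)], auto)
    have hAm\<pi>: "circuit ?B ((5 + 4 * t) + (1 + t * m * (4 * R + 3)) + (4 * R + 3))
      (((10 + 32 * real t) * (2 ^ t * V) + nA * (1 + 2 * (2 ^ t * V)) + nA * (2 + V)) + nA * (2 + D * b * V) + nA * (b * V))
       (\<pi> ` \<Lambda> \<union> (A ` \<Lambda> \<union> \<mu> ` \<Lambda>))"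
      using circuit_extend[OF hAm circuit_weaken[OF h\<pi> order_refl order_refl order_refl]] by (simp add: UNION_singleton_eq_range nA_def)
    \<comment> \<open>\<open>True\<close> selects the product with weight \<open>2 * K1\<close>,
      \<open>False\<close> the monomial with weight \<open>- K1\<close>, which undoes the shift of
      the coefficients.\<close>
    define v where "v = (\<lambda>x. min \<rho> (max 0 ((\<Sum>i\<in>\<Lambda> \<times> UNIV. (if snd i then 2 * K1 else - K1) * (if snd i then \<pi> (fst i) else \<mu> (fst i)) x) - 0)))"
    have v: "v x = min \<rho> (max 0 (\<Sum>\<alpha>\<in>\<Lambda>. 2 * K1 * \<pi> \<alpha> x - K1 * \<mu> \<alpha> x))" for x
      unfolding v_def by (simp add: sum.cartesian_product' UNIV_bool sum_subtractf algebra_simps flip: sum.distrib)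
    have "circuit (\<pi> ` \<Lambda> \<union> (A ` \<Lambda> \<union> \<mu> ` \<Lambda>)) 2 (6 + 2 * nA * (1 + 2 * K1)) {v}"
      unfolding v_def
    proof (rule circuit_clamp)
      have "(\<Sum>i\<in>\<Lambda> \<times> (UNIV::bool set). 1 + \<bar>if snd i then 2 * K1 else - K1\<bar>) \<le> (\<Sum>i\<in>\<Lambda> \<times> (UNIV::bool set). 1 + 2 * K1)"
        using K1 by (intro sum_mono) auto
      then show "6 + (\<Sum>i\<in>\<Lambda> \<times> (UNIV::bool set). 1 + \<bar>if snd i then 2 * K1 else - K1\<bar>) + \<bar>0\<bar> \<le> 6 + 2 * nA * (1 + 2 * K1)"
        by (simp add: nA_def card_cartesian_product algebra_simps)
    qed (use fin \<rho> in auto)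
    from circuit_trans[OF hAm\<pi> this]
    have "circuit ?B k ((((10 + 32 * real t) * (2 ^ t * V) + nA * (1 + 2 * (2 ^ t * V)) + nA * (2 + V)) + nA * (2 + D * b * V) + nA * (b * V))
        + (6 + 2 * nA * (1 + 2 * K1))) {v}" by (simp add: k_def)
    moreover have "(((10 + 32 * real t) * (2 ^ t * V) + nA * (1 + 2 * (2 ^ t * V)) + nA * (2 + V)) + nA * (2 + D * b * V) + nA * (b * V))
        + (6 + 2 * nA * (1 + 2 * K1)) \<le> C1 * V"
    proof -
      have "x \<le> x * V" if "0 \<le> x" for x using V1 mult_left_mono[OF V1 that] by simp
      from this[of "nA * 1"] this[of "nA * 2"] this[of "nA * 2"] this[of "6 + 2 * nA * (1 + 2 * K1)"] show ?thesis
        using nonneg K1 unfolding C1_def by (simp add: algebra_simps)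
    qed
    moreover have "C1 * V \<le> (C1 + C2 + 1) * V" using nonneg V1 by (intro mult_right_mono) auto
    ultimately have circ: "circuit ?B k ((C1 + C2 + 1) * real W ^ (2 * t)) {v}"
      unfolding V_def by (meson circuit_weaken order_refl order_trans)
    have bound: "\<bar>v x - g\<bar> \<le> \<epsilon> + (C1 + C2 + 1) * (1 / real W ^ 2) ^ R"
      if g: "0 \<le> g" "g \<le> \<rho>" and loc: "\<forall>l\<in>kuhn_nodes t (W ^ 2). (\<forall>j<t. \<bar>y j x - real (l j) / real (W ^ 2)\<bar> \<le> 1 / real (W ^ 2)) \<longrightarrow>
          \<bar>g - (\<Sum>\<alpha>\<in>box_indices t m. c l \<alpha> * (\<Prod>j<t. y j x ^ \<alpha> j))\<bar> \<le> \<epsilon>" for x g \<epsilon>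
    proof -
      let ?T = "\<Sum>\<alpha>\<in>\<Lambda>. (real M * (\<Sum>l\<in>?N. c l \<alpha> * \<psi> l x)) * p \<alpha> x"
      have T: "\<bar>?T - g\<bar> \<le> \<epsilon>" unfolding \<psi>_def
        using loc y by (intro kuhn_blend[OF M]) (auto simp: M_def \<Lambda>_def p_def)
      \<comment> \<open>The hats sum to 1/M, so the shift by \<open>K1\<close> contributes exactly
        the constant \<open>K1\<close>.\<close>
      have A: "2 * K1 * A \<alpha> x - K1 = real M * (\<Sum>l\<in>?N. c l \<alpha> * \<psi> l x)" for \<alpha>
      proof -
        have "2 * K1 * A \<alpha> x = real M * (\<Sum>l\<in>?N. (c l \<alpha> + K1) * \<psi> l x)"
          unfolding A0 S0(1) c'_def sum_distrib_left using K1 by (intro sum.cong refl) (simp add: field_simps)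
        also have "\<dots> = real M * (\<Sum>l\<in>?N. c l \<alpha> * \<psi> l x) + K1 * (real M * (\<Sum>l\<in>?N. \<psi> l x))"
          by (simp add: sum.distrib algebra_simps flip: sum_distrib_left sum_distrib_right)
        finally show ?thesis using \<psi>1[of x] M by simp
      qed
      have "\<bar>(\<Sum>\<alpha>\<in>\<Lambda>. 2 * K1 * \<pi> \<alpha> x - K1 * \<mu> \<alpha> x) - ?T\<bar> \<le> (\<Sum>\<alpha>\<in>\<Lambda>. 6 * K1 * e + 3 * K1 * D * e)"
        unfolding sum_subtractf[symmetric]
      proof (rule order_trans[OF sum_abs sum_mono])
        fix \<alpha> assume \<alpha>: "\<alpha> \<in> \<Lambda>"
        have "2 * K1 * \<pi> \<alpha> x - K1 * \<mu> \<alpha> x - (real M * (\<Sum>l\<in>?N. c l \<alpha> * \<psi> l x)) * p \<alpha> x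
          = 2 * K1 * (\<pi> \<alpha> x - A \<alpha> x * \<mu> \<alpha> x) + (2 * K1 * A \<alpha> x - K1) * (\<mu> \<alpha> x - p \<alpha> x)"
          unfolding A[symmetric] by (simp add: algebra_simps)
        also have "\<bar>\<dots>\<bar> \<le> \<bar>2 * K1 * (\<pi> \<alpha> x - A \<alpha> x * \<mu> \<alpha> x)\<bar> + \<bar>(2 * K1 * A \<alpha> x - K1) * (\<mu> \<alpha> x - p \<alpha> x)\<bar>"
          by (rule abs_triangle_ineq)
        also have "\<dots> = 2 * K1 * \<bar>\<pi> \<alpha> x - A \<alpha> x * \<mu> \<alpha> x\<bar> + \<bar>2 * K1 * A \<alpha> x - K1\<bar> * \<bar>\<mu> \<alpha> x - p \<alpha> x\<bar>"
          using K1 by (simp add: abs_mult)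
        also have "\<dots> \<le> 2 * K1 * (3 * e) + K1 * (3 * D * e)"
        proof (intro add_mono mult_mono)
          have "K1 * A \<alpha> x \<le> K1 * 1" "0 \<le> K1 * A \<alpha> x" using K1 A01[of \<alpha> x] by (auto intro: mult_left_mono)
          then show "\<bar>2 * K1 * A \<alpha> x - K1\<bar> \<le> K1" unfolding abs_le_iff by linarith
        qed (use K1 \<pi>(2)[OF \<alpha>] \<mu>(3)[OF \<alpha>] in auto)
        finally show "\<bar>2 * K1 * \<pi> \<alpha> x - K1 * \<mu> \<alpha> x - (real M * (\<Sum>l\<in>?N. c l \<alpha> * \<psi> l x)) * p \<alpha> x\<bar> \<le> 6 * K1 * e + 3 * K1 * D * e"
          by simp
      qed
      also have "\<dots> = C2 * e" by (simp add: C2_def nA_def algebra_simps)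
      finally have *: "\<bar>(\<Sum>\<alpha>\<in>\<Lambda>. 2 * K1 * \<pi> \<alpha> x - K1 * \<mu> \<alpha> x) - ?T\<bar> \<le> C2 * e" .
      have "C2 * e \<le> (C1 + C2 + 1) * e" using nonneg e0 by (intro mult_right_mono) auto
      moreover have "\<bar>v x - g\<bar> \<le> \<bar>(\<Sum>\<alpha>\<in>\<Lambda>. 2 * K1 * \<pi> \<alpha> x - K1 * \<mu> \<alpha> x) - g\<bar>"
        unfolding v using g by auto
      ultimately show ?thesis using * T unfolding e_def by linarith
    qed
    have vb: "0 \<le> v x \<and> v x \<le> \<rho>" for x using \<rho> by (auto simp: v)
    show "\<exists>v. circuit ?B k ((C1 + C2 + 1) * real W ^ (2 * t)) {v} \<and> (\<forall>x. 0 \<le> v x \<and> v x \<le> \<rho>) \<and>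
      (\<forall>x g \<epsilon>. 0 \<le> g \<longrightarrow> g \<le> \<rho> \<longrightarrow>
        (\<forall>l\<in>kuhn_nodes t (W ^ 2). (\<forall>j<t. \<bar>y j x - real (l j) / real (W ^ 2)\<bar> \<le> 1 / real (W ^ 2)) \<longrightarrow>
          \<bar>g - (\<Sum>\<alpha>\<in>box_indices t m. c l \<alpha> * (\<Prod>j<t. y j x ^ \<alpha> j))\<bar> \<le> \<epsilon>) \<longrightarrow>
        \<bar>v x - g\<bar> \<le> \<epsilon> + (C1 + C2 + 1) * (1 / real W ^ 2) ^ R)"
      using circ vb bound by blast
  qed
qed

section \<open>Local Taylor approximation on the cube\<close>

text \<open>The derivative of the remainder of order m + 1 is the remainder of order m of the
  derivative. The induction bounds the latter by B \<delta>^m, and the mean value bound over a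
  length of at most \<delta> gives the missing factor.\<close>

lemma taylor_holder_1d:
  fixes \<phi> :: "nat \<Rightarrow> real \<Rightarrow> real"
  assumes "\<And>k z. k < m \<Longrightarrow> z \<in> {a..b} \<Longrightarrow> (\<phi> k has_real_derivative \<phi> (Suc k) z) (at z within {a..b})"
    and "\<And>z. z \<in> {a..b} \<Longrightarrow> \<bar>z - c\<bar> \<le> \<delta> \<Longrightarrow> \<bar>\<phi> m z - \<phi> m c\<bar> \<le> B"
    and "c \<in> {a..b}" "x \<in> {a..b}" "\<bar>x - c\<bar> \<le> \<delta>" "0 \<le> B"
  shows "\<bar>\<phi> 0 x - (\<Sum>k\<le>m. \<phi> k c / fact k * (x - c) ^ k)\<bar> \<le> B * \<delta> ^ m"
  using assms
proof (induction m arbitrary: \<phi> x)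
  case 0 then show ?case by simp
next
  case (Suc m)
  \<comment> \<open>This interval contains c and x, and all its points are within \<delta> of c, as
    the induction hypothesis requires.\<close>
  let ?S = "{max a (c - \<delta>)..min b (c + \<delta>)}"
  define g where "g z = \<phi> 0 z - (\<Sum>k\<le>Suc m. \<phi> k c / fact k * (z - c) ^ k)" for z
  define g' where "g' z = \<phi> 1 z - (\<Sum>k\<le>m. \<phi> (Suc k) c / fact k * (z - c) ^ k)" for z
  have d0: "0 \<le> \<delta>" using Suc.prems(5) by linarith
  have "\<bar>g x - g c\<bar> \<le> (B * \<delta> ^ m) * \<bar>x - c\<bar>"
  proof (rule field_differentiable_bound[of ?S g g', unfolded real_norm_def])
    show "convex ?S" by simp
    fix z assume z: "z \<in> ?S"
    have "(\<phi> 0 has_real_derivative \<phi> 1 z) (at z within ?S)"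
      using Suc.prems(1)[of 0 z] z by (auto intro: DERIV_subset)
    moreover have "((\<lambda>z. \<Sum>k\<le>m. \<phi> (Suc k) c / fact (Suc k) * (z - c) ^ Suc k) has_real_derivative
      (\<Sum>k\<le>m. \<phi> (Suc k) c / fact k * (z - c) ^ k)) (at z within ?S)"
    proof (rule DERIV_sum)
      fix k
      have "((\<lambda>z. (z - c) ^ Suc k) has_real_derivative real (Suc k) * (z - c) ^ k) (at z within ?S)"
        by (auto intro!: derivative_eq_intros simp del: power_Suc of_nat_Suc)
      then have "((\<lambda>z. \<phi> (Suc k) c / fact (Suc k) * (z - c) ^ Suc k) has_real_derivative
        \<phi> (Suc k) c / fact (Suc k) * (real (Suc k) * (z - c) ^ k)) (at z within ?S)"
        by (rule DERIV_cmult)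
      also have "\<phi> (Suc k) c / fact (Suc k) * (real (Suc k) * (z - c) ^ k) = \<phi> (Suc k) c / fact k * (z - c) ^ k"
        by (simp add: fact_Suc field_simps del: of_nat_Suc)
      finally show "((\<lambda>z. \<phi> (Suc k) c / fact (Suc k) * (z - c) ^ Suc k) has_real_derivative
        \<phi> (Suc k) c / fact k * (z - c) ^ k) (at z within ?S)" .
    qed
    ultimately have "((\<lambda>z. \<phi> 0 z - (\<phi> 0 c + (\<Sum>k\<le>m. \<phi> (Suc k) c / fact (Suc k) * (z - c) ^ Suc k))) has_real_derivative
       \<phi> 1 z - (0 + (\<Sum>k\<le>m. \<phi> (Suc k) c / fact k * (z - c) ^ k))) (at z within ?S)"
      by (intro DERIV_diff DERIV_add DERIV_const)
    moreover have "g = (\<lambda>z. \<phi> 0 z - (\<phi> 0 c + (\<Sum>k\<le>m. \<phi> (Suc k) c / fact (Suc k) * (z - c) ^ Suc k)))"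
      unfolding g_def by (subst sum.atMost_Suc_shift) simp
    ultimately show "(g has_real_derivative g' z) (at z within ?S)" by (simp add: g'_def)
    show "\<bar>g' z\<bar> \<le> B * \<delta> ^ m" unfolding g'_def
      using Suc.IH[of "\<lambda>k. \<phi> (Suc k)" z] Suc.prems z by (auto simp: abs_le_iff)
  qed (use Suc.prems in \<open>auto simp: abs_le_iff\<close>)
  moreover have "g c = 0" unfolding g_def by (subst sum.atMost_Suc_shift) simp
  moreover have "(B * \<delta> ^ m) * \<bar>x - c\<bar> \<le> (B * \<delta> ^ m) * \<delta>"
    using Suc.prems d0 by (intro mult_left_mono) auto
  ultimately have "\<bar>g x\<bar> \<le> B * \<delta> ^ m * \<delta>" by simp
  also have "\<dots> = B * \<delta> ^ Suc m" by simp
  finally show ?case unfolding g_def .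
qed

text \<open>The Hoelder condition avoids \<^const>\<open>sup_norm\<close>, which is a junk value in dimension 0, where the
  induction on the dimension starts.\<close>

definition holder_smooth :: "nat \<Rightarrow> real \<Rightarrow> nat \<Rightarrow> real \<Rightarrow> real \<Rightarrow> ((nat \<Rightarrow> real) \<Rightarrow> real)
    \<Rightarrow> ((nat \<Rightarrow> nat) \<Rightarrow> (nat \<Rightarrow> real) \<Rightarrow> real) \<Rightarrow> bool" where
  "holder_smooth t \<rho> m \<gamma> K f u \<longleftrightarrow> partial_derivs t 0 \<rho> m f u \<and>
     (\<forall>\<alpha>\<in>multi_indices t. order_mi t \<alpha> \<le> m \<longrightarrow> (\<forall>x\<in>cube t 0 \<rho>. \<bar>u \<alpha> x\<bar> \<le> K)) \<and>
     (\<forall>\<alpha>\<in>multi_indices t. order_mi t \<alpha> = m \<longrightarrow> (\<forall>x\<in>cube t 0 \<rho>. \<forall>y\<in>cube t 0 \<rho>. \<forall>\<delta>.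
        0 \<le> \<delta> \<and> (\<forall>k<t. \<bar>x k - y k\<bar> \<le> \<delta>) \<longrightarrow> \<bar>u \<alpha> x - u \<alpha> y\<bar> \<le> K * \<delta> powr \<gamma>))"

lemma holder_smoothD:
  assumes "holder_smooth t \<rho> m \<gamma> K f u"
  shows holder_smooth_zero: "x \<in> cube t 0 \<rho> \<Longrightarrow> u (\<lambda>_. 0) x = f x"
    and holder_smooth_deriv: "\<alpha> \<in> multi_indices t \<Longrightarrow> order_mi t \<alpha> < m \<Longrightarrow> i < t \<Longrightarrow> x \<in> cube t 0 \<rho> \<Longrightarrow>
      ((\<lambda>y. u \<alpha> (x(i := y))) has_real_derivative u (\<alpha>(i := Suc (\<alpha> i))) x) (at (x i) within {0..\<rho>})"
    and holder_smooth_bound: "\<alpha> \<in> multi_indices t \<Longrightarrow> order_mi t \<alpha> \<le> m \<Longrightarrow> x \<in> cube t 0 \<rho> \<Longrightarrow> \<bar>u \<alpha> x\<bar> \<le> K"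
    and holder_smooth_holder: "\<alpha> \<in> multi_indices t \<Longrightarrow> order_mi t \<alpha> = m \<Longrightarrow> x \<in> cube t 0 \<rho> \<Longrightarrow> y \<in> cube t 0 \<rho> \<Longrightarrow>
      0 \<le> \<delta> \<Longrightarrow> (\<And>k. k < t \<Longrightarrow> \<bar>x k - y k\<bar> \<le> \<delta>) \<Longrightarrow> \<bar>u \<alpha> x - u \<alpha> y\<bar> \<le> K * \<delta> powr \<gamma>"
  using assms unfolding holder_smooth_def partial_derivs_def by simp_all

lemma multi_indices_upd: "\<alpha> \<in> multi_indices t \<Longrightarrow> \<alpha>(t := k) \<in> multi_indices (Suc t)"
  by (auto simp: multi_indices_def)

lemma multi_indices_upd_less: "\<alpha> \<in> multi_indices t \<Longrightarrow> i < t \<Longrightarrow> \<alpha>(i := k) \<in> multi_indices t"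
  by (auto simp: multi_indices_def)

lemma zero_multi_indices: "(\<lambda>_. 0) \<in> multi_indices t"
  by (auto simp: multi_indices_def)

lemma order_mi_upd: "order_mi (Suc t) (\<alpha>(t := k)) = order_mi t \<alpha> + k"
  by (simp add: order_mi_def)

lemma order_mi_zero: "order_mi t (\<lambda>_. 0) = 0"
  by (simp add: order_mi_def)

lemma order_mi_Suc: "i < t \<Longrightarrow> order_mi t (\<alpha>(i := Suc (\<alpha> i))) = Suc (order_mi t \<alpha>)"
  unfolding order_mi_def by (subst (1 2) sum.remove[of _ i]) auto

lemma cube_upd: "x \<in> cube t a b \<Longrightarrow> a \<le> z \<Longrightarrow> z \<le> b \<Longrightarrow> i < t \<Longrightarrow> x(i := z) \<in> cube t a b"
  by (auto simp: cube_def PiE_iff extensional_def)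

lemma cube_upd_Suc: "x \<in> cube t a b \<Longrightarrow> a \<le> z \<Longrightarrow> z \<le> b \<Longrightarrow> x(t := z) \<in> cube (Suc t) a b"
  by (auto simp: cube_def PiE_iff extensional_def less_Suc_eq)

lemma cube_nth: "x \<in> cube t a b \<Longrightarrow> i < t \<Longrightarrow> a \<le> x i \<and> x i \<le> b"
  by (auto simp: cube_def PiE_iff)

lemma cube_restrict: "x \<in> cube (Suc t) a b \<Longrightarrow> restrict x {..<t} \<in> cube t a b"
  by (auto simp: cube_def PiE_iff)

lemma restrict_upd_Suc: "x \<in> cube (Suc t) a b \<Longrightarrow> (restrict x {..<t})(t := z) = x(t := z)"
  by (auto simp: cube_def PiE_iff extensional_def fun_eq_iff)

text \<open>Prepares the induction on the dimension: the k-th derivative in the last variable, on a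
  slice, has m - k derivatives left. Its derivatives of top order are derivatives of f of order m,
  so \<open>K\<close> and \<gamma> stay the same.\<close>

lemma holder_smooth_slice:
  assumes S: "holder_smooth (Suc t) \<rho> m \<gamma> K f u" and k: "k \<le> m" and z: "0 \<le> z" "z \<le> \<rho>"
  shows "holder_smooth t \<rho> (m - k) \<gamma> K (\<lambda>x. u ((\<lambda>_. 0)(t := k)) (x(t := z))) (\<lambda>\<alpha> x. u (\<alpha>(t := k)) (x(t := z)))"
  unfolding holder_smooth_def partial_derivs_def
proof (intro conjI ballI allI impI)
  fix \<alpha> i x assume \<alpha>: "\<alpha> \<in> multi_indices t" "order_mi t \<alpha> < m - k" and i: "i < t" and x: "x \<in> cube t 0 \<rho>"
  have "((\<lambda>y. u (\<alpha>(t := k)) ((x(t := z))(i := y))) has_real_derivative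
      u ((\<alpha>(t := k))(i := Suc ((\<alpha>(t := k)) i))) (x(t := z))) (at ((x(t := z)) i) within {0..\<rho>})"
    using \<alpha> i by (intro holder_smooth_deriv[OF S] multi_indices_upd cube_upd_Suc x z) (auto simp: order_mi_upd)
  moreover have "(\<alpha>(t := k))(i := Suc ((\<alpha>(t := k)) i)) = (\<alpha>(i := Suc (\<alpha> i)))(t := k)"
    "(x(t := z))(i := y) = (x(i := y))(t := z)" "(x(t := z)) i = x i" for y
    using i by (auto simp: fun_upd_twist)
  ultimately show "((\<lambda>y. u (\<alpha>(t := k)) ((x(i := y))(t := z))) has_real_derivative
      u ((\<alpha>(i := Suc (\<alpha> i)))(t := k)) (x(t := z))) (at (x i) within {0..\<rho>})"
    by simp
next
  fix \<alpha> x assume "\<alpha> \<in> multi_indices t" "order_mi t \<alpha> \<le> m - k" "x \<in> cube t 0 \<rho>"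
  then show "\<bar>u (\<alpha>(t := k)) (x(t := z))\<bar> \<le> K"
    using k z by (intro holder_smooth_bound[OF S] multi_indices_upd cube_upd_Suc) (auto simp: order_mi_upd)
next
  fix \<alpha> x y \<delta> assume "\<alpha> \<in> multi_indices t" "order_mi t \<alpha> = m - k" "x \<in> cube t 0 \<rho>" "y \<in> cube t 0 \<rho>"
    and "0 \<le> \<delta> \<and> (\<forall>k<t. \<bar>x k - y k\<bar> \<le> \<delta>)"
  then show "\<bar>u (\<alpha>(t := k)) (x(t := z)) - u (\<alpha>(t := k)) (y(t := z))\<bar> \<le> K * \<delta> powr \<gamma>"
    using k z by (intro holder_smooth_holder[OF S] multi_indices_upd cube_upd_Suc) (auto simp: order_mi_upd less_Suc_eq)
qed simp

lemma sum_box_indices_Suc: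
  "(\<Sum>\<beta>\<in>box_indices (Suc t) N. F \<beta>) = (\<Sum>i\<le>N. \<Sum>\<alpha>\<in>box_indices t N. F (\<alpha>(t := i)))"
proof -
  have e: "{..<Suc t} = insert t {..<t}" by auto
  have "(\<Sum>\<beta>\<in>box_indices (Suc t) N. F \<beta>) = (\<Sum>(i, \<alpha>)\<in>{..N} \<times> box_indices t N. F (\<alpha>(t := i)))"
    unfolding box_indices_def e PiE_insert_eq
    by (subst sum.reindex[OF inj_combinator]) (auto simp: case_prod_unfold intro!: sum.cong)
  then show ?thesis by (simp add: sum.cartesian_product)
qed

text \<open>Taylor expansion in the last variable; its coefficients are functions of the other
  variables and are approximated by the induction hypothesis with order m - k, and \<delta>^k times
  \<delta>^(m - k) is \<delta>^m. The result is rewritten in powers of the coordinates instead of x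
  - c, so that the same monomials serve all centres; the coefficients stay bounded as c lies in the
  unit cube. \<open>N\<close> is fixed while the order drops, so all coefficients use one box of
  exponents.\<close>

lemma local_polynomial_exists:
  assumes "0 \<le> K"
  shows "\<exists>C\<ge>0. \<forall>\<rho> f u c. 0 \<le> \<rho> \<longrightarrow> \<rho> \<le> 1 \<longrightarrow> holder_smooth t \<rho> m \<gamma> K f u \<longrightarrow> m \<le> N \<longrightarrow> c \<in> cube t 0 \<rho> \<longrightarrow>
    (\<exists>a. (\<forall>\<alpha>. \<bar>a \<alpha>\<bar> \<le> C) \<and> (\<forall>x\<in>cube t 0 \<rho>. \<forall>\<delta>\<ge>0. (\<forall>k<t. \<bar>x k - c k\<bar> \<le> \<delta>) \<longrightarrow>
      \<bar>f x - (\<Sum>\<alpha>\<in>box_indices t N. a \<alpha> * (\<Prod>j<t. x j ^ \<alpha> j))\<bar> \<le> C * (\<delta> ^ m * \<delta> powr \<gamma>)))"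
    (is "\<exists>C\<ge>0. ?P t m C")
proof (induction t arbitrary: m)
  case 0
  show ?case
  proof (intro exI[of _ K] conjI allI impI)
    fix \<rho> f u and c :: "nat \<Rightarrow> real" assume S: "holder_smooth 0 \<rho> m \<gamma> K f u" and c: "c \<in> cube 0 0 \<rho>"
    have "cube 0 0 \<rho> = {c}" using c by (auto simp: cube_def)
    moreover have "\<bar>f c\<bar> \<le> K"
      using holder_smooth_bound[OF S zero_multi_indices _ c] holder_smooth_zero[OF S c] by (simp add: order_mi_def)
    ultimately show "\<exists>a. (\<forall>\<alpha>. \<bar>a \<alpha>\<bar> \<le> K) \<and> (\<forall>x\<in>cube 0 0 \<rho>. \<forall>\<delta>\<ge>0. (\<forall>k<0. \<bar>x k - c k\<bar> \<le> \<delta>) \<longrightarrow>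
      \<bar>f x - (\<Sum>\<alpha>\<in>box_indices 0 N. a \<alpha> * (\<Prod>j<0. x j ^ \<alpha> j))\<bar> \<le> K * (\<delta> ^ m * \<delta> powr \<gamma>))"
      using assms by (intro exI[of _ "\<lambda>_. f c"]) (auto simp: box_indices_def)
  qed (use assms in auto)
next
  case (Suc t)
  have "\<forall>k. \<exists>C\<ge>0. ?P t k C" using Suc.IH by blast
  then have "\<exists>Cf. \<forall>k. 0 \<le> Cf k \<and> ?P t k (Cf k)" by (intro choice) simp
  then obtain Cf where Cf': "\<forall>k. 0 \<le> Cf k \<and> ?P t k (Cf k)" by (elim exE)
  have Cf: "0 \<le> Cf k" "?P t k (Cf k)" for k using Cf' by simp_all
  define C0 where "C0 = (\<Sum>k\<le>m. Cf k)"
  have C0: "0 \<le> C0" "k \<le> m \<Longrightarrow> Cf k \<le> C0" for k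
    unfolding C0_def using Cf(1) by (auto intro: sum_nonneg member_le_sum)
  \<comment> \<open>There are m + 1 Taylor terms, binomial coefficients are at most 2^m, and
    \<open>K\<close> is for the Taylor remainder.\<close>
  define C where "C = real (m + 1) * 2 ^ m * C0 + K"
  have C: "0 \<le> C" using C0 assms by (simp add: C_def)
  show ?case
  proof (intro exI[of _ C] conjI allI impI C)
    fix \<rho> f u and c :: "nat \<Rightarrow> real" assume \<rho>: "0 \<le> \<rho>" "\<rho> \<le> 1" and S: "holder_smooth (Suc t) \<rho> m \<gamma> K f u"
      and N: "m \<le> N" and c: "c \<in> cube (Suc t) 0 \<rho>"
    have ct: "0 \<le> c t" "c t \<le> \<rho>" using cube_nth[OF c, of t] by auto
    let ?\<kappa> = "\<lambda>k. (\<lambda>_. 0)(t := k) :: nat \<Rightarrow> nat"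
    let ?f = "\<lambda>k x. u (?\<kappa> k) (x(t := c t))"
    let ?p = "\<lambda>\<alpha> x. \<Prod>j<t. x j ^ \<alpha> j :: real"
    have "\<forall>k\<in>{..m}. \<exists>a. (\<forall>\<alpha>. \<bar>a \<alpha>\<bar> \<le> C0) \<and> (\<forall>x\<in>cube t 0 \<rho>. \<forall>\<delta>\<ge>0. (\<forall>j<t. \<bar>x j - c j\<bar> \<le> \<delta>) \<longrightarrow>
      \<bar>?f k x - (\<Sum>\<alpha>\<in>box_indices t N. a \<alpha> * ?p \<alpha> x)\<bar> \<le> C0 * (\<delta> ^ (m - k) * \<delta> powr \<gamma>))"
    proof
      fix k assume k: "k \<in> {..m}"
      have "m - k \<le> N" using N by simp
      then obtain a where a: "\<forall>\<alpha>. \<bar>a \<alpha>\<bar> \<le> Cf (m - k)" "\<forall>x\<in>cube t 0 \<rho>. \<forall>\<delta>\<ge>0. (\<forall>j<t. \<bar>x j - restrict c {..<t} j\<bar> \<le> \<delta>) \<longrightarrow>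
        \<bar>?f k x - (\<Sum>\<alpha>\<in>box_indices t N. a \<alpha> * ?p \<alpha> x)\<bar> \<le> Cf (m - k) * (\<delta> ^ (m - k) * \<delta> powr \<gamma>)"
        using Cf(2)[rule_format, OF \<rho> holder_smooth_slice[OF S _ ct, of k] _ cube_restrict[OF c]] k by auto
      have le: "Cf (m - k) \<le> C0" by (rule C0(2)) simp
      show "\<exists>a. (\<forall>\<alpha>. \<bar>a \<alpha>\<bar> \<le> C0) \<and> (\<forall>x\<in>cube t 0 \<rho>. \<forall>\<delta>\<ge>0. (\<forall>j<t. \<bar>x j - c j\<bar> \<le> \<delta>) \<longrightarrow>
        \<bar>?f k x - (\<Sum>\<alpha>\<in>box_indices t N. a \<alpha> * ?p \<alpha> x)\<bar> \<le> C0 * (\<delta> ^ (m - k) * \<delta> powr \<gamma>))"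
      proof (intro exI[of _ a] conjI allI impI ballI)
        show "\<bar>a \<alpha>\<bar> \<le> C0" for \<alpha> using a(1) le order_trans by blast
        fix x \<delta> assume x: "x \<in> cube t 0 \<rho>" "(0::real) \<le> \<delta>" "\<forall>j<t. \<bar>x j - c j\<bar> \<le> \<delta>"
        then have "\<bar>?f k x - (\<Sum>\<alpha>\<in>box_indices t N. a \<alpha> * ?p \<alpha> x)\<bar> \<le> Cf (m - k) * (\<delta> ^ (m - k) * \<delta> powr \<gamma>)"
          using a(2) by simp
        also have "\<dots> \<le> C0 * (\<delta> ^ (m - k) * \<delta> powr \<gamma>)" using le x(2) by (intro mult_right_mono) auto
        finally show "\<bar>?f k x - (\<Sum>\<alpha>\<in>box_indices t N. a \<alpha> * ?p \<alpha> x)\<bar> \<le> C0 * (\<delta> ^ (m - k) * \<delta> powr \<gamma>)" .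
      qed
    qed
    from bchoice[OF this] obtain a where a0: "\<forall>k\<in>{..m}. (\<forall>\<alpha>. \<bar>a k \<alpha>\<bar> \<le> C0) \<and> (\<forall>x\<in>cube t 0 \<rho>. \<forall>\<delta>\<ge>0. (\<forall>j<t. \<bar>x j - c j\<bar> \<le> \<delta>) \<longrightarrow>
      \<bar>?f k x - (\<Sum>\<alpha>\<in>box_indices t N. a k \<alpha> * ?p \<alpha> x)\<bar> \<le> C0 * (\<delta> ^ (m - k) * \<delta> powr \<gamma>))" by (elim exE)
    have a: "\<And>\<alpha>. k \<le> m \<Longrightarrow> \<bar>a k \<alpha>\<bar> \<le> C0"
      "\<And>x \<delta>. k \<le> m \<Longrightarrow> x \<in> cube t 0 \<rho> \<Longrightarrow> 0 \<le> \<delta> \<Longrightarrow> (\<forall>j<t. \<bar>x j - c j\<bar> \<le> \<delta>) \<Longrightarrow>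
        \<bar>?f k x - (\<Sum>\<alpha>\<in>box_indices t N. a k \<alpha> * ?p \<alpha> x)\<bar> \<le> C0 * (\<delta> ^ (m - k) * \<delta> powr \<gamma>)" for k
      using a0 by simp_all
    \<comment> \<open>Coefficient from the binomial expansion of (x t - c t)^k, with
      \<open>\<beta> t\<close> the power of \<open>x t\<close>. For \<open>k < \<beta> t\<close> the
      binomial coefficient is 0, so the truncated subtraction is harmless.\<close>
    define b where "b \<beta> = (\<Sum>k\<le>m. real (k choose \<beta> t) * (- c t) ^ (k - \<beta> t) / fact k * a k (restrict \<beta> {..<t}))" for \<beta>
    have b: "\<bar>b \<beta>\<bar> \<le> C" for \<beta>
    proof -
      have "\<bar>b \<beta>\<bar> \<le> (\<Sum>k\<le>m. 2 ^ m * C0)" unfolding b_def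
      proof (rule order_trans[OF sum_abs sum_mono])
        fix k assume k: "k \<in> {..m}"
        have "real (k choose \<beta> t) \<le> 2 ^ k"
          using binomial_le_pow2[of k "\<beta> t"] by (metis of_nat_le_iff of_nat_numeral of_nat_power)
        also have "(2::real) ^ k \<le> 2 ^ m" using k by (intro power_increasing) auto
        finally have 1: "real (k choose \<beta> t) \<le> 2 ^ m" .
        have 2: "\<bar>(- c t) ^ (k - \<beta> t)\<bar> \<le> 1" using ct \<rho> by (auto simp: power_abs intro!: power_le_one)
        have 3: "inverse (fact k) \<le> (1::real)" by (simp add: inverse_le_1_iff)
        have "\<bar>real (k choose \<beta> t) * (- c t) ^ (k - \<beta> t) / fact k * a k (restrict \<beta> {..<t})\<bar>
          = (real (k choose \<beta> t) * \<bar>(- c t) ^ (k - \<beta> t)\<bar> * inverse (fact k)) * \<bar>a k (restrict \<beta> {..<t})\<bar>"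
          by (simp add: abs_mult divide_inverse)
        also have "\<dots> \<le> (2 ^ m * 1 * 1) * C0"
          using 1 2 3 a(1)[of k] k by (intro mult_mono) auto
        finally show "\<bar>real (k choose \<beta> t) * (- c t) ^ (k - \<beta> t) / fact k * a k (restrict \<beta> {..<t})\<bar> \<le> 2 ^ m * C0" by simp
      qed
      also have "\<dots> \<le> C" using assms by (simp add: C_def)
      finally show ?thesis .
    qed
    have poly: "(\<Sum>\<beta>\<in>box_indices (Suc t) N. b \<beta> * (\<Prod>j<Suc t. x j ^ \<beta> j)) =
      (\<Sum>k\<le>m. (x t - c t) ^ k / fact k * (\<Sum>\<alpha>\<in>box_indices t N. a k \<alpha> * ?p \<alpha> x))" for x
    proof -
      have pw: "(x t - c t) ^ k = (\<Sum>i\<le>N. real (k choose i) * (- c t) ^ (k - i) * x t ^ i)" if "k \<le> m" for k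
      proof -
        have "(x t + (- c t)) ^ k = (\<Sum>i\<le>k. real (k choose i) * x t ^ i * (- c t) ^ (k - i))" by (rule binomial_ring)
        also have "\<dots> = (\<Sum>i\<le>N. real (k choose i) * x t ^ i * (- c t) ^ (k - i))"
          using that N by (intro sum.mono_neutral_left) auto
        finally show ?thesis by (simp add: mult_ac)
      qed
      have "(\<Sum>\<beta>\<in>box_indices (Suc t) N. b \<beta> * (\<Prod>j<Suc t. x j ^ \<beta> j))
        = (\<Sum>i\<le>N. \<Sum>\<alpha>\<in>box_indices t N. \<Sum>k\<le>m. (real (k choose i) * (- c t) ^ (k - i) * x t ^ i) / fact k * (a k \<alpha> * ?p \<alpha> x))"
        unfolding sum_box_indices_Suc
      proof (intro sum.cong refl)
        fix i \<alpha> assume "\<alpha> \<in> box_indices t N"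
        then have r: "restrict (\<alpha>(t := i)) {..<t} = \<alpha>"
          by (auto simp: box_indices_def PiE_iff extensional_def fun_eq_iff restrict_def)
        have p: "(\<Prod>j<Suc t. x j ^ (\<alpha>(t := i)) j) = ?p \<alpha> x * x t ^ i" by simp
        show "b (\<alpha>(t := i)) * (\<Prod>j<Suc t. x j ^ (\<alpha>(t := i)) j) =
          (\<Sum>k\<le>m. (real (k choose i) * (- c t) ^ (k - i) * x t ^ i) / fact k * (a k \<alpha> * ?p \<alpha> x))"
          unfolding p b_def r sum_distrib_right by (intro sum.cong) (auto simp: mult_ac)
      qed
      also have "\<dots> = (\<Sum>k\<le>m. \<Sum>i\<le>N. \<Sum>\<alpha>\<in>box_indices t N. (real (k choose i) * (- c t) ^ (k - i) * x t ^ i) / fact k * (a k \<alpha> * ?p \<alpha> x))"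
        by (rule trans[OF sum.cong[OF refl sum.swap] sum.swap])
      also have "\<dots> = (\<Sum>k\<le>m. (x t - c t) ^ k / fact k * (\<Sum>\<alpha>\<in>box_indices t N. a k \<alpha> * ?p \<alpha> x))"
        by (intro sum.cong refl) (simp add: pw sum_product sum_divide_distrib)
      finally show ?thesis .
    qed
    show "\<exists>a. (\<forall>\<alpha>. \<bar>a \<alpha>\<bar> \<le> C) \<and> (\<forall>x\<in>cube (Suc t) 0 \<rho>. \<forall>\<delta>\<ge>0. (\<forall>k<Suc t. \<bar>x k - c k\<bar> \<le> \<delta>) \<longrightarrow>
      \<bar>f x - (\<Sum>\<alpha>\<in>box_indices (Suc t) N. a \<alpha> * (\<Prod>j<Suc t. x j ^ \<alpha> j))\<bar> \<le> C * (\<delta> ^ m * \<delta> powr \<gamma>))"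
    proof (intro exI[of _ b] conjI allI impI ballI b)
      fix x \<delta> assume x: "x \<in> cube (Suc t) 0 \<rho>" and \<delta>: "(0::real) \<le> \<delta>" "\<forall>k<Suc t. \<bar>x k - c k\<bar> \<le> \<delta>"
      let ?x = "restrict x {..<t}"
      have x': "?x \<in> cube t 0 \<rho>" using cube_restrict[OF x] .
      have fx: "?f k ?x = u (?\<kappa> k) (x(t := c t))" for k by (simp add: restrict_upd_Suc[OF x])
      define e where "e = \<delta> ^ m * \<delta> powr \<gamma>"
      have e: "0 \<le> e" using \<delta> by (simp add: e_def)
      define \<phi> where "\<phi> k z = u (?\<kappa> k) (x(t := z))" for k z
      have "\<bar>\<phi> 0 (x t) - (\<Sum>k\<le>m. \<phi> k (c t) / fact k * (x t - c t) ^ k)\<bar> \<le> (K * \<delta> powr \<gamma>) * \<delta> ^ m"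
      proof (rule taylor_holder_1d[of m 0 \<rho>])
        fix k z assume k: "k < m" and z: "z \<in> {0..\<rho>}"
        have "((\<lambda>y. u (?\<kappa> k) ((x(t := z))(t := y))) has_real_derivative u ((?\<kappa> k)(t := Suc (?\<kappa> k t))) (x(t := z)))
           (at ((x(t := z)) t) within {0..\<rho>})"
          using k z by (intro holder_smooth_deriv[OF S] multi_indices_upd zero_multi_indices cube_upd x)
            (auto simp: order_mi_upd order_mi_zero)
        then show "(\<phi> k has_real_derivative \<phi> (Suc k) z) (at z within {0..\<rho>})" unfolding \<phi>_def by simp
      next
        fix z assume z: "z \<in> {0..\<rho>}" "\<bar>z - c t\<bar> \<le> \<delta>"
        show "\<bar>\<phi> m z - \<phi> m (c t)\<bar> \<le> K * \<delta> powr \<gamma>" unfolding \<phi>_def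
          using z ct \<delta>(1) by (intro holder_smooth_holder[OF S] multi_indices_upd zero_multi_indices cube_upd x)
            (auto simp: order_mi_upd order_mi_zero)
      qed (use cube_nth[OF x, of t] ct \<delta> assms in auto)
      moreover have "\<phi> 0 (x t) = f x"
        unfolding \<phi>_def using holder_smooth_zero[OF S x] by (simp add: fun_upd_idem)
      ultimately have 1: "\<bar>f x - (\<Sum>k\<le>m. (x t - c t) ^ k / fact k * ?f k ?x)\<bar> \<le> K * e"
        unfolding fx \<phi>_def[symmetric] by (simp add: e_def mult_ac)
      have 2: "\<bar>(\<Sum>k\<le>m. (x t - c t) ^ k / fact k * ?f k ?x) - (\<Sum>k\<le>m. (x t - c t) ^ k / fact k * (\<Sum>\<alpha>\<in>box_indices t N. a k \<alpha> * ?p \<alpha> ?x))\<bar>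
        \<le> (\<Sum>k\<le>m. C0 * e)"
        unfolding sum_subtractf[symmetric]
      proof (rule order_trans[OF sum_abs sum_mono])
        fix k assume k: "k \<in> {..m}"
        have "\<bar>(x t - c t) ^ k\<bar> \<le> \<delta> ^ k" using \<delta> by (auto simp: power_abs intro!: power_mono)
        moreover have "\<bar>?f k ?x - (\<Sum>\<alpha>\<in>box_indices t N. a k \<alpha> * ?p \<alpha> ?x)\<bar> \<le> C0 * (\<delta> ^ (m - k) * \<delta> powr \<gamma>)"
          using a(2)[OF _ x' \<delta>(1), of k] \<delta>(2) k by auto
        ultimately have "\<bar>(x t - c t) ^ k\<bar> * \<bar>?f k ?x - (\<Sum>\<alpha>\<in>box_indices t N. a k \<alpha> * ?p \<alpha> ?x)\<bar> / fact k
           \<le> \<delta> ^ k * (C0 * (\<delta> ^ (m - k) * \<delta> powr \<gamma>)) / 1"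
          using \<delta>(1) C0(1) by (intro frac_le mult_mono mult_nonneg_nonneg) auto
        also have "\<dots> = C0 * e"
          using k by (simp add: e_def power_add[symmetric] mult_ac)
        finally have that: "\<bar>(x t - c t) ^ k\<bar> * \<bar>?f k ?x - (\<Sum>\<alpha>\<in>box_indices t N. a k \<alpha> * ?p \<alpha> ?x)\<bar> / fact k \<le> C0 * e" .
        show "\<bar>(x t - c t) ^ k / fact k * ?f k ?x - (x t - c t) ^ k / fact k * (\<Sum>\<alpha>\<in>box_indices t N. a k \<alpha> * ?p \<alpha> ?x)\<bar> \<le> C0 * e"
        proof -
          have eq: "\<bar>a / fact k * p - a / fact k * q\<bar> = \<bar>a\<bar> * \<bar>p - q\<bar> / fact k" for a p q :: real
            by (simp add: right_diff_distrib[symmetric] diff_divide_distrib[symmetric] abs_mult)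
          show ?thesis unfolding eq by (rule that)
        qed
      qed
      have 3: "(\<Sum>k\<le>m. C0 * e) \<le> real (m + 1) * 2 ^ m * C0 * e"
      proof -
        have "(C0 * e) * 1 \<le> (C0 * e) * 2 ^ m" using C0 e by (intro mult_left_mono mult_nonneg_nonneg) auto
        then have "real (m + 1) * (C0 * e * 1) \<le> real (m + 1) * (C0 * e * 2 ^ m)" by (rule mult_left_mono) simp
        then show ?thesis by (simp add: mult_ac)
      qed
      have 4: "?p \<alpha> ?x = ?p \<alpha> x" for \<alpha> by (intro prod.cong) auto
      show "\<bar>f x - (\<Sum>\<alpha>\<in>box_indices (Suc t) N. b \<alpha> * (\<Prod>j<Suc t. x j ^ \<alpha> j))\<bar> \<le> C * (\<delta> ^ m * \<delta> powr \<gamma>)"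
        unfolding poly e_def[symmetric] C_def distrib_right using 1 2 3 unfolding 4 by linarith
    qed
  qed
qed

text \<open>For m = 0 this is the Hoelder condition itself. For m > 0 the first derivatives are
  bounded by \<open>K\<close>, and changing one coordinate at a time leads from x to y inside the
  cube; the exponent is then 1.\<close>

lemma holder_smooth_modulus:
  assumes S: "holder_smooth t \<rho> m \<gamma> K f u" and x: "x \<in> cube t 0 \<rho>" "y \<in> cube t 0 \<rho>"
    and \<delta>: "0 \<le> \<delta>" "\<delta> \<le> 1" "\<forall>k<t. \<bar>x k - y k\<bar> \<le> \<delta>" and \<gamma>: "0 < \<gamma>" "\<gamma> \<le> 1" and K: "0 \<le> K"
  shows "\<bar>f x - f y\<bar> \<le> (real t + 1) * K * \<delta> powr (min (real m + \<gamma>) 1)"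
proof (cases "m = 0")
  case True
  then have "\<bar>f x - f y\<bar> \<le> K * \<delta> powr \<gamma>"
    using holder_smooth_holder[OF S zero_multi_indices _ x \<delta>(1)] \<delta>(3) holder_smooth_zero[OF S] x by (simp add: order_mi_zero)
  moreover have "K * \<delta> powr \<gamma> \<le> (real t + 1) * K * \<delta> powr \<gamma>" using K by (intro mult_right_mono) (auto simp: mult_le_cancel_right1)
  ultimately show ?thesis using True \<gamma> by simp
next
  case False
  \<comment> \<open>j counts the leading coordinates that may still differ.\<close>
  have "\<bar>f x - f y\<bar> \<le> real j * K * \<delta>" if "j \<le> t" "\<forall>k\<ge>j. x k = y k" "x \<in> cube t 0 \<rho>" "\<forall>k<t. \<bar>x k - y k\<bar> \<le> \<delta>" for j x
    using that
  proof (induction j arbitrary: x)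
    case 0 then have "x = y" by auto then show ?case by simp
  next
    case (Suc j)
    let ?z = "x(j := y j)"
    have z: "?z \<in> cube t 0 \<rho>" using Suc.prems x(2) by (intro cube_upd) (auto dest: cube_nth[of _ _ _ _ j])
    have "\<bar>f ?z - f y\<bar> \<le> real j * K * \<delta>"
      by (rule Suc.IH[OF _ _ z]) (use Suc.prems \<delta>(1) in \<open>auto simp: Suc_le_eq\<close>)
    moreover have "\<bar>f x - f ?z\<bar> \<le> K * \<delta>"
    proof -
      have f: "f v = u (\<lambda>_. 0) v" if "v \<in> cube t 0 \<rho>" for v
        using holder_smooth_zero[OF S that] by simp
      have "\<bar>u (\<lambda>_. 0) (x(j := x j)) - u (\<lambda>_. 0) (x(j := y j))\<bar> \<le> K * \<bar>x j - y j\<bar>"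
      proof (rule field_differentiable_bound[of "{0..\<rho>}" "\<lambda>z. u (\<lambda>_. 0) (x(j := z))" "\<lambda>z. u ((\<lambda>_. 0)(j := Suc 0)) (x(j := z))", unfolded real_norm_def])
        fix z assume z: "z \<in> {0..\<rho>}"
        have xz: "x(j := z) \<in> cube t 0 \<rho>" using z Suc.prems by (intro cube_upd) auto
        then have "((\<lambda>v. u (\<lambda>_. 0) ((x(j := z))(j := v))) has_real_derivative u ((\<lambda>_. 0)(j := Suc 0)) (x(j := z))) (at ((x(j := z)) j) within {0..\<rho>})"
          using holder_smooth_deriv[OF S zero_multi_indices, of j "x(j := z)"] False Suc.prems(1) by (simp add: order_mi_zero)
        then show "((\<lambda>z. u (\<lambda>_. 0) (x(j := z))) has_real_derivative u ((\<lambda>_. 0)(j := Suc 0)) (x(j := z))) (at z within {0..\<rho>})" by simp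
        have "order_mi t ((\<lambda>_. 0)(j := Suc 0)) \<le> m"
          using order_mi_Suc[of j t "\<lambda>_. 0"] Suc.prems(1) False by (simp add: order_mi_zero)
        then show "\<bar>u ((\<lambda>_. 0)(j := Suc 0)) (x(j := z))\<bar> \<le> K"
          using xz Suc.prems(1) by (intro holder_smooth_bound[OF S] multi_indices_upd_less zero_multi_indices) auto
      qed (use Suc.prems x cube_nth[of _ t 0 \<rho> j] in auto)
      also have "\<dots> \<le> K * \<delta>" using Suc.prems K by (intro mult_left_mono) auto
      finally show ?thesis using f[OF Suc.prems(3)] f[OF z] by simp
    qed
    ultimately show ?case by (simp add: algebra_simps abs_le_iff)
  qed
  moreover have "\<forall>k\<ge>t. x k = y k" using x by (auto simp: cube_def PiE_iff extensional_def)
  ultimately have "\<bar>f x - f y\<bar> \<le> real t * K * \<delta>" using x(1) \<delta>(3) by simp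
  also have "\<dots> \<le> (real t + 1) * K * \<delta>" using K \<delta> by (intro mult_right_mono) auto
  finally have 1: "\<bar>f x - f y\<bar> \<le> (real t + 1) * K * \<delta>" .
  have "1 \<le> real m" using False by linarith
  then have "min (real m + \<gamma>) 1 = 1" using \<gamma> by linarith
  with 1 \<delta>(1) show ?thesis by simp
qed

section \<open>Rescaling Hoelder balls to the unit scale\<close>

lemma sfloor_less: "0 < \<beta> \<Longrightarrow> real (sfloor \<beta>) < \<beta>"
  unfolding sfloor_def by linarith

lemma le_sfloor_iff: "0 < \<beta> \<Longrightarrow> real n < \<beta> \<longleftrightarrow> n \<le> sfloor \<beta>"
  unfolding sfloor_def by linarith

lemma sfloor_ge: "\<beta> - real (sfloor \<beta>) \<le> 1"
  unfolding sfloor_def by linarith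

text \<open>Over an infinite index set the sums in \<open>holder_ball\<close> would take the default
  value 0; finiteness makes them bound each of their terms.\<close>

lemma finite_multi_indices_le: "finite {\<alpha> \<in> multi_indices t. order_mi t \<alpha> \<le> m}"
proof (rule finite_subset)
  show "{\<alpha> \<in> multi_indices t. order_mi t \<alpha> \<le> m} \<subseteq> {\<alpha>. \<forall>x. (x \<in> {..<t} \<longrightarrow> \<alpha> x \<in> {..m}) \<and> (x \<notin> {..<t} \<longrightarrow> \<alpha> x = 0)}"
  proof (intro subsetI CollectI allI conjI impI)
    fix \<alpha> i assume a: "\<alpha> \<in> {\<alpha> \<in> multi_indices t. order_mi t \<alpha> \<le> m}"
    show "\<alpha> i = 0" if "i \<notin> {..<t}" using a that by (auto simp: multi_indices_def)
    show "\<alpha> i \<in> {..m}" if "i \<in> {..<t}"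
      using a member_le_sum[OF that, of \<alpha>] by (auto simp: order_mi_def)
  qed
qed (rule finite_set_of_finite_funs; simp)

text \<open>All terms are nonnegative in \<open>ennreal\<close>, so each supremum, and each value
  below it, is at most the total \<open>K\<close>.\<close>

lemma holder_ballE:
  assumes h: "h \<in> holder_ball t \<beta> a b K" and \<beta>: "0 < \<beta>" and K: "0 \<le> K"
  obtains u where "partial_derivs t a b (sfloor \<beta>) h u"
    "\<And>\<alpha> x. \<alpha> \<in> multi_indices t \<Longrightarrow> order_mi t \<alpha> \<le> sfloor \<beta> \<Longrightarrow> x \<in> cube t a b \<Longrightarrow> \<bar>u \<alpha> x\<bar> \<le> K"
    "\<And>\<alpha> x y. \<alpha> \<in> multi_indices t \<Longrightarrow> order_mi t \<alpha> = sfloor \<beta> \<Longrightarrow> x \<in> cube t a b \<Longrightarrow> y \<in> cube t a b \<Longrightarrow> x \<noteq> y \<Longrightarrow>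
      \<bar>u \<alpha> x - u \<alpha> y\<bar> / sup_norm t (\<lambda>k. x k - y k) powr (\<beta> - real (sfloor \<beta>)) \<le> K"
proof -
  let ?A = "{\<alpha>. \<alpha> \<in> multi_indices t \<and> real (order_mi t \<alpha>) < \<beta>}"
  let ?B = "{\<alpha>. \<alpha> \<in> multi_indices t \<and> order_mi t \<alpha> = sfloor \<beta>}"
  let ?D = "{(x, y). x \<in> cube t a b \<and> y \<in> cube t a b \<and> x \<noteq> y}"
  obtain u where u: "partial_derivs t a b (sfloor \<beta>) h u"
    and le: "(\<Sum>\<alpha>\<in>?A. SUP x\<in>cube t a b. ennreal \<bar>u \<alpha> x\<bar>) + (\<Sum>\<alpha>\<in>?B.
        SUP (x, y)\<in>?D. ennreal (\<bar>u \<alpha> x - u \<alpha> y\<bar> / sup_norm t (\<lambda>k. x k - y k) powr (\<beta> - real (sfloor \<beta>)))) \<le> ennreal K"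
    using h unfolding holder_ball_def by blast
  have finA: "finite ?A" using finite_multi_indices_le[of t "sfloor \<beta>"] by (simp add: le_sfloor_iff[OF \<beta>])
  have finB: "finite ?B" using finite_multi_indices_le[of t "sfloor \<beta>"] by (rule rev_finite_subset) auto
  show ?thesis
  proof (rule that[OF u])
    fix \<alpha> x assume \<alpha>: "\<alpha> \<in> multi_indices t" "order_mi t \<alpha> \<le> sfloor \<beta>" and x: "x \<in> cube t a b"
    have "ennreal \<bar>u \<alpha> x\<bar> \<le> (SUP x\<in>cube t a b. ennreal \<bar>u \<alpha> x\<bar>)" using x by (rule SUP_upper)
    also have "\<dots> \<le> (\<Sum>\<alpha>\<in>?A. SUP x\<in>cube t a b. ennreal \<bar>u \<alpha> x\<bar>)"
      using \<alpha> finA by (intro member_le_sum) (auto simp: le_sfloor_iff[OF \<beta>])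
    also have "\<dots> \<le> ennreal K" using le by (rule order_trans[rotated]) simp
    finally show "\<bar>u \<alpha> x\<bar> \<le> K" using K by simp
  next
    fix \<alpha> x y assume \<alpha>: "\<alpha> \<in> multi_indices t" "order_mi t \<alpha> = sfloor \<beta>" and x: "x \<in> cube t a b" "y \<in> cube t a b" "x \<noteq> y"
    let ?q = "\<lambda>\<alpha> (x, y). ennreal (\<bar>u \<alpha> x - u \<alpha> y\<bar> / sup_norm t (\<lambda>k. x k - y k) powr (\<beta> - real (sfloor \<beta>)))"
    have "?q \<alpha> (x, y) \<le> (SUP z\<in>?D. ?q \<alpha> z)" using x by (intro SUP_upper) auto
    also have "\<dots> \<le> (\<Sum>\<alpha>\<in>?B. SUP z\<in>?D. ?q \<alpha> z)"
      using \<alpha> finB by (intro member_le_sum) auto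
    also have "\<dots> \<le> ennreal K" using le by (rule order_trans[rotated]) simp
    finally show "\<bar>u \<alpha> x - u \<alpha> y\<bar> / sup_norm t (\<lambda>k. x k - y k) powr (\<beta> - real (sfloor \<beta>)) \<le> K" using K by simp
  qed
qed

text \<open>The affine change of variables maps [0, (b - a)/S]^t into [a, b]^t. A derivative of
  order k gains S^k, and the normalisation of the value divides by S; the shift by a' affects order
  0 only and adds at most \<open>F\<close>. In the Hoelder quotient the factor
  \<open>S powr \<gamma> \<le> S\<close> is cancelled by that division.\<close>

lemma holder_ball_smooth:
  assumes h: "h \<in> holder_ball t \<beta> a b K" and \<beta>: "0 < \<beta>" and K: "0 \<le> K" "K \<le> F" and t: "1 \<le> t"
    and S: "1 \<le> S" and ab: "a \<le> b" and a': "\<bar>a'\<bar> \<le> F"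
  shows "\<exists>u. holder_smooth t ((b - a) / S) (sfloor \<beta>) (\<beta> - real (sfloor \<beta>)) (S ^ sfloor \<beta> * F + F)
    (\<lambda>y. (h (\<lambda>k\<in>{..<t}. a + S * y k) - a') / S) u"
proof -
  define m where "m = sfloor \<beta>"
  define \<gamma> where "\<gamma> = \<beta> - real m"
  have \<gamma>: "0 < \<gamma>" "\<gamma> \<le> 1" using sfloor_less[OF \<beta>] sfloor_ge[of \<beta>] by (auto simp: \<gamma>_def m_def)
  obtain u where u: "partial_derivs t a b m h u"
    "\<And>\<alpha> x. \<alpha> \<in> multi_indices t \<Longrightarrow> order_mi t \<alpha> \<le> m \<Longrightarrow> x \<in> cube t a b \<Longrightarrow> \<bar>u \<alpha> x\<bar> \<le> K"
    "\<And>\<alpha> x y. \<alpha> \<in> multi_indices t \<Longrightarrow> order_mi t \<alpha> = m \<Longrightarrow> x \<in> cube t a b \<Longrightarrow> y \<in> cube t a b \<Longrightarrow> x \<noteq> y \<Longrightarrow>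
      \<bar>u \<alpha> x - u \<alpha> y\<bar> / sup_norm t (\<lambda>k. x k - y k) powr \<gamma> \<le> K"
    using holder_ballE[OF h \<beta> K(1)] unfolding m_def \<gamma>_def by blast
  let ?\<rho> = "(b - a) / S"
  define A where "A y = (\<lambda>k\<in>{..<t}. a + S * y k)" for y :: "nat \<Rightarrow> real"
  have A: "A y \<in> cube t a b" if "y \<in> cube t 0 ?\<rho>" for y
  proof -
    have "S * y k \<le> b - a" "0 \<le> S * y k" if "k < t" for k
      using cube_nth[OF \<open>y \<in> cube t 0 ?\<rho>\<close> that] S by (auto simp: field_simps)
    then show ?thesis by (force simp: A_def cube_def)
  qed
  define w where "w \<alpha> y = S ^ order_mi t \<alpha> * u \<alpha> (A y) / S - (if \<alpha> = (\<lambda>_. 0) then a' / S else 0)" for \<alpha> y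
  have Sm: "S ^ n \<le> S ^ m" if "n \<le> m" for n using S that by (rule_tac power_increasing) auto
  have "holder_smooth t ?\<rho> m \<gamma> (S ^ m * F + F) (\<lambda>y. (h (A y) - a') / S) w"
    unfolding holder_smooth_def partial_derivs_def
  proof (intro conjI ballI allI impI)
    fix x assume x: "x \<in> cube t 0 ?\<rho>"
    show "w (\<lambda>_. 0) x = (h (A x) - a') / S"
      using u(1) A[OF x] unfolding w_def partial_derivs_def by (simp add: order_mi_zero diff_divide_distrib)
  next
    fix \<alpha> i x assume \<alpha>: "\<alpha> \<in> multi_indices t" "order_mi t \<alpha> < m" and i: "i < t" and x: "x \<in> cube t 0 ?\<rho>"
    have Ai: "A (x(i := y)) = (A x)(i := a + S * y)" for y using i by (auto simp: A_def fun_eq_iff)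
    have "((\<lambda>v. u \<alpha> ((A x)(i := v))) has_real_derivative u (\<alpha>(i := Suc (\<alpha> i))) (A x)) (at (A x i) within {a..b})"
      using u(1) \<alpha> i A[OF x] unfolding partial_derivs_def by blast
    moreover have "A x i = a + S * x i" using i by (simp add: A_def)
    moreover have "(\<lambda>y. a + S * y) ` {0..?\<rho>} \<subseteq> {a..b}" using S by (auto simp: field_simps)
    ultimately have "((\<lambda>v. u \<alpha> ((A x)(i := v))) has_real_derivative u (\<alpha>(i := Suc (\<alpha> i))) (A x))
       (at (a + S * x i) within (\<lambda>y. a + S * y) ` {0..?\<rho>})"
      using DERIV_subset by fastforce
    moreover have "((\<lambda>y. a + S * y) has_real_derivative S) (at (x i) within {0..?\<rho>})"
      by (auto intro!: derivative_eq_intros)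
    ultimately have "((\<lambda>y. u \<alpha> ((A x)(i := a + S * y))) has_real_derivative u (\<alpha>(i := Suc (\<alpha> i))) (A x) * S) (at (x i) within {0..?\<rho>})"
      using DERIV_image_chain by (fastforce simp: o_def)
    then have "((\<lambda>y. w \<alpha> (x(i := y))) has_real_derivative S ^ order_mi t \<alpha> * (u (\<alpha>(i := Suc (\<alpha> i))) (A x) * S) / S - 0) (at (x i) within {0..?\<rho>})"
      unfolding w_def Ai by (intro DERIV_diff DERIV_cdivide DERIV_cmult DERIV_const)
    moreover have "\<alpha>(i := Suc (\<alpha> i)) \<noteq> (\<lambda>_. 0)" by (metis fun_upd_same nat.distinct(1))
    ultimately show "((\<lambda>y. w \<alpha> (x(i := y))) has_real_derivative w (\<alpha>(i := Suc (\<alpha> i))) x) (at (x i) within {0..?\<rho>})"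
      using i by (simp add: w_def order_mi_Suc mult_ac)
  next
    fix \<alpha> x assume \<alpha>: "\<alpha> \<in> multi_indices t" "order_mi t \<alpha> \<le> m" and x: "x \<in> cube t 0 ?\<rho>"
    have "\<bar>w \<alpha> x\<bar> \<le> S ^ order_mi t \<alpha> * \<bar>u \<alpha> (A x)\<bar> / S + \<bar>a'\<bar> / S"
      unfolding w_def using S by (auto simp: abs_mult intro!: order_trans[OF abs_triangle_ineq4])
    also have "\<dots> \<le> S ^ m * F / 1 + F / 1"
      using S Sm[OF \<alpha>(2)] u(2)[OF \<alpha> A[OF x]] K a' by (intro add_mono frac_le mult_mono) auto
    finally show "\<bar>w \<alpha> x\<bar> \<le> S ^ m * F + F" by simp
  next
    fix \<alpha> x y \<delta> assume \<alpha>: "\<alpha> \<in> multi_indices t" "order_mi t \<alpha> = m" and x: "x \<in> cube t 0 ?\<rho>" "y \<in> cube t 0 ?\<rho>"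
      and \<delta>: "0 \<le> \<delta> \<and> (\<forall>k<t. \<bar>x k - y k\<bar> \<le> \<delta>)"
    have "\<bar>u \<alpha> (A x) - u \<alpha> (A y)\<bar> \<le> F * (S * \<delta> powr \<gamma>)"
    proof (cases "A x = A y")
      case True then show ?thesis using K S \<delta> by simp
    next
      case False
      let ?s = "sup_norm t (\<lambda>k. A x k - A y k)"
      have ne: "{..<t} \<noteq> {}" using t by (auto simp: lessThan_empty_iff)
      obtain k where k: "k < t" "A x k \<noteq> A y k" using False by (auto simp: A_def fun_eq_iff split: if_splits)
      have "\<bar>A x k - A y k\<bar> \<le> ?s" unfolding sup_norm_def using k by (intro Max_ge) auto
      then have s0: "0 < ?s" using k by linarith
      have "?s \<le> S * \<delta>" unfolding sup_norm_def
      proof (rule Max.boundedI)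
        fix r assume "r \<in> (\<lambda>i. \<bar>A x i - A y i\<bar>) ` {..<t}"
        then obtain i where i: "i < t" "r = \<bar>A x i - A y i\<bar>" by auto
        have "r = S * \<bar>x i - y i\<bar>" using i S by (simp add: A_def abs_mult flip: right_diff_distrib)
        also have "\<dots> \<le> S * \<delta>" using \<delta> i S by (intro mult_left_mono) auto
        finally show "r \<le> S * \<delta>" .
      qed (use ne in auto)
      then have "?s powr \<gamma> \<le> (S * \<delta>) powr \<gamma>" using s0 \<gamma> by (intro powr_mono2) auto
      also have "\<dots> = S powr \<gamma> * \<delta> powr \<gamma>" using S \<delta> by (simp add: powr_mult)
      also have "\<dots> \<le> S * \<delta> powr \<gamma>"
        using S \<gamma> powr_mono[of \<gamma> 1 S] by (intro mult_right_mono) auto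
      finally have s1: "?s powr \<gamma> \<le> S * \<delta> powr \<gamma>" .
      have "\<bar>u \<alpha> (A x) - u \<alpha> (A y)\<bar> \<le> K * ?s powr \<gamma>"
        using u(3)[OF \<alpha> A[OF x(1)] A[OF x(2)] False] s0 by (simp add: pos_divide_le_eq)
      also have "\<dots> \<le> F * (S * \<delta> powr \<gamma>)" using K s1 by (intro mult_mono) auto
      finally show ?thesis .
    qed
    then have "S ^ m * \<bar>u \<alpha> (A x) - u \<alpha> (A y)\<bar> / S \<le> S ^ m * (F * (S * \<delta> powr \<gamma>)) / S"
      using S by (intro divide_right_mono mult_left_mono) auto
    also have "\<dots> = S ^ m * F * \<delta> powr \<gamma>" using S by simp
    also have "\<dots> \<le> (S ^ m * F + F) * \<delta> powr \<gamma>" using K by (intro mult_right_mono) auto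
    finally show "\<bar>w \<alpha> x - w \<alpha> y\<bar> \<le> (S ^ m * F + F) * \<delta> powr \<gamma>"
      unfolding w_def \<alpha>(2) using S by (simp add: abs_mult flip: diff_divide_distrib right_diff_distrib)
  qed
  then show ?thesis unfolding A_def m_def \<gamma>_def by blast
qed

text \<open>After rescaling with S = 2 F, \<open>holder_smooth_modulus\<close> applies; the leading
  factor 2 F undoes the normalisation.\<close>

lemma holder_ball_modulus:
  assumes h: "h \<in> holder_ball t \<beta> a b K" and \<beta>: "0 < \<beta>" and K: "0 \<le> K" "K \<le> F" and t: "1 \<le> t"
    and F: "1 \<le> F" and ab: "a \<le> b" "\<bar>a\<bar> \<le> F" "\<bar>b\<bar> \<le> F" and z: "z \<in> cube t a b" "z' \<in> cube t a b"
    and \<delta>: "0 \<le> \<delta>" "\<And>k. k < t \<Longrightarrow> \<bar>z k - z' k\<bar> \<le> \<delta>"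
  shows "\<bar>h z - h z'\<bar> \<le> 2 * F * ((real t + 1) * ((2 * F) ^ sfloor \<beta> * F + F)) * \<delta> powr (min \<beta> 1)"
proof -
  define S where "S = 2 * F"
  have S: "1 \<le> S" using F by (simp add: S_def)
  \<comment> \<open>The modulus on the unit scale needs a distance of at most 1. Capping \<delta> at
    S loses nothing, as two points of [a, b] differ by at most 2 F.\<close>
  define \<delta>' where "\<delta>' = min \<delta> S / S"
  define y where "y = (\<lambda>k\<in>{..<t}. (z k - a) / S)"
  define y' where "y' = (\<lambda>k\<in>{..<t}. (z' k - a) / S)"
  have yc: "y \<in> cube t 0 ((b - a) / S)" "y' \<in> cube t 0 ((b - a) / S)"
    using z S unfolding y_def y'_def cube_def by (auto simp: PiE_iff divide_right_mono)
  have zz: "(\<lambda>k\<in>{..<t}. a + S * y k) = z" "(\<lambda>k\<in>{..<t}. a + S * y' k) = z'"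
    using z S unfolding y_def y'_def cube_def by (auto simp: PiE_iff extensional_def fun_eq_iff)
  obtain u where u: "holder_smooth t ((b - a) / S) (sfloor \<beta>) (\<beta> - real (sfloor \<beta>)) (S ^ sfloor \<beta> * F + F)
    (\<lambda>y. (h (\<lambda>k\<in>{..<t}. a + S * y k) - 0) / S) u"
    using holder_ball_smooth[OF h \<beta> K t S ab(1), of 0] F by auto
  have 0: "0 \<le> S ^ sfloor \<beta> * F + F" using F S by simp
  have d: "\<bar>y k - y' k\<bar> \<le> \<delta>'" if "k < t" for k
  proof -
    have "\<bar>z k - z' k\<bar> \<le> S" using cube_nth[OF z(1) that] cube_nth[OF z(2) that] ab by (auto simp: S_def)
    then have "\<bar>z k - z' k\<bar> \<le> min \<delta> S" using \<delta>(2)[OF that] by simp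
    then show ?thesis using that S by (simp add: y_def y'_def \<delta>'_def divide_right_mono flip: diff_divide_distrib)
  qed
  have \<delta>': "0 \<le> \<delta>'" "\<delta>' \<le> 1" using S \<delta> by (auto simp: \<delta>'_def min_def field_simps)
  have "\<bar>(h z - 0) / S - (h z' - 0) / S\<bar> \<le> (real t + 1) * (S ^ sfloor \<beta> * F + F) * \<delta>' powr (min (real (sfloor \<beta>) + (\<beta> - real (sfloor \<beta>))) 1)"
    using holder_smooth_modulus[OF u yc \<delta>' _ _ _ 0] d sfloor_less[OF \<beta>] sfloor_ge[of \<beta>] unfolding zz by auto
  also have "\<dots> \<le> (real t + 1) * (S ^ sfloor \<beta> * F + F) * \<delta> powr (min \<beta> 1)"
  proof (rule mult_left_mono)
    have "min \<delta> S / S \<le> \<delta>"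
    proof -
      have "min \<delta> S / S \<le> \<delta> / S" using S by (intro divide_right_mono) auto
      also have "\<dots> \<le> \<delta> / 1" using S \<delta> by (intro divide_left_mono) auto
      finally show ?thesis by simp
    qed
    then show "\<delta>' powr (min (real (sfloor \<beta>) + (\<beta> - real (sfloor \<beta>))) 1) \<le> \<delta> powr (min \<beta> 1)"
      using \<delta>' \<beta> unfolding \<delta>'_def by (auto intro!: powr_mono2)
  qed (use 0 in auto)
  finally have "\<bar>h z - h z'\<bar> / S \<le> (real t + 1) * (S ^ sfloor \<beta> * F + F) * \<delta> powr (min \<beta> 1)"
    using S by (simp flip: diff_divide_distrib)
  then show ?thesis using S unfolding S_def[symmetric] by (simp add: field_simps)
qed

text \<open>Inputs and outputs are normalised as (value - left end) / (2 F), which lies in [0, 1]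
  for every interval inside [-F, F]. So the constants depend on \<open>F\<close>, but not on
  \<open>K\<close> or the intervals.\<close>

lemma circuit_holder:
  fixes t :: nat and \<beta> F :: real
  assumes t: "1 \<le> t" and \<beta>: "0 < \<beta>" and F: "1 \<le> F"
  shows "\<exists>k C. 0 < C \<and> (\<forall>W (y :: nat \<Rightarrow> 'a \<Rightarrow> real) h a b a' b' K. 1 \<le> W \<longrightarrow> 0 \<le> K \<longrightarrow> K \<le> F \<longrightarrow>
    a \<le> b \<longrightarrow> \<bar>a\<bar> \<le> F \<longrightarrow> \<bar>b\<bar> \<le> F \<longrightarrow> a' \<le> b' \<longrightarrow> \<bar>a'\<bar> \<le> F \<longrightarrow> \<bar>b'\<bar> \<le> F \<longrightarrow> h \<in> holder_ball t \<beta> a b K \<longrightarrow>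
    (\<forall>z\<in>cube t a b. h z \<in> {a'..b'}) \<longrightarrow> (\<forall>j<t. \<forall>x. 0 \<le> y j x \<and> y j x \<le> (b - a) / (2 * F)) \<longrightarrow>
    (\<exists>v. circuit (y ` {..<t}) k (C * real W ^ (2 * t)) {v} \<and> (\<forall>x. 0 \<le> v x \<and> v x \<le> (b' - a') / (2 * F)) \<and>
      (\<forall>x. \<bar>a' + 2 * F * v x - h (\<lambda>k\<in>{..<t}. a + 2 * F * y k x)\<bar> \<le> C * real W powr (- 2 * \<beta>))))"
proof -
  define S where "S = 2 * F"
  have S: "1 \<le> S" using F by (simp add: S_def)
  define m where "m = sfloor \<beta>"
  define \<gamma> where "\<gamma> = \<beta> - real m"
  \<comment> \<open>The multiplication error W^(-2 R) has to stay below the Taylor error W^(-2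
    \<beta>).\<close>
  define R where "R = nat \<lceil>\<beta>\<rceil>"
  define K2 where "K2 = S ^ m * F + F"
  have K2: "0 \<le> K2" using F S by (simp add: K2_def)
  from local_polynomial_exists[OF K2, of t m \<gamma> m] obtain C1 where C1: "0 \<le> C1" and
    P': "\<forall>\<rho> f u c. 0 \<le> \<rho> \<longrightarrow> \<rho> \<le> 1 \<longrightarrow> holder_smooth t \<rho> m \<gamma> K2 f u \<longrightarrow> m \<le> m \<longrightarrow> c \<in> cube t 0 \<rho> \<longrightarrow>
    (\<exists>a. (\<forall>\<alpha>. \<bar>a \<alpha>\<bar> \<le> C1) \<and> (\<forall>x\<in>cube t 0 \<rho>. \<forall>\<delta>\<ge>0. (\<forall>k<t. \<bar>x k - c k\<bar> \<le> \<delta>) \<longrightarrow>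
      \<bar>f x - (\<Sum>\<alpha>\<in>box_indices t m. a \<alpha> * (\<Prod>j<t. x j ^ \<alpha> j))\<bar> \<le> C1 * (\<delta> ^ m * \<delta> powr \<gamma>)))"
    by (elim exE conjE)
  have "0 < C1 + 1" using C1 by simp
  from circuit_local_polynomials[OF t this, where ?'a = 'a and m = m and R = R]
  obtain k C2 where C2: "0 < C2" and N: "\<And>W (y :: nat \<Rightarrow> 'a \<Rightarrow> real) (c :: (nat \<Rightarrow> nat) \<Rightarrow> (nat \<Rightarrow> nat) \<Rightarrow> real) \<rho>.
    1 \<le> W \<Longrightarrow> (\<forall>j<t. \<forall>x. 0 \<le> y j x \<and> y j x \<le> 1) \<Longrightarrow> (\<forall>l \<alpha>. \<bar>c l \<alpha>\<bar> \<le> C1 + 1) \<Longrightarrow> 0 \<le> \<rho> \<Longrightarrow> \<rho> \<le> 1 \<Longrightarrow>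
    (\<exists>v. circuit (y ` {..<t}) k (C2 * real W ^ (2 * t)) {v} \<and> (\<forall>x. 0 \<le> v x \<and> v x \<le> \<rho>) \<and>
      (\<forall>x g \<epsilon>. 0 \<le> g \<longrightarrow> g \<le> \<rho> \<longrightarrow>
        (\<forall>l\<in>kuhn_nodes t (W ^ 2). (\<forall>j<t. \<bar>y j x - real (l j) / real (W ^ 2)\<bar> \<le> 1 / real (W ^ 2)) \<longrightarrow>
          \<bar>g - (\<Sum>\<alpha>\<in>box_indices t m. c l \<alpha> * (\<Prod>j<t. y j x ^ \<alpha> j))\<bar> \<le> \<epsilon>) \<longrightarrow>
        \<bar>v x - g\<bar> \<le> \<epsilon> + C2 * (1 / real W ^ 2) ^ R))"
    by blast
  define C where "C = C2 + S * (C1 + C2)"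
  have C: "0 < C" "C2 \<le> C" "S * (C1 + C2) \<le> C" using C1 C2 S by (auto simp: C_def add_pos_nonneg)
  show ?thesis
  proof (intro exI[of _ k] exI[of _ C] conjI allI impI C(1))
    fix W :: nat and y :: "nat \<Rightarrow> 'a \<Rightarrow> real" and h a b a' b' K
    assume W: "1 \<le> W" and K: "0 \<le> K" "K \<le> F" and ab: "a \<le> b" "\<bar>a\<bar> \<le> F" "\<bar>b\<bar> \<le> F" and ab': "a' \<le> b'" "\<bar>a'\<bar> \<le> F" "\<bar>b'\<bar> \<le> F"
      and h: "h \<in> holder_ball t \<beta> a b K" and h': "\<forall>z\<in>cube t a b. h z \<in> {a'..b'}"
      and y: "\<forall>j<t. \<forall>x. 0 \<le> y j x \<and> y j x \<le> (b - a) / (2 * F)"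
    let ?\<rho> = "(b - a) / S" and ?\<rho>' = "(b' - a') / S"
    let ?H = "\<lambda>z. (h (\<lambda>k\<in>{..<t}. a + S * z k) - a') / S"
    have \<rho>: "0 \<le> ?\<rho>" "?\<rho> \<le> 1" "0 \<le> ?\<rho>'" "?\<rho>' \<le> 1" using ab ab' S F by (auto simp: S_def field_simps)
    obtain u where u: "holder_smooth t ?\<rho> m \<gamma> K2 ?H u"
      using holder_ball_smooth[OF h \<beta> K t S ab(1) ab'(2)] unfolding m_def \<gamma>_def K2_def by blast
    define M where "M = W ^ 2"
    \<comment> \<open>Grid nodes outside [0, \<rho>] are projected onto it, because h is controlled
      only there. Their distance to points of the cube does not grow.\<close>
    define c where "c l = (\<lambda>k\<in>{..<t}. min (real (l k) / real M) ?\<rho>)" for l :: "nat \<Rightarrow> nat"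
    have c: "c l \<in> cube t 0 ?\<rho>" for l unfolding c_def cube_def using \<rho> by auto
    have "\<forall>l. \<exists>a. (\<forall>\<alpha>. \<bar>a \<alpha>\<bar> \<le> C1) \<and> (\<forall>x\<in>cube t 0 ?\<rho>. \<forall>\<delta>\<ge>0. (\<forall>k<t. \<bar>x k - c l k\<bar> \<le> \<delta>) \<longrightarrow>
      \<bar>?H x - (\<Sum>\<alpha>\<in>box_indices t m. a \<alpha> * (\<Prod>j<t. x j ^ \<alpha> j))\<bar> \<le> C1 * (\<delta> ^ m * \<delta> powr \<gamma>))"
      using P'[rule_format, OF \<rho>(1,2) u order_refl c] by blast
    from choice[OF this] obtain e where e: "\<forall>l. (\<forall>\<alpha>. \<bar>e l \<alpha>\<bar> \<le> C1) \<and> (\<forall>x\<in>cube t 0 ?\<rho>. \<forall>\<delta>\<ge>0. (\<forall>k<t. \<bar>x k - c l k\<bar> \<le> \<delta>) \<longrightarrow>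
      \<bar>?H x - (\<Sum>\<alpha>\<in>box_indices t m. e l \<alpha> * (\<Prod>j<t. x j ^ \<alpha> j))\<bar> \<le> C1 * (\<delta> ^ m * \<delta> powr \<gamma>))" by (elim exE)
    have y1: "\<forall>j<t. \<forall>x. 0 \<le> y j x \<and> y j x \<le> 1" using y \<rho> unfolding S_def by (meson order_trans)
    have e1: "\<forall>l \<alpha>. \<bar>e l \<alpha>\<bar> \<le> C1 + 1" using e by (meson less_add_one less_imp_le order_trans)
    from N[OF W y1 e1 \<rho>(3,4)] obtain v where v: "circuit (y ` {..<t}) k (C2 * real W ^ (2 * t)) {v}" "\<forall>x. 0 \<le> v x \<and> v x \<le> ?\<rho>'"
      "\<forall>x g \<epsilon>. 0 \<le> g \<longrightarrow> g \<le> ?\<rho>' \<longrightarrow>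
        (\<forall>l\<in>kuhn_nodes t (W ^ 2). (\<forall>j<t. \<bar>y j x - real (l j) / real (W ^ 2)\<bar> \<le> 1 / real (W ^ 2)) \<longrightarrow>
          \<bar>g - (\<Sum>\<alpha>\<in>box_indices t m. e l \<alpha> * (\<Prod>j<t. y j x ^ \<alpha> j))\<bar> \<le> \<epsilon>) \<longrightarrow>
        \<bar>v x - g\<bar> \<le> \<epsilon> + C2 * (1 / real W ^ 2) ^ R"
      by (elim exE conjE)
    have pw: "(1 / real M) ^ m * (1 / real M) powr \<gamma> = real W powr (- 2 * \<beta>)"
    proof -
      have "0 < 1 / real M" using W by (simp add: M_def)
      then have "(1 / real M) ^ m = (1 / real M) powr real m" by (simp add: powr_realpow)
      then have "(1 / real M) ^ m * (1 / real M) powr \<gamma> = (1 / real M) powr (real m + \<gamma>)" by (simp add: powr_add)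
      also have "real m + \<gamma> = \<beta>" by (simp add: \<gamma>_def)
      also have "(1 / real M) powr \<beta> = (real W powr (- 2)) powr \<beta>" using W by (simp add: M_def powr_minus_divide powr_numeral)
      also have "(real W powr (- 2)) powr \<beta> = real W powr (- 2 * \<beta>)" by (simp add: powr_powr)
      finally show ?thesis .
    qed
    have R: "(1 / real W ^ 2) ^ R \<le> real W powr (- 2 * \<beta>)"
    proof -
      have "(1 / real W ^ 2) ^ R = (real W powr (- 2)) powr real R"
        using W by (simp add: powr_minus_divide powr_numeral powr_realpow)
      also have "\<dots> = real W powr (- 2 * real R)" by (simp add: powr_powr)
      also have "\<dots> \<le> real W powr (- 2 * \<beta>)" using W \<beta> unfolding R_def by (intro powr_mono) linarith+
      finally show ?thesis .
    qed
    have err: "\<bar>a' + S * v x - h (\<lambda>k\<in>{..<t}. a + S * y k x)\<bar> \<le> C * real W powr (- 2 * \<beta>)" for x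
    proof -
      define z where "z = (\<lambda>k\<in>{..<t}. y k x)"
      have zc: "z \<in> cube t 0 ?\<rho>" using y unfolding z_def cube_def S_def by auto
      have zz: "(\<lambda>k\<in>{..<t}. a + S * z k) = (\<lambda>k\<in>{..<t}. a + S * y k x)" by (auto simp: z_def fun_eq_iff)
      have "(\<lambda>k\<in>{..<t}. a + S * z k) \<in> cube t a b"
      proof -
        have "0 \<le> S * z k \<and> S * z k \<le> b - a" if "k < t" for k using cube_nth[OF zc that] S by (auto simp: field_simps)
        then show ?thesis by (force simp: cube_def)
      qed
      then have "h (\<lambda>k\<in>{..<t}. a + S * z k) \<in> {a'..b'}" using h' by blast
      then have g: "0 \<le> ?H z" "?H z \<le> ?\<rho>'" using S by (auto simp: divide_right_mono)
      have "\<bar>v x - ?H z\<bar> \<le> C1 * ((1 / real M) ^ m * (1 / real M) powr \<gamma>) + C2 * (1 / real W ^ 2) ^ R"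
      proof (rule v(3)[THEN spec, THEN spec, THEN spec, THEN mp, THEN mp, THEN mp, OF g], intro ballI impI)
        fix l assume l: "\<forall>j<t. \<bar>y j x - real (l j) / real (W ^ 2)\<bar> \<le> 1 / real (W ^ 2)"
        have "\<bar>z j - c l j\<bar> \<le> 1 / real M" if "j < t" for j
        proof -
          have "\<bar>y j x - real (l j) / real M\<bar> \<le> 1 / real M" "y j x \<le> ?\<rho>" using l y that by (auto simp: M_def S_def)
          then show ?thesis using that unfolding z_def c_def by (auto simp: min_def abs_le_iff)
        qed
        then have "\<bar>?H z - (\<Sum>\<alpha>\<in>box_indices t m. e l \<alpha> * (\<Prod>j<t. z j ^ \<alpha> j))\<bar> \<le> C1 * ((1 / real M) ^ m * (1 / real M) powr \<gamma>)"
          using e[rule_format, of l] zc by simp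
        moreover have "(\<Prod>j<t. z j ^ \<alpha> j) = (\<Prod>j<t. y j x ^ \<alpha> j)" for \<alpha> by (intro prod.cong) (auto simp: z_def)
        ultimately show "\<bar>?H z - (\<Sum>\<alpha>\<in>box_indices t m. e l \<alpha> * (\<Prod>j<t. y j x ^ \<alpha> j))\<bar> \<le> C1 * ((1 / real M) ^ m * (1 / real M) powr \<gamma>)"
          by simp
      qed
      also have "\<dots> \<le> (C1 + C2) * real W powr (- 2 * \<beta>)" unfolding pw using R C2 by (simp add: distrib_right mult_left_mono)
      finally have 1: "\<bar>v x - ?H z\<bar> \<le> (C1 + C2) * real W powr (- 2 * \<beta>)" .
      have "a' + S * v x - h (\<lambda>k\<in>{..<t}. a + S * y k x) = S * (v x - ?H z)" unfolding zz using S by (simp add: field_simps)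
      then have "\<bar>a' + S * v x - h (\<lambda>k\<in>{..<t}. a + S * y k x)\<bar> = S * \<bar>v x - ?H z\<bar>" using S by (simp add: abs_mult)
      also have "\<dots> \<le> S * ((C1 + C2) * real W powr (- 2 * \<beta>))" using 1 S by (intro mult_left_mono) auto
      also have "\<dots> \<le> C * real W powr (- 2 * \<beta>)" using C(3) by (simp add: mult.assoc[symmetric] mult_right_mono)
      finally show ?thesis .
    qed
    have "circuit (y ` {..<t}) k (C * real W ^ (2 * t)) {v}"
      by (rule circuit_weaken[OF v(1)]) (use C(2) in \<open>auto intro: mult_right_mono\<close>)
    then show "\<exists>v. circuit (y ` {..<t}) k (C * real W ^ (2 * t)) {v} \<and> (\<forall>x. 0 \<le> v x \<and> v x \<le> (b' - a') / (2 * F)) \<and>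
      (\<forall>x. \<bar>a' + 2 * F * v x - h (\<lambda>k\<in>{..<t}. a + 2 * F * y k x)\<bar> \<le> C * real W powr (- 2 * \<beta>))"
      using v(2) err unfolding S_def by blast
  qed
qed

section \<open>Approximation of compositions\<close>

text \<open>By homogeneity it is enough to treat x + y = 1, and there
  \<open>r \<le> r powr \<mu>\<close> for both summands.\<close>

lemma powr_add_le:
  fixes x y \<mu> :: real
  assumes "0 \<le> x" "0 \<le> y" "0 < \<mu>" "\<mu> \<le> 1"
  shows "(x + y) powr \<mu> \<le> x powr \<mu> + y powr \<mu>"
proof (cases "x + y = 0")
  case True then show ?thesis using assms by simp
next
  case False
  then have s: "0 < x + y" using assms by linarith
  have p: "r \<le> r powr \<mu>" if "0 \<le> r" "r \<le> 1" for r
    using that assms powr_mono'[of \<mu> 1 r] by simp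
  have "1 = x / (x + y) + y / (x + y)" using s by (simp add: add_divide_distrib[symmetric])
  also have "\<dots> \<le> (x / (x + y)) powr \<mu> + (y / (x + y)) powr \<mu>"
    using assms s by (intro add_mono p) auto
  also have "\<dots> = (x powr \<mu> + y powr \<mu>) / (x + y) powr \<mu>"
    using assms s by (simp add: powr_divide add_divide_distrib)
  finally show ?thesis using s by (simp add: field_simps)
qed

lemma powr_sum_le:
  fixes f :: "'b \<Rightarrow> real"
  assumes "finite A" "\<And>i. i \<in> A \<Longrightarrow> 0 \<le> f i" "0 < \<mu>" "\<mu> \<le> 1"
  shows "(\<Sum>i\<in>A. f i) powr \<mu> \<le> (\<Sum>i\<in>A. f i powr \<mu>)"
  using assms(1,2)
proof (induction A)
  case (insert i A)
  have "(f i + (\<Sum>i\<in>A. f i)) powr \<mu> \<le> f i powr \<mu> + (\<Sum>i\<in>A. f i) powr \<mu>"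
    using insert.prems assms by (intro powr_add_le sum_nonneg) auto
  then show ?case using insert by fastforce
qed simp

text \<open>Two errors add: that of the circuit for each component at its actual inputs, and the
  modulus of continuity at the input error \<delta>, which produces the exponent
  \<open>min \<beta> 1\<close>.\<close>

lemma circuit_layer:
  fixes t :: nat and \<beta> F :: real
  assumes t: "1 \<le> t" and \<beta>: "0 < \<beta>" and F: "1 \<le> F"
  shows "\<exists>k C. 1 \<le> C \<and> (\<forall>W D D' (u :: nat \<Rightarrow> 'a \<Rightarrow> real) G a b a' b' K z \<delta>. 1 \<le> W \<longrightarrow> 0 \<le> K \<longrightarrow> K \<le> F \<longrightarrow>
    a \<le> b \<longrightarrow> \<bar>a\<bar> \<le> F \<longrightarrow> \<bar>b\<bar> \<le> F \<longrightarrow> a' \<le> b' \<longrightarrow> \<bar>a'\<bar> \<le> F \<longrightarrow> \<bar>b'\<bar> \<le> F \<longrightarrow> G \<in> cube D a b \<rightarrow> cube D' a' b' \<longrightarrow>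
    (\<forall>j<D'. \<exists>\<iota> h. inj_on \<iota> {..<t} \<and> \<iota> ` {..<t} \<subseteq> {..<D} \<and> h \<in> holder_ball t \<beta> a b K \<and>
      (\<forall>x\<in>cube D a b. G x j = h (\<lambda>k\<in>{..<t}. x (\<iota> k)))) \<longrightarrow>
    (\<forall>j<D. \<forall>x. 0 \<le> u j x \<and> u j x \<le> (b - a) / (2 * F)) \<longrightarrow> (\<forall>x. z x \<in> cube D a b) \<longrightarrow> 0 \<le> \<delta> \<longrightarrow>
    (\<forall>j<D. \<forall>x. \<bar>a + 2 * F * u j x - z x j\<bar> \<le> \<delta>) \<longrightarrow>
    (\<exists>v. circuit (u ` {..<D}) k (real D' * (C * real W ^ (2 * t))) (v ` {..<D'}) \<and>
      (\<forall>j<D'. \<forall>x. 0 \<le> v j x \<and> v j x \<le> (b' - a') / (2 * F) \<and>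
        \<bar>a' + 2 * F * v j x - G (z x) j\<bar> \<le> C * real W powr (- 2 * \<beta>) + C * \<delta> powr (min \<beta> 1))))"
proof -
  from circuit_holder[OF t \<beta> F, where ?'a = 'a] obtain k C1 where C1: "0 < C1" and
    H: "\<forall>W (y :: nat \<Rightarrow> 'a \<Rightarrow> real) h a b a' b' K. 1 \<le> W \<longrightarrow> 0 \<le> K \<longrightarrow> K \<le> F \<longrightarrow>
    a \<le> b \<longrightarrow> \<bar>a\<bar> \<le> F \<longrightarrow> \<bar>b\<bar> \<le> F \<longrightarrow> a' \<le> b' \<longrightarrow> \<bar>a'\<bar> \<le> F \<longrightarrow> \<bar>b'\<bar> \<le> F \<longrightarrow> h \<in> holder_ball t \<beta> a b K \<longrightarrow>
    (\<forall>z\<in>cube t a b. h z \<in> {a'..b'}) \<longrightarrow> (\<forall>j<t. \<forall>x. 0 \<le> y j x \<and> y j x \<le> (b - a) / (2 * F)) \<longrightarrow>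
    (\<exists>v. circuit (y ` {..<t}) k (C1 * real W ^ (2 * t)) {v} \<and> (\<forall>x. 0 \<le> v x \<and> v x \<le> (b' - a') / (2 * F)) \<and>
      (\<forall>x. \<bar>a' + 2 * F * v x - h (\<lambda>k\<in>{..<t}. a + 2 * F * y k x)\<bar> \<le> C1 * real W powr (- 2 * \<beta>)))"
    by (elim exE conjE)
  define C where "C = 1 + C1 + 2 * F * ((real t + 1) * ((2 * F) ^ sfloor \<beta> * F + F))"
  have C2: "0 \<le> 2 * F * ((real t + 1) * ((2 * F) ^ sfloor \<beta> * F + F))" using F by simp
  have C: "1 \<le> C" "C1 \<le> C" "2 * F * ((real t + 1) * ((2 * F) ^ sfloor \<beta> * F + F)) \<le> C"
    using C1 C2 by (auto simp: C_def)
  show ?thesis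
  proof (intro exI[of _ k] exI[of _ C] conjI C(1) allI impI)
    fix W :: nat and D D' :: nat and u :: "nat \<Rightarrow> 'a \<Rightarrow> real" and G :: "(nat \<Rightarrow> real) \<Rightarrow> nat \<Rightarrow> real" and a b a' b' K :: real and z :: "'a \<Rightarrow> nat \<Rightarrow> real" and \<delta> :: real
    assume W: "1 \<le> W" and K: "0 \<le> K" "K \<le> F" and ab: "a \<le> b" "\<bar>a\<bar> \<le> F" "\<bar>b\<bar> \<le> F" and ab': "a' \<le> b'" "\<bar>a'\<bar> \<le> F" "\<bar>b'\<bar> \<le> F"
      and G: "G \<in> cube D a b \<rightarrow> cube D' a' b'"
      and h: "\<forall>j<D'. \<exists>\<iota> h. inj_on \<iota> {..<t} \<and> \<iota> ` {..<t} \<subseteq> {..<D} \<and> h \<in> holder_ball t \<beta> a b K \<and>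
      (\<forall>x\<in>cube D a b. G x j = h (\<lambda>k\<in>{..<t}. x (\<iota> k)))"
      and u: "\<forall>j<D. \<forall>x. 0 \<le> u j x \<and> u j x \<le> (b - a) / (2 * F)" and z: "\<forall>x. z x \<in> cube D a b" and \<delta>: "0 \<le> \<delta>"
      and uz: "\<forall>j<D. \<forall>x. \<bar>a + 2 * F * u j x - z x j\<bar> \<le> \<delta>"
    let ?Q = "\<lambda>j v. circuit (u ` {..<D}) k (C * real W ^ (2 * t)) {v} \<and>
      (\<forall>x. 0 \<le> v x \<and> v x \<le> (b' - a') / (2 * F) \<and>
        \<bar>a' + 2 * F * v x - G (z x) j\<bar> \<le> C * real W powr (- 2 * \<beta>) + C * \<delta> powr (min \<beta> 1))"
    have "\<forall>j\<in>{..<D'}. \<exists>v. ?Q j v"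
    proof
      fix j assume j: "j \<in> {..<D'}"
      then obtain \<iota> h where \<iota>: "inj_on \<iota> {..<t}" "\<iota> ` {..<t} \<subseteq> {..<D}" and hb: "h \<in> holder_ball t \<beta> a b K"
        and Gh: "\<forall>x\<in>cube D a b. G x j = h (\<lambda>k\<in>{..<t}. x (\<iota> k))" using h by blast
      have hr: "\<forall>w\<in>cube t a b. h w \<in> {a'..b'}"
      proof
        fix w assume w: "w \<in> cube t a b"
        \<comment> \<open>h has to map the whole t-dimensional cube into [a', b'], but the range is
          stated for G. Since \<iota> is injective, every argument of h extends to an argument of G,
          with a in the other coordinates.\<close>
        define w' where "w' = (\<lambda>m\<in>{..<D}. if m \<in> \<iota> ` {..<t} then w (inv_into {..<t} \<iota> m) else a)"
        have w': "w' \<in> cube D a b" unfolding w'_def cube_def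
          using cube_nth[OF w] ab(1) by (auto simp: inv_into_f_f[OF \<iota>(1)])
        have "(\<lambda>k\<in>{..<t}. w' (\<iota> k)) = w"
          using w \<iota> by (auto simp: w'_def fun_eq_iff cube_def PiE_iff extensional_def)
        then have "h w = G w' j" using Gh w' by simp
        moreover have "G w' \<in> cube D' a' b'" using G w' by auto
        ultimately show "h w \<in> {a'..b'}" using j by (auto dest: cube_nth)
      qed
      define y where "y k = u (\<iota> k)" for k
      have \<iota>D: "\<iota> k < D" if "k < t" for k using \<iota>(2) that by auto
      have y: "\<forall>j<t. \<forall>x. 0 \<le> y j x \<and> y j x \<le> (b - a) / (2 * F)" using u \<iota>D by (simp add: y_def)
      from H[THEN spec, THEN spec, THEN spec, THEN spec, THEN spec, THEN spec, THEN spec, THEN spec, THEN mp, THEN mp, THEN mp, THEN mp, THEN mp, THEN mp, THEN mp, THEN mp, THEN mp, THEN mp, THEN mp, THEN mp, OF W K ab ab' hb hr y]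
      obtain v where v: "circuit (y ` {..<t}) k (C1 * real W ^ (2 * t)) {v}" "\<forall>x. 0 \<le> v x \<and> v x \<le> (b' - a') / (2 * F)"
        "\<forall>x. \<bar>a' + 2 * F * v x - h (\<lambda>k\<in>{..<t}. a + 2 * F * y k x)\<bar> \<le> C1 * real W powr (- 2 * \<beta>)" by blast
      have "circuit (u ` {..<D}) k (C * real W ^ (2 * t)) {v}"
        by (rule circuit_weaken[OF v(1)]) (use C(2) \<iota>D in \<open>auto simp: y_def intro: mult_right_mono\<close>)
      moreover have "\<bar>a' + 2 * F * v x - G (z x) j\<bar> \<le> C * real W powr (- 2 * \<beta>) + C * \<delta> powr (min \<beta> 1)" for x
      proof -
        have zc: "(\<lambda>k\<in>{..<t}. z x (\<iota> k)) \<in> cube t a b"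
          using cube_nth[OF z[rule_format, of x] \<iota>D] by (auto simp: cube_def)
        have yc: "(\<lambda>k\<in>{..<t}. a + 2 * F * y k x) \<in> cube t a b"
        proof -
          have "0 \<le> 2 * F * y k x \<and> 2 * F * y k x \<le> b - a" if "k < t" for k
            using y[rule_format, OF that, of x] F by (auto simp: field_simps)
          then show ?thesis by (force simp: cube_def)
        qed
        have "\<bar>h (\<lambda>k\<in>{..<t}. a + 2 * F * y k x) - h (\<lambda>k\<in>{..<t}. z x (\<iota> k))\<bar>
           \<le> 2 * F * ((real t + 1) * ((2 * F) ^ sfloor \<beta> * F + F)) * \<delta> powr (min \<beta> 1)"
          by (rule holder_ball_modulus[OF hb \<beta> K t F ab yc zc \<delta>]) (use uz \<iota>D in \<open>auto simp: y_def\<close>)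
        also have "\<dots> \<le> C * \<delta> powr (min \<beta> 1)" using C(3) by (intro mult_right_mono) auto
        finally have "\<bar>h (\<lambda>k\<in>{..<t}. a + 2 * F * y k x) - G (z x) j\<bar> \<le> C * \<delta> powr (min \<beta> 1)"
          using Gh z by simp
        moreover have "C1 * real W powr (- 2 * \<beta>) \<le> C * real W powr (- 2 * \<beta>)" using C(2) by (intro mult_right_mono) auto
        ultimately show ?thesis using v(3)[rule_format, of x] by linarith
      qed
      ultimately show "\<exists>v. ?Q j v" using v(2) by blast
    qed
    from bchoice[OF this] obtain v where v: "\<forall>j\<in>{..<D'}. ?Q j (v j)" by (elim exE)
    have "circuit (u ` {..<D}) k (\<Sum>j<D'. C * real W ^ (2 * t)) (\<Union>j\<in>{..<D'}. {v j})"
      by (rule circuit_UN) (use v in auto)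
    then have "circuit (u ` {..<D}) k (real D' * (C * real W ^ (2 * t))) (v ` {..<D'})"
      by (rule circuit_weaken) auto
    then show "\<exists>v. circuit (u ` {..<D}) k (real D' * (C * real W ^ (2 * t))) (v ` {..<D'}) \<and>
      (\<forall>j<D'. \<forall>x. 0 \<le> v j x \<and> v j x \<le> (b' - a') / (2 * F) \<and>
        \<bar>a' + 2 * F * v j x - G (z x) j\<bar> \<le> C * real W powr (- 2 * \<beta>) + C * \<delta> powr (min \<beta> 1))"
      using v by (intro exI[of _ v]) simp
  qed
qed

text \<open>The witnesses hidden in \<open>composition_class\<close>, made a predicate so that
  \<open>a\<close>, \<open>b\<close> and \<open>g\<close> stay fixed during the induction over the
  levels.\<close>

definition decomposition ::
  "nat \<Rightarrow> (nat \<Rightarrow> nat) \<Rightarrow> (nat \<Rightarrow> nat) \<Rightarrow> (nat \<Rightarrow> real) \<Rightarrow> real \<Rightarrow> (nat \<Rightarrow> real) \<Rightarrow> (nat \<Rightarrow> real)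
    \<Rightarrow> (nat \<Rightarrow> (nat \<Rightarrow> real) \<Rightarrow> nat \<Rightarrow> real) \<Rightarrow> bool" where
  "decomposition q d t \<beta> K a b g \<longleftrightarrow> a 0 = 0 \<and> b 0 = 1 \<and>
     (\<forall>i\<in>{1..q + 1}. \<bar>a i\<bar> \<le> K \<and> \<bar>b i\<bar> \<le> K) \<and>
     (\<forall>i\<le>q. g i \<in> cube (d i) (a i) (b i) \<rightarrow> cube (d (i + 1)) (a (i + 1)) (b (i + 1))) \<and>
     (\<forall>i\<le>q. \<forall>j<d (i + 1). \<exists>\<iota> h.
        inj_on \<iota> {..<t i} \<and> \<iota> ` {..<t i} \<subseteq> {..<d i} \<and>
        h \<in> holder_ball (t i) (\<beta> i) (a i) (b i) K \<and>
        (\<forall>x\<in>cube (d i) (a i) (b i). g i x j = h (\<lambda>k\<in>{..<t i}. x (\<iota> k))))"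

lemma decomposition_bounds:
  assumes "decomposition q d t \<beta> K a b g" "i \<in> {1..q + 1}" "K \<le> F"
  shows "\<bar>a i\<bar> \<le> F" "\<bar>b i\<bar> \<le> F"
proof -
  have "\<forall>i\<in>{1..q + 1}. \<bar>a i\<bar> \<le> K \<and> \<bar>b i\<bar> \<le> K" using assms(1) unfolding decomposition_def by blast
  from bspec[OF this assms(2)] show "\<bar>a i\<bar> \<le> F" "\<bar>b i\<bar> \<le> F" using assms(3) by auto
qed

lemma decomposition_level:
  assumes "decomposition q d t \<beta> K a b g" "i \<le> q"
  shows "g i \<in> cube (d i) (a i) (b i) \<rightarrow> cube (d (i + 1)) (a (i + 1)) (b (i + 1))"
    and "\<forall>j<d (i + 1). \<exists>\<iota> h.
        inj_on \<iota> {..<t i} \<and> \<iota> ` {..<t i} \<subseteq> {..<d i} \<and>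
        h \<in> holder_ball (t i) (\<beta> i) (a i) (b i) K \<and>
        (\<forall>x\<in>cube (d i) (a i) (b i). g i x j = h (\<lambda>k\<in>{..<t i}. x (\<iota> k)))"
  using assms unfolding decomposition_def by blast+

lemma decomposition_0: "decomposition q d t \<beta> K a b g \<Longrightarrow> a 0 = 0 \<and> b 0 = 1"
  unfolding decomposition_def by blast

lemma compose_upto_cube:
  assumes "decomposition q d t \<beta> K a b g" "i \<le> q" "x \<in> cube (d 0) 0 1"
  shows "compose_upto g i x \<in> cube (d (i + 1)) (a (i + 1)) (b (i + 1))"
  using assms(2)
proof (induction i)
  case 0
  then show ?case using decomposition_level(1)[OF assms(1), of 0] decomposition_0[OF assms(1)] assms(3)
    by (auto simp: Pi_iff)
next
  case (Suc i)
  then have "g (Suc i) \<in> cube (d (Suc i)) (a (Suc i)) (b (Suc i)) \<rightarrow> cube (d (Suc i + 1)) (a (Suc i + 1)) (b (Suc i + 1))"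
    using decomposition_level(1)[OF assms(1)] by simp
  with Suc show ?case by (auto simp: Pi_iff)
qed

text \<open>Induction over the levels. Earlier errors enter a level through the power
  \<open>min (\<beta> i) 1\<close>, which is at most 1 and can therefore be taken termwise; the
  accumulated powers form the product in \<open>beta_star\<close>. Each level has its own grid size
  \<open>W l\<close>, because its cost grows with the exponent \<open>2 * t l\<close>.\<close>

lemma circuit_decomposition:
  fixes q :: nat and d t :: "nat \<Rightarrow> nat" and \<beta> :: "nat \<Rightarrow> real" and F :: real
  assumes dq: "d (q + 1) = 1" and t: "\<forall>i\<le>q. 1 \<le> t i \<and> t i \<le> d i" and \<beta>: "\<forall>i\<le>q. 0 < \<beta> i" and F: "1 \<le> F"
    and i: "i \<le> q"
  shows "\<exists>k C. 1 \<le> C \<and> (\<forall>W (e :: nat \<Rightarrow> 'a \<Rightarrow> real) K a b g. (\<forall>l\<le>q. 1 \<le> W l) \<longrightarrow> 0 \<le> K \<longrightarrow> K \<le> F \<longrightarrow>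
    decomposition q d t \<beta> K a b g \<longrightarrow> (\<forall>j<d 0. \<forall>x. 0 \<le> e j x \<and> e j x \<le> 1) \<longrightarrow>
    (\<exists>v. circuit (e ` {..<d 0}) k (C * (\<Sum>l\<le>i. real (W l) ^ (2 * t l))) (v ` {..<d (i + 1)}) \<and>
      (\<forall>j<d (i + 1). \<forall>x. 0 \<le> v j x \<and> v j x \<le> (b (i + 1) - a (i + 1)) / (2 * F) \<and>
        \<bar>a (i + 1) + 2 * F * v j x - compose_upto g i (\<lambda>j\<in>{..<d 0}. e j x) j\<bar>
          \<le> C * (\<Sum>l\<le>i. real (W l) powr (- 2 * \<beta> l * (\<Prod>m\<in>{l + 1..i}. min (\<beta> m) 1))))))"
  using i
proof (induction i)
  case 0
  have t0: "1 \<le> t 0" and \<beta>0: "0 < \<beta> 0" using t \<beta> by auto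
  from circuit_layer[OF t0 \<beta>0 F, where ?'a = 'a] obtain k C where C: "1 \<le> C" and
    L: "\<forall>W D D' (u :: nat \<Rightarrow> 'a \<Rightarrow> real) G a b a' b' K z \<delta>. 1 \<le> W \<longrightarrow> 0 \<le> K \<longrightarrow> K \<le> F \<longrightarrow>
    a \<le> b \<longrightarrow> \<bar>a\<bar> \<le> F \<longrightarrow> \<bar>b\<bar> \<le> F \<longrightarrow> a' \<le> b' \<longrightarrow> \<bar>a'\<bar> \<le> F \<longrightarrow> \<bar>b'\<bar> \<le> F \<longrightarrow> G \<in> cube D a b \<rightarrow> cube D' a' b' \<longrightarrow>
    (\<forall>j<D'. \<exists>\<iota> h. inj_on \<iota> {..<t 0} \<and> \<iota> ` {..<t 0} \<subseteq> {..<D} \<and> h \<in> holder_ball (t 0) (\<beta> 0) a b K \<and>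
      (\<forall>x\<in>cube D a b. G x j = h (\<lambda>k\<in>{..<t 0}. x (\<iota> k)))) \<longrightarrow>
    (\<forall>j<D. \<forall>x. 0 \<le> u j x \<and> u j x \<le> (b - a) / (2 * F)) \<longrightarrow> (\<forall>x. z x \<in> cube D a b) \<longrightarrow> 0 \<le> \<delta> \<longrightarrow>
    (\<forall>j<D. \<forall>x. \<bar>a + 2 * F * u j x - z x j\<bar> \<le> \<delta>) \<longrightarrow>
    (\<exists>v. circuit (u ` {..<D}) k (real D' * (C * real W ^ (2 * t 0))) (v ` {..<D'}) \<and>
      (\<forall>j<D'. \<forall>x. 0 \<le> v j x \<and> v j x \<le> (b' - a') / (2 * F) \<and>
        \<bar>a' + 2 * F * v j x - G (z x) j\<bar> \<le> C * real W powr (- 2 * \<beta> 0) + C * \<delta> powr (min (\<beta> 0) 1)))"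
    by (elim exE conjE)
  \<comment> \<open>The summand \<open>3 * real (d 0)\<close> pays for scaling the inputs by 1/(2
    F).\<close>
  define C' where "C' = 3 * real (d 0) + real (d 1) * C + C"
  have "0 \<le> real (d 1) * C" using C by simp
  then have C': "1 \<le> C'" "C \<le> C'" using C unfolding C'_def by linarith+
  show ?case
  proof (intro exI[of _ "1 + k"] exI[of _ C'] conjI C' allI impI)
    fix W :: "nat \<Rightarrow> nat" and e :: "nat \<Rightarrow> 'a \<Rightarrow> real" and K a b g
    assume W: "\<forall>l\<le>q. 1 \<le> W l" and K: "0 \<le> K" "K \<le> F" and dec: "decomposition q d t \<beta> K a b g"
      and e: "\<forall>j<d 0. \<forall>x. 0 \<le> e j x \<and> e j x \<le> 1"
    define \<xi> where "\<xi> x = (\<lambda>j\<in>{..<d 0}. e j x)" for x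
    have \<xi>: "\<xi> x \<in> cube (d 0) 0 1" for x using e by (auto simp: \<xi>_def cube_def)
    have d1: "0 < d 1" 
    proof (cases "q = 0")
      case False
      then have "1 \<le> t 1 \<and> t 1 \<le> d 1" using t by simp
      then show ?thesis by linarith
    qed (use dq in simp)
    define u where "u j = (\<lambda>x. max 0 ((\<Sum>i\<in>{()}. 1 / (2 * F) * e j x) - 0))" for j
    have u: "u j x = e j x / (2 * F)" if "j < d 0" for j x using e that F by (simp add: u_def)
    have "circuit (e ` {..<d 0}) 1 (\<Sum>j<d 0. 3) (\<Union>j\<in>{..<d 0}. {u j})"
      unfolding u_def by (intro circuit_UN circuit_lincomb) (use F in auto)
    then have c1: "circuit (e ` {..<d 0}) 1 (3 * real (d 0)) (u ` {..<d 0})"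
      by (rule circuit_weaken) auto
    have ab: "\<bar>a 1\<bar> \<le> F" "\<bar>b 1\<bar> \<le> F" using decomposition_bounds[OF dec _ K(2), of 1] by auto
    \<comment> \<open>The order of the end points follows because the interval contains a value of
      the composition.\<close>
    have "a 1 \<le> compose_upto g 0 (\<xi> x) 0 \<and> compose_upto g 0 (\<xi> x) 0 \<le> b 1" for x
      using cube_nth[OF compose_upto_cube[OF dec _ \<xi>, of 0], of 0] d1 by simp
    then have ab1: "a 1 \<le> b 1" by (meson order_trans)
    have W0: "1 \<le> W 0" using W by simp
    have F01: "(0::real) \<le> 1" "\<bar>0::real\<bar> \<le> F" "\<bar>1::real\<bar> \<le> F" using F by auto
    have g0: "g 0 \<in> cube (d 0) 0 1 \<rightarrow> cube (d 1) (a 1) (b 1)"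
      "\<forall>j<d 1. \<exists>\<iota> h. inj_on \<iota> {..<t 0} \<and> \<iota> ` {..<t 0} \<subseteq> {..<d 0} \<and> h \<in> holder_ball (t 0) (\<beta> 0) 0 1 K \<and>
        (\<forall>x\<in>cube (d 0) 0 1. g 0 x j = h (\<lambda>k\<in>{..<t 0}. x (\<iota> k)))"
      using decomposition_level[OF dec, of 0] decomposition_0[OF dec] by simp_all
    have u01: "\<forall>j<d 0. \<forall>x. 0 \<le> u j x \<and> u j x \<le> (1 - 0) / (2 * F)" using u e F by (simp add: divide_right_mono)
    have uz: "\<forall>j<d 0. \<forall>x. \<bar>0 + 2 * F * u j x - \<xi> x j\<bar> \<le> 0" using u F by (simp add: \<xi>_def)
    have \<xi>': "\<forall>x. \<xi> x \<in> cube (d 0) 0 1" using \<xi> by blast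
    from L[THEN spec, THEN spec, THEN spec, THEN spec, THEN spec, THEN spec, THEN spec, THEN spec, THEN spec, THEN spec, THEN spec, THEN spec, THEN mp, THEN mp, THEN mp, THEN mp, THEN mp, THEN mp, THEN mp, THEN mp, THEN mp, THEN mp, THEN mp, THEN mp, THEN mp, THEN mp, THEN mp,
      OF W0 K F01 ab1 ab g0 u01 \<xi>' order_refl uz]
    obtain v where v: "circuit (u ` {..<d 0}) k (real (d 1) * (C * real (W 0) ^ (2 * t 0))) (v ` {..<d 1})"
      "\<forall>j<d 1. \<forall>x. 0 \<le> v j x \<and> v j x \<le> (b 1 - a 1) / (2 * F) \<and>
        \<bar>a 1 + 2 * F * v j x - g 0 (\<xi> x) j\<bar> \<le> C * real (W 0) powr (- 2 * \<beta> 0) + C * 0 powr (min (\<beta> 0) 1)"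
      by (elim exE conjE)
    have W1: "1 \<le> real (W 0) ^ (2 * t 0)" using W0 by simp
    have "circuit (e ` {..<d 0}) (1 + k) (3 * real (d 0) + real (d 1) * (C * real (W 0) ^ (2 * t 0))) (v ` {..<d 1})"
      by (rule circuit_trans[OF c1 v(1)])
    then have "circuit (e ` {..<d 0}) (1 + k) (C' * (\<Sum>l\<le>0. real (W l) ^ (2 * t l))) (v ` {..<d (0 + 1)})"
    proof (rule circuit_weaken)
      have "3 * real (d 0) * 1 \<le> 3 * real (d 0) * real (W 0) ^ (2 * t 0)" using W1 by (intro mult_left_mono) auto
      moreover have "0 \<le> C * real (W 0) ^ (2 * t 0)" using C by simp
      ultimately show "3 * real (d 0) + real (d 1) * (C * real (W 0) ^ (2 * t 0)) \<le> C' * (\<Sum>l\<le>0. real (W l) ^ (2 * t l))"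
        by (simp add: C'_def algebra_simps)
    qed auto
    moreover have "C * real (W 0) powr (- 2 * \<beta> 0) \<le> C' * real (W 0) powr (- 2 * \<beta> 0)"
      using C' by (intro mult_right_mono) auto
    ultimately show "\<exists>v. circuit (e ` {..<d 0}) (1 + k) (C' * (\<Sum>l\<le>0. real (W l) ^ (2 * t l))) (v ` {..<d (0 + 1)}) \<and>
      (\<forall>j<d (0 + 1). \<forall>x. 0 \<le> v j x \<and> v j x \<le> (b (0 + 1) - a (0 + 1)) / (2 * F) \<and>
        \<bar>a (0 + 1) + 2 * F * v j x - compose_upto g 0 (\<lambda>j\<in>{..<d 0}. e j x) j\<bar>
          \<le> C' * (\<Sum>l\<le>0. real (W l) powr (- 2 * \<beta> l * (\<Prod>m\<in>{l + 1..0}. min (\<beta> m) 1))))"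
      using v(2) by (intro exI[of _ v]) (fastforce simp: \<xi>_def intro: order_trans)
  qed
next
  case (Suc i)
  have tS: "1 \<le> t (Suc i)" and \<beta>S: "0 < \<beta> (Suc i)" using t \<beta> Suc.prems by auto
  from circuit_layer[OF tS \<beta>S F, where ?'a = 'a] obtain k2 C2 where C2: "1 \<le> C2" and
    L: "\<forall>W D D' (u :: nat \<Rightarrow> 'a \<Rightarrow> real) G a b a' b' K z \<delta>. 1 \<le> W \<longrightarrow> 0 \<le> K \<longrightarrow> K \<le> F \<longrightarrow>
    a \<le> b \<longrightarrow> \<bar>a\<bar> \<le> F \<longrightarrow> \<bar>b\<bar> \<le> F \<longrightarrow> a' \<le> b' \<longrightarrow> \<bar>a'\<bar> \<le> F \<longrightarrow> \<bar>b'\<bar> \<le> F \<longrightarrow> G \<in> cube D a b \<rightarrow> cube D' a' b' \<longrightarrow>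
    (\<forall>j<D'. \<exists>\<iota> h. inj_on \<iota> {..<t (Suc i)} \<and> \<iota> ` {..<t (Suc i)} \<subseteq> {..<D} \<and> h \<in> holder_ball (t (Suc i)) (\<beta> (Suc i)) a b K \<and>
      (\<forall>x\<in>cube D a b. G x j = h (\<lambda>k\<in>{..<t (Suc i)}. x (\<iota> k)))) \<longrightarrow>
    (\<forall>j<D. \<forall>x. 0 \<le> u j x \<and> u j x \<le> (b - a) / (2 * F)) \<longrightarrow> (\<forall>x. z x \<in> cube D a b) \<longrightarrow> 0 \<le> \<delta> \<longrightarrow>
    (\<forall>j<D. \<forall>x. \<bar>a + 2 * F * u j x - z x j\<bar> \<le> \<delta>) \<longrightarrow>
    (\<exists>v. circuit (u ` {..<D}) k2 (real D' * (C2 * real W ^ (2 * t (Suc i)))) (v ` {..<D'}) \<and>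
      (\<forall>j<D'. \<forall>x. 0 \<le> v j x \<and> v j x \<le> (b' - a') / (2 * F) \<and>
        \<bar>a' + 2 * F * v j x - G (z x) j\<bar> \<le> C2 * real W powr (- 2 * \<beta> (Suc i)) + C2 * \<delta> powr (min (\<beta> (Suc i)) 1)))"
    by (elim exE conjE)
  from Suc.IH[OF Suc_leD[OF Suc.prems]] obtain k1 C1 where C1: "1 \<le> C1" and
    I: "\<forall>W (e :: nat \<Rightarrow> 'a \<Rightarrow> real) K a b g. (\<forall>l\<le>q. 1 \<le> W l) \<longrightarrow> 0 \<le> K \<longrightarrow> K \<le> F \<longrightarrow>
    decomposition q d t \<beta> K a b g \<longrightarrow> (\<forall>j<d 0. \<forall>x. 0 \<le> e j x \<and> e j x \<le> 1) \<longrightarrow>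
    (\<exists>v. circuit (e ` {..<d 0}) k1 (C1 * (\<Sum>l\<le>i. real (W l) ^ (2 * t l))) (v ` {..<d (i + 1)}) \<and>
      (\<forall>j<d (i + 1). \<forall>x. 0 \<le> v j x \<and> v j x \<le> (b (i + 1) - a (i + 1)) / (2 * F) \<and>
        \<bar>a (i + 1) + 2 * F * v j x - compose_upto g i (\<lambda>j\<in>{..<d 0}. e j x) j\<bar>
          \<le> C1 * (\<Sum>l\<le>i. real (W l) powr (- 2 * \<beta> l * (\<Prod>m\<in>{l + 1..i}. min (\<beta> m) 1)))))"
    by (elim exE conjE)
  define \<mu> where "\<mu> = min (\<beta> (Suc i)) 1"
  have \<mu>: "0 < \<mu>" "\<mu> \<le> 1" using \<beta>S by (auto simp: \<mu>_def)
  let ?D' = "real (d (Suc i + 1))"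
  define C where "C = C1 + ?D' * C2 + C2 * C1"
  have "0 \<le> ?D' * C2" "C2 * 1 \<le> C2 * C1" "0 \<le> C2 * C1" using C1 C2 by (auto intro: mult_left_mono simp del: mult_1_right)
  then have C: "1 \<le> C" "C1 \<le> C" "?D' * C2 \<le> C" "C2 \<le> C" "C2 * C1 \<le> C" using C1 C2 unfolding C_def by linarith+
  show ?case
  proof (intro exI[of _ "k1 + k2"] exI[of _ C] conjI C(1) allI impI)
    fix W :: "nat \<Rightarrow> nat" and e :: "nat \<Rightarrow> 'a \<Rightarrow> real" and K a b g
    assume W: "\<forall>l\<le>q. 1 \<le> W l" and K: "0 \<le> K" "K \<le> F" and dec: "decomposition q d t \<beta> K a b g"
      and e: "\<forall>j<d 0. \<forall>x. 0 \<le> e j x \<and> e j x \<le> 1"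
    define \<xi> where "\<xi> x = (\<lambda>j\<in>{..<d 0}. e j x)" for x
    have \<xi>: "\<xi> x \<in> cube (d 0) 0 1" for x using e by (auto simp: \<xi>_def cube_def)
    let ?E = "\<lambda>i l. real (W l) powr (- 2 * \<beta> l * (\<Prod>m\<in>{l + 1..i}. min (\<beta> m) 1))"
    from I[THEN spec, THEN spec, THEN spec, THEN spec, THEN spec, THEN spec, THEN mp, THEN mp, THEN mp, THEN mp, THEN mp, OF W K dec e]
    obtain u where u: "circuit (e ` {..<d 0}) k1 (C1 * (\<Sum>l\<le>i. real (W l) ^ (2 * t l))) (u ` {..<d (i + 1)})"
      "\<forall>j<d (i + 1). \<forall>x. 0 \<le> u j x \<and> u j x \<le> (b (i + 1) - a (i + 1)) / (2 * F) \<and>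
        \<bar>a (i + 1) + 2 * F * u j x - compose_upto g i (\<xi> x) j\<bar> \<le> C1 * (\<Sum>l\<le>i. ?E i l)"
      unfolding \<xi>_def by blast
    define \<delta> where "\<delta> = C1 * (\<Sum>l\<le>i. ?E i l)"
    have \<delta>: "0 \<le> \<delta>" using C1 by (auto simp: \<delta>_def intro!: mult_nonneg_nonneg sum_nonneg)
    have dpos: "0 < d (i + 1)" "0 < d (Suc i + 1)"
    proof -
      have "1 \<le> t (i + 1) \<and> t (i + 1) \<le> d (i + 1)" using t Suc.prems by simp
      then show "0 < d (i + 1)" by linarith
      show "0 < d (Suc i + 1)"
      proof (cases "Suc i = q")
        case False
        then have "1 \<le> t (Suc i + 1) \<and> t (Suc i + 1) \<le> d (Suc i + 1)" using t Suc.prems by simp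
        then show ?thesis by linarith
      qed (use dq in simp)
    qed
    have z: "\<forall>x. compose_upto g i (\<xi> x) \<in> cube (d (i + 1)) (a (i + 1)) (b (i + 1))"
      using compose_upto_cube[OF dec _ \<xi>] Suc.prems by simp
    have z2: "\<forall>x. compose_upto g (Suc i) (\<xi> x) \<in> cube (d (Suc i + 1)) (a (Suc i + 1)) (b (Suc i + 1))"
      using compose_upto_cube[OF dec _ \<xi>] Suc.prems by blast
    have zi: "a (i + 1) \<le> compose_upto g i (\<xi> x) 0 \<and> compose_upto g i (\<xi> x) 0 \<le> b (i + 1)" for x
      using cube_nth[OF spec[OF z] dpos(1)] .
    have zi2: "a (Suc i + 1) \<le> compose_upto g (Suc i) (\<xi> x) 0 \<and> compose_upto g (Suc i) (\<xi> x) 0 \<le> b (Suc i + 1)" for x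
      using cube_nth[OF spec[OF z2] dpos(2)] .
    have ab: "a (i + 1) \<le> b (i + 1)" "\<bar>a (i + 1)\<bar> \<le> F" "\<bar>b (i + 1)\<bar> \<le> F"
      "a (Suc i + 1) \<le> b (Suc i + 1)" "\<bar>a (Suc i + 1)\<bar> \<le> F" "\<bar>b (Suc i + 1)\<bar> \<le> F"
      using decomposition_bounds[OF dec _ K(2), of "i + 1"] decomposition_bounds[OF dec _ K(2), of "Suc i + 1"] Suc.prems
        order_trans[OF conjunct1[OF zi] conjunct2[OF zi]] order_trans[OF conjunct1[OF zi2] conjunct2[OF zi2]]
      by simp_all
    have gS: "g (Suc i) \<in> cube (d (i + 1)) (a (i + 1)) (b (i + 1)) \<rightarrow> cube (d (Suc i + 1)) (a (Suc i + 1)) (b (Suc i + 1))"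
      "\<forall>j<d (Suc i + 1). \<exists>\<iota> h. inj_on \<iota> {..<t (Suc i)} \<and> \<iota> ` {..<t (Suc i)} \<subseteq> {..<d (i + 1)} \<and>
        h \<in> holder_ball (t (Suc i)) (\<beta> (Suc i)) (a (i + 1)) (b (i + 1)) K \<and>
        (\<forall>x\<in>cube (d (i + 1)) (a (i + 1)) (b (i + 1)). g (Suc i) x j = h (\<lambda>k\<in>{..<t (Suc i)}. x (\<iota> k)))"
      using decomposition_level[OF dec Suc.prems] by simp_all
    have u01: "\<forall>j<d (i + 1). \<forall>x. 0 \<le> u j x \<and> u j x \<le> (b (i + 1) - a (i + 1)) / (2 * F)"
      and uz: "\<forall>j<d (i + 1). \<forall>x. \<bar>a (i + 1) + 2 * F * u j x - compose_upto g i (\<xi> x) j\<bar> \<le> \<delta>"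
      using u(2) unfolding \<delta>_def by simp_all
    have WS: "1 \<le> W (Suc i)" using W Suc.prems by simp
    from L[THEN spec, THEN spec, THEN spec, THEN spec, THEN spec, THEN spec, THEN spec, THEN spec, THEN spec, THEN spec, THEN spec, THEN spec, THEN mp, THEN mp, THEN mp, THEN mp, THEN mp, THEN mp, THEN mp, THEN mp, THEN mp, THEN mp, THEN mp, THEN mp, THEN mp, THEN mp, THEN mp,
      OF WS K ab gS u01 z \<delta> uz]
    obtain v where v: "circuit (u ` {..<d (i + 1)}) k2 (?D' * (C2 * real (W (Suc i)) ^ (2 * t (Suc i)))) (v ` {..<d (Suc i + 1)})"
      "\<forall>j<d (Suc i + 1). \<forall>x. 0 \<le> v j x \<and> v j x \<le> (b (Suc i + 1) - a (Suc i + 1)) / (2 * F) \<and>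
        \<bar>a (Suc i + 1) + 2 * F * v j x - g (Suc i) (compose_upto g i (\<xi> x)) j\<bar> \<le> C2 * real (W (Suc i)) powr (- 2 * \<beta> (Suc i)) + C2 * \<delta> powr \<mu>"
      unfolding \<mu>_def by (elim exE conjE)
    have "circuit (e ` {..<d 0}) (k1 + k2) (C1 * (\<Sum>l\<le>i. real (W l) ^ (2 * t l)) + ?D' * (C2 * real (W (Suc i)) ^ (2 * t (Suc i)))) (v ` {..<d (Suc i + 1)})"
      by (rule circuit_trans[OF u(1) v(1)])
    then have c: "circuit (e ` {..<d 0}) (k1 + k2) (C * (\<Sum>l\<le>Suc i. real (W l) ^ (2 * t l))) (v ` {..<d (Suc i + 1)})"
    proof (rule circuit_weaken)
      have "C1 * (\<Sum>l\<le>i. real (W l) ^ (2 * t l)) \<le> C * (\<Sum>l\<le>i. real (W l) ^ (2 * t l))"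
        using C by (intro mult_right_mono sum_nonneg) auto
      moreover have "?D' * C2 * real (W (Suc i)) ^ (2 * t (Suc i)) \<le> C * real (W (Suc i)) ^ (2 * t (Suc i))"
        using C by (intro mult_right_mono) auto
      ultimately show "C1 * (\<Sum>l\<le>i. real (W l) ^ (2 * t l)) + ?D' * (C2 * real (W (Suc i)) ^ (2 * t (Suc i))) \<le> C * (\<Sum>l\<le>Suc i. real (W l) ^ (2 * t l))"
        by (simp add: distrib_left mult.assoc)
    qed auto
    \<comment> \<open>\<open>C1 powr \<mu> \<le> C1\<close> because \<open>1 \<le> C1\<close>, and
      multiplying each exponent by \<mu> appends the factor of level \<open>Suc i\<close> to its
      product.\<close>
    have "\<delta> powr \<mu> \<le> C1 * (\<Sum>l\<le>i. ?E (Suc i) l)"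
    proof -
      have "\<delta> powr \<mu> = C1 powr \<mu> * (\<Sum>l\<le>i. ?E i l) powr \<mu>"
        unfolding \<delta>_def by (rule powr_mult)
      also have "\<dots> \<le> C1 * (\<Sum>l\<le>i. ?E i l powr \<mu>)"
      proof (rule mult_mono)
        show "C1 powr \<mu> \<le> C1" using C1 \<mu> powr_mono[of \<mu> 1 C1] by simp
        show "(\<Sum>l\<le>i. ?E i l) powr \<mu> \<le> (\<Sum>l\<le>i. ?E i l powr \<mu>)" using \<mu> by (intro powr_sum_le) auto
      qed (use C1 in auto)
      also have "(\<Sum>l\<le>i. ?E i l powr \<mu>) = (\<Sum>l\<le>i. ?E (Suc i) l)"
      proof (intro sum.cong refl)
        fix l assume "l \<in> {..i}"
        then have "{l + 1..Suc i} = insert (Suc i) {l + 1..i}" by auto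
        then show "?E i l powr \<mu> = ?E (Suc i) l" by (simp add: powr_powr \<mu>_def mult_ac)
      qed
      finally show ?thesis .
    qed
    then have "C2 * \<delta> powr \<mu> \<le> C2 * (C1 * (\<Sum>l\<le>i. ?E (Suc i) l))" using C2 by (intro mult_left_mono) auto
    also have "\<dots> \<le> C * (\<Sum>l\<le>i. ?E (Suc i) l)"
      unfolding mult.assoc[symmetric] using C by (intro mult_right_mono sum_nonneg) auto
    finally have e1: "C2 * \<delta> powr \<mu> \<le> C * (\<Sum>l\<le>i. ?E (Suc i) l)" .
    have e2: "C2 * real (W (Suc i)) powr (- 2 * \<beta> (Suc i)) \<le> C * ?E (Suc i) (Suc i)" using C by (simp add: mult_right_mono)
    have e3: "C * (\<Sum>l\<le>Suc i. ?E (Suc i) l) = C * (\<Sum>l\<le>i. ?E (Suc i) l) + C * ?E (Suc i) (Suc i)"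
      by (simp add: distrib_left)
    show "\<exists>v. circuit (e ` {..<d 0}) (k1 + k2) (C * (\<Sum>l\<le>Suc i. real (W l) ^ (2 * t l))) (v ` {..<d (Suc i + 1)}) \<and>
      (\<forall>j<d (Suc i + 1). \<forall>x. 0 \<le> v j x \<and> v j x \<le> (b (Suc i + 1) - a (Suc i + 1)) / (2 * F) \<and>
        \<bar>a (Suc i + 1) + 2 * F * v j x - compose_upto g (Suc i) (\<lambda>j\<in>{..<d 0}. e j x) j\<bar> \<le> C * (\<Sum>l\<le>Suc i. ?E (Suc i) l))"
    proof (intro exI[of _ v] conjI allI impI c)
      fix j x assume j: "j < d (Suc i + 1)"
      show "0 \<le> v j x" "v j x \<le> (b (Suc i + 1) - a (Suc i + 1)) / (2 * F)" using v(2) j by auto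
      have ce: "compose_upto g (Suc i) (\<lambda>j\<in>{..<d 0}. e j x) = g (Suc i) (compose_upto g i (\<xi> x))" by (simp add: \<xi>_def)
      show "\<bar>a (Suc i + 1) + 2 * F * v j x - compose_upto g (Suc i) (\<lambda>j\<in>{..<d 0}. e j x) j\<bar> \<le> C * (\<Sum>l\<le>Suc i. ?E (Suc i) l)"
        unfolding e3 ce using v(2)[rule_format, OF j, of x] e1 e2 by linarith
    qed
  qed
qed

text \<open>The output is split into positive and negative part, as every circuit function is nonnegative.\<close>

lemma circuit_composition_class:
  fixes q :: nat and d t :: "nat \<Rightarrow> nat" and \<beta> :: "nat \<Rightarrow> real" and F :: real
  assumes dq: "d (q + 1) = 1" and t: "\<forall>i\<le>q. 1 \<le> t i \<and> t i \<le> d i" and \<beta>: "\<forall>i\<le>q. 0 < \<beta> i" and F: "1 \<le> F"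
  shows "\<exists>k C. 1 \<le> C \<and> (\<forall>W (e :: nat \<Rightarrow> 'a \<Rightarrow> real) K f. (\<forall>l\<le>q. 1 \<le> W l) \<longrightarrow> 0 \<le> K \<longrightarrow> K \<le> F \<longrightarrow>
    f \<in> composition_class q d t \<beta> K \<longrightarrow> (\<forall>j<d 0. \<forall>x. 0 \<le> e j x \<and> e j x \<le> 1) \<longrightarrow>
    (\<exists>v w. circuit (e ` {..<d 0}) k (C * (\<Sum>l\<le>q. real (W l) ^ (2 * t l))) {v, w} \<and>
      (\<forall>x. \<bar>v x - w x\<bar> \<le> F \<and> \<bar>v x - w x - f (\<lambda>j\<in>{..<d 0}. e j x)\<bar>
          \<le> C * (\<Sum>l\<le>q. real (W l) powr (- 2 * beta_star q \<beta> l)))))"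
proof -
  from circuit_decomposition[OF dq t \<beta> F order_refl, where ?'a = 'a] obtain k C1 where C1: "1 \<le> C1" and
    I: "\<forall>W (e :: nat \<Rightarrow> 'a \<Rightarrow> real) K a b g. (\<forall>l\<le>q. 1 \<le> W l) \<longrightarrow> 0 \<le> K \<longrightarrow> K \<le> F \<longrightarrow>
    decomposition q d t \<beta> K a b g \<longrightarrow> (\<forall>j<d 0. \<forall>x. 0 \<le> e j x \<and> e j x \<le> 1) \<longrightarrow>
    (\<exists>v. circuit (e ` {..<d 0}) k (C1 * (\<Sum>l\<le>q. real (W l) ^ (2 * t l))) (v ` {..<d (q + 1)}) \<and>
      (\<forall>j<d (q + 1). \<forall>x. 0 \<le> v j x \<and> v j x \<le> (b (q + 1) - a (q + 1)) / (2 * F) \<and>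
        \<bar>a (q + 1) + 2 * F * v j x - compose_upto g q (\<lambda>j\<in>{..<d 0}. e j x) j\<bar>
          \<le> C1 * (\<Sum>l\<le>q. real (W l) powr (- 2 * \<beta> l * (\<Prod>m\<in>{l + 1..q}. min (\<beta> m) 1)))))"
    by (elim exE conjE)
  define C where "C = C1 + 2 * (2 + 3 * F)"
  have C: "1 \<le> C" "C1 \<le> C" using C1 F by (auto simp: C_def)
  show ?thesis
  proof (intro exI[of _ "k + 1"] exI[of _ C] conjI C(1) allI impI)
    fix W :: "nat \<Rightarrow> nat" and e :: "nat \<Rightarrow> 'a \<Rightarrow> real" and K f
    assume W: "\<forall>l\<le>q. 1 \<le> W l" and K: "0 \<le> K" "K \<le> F" and f: "f \<in> composition_class q d t \<beta> K"
      and e: "\<forall>j<d 0. \<forall>x. 0 \<le> e j x \<and> e j x \<le> 1"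
    define \<xi> where "\<xi> x = (\<lambda>j\<in>{..<d 0}. e j x)" for x
    have \<xi>: "\<xi> x \<in> cube (d 0) 0 1" for x using e by (auto simp: \<xi>_def cube_def)
    from f obtain a b g where dec: "decomposition q d t \<beta> K a b g" and fg: "\<forall>x\<in>cube (d 0) 0 1. f x = compose_upto g q x 0"
      unfolding composition_class_def mem_Collect_eq by (elim exE conjE) (auto simp: decomposition_def)
    from I[THEN spec, THEN spec, THEN spec, THEN spec, THEN spec, THEN spec, THEN mp, THEN mp, THEN mp, THEN mp, THEN mp, OF W K dec e]
    obtain u where u: "circuit (e ` {..<d 0}) k (C1 * (\<Sum>l\<le>q. real (W l) ^ (2 * t l))) (u ` {..<d (q + 1)})"
      "\<forall>j<d (q + 1). \<forall>x. 0 \<le> u j x \<and> u j x \<le> (b (q + 1) - a (q + 1)) / (2 * F) \<and>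
        \<bar>a (q + 1) + 2 * F * u j x - compose_upto g q (\<xi> x) j\<bar> \<le> C1 * (\<Sum>l\<le>q. real (W l) powr (- 2 * beta_star q \<beta> l))"
      unfolding \<xi>_def beta_star_def mult.assoc by blast
    let ?a = "a (q + 1)" and ?b = "b (q + 1)"
    have ab: "\<bar>?a\<bar> \<le> F" "\<bar>?b\<bar> \<le> F" using decomposition_bounds[OF dec _ K(2), of "q + 1"] by auto
    define out where "out x = ?a + 2 * F * u 0 x" for x
    define v where "v = (\<lambda>x. max 0 ((\<Sum>i\<in>{()}. 2 * F * u 0 x) - - ?a))"
    define w where "w = (\<lambda>x. max 0 ((\<Sum>i\<in>{()}. - (2 * F) * u 0 x) - ?a))"
    have vw: "v x - w x = out x" for x by (auto simp: v_def w_def out_def max_def)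
    have "circuit (u ` {..<d (q + 1)}) 1 (2 + 3 * F) {v}" unfolding v_def
      by (rule circuit_lincomb) (use ab F dq in auto)
    moreover have "circuit (u ` {..<d (q + 1)}) 1 (2 + 3 * F) {w}" unfolding w_def
      by (rule circuit_lincomb) (use ab F dq in auto)
    ultimately have "circuit (u ` {..<d (q + 1)}) 1 (2 + 3 * F + (2 + 3 * F)) ({v} \<union> {w})" by (rule circuit_Un)
    from circuit_trans[OF u(1) this]
    have "circuit (e ` {..<d 0}) (k + 1) (C * (\<Sum>l\<le>q. real (W l) ^ (2 * t l))) {v, w}"
    proof (rule circuit_weaken)
      have "1 \<le> real (W 0) ^ (2 * t 0)" using W by simp
      also have "\<dots> \<le> (\<Sum>l\<le>q. real (W l) ^ (2 * t l))" by (rule member_le_sum) auto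
      finally have "2 * (2 + 3 * F) * 1 \<le> 2 * (2 + 3 * F) * (\<Sum>l\<le>q. real (W l) ^ (2 * t l))"
        using F by (intro mult_left_mono) auto
      then show "C1 * (\<Sum>l\<le>q. real (W l) ^ (2 * t l)) + (2 + 3 * F + (2 + 3 * F)) \<le> C * (\<Sum>l\<le>q. real (W l) ^ (2 * t l))"
        unfolding C_def distrib_right by simp
    qed auto
    \<comment> \<open>The output stays between the last two end points, which lie in [-F, F], so the
      bound of the network class holds automatically.\<close>
    moreover have "\<bar>v x - w x\<bar> \<le> F" for x
    proof -
      have "0 \<le> 2 * F * u 0 x \<and> 2 * F * u 0 x \<le> ?b - ?a" using u(2)[rule_format, of 0 x] dq F by (auto simp: field_simps)
      then show ?thesis unfolding vw out_def using ab by (auto simp: abs_le_iff)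
    qed
    moreover have "\<bar>v x - w x - f (\<lambda>j\<in>{..<d 0}. e j x)\<bar> \<le> C * (\<Sum>l\<le>q. real (W l) powr (- 2 * beta_star q \<beta> l))" for x
    proof -
      have "\<bar>out x - f (\<xi> x)\<bar> \<le> C1 * (\<Sum>l\<le>q. real (W l) powr (- 2 * beta_star q \<beta> l))"
        unfolding out_def using u(2)[rule_format, of 0 x] dq fg \<xi>[of x] by simp
      also have "\<dots> \<le> C * (\<Sum>l\<le>q. real (W l) powr (- 2 * beta_star q \<beta> l))" using C by (intro mult_right_mono sum_nonneg) auto
      finally show ?thesis unfolding vw \<xi>_def .
    qed
    ultimately show "\<exists>v w. circuit (e ` {..<d 0}) (k + 1) (C * (\<Sum>l\<le>q. real (W l) ^ (2 * t l))) {v, w} \<and>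
      (\<forall>x. \<bar>v x - w x\<bar> \<le> F \<and> \<bar>v x - w x - f (\<lambda>j\<in>{..<d 0}. e j x)\<bar>
          \<le> C * (\<Sum>l\<le>q. real (W l) powr (- 2 * beta_star q \<beta> l)))" by blast
  qed
qed

section \<open>Circuits as sparse networks\<close>

text \<open>Values after the ReLU of hidden layer \<open>k\<close>, with the input as layer 0. The
  recursion of \<open>network\<close> runs through the values before the ReLU instead.\<close>

primrec activation ::
  "(nat \<Rightarrow> nat) \<Rightarrow> (nat \<Rightarrow> nat \<Rightarrow> nat \<Rightarrow> real) \<Rightarrow> (nat \<Rightarrow> nat \<Rightarrow> real) \<Rightarrow> nat
    \<Rightarrow> (nat \<Rightarrow> real) \<Rightarrow> nat \<Rightarrow> real" where
  "activation p W v 0 x = x"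
| "activation p W v (Suc k) x = shifted_relu (p (Suc k)) (v (Suc k)) (network p W v k x)"

lemma network_activation: "network p W v k x = mat_vec (p (k + 1)) (p k) (W k) (activation p W v k x)"
  by (cases k) auto

lemma activation_Suc:
  "i < p (Suc k) \<Longrightarrow> activation p W v (Suc k) x i = max ((\<Sum>j<p k. W k i j * activation p W v k x j) - v (Suc k) i) 0"
  by (simp add: network_activation shifted_relu_def mat_vec_def)

declare activation.simps(2) [simp del]

lemma activation_cong:
  assumes "\<And>j. j < k \<Longrightarrow> W j = W' j" "\<And>j. j \<le> k \<Longrightarrow> v j = v' j"
  shows "activation p W v k x = activation p W' v' k x"
  using assms
proof (induction k)
  case (Suc k)
  then show ?case by (simp add: activation.simps network_activation)
qed simp

text \<open>Parameters up to hidden layer \<open>k\<close> whose activations with index below \<open>m\<close> are \<open>\<phi>\<close>; the remaining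
  activations are not constrained, as later layers give them weight 0.\<close>

definition realizes :: "(nat \<Rightarrow> nat) \<Rightarrow> nat \<Rightarrow> nat \<Rightarrow> real \<Rightarrow> (nat \<Rightarrow> (nat \<Rightarrow> real) \<Rightarrow> real) \<Rightarrow> bool" where
  "realizes p k m s \<phi> \<longleftrightarrow> m \<le> p k \<and> (\<exists>W v. v 0 = (\<lambda>_. 0) \<and>
     (\<forall>j<k. \<forall>i<p (j + 1). \<forall>l<p j. \<bar>W j i l\<bar> \<le> 1) \<and> (\<forall>j\<le>k. \<forall>i<p j. \<bar>v j i\<bar> \<le> 1) \<and>
     real (\<Sum>j<k. mat_nnz (p (j + 1)) (p j) (W j) + vec_nnz (p (j + 1)) (v (j + 1))) \<le> s \<and>
     (\<forall>x\<in>cube (p 0) 0 1. \<forall>i<m. activation p W v k x i = \<phi> i x))"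

lemma realizes_0:
  assumes "\<And>x i. x \<in> cube (p 0) 0 1 \<Longrightarrow> i < p 0 \<Longrightarrow> \<phi> i x = x i"
  shows "realizes p 0 (p 0) 0 \<phi>"
  unfolding realizes_def using assms by (intro conjI exI[of _ "\<lambda>_ _ _. 0"] exI[of _ "\<lambda>_ _. 0"]) auto

text \<open>Rows from m' on and columns from m on are filled with 0, so the unconstrained
  activations neither influence the new layer nor count in the sparsity.\<close>

lemma realizes_Suc:
  assumes R: "realizes p k m s \<phi>" and m': "m' \<le> p (Suc k)"
    and A: "\<And>i j. i < m' \<Longrightarrow> j < m \<Longrightarrow> \<bar>A i j\<bar> \<le> 1" and b: "\<And>i. i < m' \<Longrightarrow> \<bar>b i\<bar> \<le> 1"
    and \<phi>': "\<And>x i. x \<in> cube (p 0) 0 1 \<Longrightarrow> i < m' \<Longrightarrow> \<phi>' i x = max 0 ((\<Sum>j<m. A i j * \<phi> j x) - b i)"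
    and c: "(\<Sum>i<m'. real (card {j. j < m \<and> A i j \<noteq> 0}) + (if b i = 0 then 0 else 1)) \<le> c"
  shows "realizes p (Suc k) m' (s + c) \<phi>'"
proof -
  obtain W v where mp: "m \<le> p k" and v0: "v 0 = (\<lambda>_. 0)" and W: "\<forall>j<k. \<forall>i<p (j + 1). \<forall>l<p j. \<bar>W j i l\<bar> \<le> 1"
    and v: "\<forall>j\<le>k. \<forall>i<p j. \<bar>v j i\<bar> \<le> 1"
    and s: "real (\<Sum>j<k. mat_nnz (p (j + 1)) (p j) (W j) + vec_nnz (p (j + 1)) (v (j + 1))) \<le> s"
    and act: "\<forall>x\<in>cube (p 0) 0 1. \<forall>i<m. activation p W v k x i = \<phi> i x"
    using R unfolding realizes_def by blast
  define W' where "W' = W(k := (\<lambda>i j. if i < m' \<and> j < m then A i j else 0))"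
  define v' where "v' = v(Suc k := (\<lambda>i. if i < m' then b i else 0))"
  have act': "activation p W' v' k x = activation p W v k x" for x
    by (rule activation_cong) (auto simp: W'_def v'_def)
  have "real (mat_nnz (p (Suc k)) (p k) (W' k)) = (\<Sum>i<m'. real (card {j. j < m \<and> A i j \<noteq> 0}))"
  proof -
    have "{(i, j). i < p (Suc k) \<and> j < p k \<and> W' k i j \<noteq> 0} = Sigma {..<m'} (\<lambda>i. {j. j < m \<and> A i j \<noteq> 0})"
      using m' mp by (auto simp: W'_def split: if_splits)
    then show ?thesis unfolding mat_nnz_def by (simp add: card_SigmaI)
  qed
  moreover have "real (vec_nnz (p (Suc k)) (v' (Suc k))) = (\<Sum>i<m'. if b i = 0 then 0 else 1)"
  proof -
    have "{i. i < p (Suc k) \<and> v' (Suc k) i \<noteq> 0} = {i\<in>{..<m'}. b i \<noteq> 0}"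
      using m' by (auto simp: v'_def split: if_splits)
    then show ?thesis unfolding vec_nnz_def by (simp add: sum.If_cases Int_def)
  qed
  ultimately have nn: "real (mat_nnz (p (Suc k)) (p k) (W' k)) + real (vec_nnz (p (Suc k)) (v' (Suc k))) \<le> c"
    using c by (simp add: sum.distrib)
  have "(\<Sum>j<k. mat_nnz (p (j + 1)) (p j) (W' j) + vec_nnz (p (j + 1)) (v' (j + 1))) =
     (\<Sum>j<k. mat_nnz (p (j + 1)) (p j) (W j) + vec_nnz (p (j + 1)) (v (j + 1)))"
    by (intro sum.cong) (auto simp: W'_def v'_def)
  then have nnz: "real (\<Sum>j<Suc k. mat_nnz (p (j + 1)) (p j) (W' j) + vec_nnz (p (j + 1)) (v' (j + 1))) \<le> s + c"
    using s nn by simp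
  have val: "activation p W' v' (Suc k) x i = \<phi>' i x" if x: "x \<in> cube (p 0) 0 1" and i: "i < m'" for x i
  proof -
    have "(\<Sum>j<p k. W' k i j * activation p W v k x j) = (\<Sum>j<m. A i j * \<phi> j x)"
    proof -
      have "(\<Sum>j<p k. W' k i j * activation p W v k x j) = (\<Sum>j<m. W' k i j * activation p W v k x j)"
        using mp by (intro sum.mono_neutral_right) (auto simp: W'_def)
      also have "\<dots> = (\<Sum>j<m. A i j * \<phi> j x)" using act x i by (intro sum.cong) (auto simp: W'_def)
      finally show ?thesis .
    qed
    moreover have "v' (Suc k) i = b i" using i by (simp add: v'_def)
    ultimately show ?thesis using i m' \<phi>'[OF x i] by (simp add: activation_Suc act' max.commute)
  qed
  show ?thesis unfolding realizes_def
  proof (intro conjI exI[of _ W'] exI[of _ v'] allI impI ballI m')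
    show "v' 0 = (\<lambda>_. 0)" using v0 by (simp add: v'_def)
    show "\<bar>W' j i l\<bar> \<le> 1" if "j < Suc k" "i < p (j + 1)" "l < p j" for j i l
      using W A that by (auto simp: W'_def less_Suc_eq)
    show "\<bar>v' j i\<bar> \<le> 1" if "j \<le> Suc k" "i < p j" for j i
      using v b that by (auto simp: v'_def le_Suc_eq)
  qed (use nnz val in auto)
qed

text \<open>Number of copies over which a weight r is spread, each share having absolute value at
  most 1; no copy is made for r = 0.\<close>

definition nat_abs :: "real \<Rightarrow> nat" where "nat_abs r = nat \<lceil>\<bar>r\<bar>\<rceil>"

lemma nat_abs_le: "real (nat_abs r) \<le> 1 + \<bar>r\<bar>"
  unfolding nat_abs_def by linarith

lemma nat_abs_split: "(\<Sum>k<nat_abs r. r / real (nat_abs r) * y) = r * y"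
proof (cases "r = 0")
  case False
  then have "0 < nat_abs r" by (simp add: nat_abs_def)
  then show ?thesis by simp
qed (simp add: nat_abs_def)

lemma abs_div_nat_abs: "\<bar>r / real (nat_abs r)\<bar> \<le> 1"
proof (cases "r = 0")
  case False
  then have "0 < nat_abs r" by (simp add: nat_abs_def)
  moreover have "\<bar>r\<bar> \<le> real (nat_abs r)" unfolding nat_abs_def by linarith
  ultimately show ?thesis by (simp add: abs_divide)
qed simp

lemma finite_set_enum: "finite C \<Longrightarrow> \<exists>e. bij_betw e {..<card C} C"
  using ex_bij_betw_nat_finite[of C] by (simp add: atLeast0LessThan)

text \<open>One circuit layer becomes two network layers: the first one makes \<open>\<lceil>\<bar>a\<bar>\<rceil>\<close> copies of every function
  used with weight \<open>a\<close> (and of the constant 1 for the bias), so that the second one has weights in \<open>[-1, 1]\<close>.\<close>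

lemma realizes_circuit_layer:
  assumes R: "realizes p k m s \<phi>" and G: "G \<subseteq> \<phi> ` {..<m}" "finite G" "\<forall>g\<in>G. \<forall>x. 0 \<le> g x"
    and N: "finite N" "\<And>h. h \<in> N \<Longrightarrow> relu_unit G h (c h)"
    and p: "real (card G) + (\<Sum>h\<in>N. c h) \<le> real (p (Suc k))" "real (card G) + (\<Sum>h\<in>N. c h) \<le> real (p (Suc (Suc k)))"
  shows "\<exists>m' \<phi>'. realizes p (Suc (Suc k)) m' (s + 3 * (real (card G) + (\<Sum>h\<in>N. c h))) \<phi>' \<and> G \<union> N \<subseteq> \<phi>' ` {..<m'}"
proof -
  let ?T = "real (card G) + (\<Sum>h\<in>N. c h)"
  have "\<forall>h\<in>N. \<exists>z. fst z \<subseteq> G \<and> finite (fst z) \<and>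
     h = (\<lambda>x. max 0 ((\<Sum>g\<in>fst z. fst (snd z) g * g x) - snd (snd z))) \<and>
     1 + (\<Sum>g\<in>fst z. 1 + \<bar>fst (snd z) g\<bar>) + \<bar>snd (snd z)\<bar> \<le> c h"
  proof
    fix h assume "h \<in> N"
    then obtain A a b where "A \<subseteq> G" "finite A" "h = (\<lambda>x. max 0 ((\<Sum>g\<in>A. a g * g x) - b))"
      "1 + (\<Sum>g\<in>A. 1 + \<bar>a g\<bar>) + \<bar>b\<bar> \<le> c h" using N(2) unfolding relu_unit_def by blast
    then show "\<exists>z. fst z \<subseteq> G \<and> finite (fst z) \<and>
     h = (\<lambda>x. max 0 ((\<Sum>g\<in>fst z. fst (snd z) g * g x) - snd (snd z))) \<and>
     1 + (\<Sum>g\<in>fst z. 1 + \<bar>fst (snd z) g\<bar>) + \<bar>snd (snd z)\<bar> \<le> c h"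
      by (intro exI[of _ "(A, a, b)"]) simp
  qed
  from bchoice[OF this] obtain z where z: "\<forall>h\<in>N. fst (z h) \<subseteq> G \<and> finite (fst (z h)) \<and>
     h = (\<lambda>x. max 0 ((\<Sum>g\<in>fst (z h). fst (snd (z h)) g * g x) - snd (snd (z h)))) \<and>
     1 + (\<Sum>g\<in>fst (z h). 1 + \<bar>fst (snd (z h)) g\<bar>) + \<bar>snd (snd (z h))\<bar> \<le> c h" by (elim exE)
  define A where "A h = fst (z h)" for h
  define a where "a h = fst (snd (z h))" for h
  define b where "b h = snd (snd (z h))" for h
  have u: "A h \<subseteq> G" "finite (A h)" "h = (\<lambda>x. max 0 ((\<Sum>g\<in>A h. a h g * g x) - b h))"
    "1 + (\<Sum>g\<in>A h. 1 + \<bar>a h g\<bar>) + \<bar>b h\<bar> \<le> c h" if "h \<in> N" for h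
    using bspec[OF z that] unfolding A_def a_def b_def by blast+
  have "\<forall>g\<in>G. \<exists>i<m. \<phi> i = g" using G(1) by auto
  then obtain ix where ix: "\<And>g. g \<in> G \<Longrightarrow> ix g < m" "\<And>g. g \<in> G \<Longrightarrow> \<phi> (ix g) = g" by metis
  \<comment> \<open>A node of the first new layer is a pair (source, copy number), with
    \<open>Some g\<close> for a function and \<open>None\<close> for the constant 1 that serves the
    bias. \<open>Ca h\<close> and \<open>Cb h\<close> hold the copies needed by h.\<close>
  define Ca :: "((nat \<Rightarrow> real) \<Rightarrow> real) \<Rightarrow> (((nat \<Rightarrow> real) \<Rightarrow> real) option \<times> nat) set" where
    "Ca h = Sigma (Some ` A h) (\<lambda>o'. {..<nat_abs (a h (the o'))})" for h
  define Cb :: "((nat \<Rightarrow> real) \<Rightarrow> real) \<Rightarrow> (((nat \<Rightarrow> real) \<Rightarrow> real) option \<times> nat) set" where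
    "Cb h = {None} \<times> {..<nat_abs (b h)}" for h
  \<comment> \<open>Copy 0 of every g in G is always present, so that old functions can be passed
    on.\<close>
  define P :: "(((nat \<Rightarrow> real) \<Rightarrow> real) option \<times> nat) set" where "P = Some ` G \<times> {0}"
  define C where "C = P \<union> (\<Union>h\<in>N. Ca h \<union> Cb h)"
  have finCa: "finite (Ca h)" "finite (Cb h)" if "h \<in> N" for h using u(2)[OF that] by (auto simp: Ca_def Cb_def)
  have fin: "finite P" "finite C" using G(2) N(1) finCa by (auto simp: C_def P_def)
  \<comment> \<open>The price in \<open>relu_unit\<close> is made for this: one plus the absolute
    weight bounds the number of copies for an input, and the leading 1 together with the absolute
    bias bounds those of the constant 1.\<close>
  have cardC: "real (card (Ca h \<union> Cb h)) \<le> c h" if h: "h \<in> N" for h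
  proof -
    have "real (card (Ca h)) = (\<Sum>g\<in>A h. real (nat_abs (a h g)))"
      unfolding Ca_def using u(2)[OF h] by (simp add: card_SigmaI sum.reindex)
    also have "\<dots> \<le> (\<Sum>g\<in>A h. 1 + \<bar>a h g\<bar>)" by (intro sum_mono nat_abs_le)
    finally have "real (card (Ca h)) \<le> (\<Sum>g\<in>A h. 1 + \<bar>a h g\<bar>)" .
    moreover have "real (card (Cb h)) \<le> 1 + \<bar>b h\<bar>" unfolding Cb_def using nat_abs_le[of "b h"] by (simp add: card_cartesian_product)
    moreover have "card (Ca h \<union> Cb h) \<le> card (Ca h) + card (Cb h)" by (rule card_Un_le)
    ultimately show ?thesis using u(4)[OF h] by linarith
  qed
  have cardT: "real (card C) \<le> ?T"
  proof -
    have "card C \<le> card P + (\<Sum>h\<in>N. card (Ca h \<union> Cb h))"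
      unfolding C_def using card_UN_le[OF N(1), of "\<lambda>h. Ca h \<union> Cb h"] card_Un_le[of P] by (meson add_left_mono le_trans)
    moreover have "card P = card G" unfolding P_def by (simp add: card_cartesian_product card_image)
    ultimately have "card C \<le> card G + (\<Sum>h\<in>N. card (Ca h \<union> Cb h))" by simp
    then have "real (card C) \<le> real (card G + (\<Sum>h\<in>N. card (Ca h \<union> Cb h)))" by (simp only: of_nat_le_iff)
    also have "\<dots> = real (card G) + (\<Sum>h\<in>N. real (card (Ca h \<union> Cb h)))" by simp
    also have "\<dots> \<le> ?T" by (intro add_left_mono sum_mono cardC)
    finally show ?thesis .
  qed
  have CG: "g \<in> G" if "(Some g, n) \<in> C" for g n
    using that u(1) by (auto simp: C_def P_def Ca_def Cb_def)
  obtain e where e: "bij_betw e {..<card C} C" using finite_set_enum[OF fin(2)] by blast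
  define val where "val z x = (case fst z of Some g \<Rightarrow> g x | None \<Rightarrow> 1)" for z :: "((nat \<Rightarrow> real) \<Rightarrow> real) option \<times> nat" and x
  \<comment> \<open>A copy of g reads g with weight 1. The constant 1 has no input and bias
    -1.\<close>
  define A1 where "A1 i j = (case fst (e i) of Some g \<Rightarrow> if j = ix g then 1 else 0 | None \<Rightarrow> (0::real))" for i j
  define b1 where "b1 i = (case fst (e i) of Some g \<Rightarrow> 0 | None \<Rightarrow> (- 1 :: real))" for i
  have eC: "e i \<in> C" if "i < card C" for i using e that by (auto simp: bij_betw_def)
  have R1: "realizes p (Suc k) (card C) (s + 2 * ?T) (\<lambda>i. val (e i))"
  proof (rule realizes_Suc[OF R, of _ A1 b1])
    show "card C \<le> p (Suc k)" using cardT p(1) by linarith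
    fix i assume i: "i < card C"
    show "\<bar>b1 i\<bar> \<le> 1" by (auto simp: b1_def split: option.splits)
    show "\<bar>A1 i j\<bar> \<le> 1" for j by (auto simp: A1_def split: option.splits)
    fix x assume x: "x \<in> cube (p 0) 0 1"
    show "val (e i) x = max 0 ((\<Sum>j<m. A1 i j * \<phi> j x) - b1 i)"
    proof (cases "fst (e i)")
      case None then show ?thesis by (simp add: val_def A1_def b1_def)
    next
      case (Some g)
      then have g: "g \<in> G" using eC[OF i] CG by (metis prod.collapse)
      have "(\<Sum>j<m. A1 i j * \<phi> j x) = (\<Sum>j<m. if j = ix g then \<phi> j x else 0)"
        by (intro sum.cong) (auto simp: A1_def Some)
      also have "\<dots> = g x" using ix[OF g] by (simp add: sum.delta)
      finally show ?thesis using bspec[OF G(3) g] Some by (simp add: val_def b1_def)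
    qed
  next
    \<comment> \<open>At most one weight and one bias per copy give \<open>2 * ?T\<close> here; the
      second layer adds another \<open>?T\<close>.\<close>
    have "(\<Sum>i<card C. real (card {j. j < m \<and> A1 i j \<noteq> 0}) + (if b1 i = 0 then 0 else 1)) \<le> (\<Sum>i<card C. 2)"
    proof (rule sum_mono)
      fix i
      have "card {j. j < m \<and> A1 i j \<noteq> 0} \<le> 1"
      proof (cases "fst (e i)")
        case (Some g)
        then have "{j. j < m \<and> A1 i j \<noteq> 0} \<subseteq> {ix g}" by (auto simp: A1_def)
        then show ?thesis using card_mono[of "{ix g}"] by fastforce
      qed (simp add: A1_def)
      then show "real (card {j. j < m \<and> A1 i j \<noteq> 0}) + (if b1 i = 0 then 0 else 1) \<le> 2" by simp
    qed
    also have "\<dots> \<le> 2 * ?T" using cardT by simp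
    finally show "(\<Sum>i<card C. real (card {j. j < m \<and> A1 i j \<noteq> 0}) + (if b1 i = 0 then 0 else 1)) \<le> 2 * ?T" .
  qed
  \<comment> \<open>Functions of G read their copy 0. A new unit spreads each weight, and minus its
    bias, evenly over the copies made for it.\<close>
  define w where "w h z = (if h \<in> G then (if z = (Some h, 0) then 1 else 0)
     else if z \<in> Ca h then a h (the (fst z)) / real (nat_abs (a h (the (fst z))))
     else if z \<in> Cb h then - (b h / real (nat_abs (b h))) else 0)" for h z
  have wC: "(\<Sum>z\<in>C. w h z * val z x) = (\<Sum>g\<in>A h. a h g * g x) - b h" if h: "h \<in> N" "h \<notin> G" for h x
  proof -
    have disj: "Ca h \<inter> Cb h = {}" by (auto simp: Ca_def Cb_def)
    have "(\<Sum>z\<in>C. w h z * val z x) = (\<Sum>z\<in>Ca h \<union> Cb h. w h z * val z x)"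
      using h fin by (intro sum.mono_neutral_right) (auto simp: C_def w_def)
    also have "\<dots> = (\<Sum>z\<in>Ca h. w h z * val z x) + (\<Sum>z\<in>Cb h. w h z * val z x)"
      using finCa[OF h(1)] disj by (intro sum.union_disjoint) auto
    also have "(\<Sum>z\<in>Cb h. w h z * val z x) = (\<Sum>z\<in>Cb h. - (b h / real (nat_abs (b h)) * 1))"
      using h disj by (intro sum.cong) (auto simp: w_def val_def Cb_def Ca_def)
    also have "\<dots> = - (\<Sum>n<nat_abs (b h). b h / real (nat_abs (b h)) * 1)"
      unfolding Cb_def by (simp add: sum_negf card_cartesian_product)
    also have "\<dots> = - b h" unfolding nat_abs_split by simp
    also have "(\<Sum>z\<in>Ca h. w h z * val z x) = (\<Sum>z\<in>Ca h. a h (the (fst z)) / real (nat_abs (a h (the (fst z)))) * (the (fst z) x))"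
      using h by (intro sum.cong) (auto simp: w_def val_def Ca_def)
    also have "\<dots> = (\<Sum>o'\<in>Some ` A h. \<Sum>n<nat_abs (a h (the o')). a h (the o') / real (nat_abs (a h (the o'))) * (the o' x))"
      unfolding Ca_def using u(2)[OF h(1)] by (subst sum.Sigma) (auto simp: case_prod_unfold)
    also have "\<dots> = (\<Sum>g\<in>A h. a h g * g x)"
      unfolding nat_abs_split by (simp add: sum.reindex)
    finally show ?thesis by simp
  qed
  define G' where "G' = G \<union> N"
  have finG': "finite G'" using G(2) N(1) by (simp add: G'_def)
  obtain e' where e': "bij_betw e' {..<card G'} G'" using finite_set_enum[OF finG'] by blast
  have e'G: "e' i \<in> G'" if "i < card G'" for i using e' that by (auto simp: bij_betw_def)
  have one: "1 \<le> c h" if "h \<in> N" for h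
    using u(4)[OF that] sum_nonneg[of "A h" "\<lambda>g. 1 + \<bar>a h g\<bar>"] by force
  have cardG': "real (card G') \<le> ?T"
  proof -
    have "card G' \<le> card G + card N" unfolding G'_def by (rule card_Un_le)
    moreover have "real (card N) \<le> (\<Sum>h\<in>N. c h)" using sum_mono[of N "\<lambda>_. 1" c] one by simp
    ultimately show ?thesis by linarith
  qed
  have row: "(\<Sum>j<card C. w h (e j) * val (e j) x) = (\<Sum>z\<in>C. w h z * val z x)" for h x
    using sum.reindex_bij_betw[OF e, of "\<lambda>z. w h z * val z x"] by simp
  have w1: "\<bar>w h z\<bar> \<le> 1" for h z
    unfolding w_def using abs_div_nat_abs by auto
  have nz: "real (card {j. j < card C \<and> w h (e j) \<noteq> 0}) \<le> (if h \<in> G then 1 else c h)" if "h \<in> G'" for h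
  proof -
    have inj: "inj_on e {j. j < card C \<and> w h (e j) \<noteq> 0}" using e by (auto simp: bij_betw_def inj_on_def)
    have "card {j. j < card C \<and> w h (e j) \<noteq> 0} = card (e ` {j. j < card C \<and> w h (e j) \<noteq> 0})"
      using card_image[OF inj] by simp
    also have "\<dots> \<le> card {z. w h z \<noteq> 0}"
    proof (rule card_mono)
      show "finite {z. w h z \<noteq> 0}"
      proof (cases "h \<in> G")
        case True then have "{z. w h z \<noteq> 0} \<subseteq> {(Some h, 0)}" by (auto simp: w_def)
        then show ?thesis by (rule finite_subset) simp
      next
        case False then have "{z. w h z \<noteq> 0} \<subseteq> Ca h \<union> Cb h" by (auto simp: w_def split: if_splits)
        then show ?thesis by (rule finite_subset) (use False that finCa in \<open>auto simp: G'_def\<close>)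
      qed
    qed auto
    also have "real \<dots> \<le> (if h \<in> G then 1 else c h)"
    proof (cases "h \<in> G")
      case True then have "{z. w h z \<noteq> 0} \<subseteq> {(Some h, 0)}" by (auto simp: w_def)
      then have "card {z. w h z \<noteq> 0} \<le> 1" using card_mono[of "{(Some h, 0)}" "{z. w h z \<noteq> 0}"] by simp
      then show ?thesis using True by simp
    next
      case False
      then have h: "h \<in> N" using that by (simp add: G'_def)
      have "{z. w h z \<noteq> 0} \<subseteq> Ca h \<union> Cb h" using False by (auto simp: w_def split: if_splits)
      then have "card {z. w h z \<noteq> 0} \<le> card (Ca h \<union> Cb h)" by (rule card_mono[rotated]) (use finCa[OF h] in auto)
      then show ?thesis using cardC[OF h] False by simp
    qed
    finally show ?thesis by simp
  qed
  have R2: "realizes p (Suc (Suc k)) (card G') (s + 2 * ?T + ?T) e'"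
  proof (rule realizes_Suc[OF R1, of _ "\<lambda>i j. w (e' i) (e j)" "\<lambda>_. 0"])
    show "card G' \<le> p (Suc (Suc k))" using cardG' p(2) by linarith
    fix i assume i: "i < card G'"
    fix x assume x: "x \<in> cube (p 0) 0 1"
    show "e' i x = max 0 ((\<Sum>j<card C. w (e' i) (e j) * val (e j) x) - 0)"
    proof (cases "e' i \<in> G")
      case True
      have "(Some (e' i), 0) \<in> C" using True by (simp add: C_def P_def)
      have "(\<Sum>z\<in>C. w (e' i) z * val z x) = (\<Sum>z\<in>C. if z = (Some (e' i), 0) then val z x else 0)"
        using True by (intro sum.cong) (auto simp: w_def)
      also have "\<dots> = e' i x" using fin(2) \<open>(Some (e' i), 0) \<in> C\<close> by (simp add: sum.delta val_def)
      finally show ?thesis unfolding row using bspec[OF G(3) True] by simp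
    next
      case False
      then have h: "e' i \<in> N" using e'G[OF i] by (simp add: G'_def)
      show ?thesis unfolding row wC[OF h False] using fun_cong[OF u(3)[OF h], of x] by simp
    qed
  next
    have "(\<Sum>i<card G'. real (card {j. j < card C \<and> w (e' i) (e j) \<noteq> 0}) + (if (0::real) = 0 then 0 else 1))
       \<le> (\<Sum>i<card G'. if e' i \<in> G then 1 else c (e' i))"
      using nz e'G by (intro sum_mono) auto
    also have "\<dots> = (\<Sum>h\<in>G'. if h \<in> G then 1 else c h)"
      using sum.reindex_bij_betw[OF e', of "\<lambda>h. if h \<in> G then 1 else c h"] by simp
    also have "\<dots> = real (card G) + (\<Sum>h\<in>G' - G. c h)"
      using finG' by (subst sum.If_cases) (auto simp: G'_def Int_absorb1 Diff_eq intro!: sum.cong arg_cong[where f = card])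
    also have "(\<Sum>h\<in>G' - G. c h) \<le> (\<Sum>h\<in>N. c h)"
    proof (rule sum_mono2[OF N(1)])
      show "0 \<le> c h" if "h \<in> N - (G' - G)" for h using one[of h] that by auto
    qed (auto simp: G'_def)
    finally show "(\<Sum>i<card G'. real (card {j. j < card C \<and> w (e' i) (e j) \<noteq> 0}) + (if (0::real) = 0 then 0 else 1)) \<le> ?T" by simp
  qed (use w1 in auto)
  have "s + 2 * ?T + ?T = s + 3 * ?T" by simp
  moreover have "G \<union> N \<subseteq> e' ` {..<card G'}" using e' by (auto simp: bij_betw_def G'_def)
  ultimately show ?thesis using R2 by metis
qed

text \<open>\<open>S\<close> bounds the price of the whole circuit, so that one width condition
  works for all layers. Each circuit layer adds 3 times the number of carried functions, which is at
  most \<open>card B + S\<close>, and 3 times its own price.\<close>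

lemma realizes_circuit:
  assumes "circuit B k s H" "s \<le> S" and B: "finite B" "\<forall>g\<in>B. \<forall>x. 0 \<le> g x" "B \<subseteq> \<phi> ` {..<p 0}"
    and \<phi>: "\<And>x i. x \<in> cube (p 0) 0 1 \<Longrightarrow> i < p 0 \<Longrightarrow> \<phi> i x = x i"
    and p: "\<And>i. i \<in> {1..2 * k} \<Longrightarrow> real (card B) + S \<le> real (p i)"
  shows "\<exists>m \<phi>'. realizes p (2 * k) m (3 * s + 3 * real k * (real (card B) + S)) \<phi>' \<and> H \<subseteq> \<phi>' ` {..<m}"
  using assms(1,2) p
proof (induction k arbitrary: s H)
  case 0
  then have H: "H \<subseteq> B" "0 \<le> s" by (auto simp: circuit.simps)
  have "realizes p 0 (p 0) 0 \<phi>" using \<phi> by (rule realizes_0)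
  then have "realizes p 0 (p 0) (3 * s) \<phi>" using H(2) unfolding realizes_def by (auto intro: order_trans)
  then show ?case using H B(3) by (intro exI[of _ "p 0"] exI[of _ \<phi>]) auto
next
  case (Suc k)
  then obtain G s' c where G: "circuit B k s' G" "finite (H - G)" "\<forall>h. 0 \<le> c h" "\<forall>h\<in>H - G. relu_unit G h (c h)"
    "s' + (\<Sum>h\<in>H - G. c h) \<le> s" by (auto simp: circuit.simps)
  have s': "s' \<le> s" using G(3,5) sum_nonneg[of "H - G" c] by simp
  obtain m \<phi>' where R: "realizes p (2 * k) m (3 * s' + 3 * real k * (real (card B) + S)) \<phi>'" "G \<subseteq> \<phi>' ` {..<m}"
    using Suc.IH[OF G(1)] s' Suc.prems(2,3) by force
  have fG: "finite (G - B)" "real (card (G - B)) \<le> s'" using circuit_finite[OF G(1)] by auto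
  have GB: "G \<subseteq> B \<union> (G - B)" by auto
  have finG: "finite G" by (rule finite_subset[OF GB]) (use B(1) fG(1) in simp)
  have "card G \<le> card (B \<union> (G - B))" by (rule card_mono[OF _ GB]) (use B(1) fG(1) in simp)
  also have "\<dots> \<le> card B + card (G - B)" by (rule card_Un_le)
  finally have cG: "real (card G) \<le> real (card B) + s'" using fG(2) by linarith
  have tot: "real (card G) + (\<Sum>h\<in>H - G. c h) \<le> real (card B) + S" using cG G(5) Suc.prems(2) by linarith
  have nn: "\<forall>g\<in>G. \<forall>x. 0 \<le> g x"
    using circuit_nonneg[OF G(1)] B(2) by blast
  have pp: "real (card B) + S \<le> real (p (Suc (2 * k)))" "real (card B) + S \<le> real (p (Suc (Suc (2 * k))))"
    using Suc.prems(3)[of "Suc (2 * k)"] Suc.prems(3)[of "Suc (Suc (2 * k))"] by auto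
  obtain m2 \<phi>2 where R2: "realizes p (Suc (Suc (2 * k))) m2 (3 * s' + 3 * real k * (real (card B) + S) + 3 * (real (card G) + (\<Sum>h\<in>H - G. c h))) \<phi>2"
    "G \<union> (H - G) \<subseteq> \<phi>2 ` {..<m2}"
    using realizes_circuit_layer[OF R finG nn G(2), of c] G(4) tot pp by fastforce
  have "3 * s' + 3 * real k * (real (card B) + S) + 3 * (real (card G) + (\<Sum>h\<in>H - G. c h)) \<le> 3 * s + 3 * real (Suc k) * (real (card B) + S)"
    using tot s' by (simp add: algebra_simps)
  then have "realizes p (2 * Suc k) m2 (3 * s + 3 * real (Suc k) * (real (card B) + S)) \<phi>2"
    using R2(1) unfolding realizes_def by (auto intro: order_trans)
  then show ?case using R2(2) by blast
qed

lemma realizes_select: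
  assumes R: "realizes p k m s \<phi>" and vw: "v \<in> \<phi> ` {..<m}" "w \<in> \<phi> ` {..<m}" "\<And>x. 0 \<le> v x" "\<And>x. 0 \<le> w x"
    and p: "2 \<le> p (Suc k)"
  shows "realizes p (Suc k) 2 (s + 2) (\<lambda>i. if i = 0 then v else w)"
proof -
  obtain i1 i2 where i: "i1 < m" "\<phi> i1 = v" "i2 < m" "\<phi> i2 = w" using vw by auto
  let ?A = "\<lambda>i j. if j = (if i = (0::nat) then i1 else i2) then 1 else 0 :: real"
  show ?thesis
  proof (rule realizes_Suc[OF R, of _ ?A "\<lambda>_. 0"])
    fix x i assume "i < (2::nat)"
    have "(\<Sum>j<m. ?A i j * \<phi> j x) = (\<Sum>j<m. if j = (if i = 0 then i1 else i2) then \<phi> j x else 0)"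
      by (intro sum.cong) auto
    also have "\<dots> = (if i = 0 then v else w) x" using i by (simp add: sum.delta)
    finally show "(if i = 0 then v else w) x = max 0 ((\<Sum>j<m. ?A i j * \<phi> j x) - 0)" using vw by simp
  next
    have "card {j. j < m \<and> ?A i j \<noteq> 0} \<le> 1" for i
    proof -
      have "{j. j < m \<and> ?A i j \<noteq> 0} \<subseteq> {if i = 0 then i1 else i2}" by (auto split: if_splits)
      from card_mono[OF _ this] show ?thesis by simp
    qed
    then have "(\<Sum>i<2. real (card {j. j < m \<and> ?A i j \<noteq> 0}) + (if (0::real) = 0 then 0 else 1)) \<le> (\<Sum>i<(2::nat). 1)"
      by (intro sum_mono) simp
    then show "(\<Sum>i<2. real (card {j. j < m \<and> ?A i j \<noteq> 0}) + (if (0::real) = 0 then 0 else 1)) \<le> 2" by simp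
  qed (use p in auto)
qed

text \<open>Surplus layers repeat v and w, which survive the ReLU because they are nonnegative; each
  repetition costs at most two weights.\<close>

lemma realizes_pad:
  assumes R: "realizes p k m s \<phi>" and vw: "v \<in> \<phi> ` {..<m}" "w \<in> \<phi> ` {..<m}" "\<And>x. 0 \<le> v x" "\<And>x. 0 \<le> w x"
    and L: "k < L" and p: "\<And>i. i \<in> {1..L} \<Longrightarrow> 2 \<le> p i"
  shows "realizes p L 2 (s + 2 * real (L - k)) (\<lambda>i. if i = 0 then v else w)"
  using L p
proof (induction L)
  case (Suc L)
  show ?case
  proof (cases "k = L")
    case True
    then show ?thesis using realizes_select[OF R vw, of] Suc.prems by simp
  next
    case False
    then have "realizes p L 2 (s + 2 * real (L - k)) (\<lambda>i. if i = 0 then v else w)" using Suc by simp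
    moreover have "v \<in> (\<lambda>i. if i = 0 then v else w) ` {..<2::nat}" by (rule image_eqI[of _ _ 0]) auto
    moreover have "w \<in> (\<lambda>i. if i = 0 then v else w) ` {..<2::nat}" by (rule image_eqI[of _ _ 1]) auto
    ultimately have "realizes p (Suc L) 2 (s + 2 * real (L - k) + 2) (\<lambda>i. if i = 0 then v else w)"
      by (rule realizes_select) (use vw(3,4) Suc.prems in auto)
    moreover have "s + 2 * real (L - k) + 2 = s + 2 * real (Suc L - k)" using False Suc.prems by (simp add: Suc_diff_le)
    ultimately show ?thesis by metis
  qed
qed simp

lemma network_class_realizes:
  assumes R: "realizes p L 2 s (\<lambda>i. if i = 0 then v else w)" and p: "p (L + 1) = 1" "\<And>i. i \<le> L + 1 \<Longrightarrow> 0 < p i"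
    and F: "\<And>x. x \<in> cube (p 0) 0 1 \<Longrightarrow> \<bar>v x - w x\<bar> \<le> F" and s: "s + 2 \<le> \<sigma>"
  shows "\<exists>f\<in>network_class L p \<sigma> F. \<forall>x\<in>cube (p 0) 0 1. f x 0 = v x - w x"
proof -
  obtain W b where mp: "2 \<le> p L" and b0: "b 0 = (\<lambda>_. 0)" and W: "\<forall>j<L. \<forall>i<p (j + 1). \<forall>l<p j. \<bar>W j i l\<bar> \<le> 1"
    and b: "\<forall>j\<le>L. \<forall>i<p j. \<bar>b j i\<bar> \<le> 1"
    and s': "real (\<Sum>j<L. mat_nnz (p (j + 1)) (p j) (W j) + vec_nnz (p (j + 1)) (b (j + 1))) \<le> s"
    and act: "\<forall>x\<in>cube (p 0) 0 1. \<forall>i<2. activation p W b L x i = (if i = 0 then v else w) x"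
    using R unfolding realizes_def by blast
  \<comment> \<open>The output row is (1, -1), which forms v - w without an activation.\<close>
  define W' where "W' = W(L := (\<lambda>i l. if l = 0 then 1 else if l = 1 then - 1 else 0))"
  have val: "network p W' b L x 0 = v x - w x" if "x \<in> cube (p 0) 0 1" for x
  proof -
    have "activation p W' b L x = activation p W b L x" by (rule activation_cong) (auto simp: W'_def)
    then have "network p W' b L x 0 = (\<Sum>j<p L. W' L 0 j * activation p W b L x j)"
      using p(1) by (simp add: network_activation mat_vec_def)
    also have "\<dots> = (\<Sum>j<2. W' L 0 j * activation p W b L x j)"
      using mp by (intro sum.mono_neutral_right) (auto simp: W'_def)
    also have "\<dots> = v x - w x" using act that by (simp add: W'_def numeral_2_eq_2)
    finally show ?thesis .
  qed
  have "mat_nnz (p (L + 1)) (p L) (W' L) \<le> 2"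
  proof -
    have "{(i, j). i < p (L + 1) \<and> j < p L \<and> W' L i j \<noteq> 0} \<subseteq> {(0, 0), (0, 1)}"
      using p(1) by (auto simp: W'_def split: if_splits)
    from card_mono[OF _ this] show ?thesis unfolding mat_nnz_def by simp
  qed
  \<comment> \<open>The class counts the shift vectors 0 to L, \<open>realizes\<close> those of the
    layers 1 to L; the difference is the zero vector of layer 0.\<close>
  moreover have "(\<Sum>j\<le>L. mat_nnz (p (j + 1)) (p j) (W' j) + vec_nnz (p j) (b j)) =
    (\<Sum>j<L. mat_nnz (p (j + 1)) (p j) (W j) + vec_nnz (p (j + 1)) (b (j + 1))) + mat_nnz (p (L + 1)) (p L) (W' L)"
  proof -
    have "(\<Sum>j\<le>L. vec_nnz (p j) (b j)) = vec_nnz (p 0) (b 0) + (\<Sum>j<L. vec_nnz (p (j + 1)) (b (j + 1)))"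
      by (subst lessThan_Suc_atMost[symmetric], subst sum.lessThan_Suc_shift) simp
    moreover have "vec_nnz (p 0) (b 0) = 0" by (simp add: vec_nnz_def b0)
    moreover have "(\<Sum>j\<le>L. mat_nnz (p (j + 1)) (p j) (W' j)) = (\<Sum>j<L. mat_nnz (p (j + 1)) (p j) (W j)) + mat_nnz (p (L + 1)) (p L) (W' L)"
      by (subst lessThan_Suc_atMost[symmetric]) (simp add: W'_def)
    ultimately show ?thesis by (simp add: sum.distrib)
  qed
  ultimately have nnz: "real (\<Sum>j\<le>L. mat_nnz (p (j + 1)) (p j) (W' j) + vec_nnz (p j) (b j)) \<le> \<sigma>"
    using s' s by simp
  have "network p W' b L \<in> network_class L p \<sigma> F"
    unfolding network_class_def
  proof (intro CollectI exI[of _ W'] exI[of _ b] conjI refl b0 nnz allI impI ballI)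
    fix j assume j: "j \<le> L"
    have ne: "p j > 0" "p (j + 1) > 0" using p(2) j by auto
    have "mat_sup_norm (p (j + 1)) (p j) (W' j) \<le> 1"
      unfolding mat_sup_norm_def
    proof (rule Max.boundedI)
      show "(\<lambda>(i, ja). \<bar>W' j i ja\<bar>) ` ({..<p (j + 1)} \<times> {..<p j}) \<noteq> {}" using ne by (auto simp: lessThan_empty_iff)
      fix r assume "r \<in> (\<lambda>(i, ja). \<bar>W' j i ja\<bar>) ` ({..<p (j + 1)} \<times> {..<p j})"
      then show "r \<le> 1" using W j by (auto simp: W'_def)
    qed simp
    moreover have "sup_norm (p j) (b j) \<le> 1"
      unfolding sup_norm_def
    proof (rule Max.boundedI)
      show "(\<lambda>i. \<bar>b j i\<bar>) ` {..<p j} \<noteq> {}" using ne by (auto simp: lessThan_empty_iff)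
    qed (use b j in auto)
    ultimately show "max (mat_sup_norm (p (j + 1)) (p j) (W' j)) (sup_norm (p j) (b j)) \<le> 1" by simp
  next
    fix x assume "x \<in> cube (p 0) 0 1"
    then show "sup_norm (p (L + 1)) (network p W' b L x) \<le> F"
      using val F p(1) by (simp add: sup_norm_def lessThan_Suc)
  qed
  then show ?thesis using val by blast
qed

text \<open>Circuit inputs have to lie in [0, 1] on the whole type, hence the value 0 off the
  cube.\<close>

definition input_fun :: "nat \<Rightarrow> nat \<Rightarrow> (nat \<Rightarrow> real) \<Rightarrow> real" where
  "input_fun d j x = (if x \<in> cube d 0 1 then x j else 0)"

text \<open>\<open>2 * k < L\<close> leaves at least one layer in which v and w are selected. The
  parameters are those of the translated circuit, two per remaining layer, and two for the
  output.\<close>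

lemma circuit_network_class:
  assumes C: "circuit (input_fun d ` {..<d}) k s {v, w}" and p: "p 0 = d" "p (L + 1) = 1" "\<And>i. i \<le> L + 1 \<Longrightarrow> 0 < p i"
    and L: "2 * k < L" and pw: "\<And>i. i \<in> {1..L} \<Longrightarrow> real d + s + 2 \<le> real (p i)"
    and F: "\<And>x. \<bar>v x - w x\<bar> \<le> F" and \<sigma>: "3 * s + 3 * real k * (real d + s) + 2 * real L + 2 \<le> \<sigma>"
  shows "\<exists>f\<in>network_class L p \<sigma> F. \<forall>x\<in>cube d 0 1. f x 0 = v x - w x"
proof -
  let ?B = "input_fun d ` {..<d}"
  have cB: "card ?B \<le> d" using card_image_le[of "{..<d}" "input_fun d"] by simp
  have nn: "0 \<le> g x" if "g \<in> ?B" for g x using that by (auto simp: input_fun_def cube_def PiE_iff)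
  have s0: "0 \<le> s" using circuit_finite[OF C] by linarith
  have "\<exists>m \<phi>'. realizes p (2 * k) m (3 * s + 3 * real k * (real (card ?B) + s)) \<phi>' \<and> {v, w} \<subseteq> \<phi>' ` {..<m}"
  proof (rule realizes_circuit[OF C order_refl, where \<phi> = "input_fun d"])
    fix i assume "i \<in> {1..2 * k}"
    then show "real (card ?B) + s \<le> real (p i)" using pw[of i] cB L by simp
  qed (use nn in \<open>auto simp: p(1) input_fun_def\<close>)
  then obtain m \<phi>' where R: "realizes p (2 * k) m (3 * s + 3 * real k * (real (card ?B) + s)) \<phi>'" "{v, w} \<subseteq> \<phi>' ` {..<m}" by blast
  have vw0: "0 \<le> v x" "0 \<le> w x" for x by (rule circuit_nonneg[OF C]; use nn in auto)+
  have p2: "2 \<le> p i" if "i \<in> {1..L}" for i using pw[OF that] s0 by linarith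
  have R3: "realizes p L 2 (3 * s + 3 * real k * (real (card ?B) + s) + 2 * real (L - 2 * k)) (\<lambda>i. if i = 0 then v else w)"
    using R(2) by (intro realizes_pad[OF R(1) _ _ vw0 L p2]) auto
  have R4: "3 * s + 3 * real k * (real (card ?B) + s) + 2 * real (L - 2 * k) + 2 \<le> \<sigma>"
  proof -
    have "3 * real k * (real (card ?B) + s) \<le> 3 * real k * (real d + s)" using cB by (intro mult_left_mono) auto
    then show ?thesis using \<sigma> by linarith
  qed
  show ?thesis using network_class_realizes[OF R3 p(2,3) F R4] p(1) by simp
qed

section \<open>Covering numbers of sparse networks\<close>

text \<open>The relevant nodes of layer l are renumbered by \<open>e l\<close>. All other nodes have
  outgoing weights 0, so dropping them leaves the sums unchanged. \<open>e 0\<close> is the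
  identity, as the input is given.\<close>

lemma activation_compress:
  assumes e: "\<And>l. l \<le> L \<Longrightarrow> bij_betw (e l) {..<n l} (A l)"
    and A: "\<And>l. l \<le> L \<Longrightarrow> A l \<subseteq> {..<p l}" "\<And>l i j. l < L \<Longrightarrow> i < p (l + 1) \<Longrightarrow> j < p l \<Longrightarrow> j \<notin> A l \<Longrightarrow> W l i j = 0"
    and A0: "\<And>i. e 0 i = i"
    and n: "\<And>l. l \<le> L \<Longrightarrow> n l \<le> p' l"
    and W': "\<And>l i j. W' l i j = (if i < n (l + 1) \<and> j < n l then W l (e (l + 1) i) (e l j) else 0)"
    and v': "\<And>l i. l \<le> L \<Longrightarrow> v' l i = (if i < n l then v l (e l i) else 0)"
    and k: "k \<le> L" and i: "i < n k"
  shows "activation p' W' v' k x i = activation p W v k x (e k i)"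
  using k i
proof (induction k arbitrary: i)
  case 0 then show ?case using A0 by simp
next
  case (Suc k)
  have ei: "e (Suc k) i < p (Suc k)" using e[OF Suc.prems(1)] A(1)[OF Suc.prems(1)] Suc.prems(2) by (auto simp: bij_betw_def)
  have kL: "k \<le> L" "k < L" using Suc.prems by auto
  have "(\<Sum>j<p' k. W' k i j * activation p' W' v' k x j) = (\<Sum>j<n k. W' k i j * activation p' W' v' k x j)"
    using n[OF kL(1)] by (intro sum.mono_neutral_right) (auto simp: W'[of k])
  also have "\<dots> = (\<Sum>j<n k. W k (e (Suc k) i) (e k j) * activation p W v k x (e k j))"
    using Suc.IH[OF kL(1)] Suc.prems by (intro sum.cong refl) (simp add: W'[of k])
  also have "\<dots> = (\<Sum>j\<in>A k. W k (e (Suc k) i) j * activation p W v k x j)"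
    by (rule sum.reindex_bij_betw[OF e[OF kL(1)]])
  also have "\<dots> = (\<Sum>j<p k. W k (e (Suc k) i) j * activation p W v k x j)"
    using A(1)[OF kL(1)] A(2)[OF kL(2)] ei by (intro sum.mono_neutral_left) auto
  finally show ?case
    using Suc.prems n[OF Suc.prems(1)] ei by (simp add: activation_Suc v'[OF Suc.prems(1)])
qed

text \<open>Hidden nodes without outgoing weights are irrelevant, and at most \<open>S\<close> others exist in each layer; so
  the number of functions in the class does not depend on the widths.\<close>

lemma network_compress:
  assumes p: "p 0 = d" "p (L + 1) = 1" and w: "d \<le> w" "S \<le> w" "1 \<le> w" and v0: "v 0 = (\<lambda>_. 0)"
    and W1: "\<And>j i l. j \<le> L \<Longrightarrow> i < p (j + 1) \<Longrightarrow> l < p j \<Longrightarrow> \<bar>W j i l\<bar> \<le> 1" and v1: "\<And>j i. j \<le> L \<Longrightarrow> i < p j \<Longrightarrow> \<bar>v j i\<bar> \<le> 1"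
    and S: "(\<Sum>j\<le>L. mat_nnz (p (j + 1)) (p j) (W j) + vec_nnz (p j) (v j)) \<le> S"
    and p': "p' 0 = d" "p' (L + 1) = 1" "\<And>l. 1 \<le> l \<Longrightarrow> l \<le> L \<Longrightarrow> p' l = w"
  shows "\<exists>W' v'. (\<forall>j i l. \<bar>W' j i l\<bar> \<le> 1) \<and> (\<forall>j i. \<bar>v' j i\<bar> \<le> 1) \<and> (\<forall>x. network p' W' v' L x 0 = network p W v L x 0) \<and>
    (\<forall>j i l. W' j i l \<noteq> 0 \<longrightarrow> j \<le> L \<and> i < w \<and> l < w) \<and> (\<forall>j i. v' j i \<noteq> 0 \<longrightarrow> j \<le> L \<and> i < w) \<and>
    (\<Sum>j\<le>L. card {(i, l). W' j i l \<noteq> 0} + card {i. v' j i \<noteq> 0}) \<le> S"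
proof -
  \<comment> \<open>All inputs are kept, which fixes their numbering. A hidden node is kept if a
    nonzero weight leaves it, so there are at most as many as nonzero weights in that layer.\<close>
  define A where "A l = (if l = 0 then {..<d} else {j. j < p l \<and> (\<exists>i<p (l + 1). W l i j \<noteq> 0)})" for l
  define n where "n l = (if l \<le> L then card (A l) else if l = L + 1 then 1 else 0)" for l
  have finA: "finite (A l)" for l by (simp add: A_def)
  have "\<forall>l. \<exists>e. bij_betw e {..<card (A l)} (A l)" using finite_set_enum[OF finA] by blast
  then obtain e0 where e0: "\<And>l. bij_betw (e0 l) {..<card (A l)} (A l)" by metis
  define e where "e l = (if l = 0 \<or> L < l then id else e0 l)" for l
  have e: "bij_betw (e l) {..<n l} (A l)" if "l \<le> L" for l
    using e0[of l] that by (auto simp: e_def n_def A_def)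
  have eA: "e l i \<in> A l" if "l \<le> L" "i < n l" for l i using e[OF that(1)] that(2) by (auto simp: bij_betw_def)
  have Ap: "A l \<subseteq> {..<p l}" for l using p by (auto simp: A_def)
  have ep: "e l i < p l" if "l \<le> L + 1" "i < n l" for l i
  proof (cases "l = L + 1")
    case True then show ?thesis using that p by (simp add: e_def n_def)
  next
    case False then show ?thesis using that eA[of l i] Ap[of l] by auto
  qed
  have einj: "inj_on (e l) {..<n l}" for l
    using e[of l] by (cases "l \<le> L") (auto simp: bij_betw_def e_def)
  have term_le: "mat_nnz (p (j + 1)) (p j) (W j) \<le> S" if "j \<le> L" for j
  proof -
    have "mat_nnz (p (j + 1)) (p j) (W j) \<le> mat_nnz (p (j + 1)) (p j) (W j) + vec_nnz (p j) (v j)" by simp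
    also have "\<dots> \<le> (\<Sum>j\<le>L. mat_nnz (p (j + 1)) (p j) (W j) + vec_nnz (p j) (v j))"
      using that by (intro member_le_sum[where f = "\<lambda>j. mat_nnz (p (j + 1)) (p j) (W j) + vec_nnz (p j) (v j)"]) auto
    finally show ?thesis using S by simp
  qed
  have nw: "n l \<le> p' l" if "l \<le> L + 1" for l
  proof -
    have "l = 0 \<or> 1 \<le> l \<and> l \<le> L \<or> l = L + 1" using that by linarith
    then show ?thesis
    proof (elim disjE)
      assume 2: "1 \<le> l \<and> l \<le> L"
      have "card (A l) \<le> mat_nnz (p (l + 1)) (p l) (W l)"
      proof -
        have "finite ({..<p (l + 1)} \<times> {..<p l})" by simp
        then have f: "finite {(i, j). i < p (l + 1) \<and> j < p l \<and> W l i j \<noteq> 0}" by (rule rev_finite_subset) auto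
        have "A l \<subseteq> snd ` {(i, j). i < p (l + 1) \<and> j < p l \<and> W l i j \<noteq> 0}" using 2 by (force simp: A_def image_iff)
        from card_mono[OF finite_imageI[OF f] this] card_image_le[OF f, of snd] show ?thesis unfolding mat_nnz_def by simp
      qed
      then show ?thesis using 2 term_le[of l] w p' by (simp add: n_def)
    qed (use p'(2) in \<open>auto simp: n_def A_def p'(1)\<close>)
  qed
  have p'w: "p' l \<le> w" if "l \<le> L + 1" for l
  proof -
    have "l = 0 \<or> 1 \<le> l \<and> l \<le> L \<or> l = L + 1" using that by linarith
    then show ?thesis using p' w by auto
  qed
  define W' where "W' l i j = (if i < n (l + 1) \<and> j < n l then W l (e (l + 1) i) (e l j) else 0)" for l i j
  define v' where "v' l i = (if l \<le> L \<and> i < n l then v l (e l i) else 0)" for l i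
  have act: "activation p' W' v' k x i = activation p W v k x (e k i)" if "k \<le> L" "i < n k" for k x i
    using that
  proof (intro activation_compress[where e = e and n = n and A = A and p = p and p' = p' and L = L])
    show "W l i j = 0" if "l < L" "i < p (l + 1)" "j < p l" "j \<notin> A l" for l i j
      using that p by (auto simp: A_def split: if_splits)
  qed (use e Ap nw in \<open>auto simp: e_def[of 0] W'_def v'_def\<close>)
  have net: "network p' W' v' L x 0 = network p W v L x 0" for x
  proof -
    have "network p' W' v' L x 0 = (\<Sum>j<p' L. W' L 0 j * activation p' W' v' L x j)"
      using p' by (simp add: network_activation mat_vec_def)
    also have "\<dots> = (\<Sum>j<n L. W' L 0 j * activation p' W' v' L x j)"
      using nw[of L] by (intro sum.mono_neutral_right) (auto simp: W'_def)
    also have "\<dots> = (\<Sum>j<n L. W L 0 (e L j) * activation p W v L x (e L j))"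
      by (intro sum.cong refl) (auto simp: W'_def act n_def[of "Suc L"] e_def[of "Suc L"])
    also have "\<dots> = (\<Sum>j\<in>A L. W L 0 j * activation p W v L x j)"
      by (rule sum.reindex_bij_betw[OF e[OF order_refl]])
    also have "\<dots> = (\<Sum>j<p L. W L 0 j * activation p W v L x j)"
      using Ap[of L] p by (intro sum.mono_neutral_left) (auto simp: A_def split: if_splits)
    finally show ?thesis using p by (simp add: network_activation mat_vec_def)
  qed
  have Wnz: "j \<le> L \<and> i < n (j + 1) \<and> l < n j \<and> W' j i l = W j (e (j + 1) i) (e j l)" if "W' j i l \<noteq> 0" for j i l
  proof -
    have 1: "i < n (j + 1) \<and> l < n j \<and> W' j i l = W j (e (j + 1) i) (e j l)"
      using that unfolding W'_def by (auto split: if_splits)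
    then have "j + 1 \<le> L + 1" by (auto simp: n_def split: if_splits)
    with 1 show ?thesis by simp
  qed
  have vnz: "j \<le> L \<and> i < n j \<and> v' j i = v j (e j i)" if "v' j i \<noteq> 0" for j i
    using that by (auto simp: v'_def split: if_splits)
  show ?thesis
  proof (intro exI[of _ W'] exI[of _ v'] conjI allI impI net)
    fix j i l
    show "\<bar>W' j i l\<bar> \<le> 1"
    proof (cases "W' j i l = 0")
      case False
      from Wnz[OF this] show ?thesis using W1[of j "e (j + 1) i" "e j l"] ep[of "j + 1" i] ep[of j l] by auto
    qed simp
    show "\<bar>v' j i\<bar> \<le> 1"
    proof (cases "v' j i = 0")
      case False
      from vnz[OF this] show ?thesis using v1[of j "e j i"] ep[of j i] by auto
    qed simp
    show "j \<le> L" "i < w" "l < w" if "W' j i l \<noteq> 0"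
      using Wnz[OF that] nw[of "j + 1"] nw[of j] p'w[of "j + 1"] p'w[of j] by auto
    show "j \<le> L" "i < w" if "v' j i \<noteq> 0"
      using vnz[OF that] nw[of j] p'w[of j] by auto
  next
    have "(\<Sum>j\<le>L. card {(i, l). W' j i l \<noteq> 0} + card {i. v' j i \<noteq> 0}) \<le> (\<Sum>j\<le>L. mat_nnz (p (j + 1)) (p j) (W j) + vec_nnz (p j) (v j))"
    proof (intro sum_mono add_mono)
      fix j assume j: "j \<in> {..L}"
      have "finite ({..<p (j + 1)} \<times> {..<p j})" by simp
      then have f: "finite {(i, l). i < p (j + 1) \<and> l < p j \<and> W j i l \<noteq> 0}" by (rule rev_finite_subset) auto
      show "card {(i, l). W' j i l \<noteq> 0} \<le> mat_nnz (p (j + 1)) (p j) (W j)"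
        unfolding mat_nnz_def
      proof (rule card_inj_on_le[OF _ _ f])
        show "inj_on (\<lambda>(i, l). (e (j + 1) i, e j l)) {(i, l). W' j i l \<noteq> 0}"
          using Wnz einj[of "j + 1"] einj[of j] by (fastforce simp: inj_on_def)
        show "(\<lambda>(i, l). (e (j + 1) i, e j l)) ` {(i, l). W' j i l \<noteq> 0} \<subseteq> {(i, l). i < p (j + 1) \<and> l < p j \<and> W j i l \<noteq> 0}"
        proof (clarify)
          fix i l assume a: "W' j i l \<noteq> 0"
          from Wnz[OF a] show "e (j + 1) i < p (j + 1) \<and> e j l < p j \<and> W j (e (j + 1) i) (e j l) \<noteq> 0"
            using a ep[of "j + 1" i] ep[of j l] by auto
        qed
      qed
      show "card {i. v' j i \<noteq> 0} \<le> vec_nnz (p j) (v j)"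
        unfolding vec_nnz_def
      proof (rule card_inj_on_le)
        show "inj_on (e j) {i. v' j i \<noteq> 0}" using vnz einj[of j] by (fastforce simp: inj_on_def)
        show "e j ` {i. v' j i \<noteq> 0} \<subseteq> {i. i < p j \<and> v j i \<noteq> 0}"
        proof (clarify)
          fix i assume a: "v' j i \<noteq> 0"
          from vnz[OF a] show "e j i < p j \<and> v j (e j i) \<noteq> 0" using a ep[of j i] by auto
        qed
      qed simp
    qed
    then show "(\<Sum>j\<le>L. card {(i, l). W' j i l \<noteq> 0} + card {i. v' j i \<noteq> 0}) \<le> S" using S by simp
  qed
qed

section \<open>Perturbation of parameters and finite nets\<close>

lemma abs_mult_diff_le:
  fixes A A' a a' :: real
  assumes "\<bar>A - A'\<bar> \<le> \<eta>" "\<bar>a\<bar> \<le> X" "\<bar>A'\<bar> \<le> 1" "\<bar>a - a'\<bar> \<le> Y"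
  shows "\<bar>A * a - A' * a'\<bar> \<le> \<eta> * X + Y"
proof -
  have "A * a - A' * a' = (A - A') * a + A' * (a - a')" by (simp add: algebra_simps)
  then have "\<bar>A * a - A' * a'\<bar> \<le> \<bar>(A - A') * a\<bar> + \<bar>A' * (a - a')\<bar>" by (simp add: abs_triangle_ineq)
  also have "\<dots> = \<bar>A - A'\<bar> * \<bar>a\<bar> + \<bar>A'\<bar> * \<bar>a - a'\<bar>" by (simp add: abs_mult)
  also have "\<dots> \<le> \<eta> * X + 1 * Y" using assms by (intro add_mono mult_mono) linarith+
  finally show ?thesis by simp
qed

text \<open>Size and difference are bounded together, since a perturbed weight contributes \<eta>
  times the size of its input. Doubling w pays for the shift in the size bound; in the difference
  bound the factor 4 covers the two product errors and the shift.\<close>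

lemma activation_lipschitz:
  assumes w: "\<And>l. l \<le> k \<Longrightarrow> p l \<le> w" "1 \<le> w" and x: "\<And>i. i < p 0 \<Longrightarrow> \<bar>x i\<bar> \<le> 1"
    and b: "\<And>j i l. \<bar>W j i l\<bar> \<le> 1" "\<And>j i. \<bar>v j i\<bar> \<le> 1" "\<And>j i l. \<bar>W' j i l\<bar> \<le> 1"
    and \<eta>: "\<And>j i l. \<bar>W j i l - W' j i l\<bar> \<le> \<eta>" "\<And>j i. \<bar>v j i - v' j i\<bar> \<le> \<eta>"
  shows "\<forall>i<p k. \<bar>activation p W v k x i\<bar> \<le> (2 * real w) ^ k \<and>
    \<bar>activation p W v k x i - activation p W' v' k x i\<bar> \<le> \<eta> * (4 * real w) ^ k"
  using w(1)
proof (induction k)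
  case 0
  have "0 \<le> \<eta>" using \<eta>(2)[of 0 0] by linarith
  then show ?case using x by simp
next
  case (Suc k)
  have \<eta>0: "0 \<le> \<eta>" using \<eta>(2)[of 0 0] by linarith
  have w1: "1 \<le> real w" using w(2) by simp
  have pk: "real (p k) \<le> real w" using Suc.prems[of k] by simp
  let ?a = "activation p W v k x" and ?a' = "activation p W' v' k x"
  have IH: "\<bar>?a j\<bar> \<le> (2 * real w) ^ k" "\<bar>?a j - ?a' j\<bar> \<le> \<eta> * (4 * real w) ^ k" if "j < p k" for j
    using Suc that by auto
  have one: "1 \<le> (2 * real w) ^ k" "(2 * real w) ^ k \<le> (4 * real w) ^ k"
  proof -
    show "1 \<le> (2 * real w) ^ k" by (rule one_le_power) (use w1 in linarith)
    show "(2 * real w) ^ k \<le> (4 * real w) ^ k" by (rule power_mono) auto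
  qed
  show ?case
  proof (intro allI impI conjI)
    fix i assume i: "i < p (Suc k)"
    have A: "\<bar>\<Sum>j<p k. W k i j * ?a j\<bar> \<le> real w * (2 * real w) ^ k"
    proof -
      have "\<bar>\<Sum>j<p k. W k i j * ?a j\<bar> \<le> (\<Sum>j<p k. 1 * (2 * real w) ^ k)"
      proof (rule order_trans[OF sum_abs sum_mono])
        fix j assume "j \<in> {..<p k}"
        then show "\<bar>W k i j * ?a j\<bar> \<le> 1 * (2 * real w) ^ k"
          unfolding abs_mult using b(1) IH(1)[of j] by (intro mult_mono) auto
      qed
      also have "\<dots> \<le> real w * (2 * real w) ^ k" using pk one by (simp add: mult_right_mono)
      finally show ?thesis .
    qed
    have "\<bar>activation p W v (Suc k) x i\<bar> \<le> \<bar>\<Sum>j<p k. W k i j * ?a j\<bar> + \<bar>v (Suc k) i\<bar>"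
      using i by (simp add: activation_Suc)
    also have "\<dots> \<le> real w * (2 * real w) ^ k + real w * (2 * real w) ^ k"
    proof -
      have "1 * 1 \<le> real w * (2 * real w) ^ k" using w1 one by (intro mult_mono) auto
      then show ?thesis using A b(2)[of "Suc k" i] by linarith
    qed
    finally show "\<bar>activation p W v (Suc k) x i\<bar> \<le> (2 * real w) ^ Suc k" by (simp add: mult_ac)
    have D: "\<bar>(\<Sum>j<p k. W k i j * ?a j) - (\<Sum>j<p k. W' k i j * ?a' j)\<bar> \<le> real w * (2 * (\<eta> * (4 * real w) ^ k))"
    proof -
      have "\<bar>(\<Sum>j<p k. W k i j * ?a j) - (\<Sum>j<p k. W' k i j * ?a' j)\<bar> \<le> (\<Sum>j<p k. 2 * (\<eta> * (4 * real w) ^ k))"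
        unfolding sum_subtractf[symmetric]
      proof (rule order_trans[OF sum_abs sum_mono])
        fix j assume j: "j \<in> {..<p k}"
        have "\<bar>?a j\<bar> \<le> (4 * real w) ^ k" using IH(1)[of j] one(2) j by auto
        then have "\<bar>W k i j * ?a j - W' k i j * ?a' j\<bar> \<le> \<eta> * (4 * real w) ^ k + \<eta> * (4 * real w) ^ k"
          using IH(2)[of j] j by (intro abs_mult_diff_le \<eta>(1) b(3)) auto
        then show "\<bar>W k i j * ?a j - W' k i j * ?a' j\<bar> \<le> 2 * (\<eta> * (4 * real w) ^ k)" by linarith
      qed
      also have "\<dots> \<le> real w * (2 * (\<eta> * (4 * real w) ^ k))" using pk \<eta>0 by (simp add: mult_right_mono)
      finally show ?thesis .
    qed
    have "\<bar>activation p W v (Suc k) x i - activation p W' v' (Suc k) x i\<bar> \<le>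
        \<bar>(\<Sum>j<p k. W k i j * ?a j) - (\<Sum>j<p k. W' k i j * ?a' j)\<bar> + \<bar>v (Suc k) i - v' (Suc k) i\<bar>"
      using i by (simp add: activation_Suc)
    also have "\<dots> \<le> real w * (2 * (\<eta> * (4 * real w) ^ k)) + \<eta> * (2 * (real w * (4 * real w) ^ k))"
    proof -
      have "1 \<le> (4 * real w) ^ k" using one by linarith
      then have "1 * 1 \<le> real w * (4 * real w) ^ k" using w1 by (intro mult_mono) auto
      then have "\<eta> * 1 \<le> \<eta> * (2 * (real w * (4 * real w) ^ k))" using \<eta>0 by (intro mult_left_mono) auto
      then show ?thesis using D \<eta>(2)[of "Suc k" i] by linarith
    qed
    finally show "\<bar>activation p W v (Suc k) x i - activation p W' v' (Suc k) x i\<bar> \<le> \<eta> * (4 * real w) ^ Suc k"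
      by (simp add: algebra_simps)
  qed
qed

lemma network_lipschitz:
  assumes w: "\<And>l. l \<le> L \<Longrightarrow> p l \<le> w" "1 \<le> w" and p1: "p (L + 1) = 1" and x: "\<And>i. i < p 0 \<Longrightarrow> \<bar>x i\<bar> \<le> 1"
    and b: "\<And>j i l. \<bar>W j i l\<bar> \<le> 1" "\<And>j i. \<bar>v j i\<bar> \<le> 1" "\<And>j i l. \<bar>W' j i l\<bar> \<le> 1"
    and \<eta>: "\<And>j i l. \<bar>W j i l - W' j i l\<bar> \<le> \<eta>" "\<And>j i. \<bar>v j i - v' j i\<bar> \<le> \<eta>"
  shows "\<bar>network p W v L x 0 - network p W' v' L x 0\<bar> \<le> \<eta> * (4 * real w) ^ (L + 1)"
proof -
  have \<eta>0: "0 \<le> \<eta>" using \<eta>(2)[of 0 0] by linarith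
  let ?a = "activation p W v L x" and ?a' = "activation p W' v' L x"
  have A: "\<forall>i<p L. \<bar>?a i\<bar> \<le> (2 * real w) ^ L \<and> \<bar>?a i - ?a' i\<bar> \<le> \<eta> * (4 * real w) ^ L"
    by (rule activation_lipschitz) (use w x b \<eta> in auto)
  have one: "(2 * real w) ^ L \<le> (4 * real w) ^ L" by (intro power_mono) auto
  have "\<bar>network p W v L x 0 - network p W' v' L x 0\<bar> = \<bar>\<Sum>j<p L. W L 0 j * ?a j - W' L 0 j * ?a' j\<bar>"
    using p1 by (simp add: network_activation mat_vec_def sum_subtractf)
  also have "\<dots> \<le> (\<Sum>j<p L. 2 * (\<eta> * (4 * real w) ^ L))"
  proof (rule order_trans[OF sum_abs sum_mono])
    fix j assume "j \<in> {..<p L}"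
    then have a: "\<bar>?a j\<bar> \<le> (4 * real w) ^ L" "\<bar>?a j - ?a' j\<bar> \<le> \<eta> * (4 * real w) ^ L"
      using A one order_trans[of "\<bar>?a j\<bar>"] by blast+
    have "\<bar>W L 0 j * ?a j - W' L 0 j * ?a' j\<bar> \<le> \<eta> * (4 * real w) ^ L + \<eta> * (4 * real w) ^ L"
      by (intro abs_mult_diff_le \<eta>(1) b(3) a)
    then show "\<bar>W L 0 j * ?a j - W' L 0 j * ?a' j\<bar> \<le> 2 * (\<eta> * (4 * real w) ^ L)" by linarith
  qed
  also have "\<dots> = real (p L) * (2 * (\<eta> * (4 * real w) ^ L))" by simp
  also have "\<dots> \<le> (4 * real w) * (\<eta> * (4 * real w) ^ L)"
    using w(1)[of L] \<eta>0 unfolding mult.assoc[symmetric] by (intro mult_right_mono) auto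
  finally show ?thesis by (simp add: mult_ac)
qed

text \<open>A code is determined by a list of exactly \<open>S\<close> pairs (position, value)
  covering its support. Lists are padded with a repeated position that carries its true value, so
  the padding cannot change what is decoded.\<close>

lemma card_sparse_codes:
  fixes P :: "'b set" and V :: "'c::zero set"
  assumes P: "finite P" "P \<noteq> {}" and V: "finite V"
  shows "finite {\<kappa>. {z. \<kappa> z \<noteq> 0} \<subseteq> P \<and> card {z. \<kappa> z \<noteq> 0} \<le> S \<and> range \<kappa> \<subseteq> V}" (is "finite ?K")
    and "card {\<kappa>. {z. \<kappa> z \<noteq> 0} \<subseteq> P \<and> card {z. \<kappa> z \<noteq> 0} \<le> S \<and> range \<kappa> \<subseteq> V} \<le> (card P * card V) ^ S"
proof -
  let ?X = "{xs. set xs \<subseteq> P \<times> V \<and> length xs = S}"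
  let ?f = "\<lambda>xs z. case map_of xs z of None \<Rightarrow> 0 | Some y \<Rightarrow> y"
  have m: "map_of (map (\<lambda>z. (z, \<kappa> z)) ys) z = (if z \<in> set ys then Some (\<kappa> z) else None)" for \<kappa> :: "'b \<Rightarrow> 'c" and ys z
    by (induction ys) auto
  have sub: "?K \<subseteq> ?f ` ?X"
  proof
    fix \<kappa> assume \<kappa>: "\<kappa> \<in> ?K"
    obtain z0 where z0: "z0 \<in> P" using P by blast
    have "finite {z. \<kappa> z \<noteq> 0}" using \<kappa> P by (auto intro: finite_subset)
    then obtain zs where zs: "set zs = {z. \<kappa> z \<noteq> 0}" "length zs = card {z. \<kappa> z \<noteq> 0}"
      using finite_distinct_list distinct_card by metis
    define ys where "ys = zs @ replicate (S - length zs) z0"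
    have "length ys = S" "set ys \<subseteq> P" "{z. \<kappa> z \<noteq> 0} \<subseteq> set ys" using \<kappa> zs z0 by (auto simp: ys_def)
    then have "map (\<lambda>z. (z, \<kappa> z)) ys \<in> ?X" "\<kappa> = ?f (map (\<lambda>z. (z, \<kappa> z)) ys)" using \<kappa> by (auto simp: m fun_eq_iff)
    then show "\<kappa> \<in> ?f ` ?X" by (rule image_eqI[rotated])
  qed
  have fin: "finite ?X" using P V by (intro finite_lists_length_eq) auto
  show "finite ?K" using sub fin by (rule finite_subset[OF _ finite_imageI])
  have "card ?K \<le> card (?f ` ?X)" by (rule card_mono[OF finite_imageI[OF fin] sub])
  also have "\<dots> \<le> card ?X" by (rule card_image_le[OF fin])
  also have "\<dots> = (card P * card V) ^ S" using P V by (subst card_lists_length_eq) (auto simp: card_cartesian_product)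
  finally show "card ?K \<le> (card P * card V) ^ S" .
qed

text \<open>Parameters are rounded down to multiples of \<eta>; zeros stay zero, so the codes are as
  sparse as the networks. Networks with equal codes differ by at most \<delta>. The net consists of
  one network of the class per code, not of the rounded networks, which might violate the bound
  \<open>F\<close>.\<close>

lemma network_class_cover:
  assumes p: "p 0 = d" "p (L + 1) = 1" "\<And>i. i \<le> L + 1 \<Longrightarrow> 0 < p i" and \<delta>: "0 < \<delta>"
    and w: "d \<le> w" "nat \<lfloor>s\<rfloor> \<le> w" "1 \<le> w"
  shows "\<exists>N\<subseteq>network_class L p s F. finite N \<and>
    card N \<le> (((L + 1) * w * (w + 1)) * (2 * nat \<lceil>(4 * real w) ^ (L + 1) / \<delta>\<rceil> + 1)) ^ nat \<lfloor>s\<rfloor> \<and>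
    (\<forall>f\<in>network_class L p s F. \<exists>g\<in>N. \<forall>x\<in>cube d 0 1. \<bar>f x 0 - g x 0\<bar> \<le> \<delta>)"
proof -
  let ?F = "network_class L p s F" and ?S = "nat \<lfloor>s\<rfloor>"
  \<comment> \<open>The denominator is the Lipschitz factor of
    \<open>network_lipschitz\<close>.\<close>
  define \<eta> where "\<eta> = \<delta> / (4 * real w) ^ (L + 1)"
  have w0: "0 < (4 * real w) ^ (L + 1)" using w by simp
  have \<eta>: "0 < \<eta>" using \<delta> w0 by (simp add: \<eta>_def)
  define p' where "p' l = (if l = 0 then d else if l \<le> L then w else 1)" for l
  have p': "p' 0 = d" "p' (L + 1) = 1" "\<And>l. 1 \<le> l \<Longrightarrow> l \<le> L \<Longrightarrow> p' l = w" by (auto simp: p'_def)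
  define q where "q = \<lceil>(4 * real w) ^ (L + 1) / \<delta>\<rceil>"
  define P where "P = {..L} \<times> {..<w} \<times> {..<w + 1}"
  have finP: "finite P" "P \<noteq> {}" "card P = (L + 1) * w * (w + 1)"
    using w by (auto simp: P_def card_cartesian_product lessThan_empty_iff) (simp add: algebra_simps)
  \<comment> \<open>In a triple (j, i, l) the value l = 0 addresses the shift \<open>v j i\<close>
    and \<open>Suc l\<close> the weight \<open>W j i l\<close>; hence the w + 1 values of the last
    component.\<close>
  define code where "code W v = (\<lambda>(j, i, l). \<lfloor>(case l of 0 \<Rightarrow> v j i | Suc l \<Rightarrow> W j i l) / \<eta>\<rfloor>)"
    for W :: "nat \<Rightarrow> nat \<Rightarrow> nat \<Rightarrow> real" and v :: "nat \<Rightarrow> nat \<Rightarrow> real"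
  let ?K = "{\<kappa>. {z. \<kappa> z \<noteq> 0} \<subseteq> P \<and> card {z. \<kappa> z \<noteq> 0} \<le> ?S \<and> range \<kappa> \<subseteq> {- q..q}}"
  have "\<forall>f\<in>?F. \<exists>z. (\<forall>j i l. \<bar>fst z j i l\<bar> \<le> 1) \<and> (\<forall>j i. \<bar>snd z j i\<bar> \<le> 1) \<and> (\<forall>x. network p' (fst z) (snd z) L x 0 = f x 0) \<and>
    code (fst z) (snd z) \<in> ?K"
  proof
    fix f assume "f \<in> ?F"
    then obtain W v where f: "f = network p W v L" and v0: "v 0 = (\<lambda>_. 0)"
      and b: "\<forall>j\<le>L. max (mat_sup_norm (p (j + 1)) (p j) (W j)) (sup_norm (p j) (v j)) \<le> 1"
      and s: "real (\<Sum>j\<le>L. mat_nnz (p (j + 1)) (p j) (W j) + vec_nnz (p j) (v j)) \<le> s"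
      unfolding network_class_def by blast
    have W1: "\<bar>W j i l\<bar> \<le> 1" if "j \<le> L" "i < p (j + 1)" "l < p j" for j i l
    proof -
      have "\<bar>W j i l\<bar> \<le> mat_sup_norm (p (j + 1)) (p j) (W j)"
        unfolding mat_sup_norm_def using that by (intro Max_ge) force+
      then show ?thesis using b that(1) by auto
    qed
    have v1: "\<bar>v j i\<bar> \<le> 1" if "j \<le> L" "i < p j" for j i
    proof -
      have "\<bar>v j i\<bar> \<le> sup_norm (p j) (v j)" unfolding sup_norm_def using that by (intro Max_ge) auto
      then show ?thesis using b that(1) by auto
    qed
    have S: "(\<Sum>j\<le>L. mat_nnz (p (j + 1)) (p j) (W j) + vec_nnz (p j) (v j)) \<le> ?S"
      using s by (simp add: le_nat_floor)
    obtain W' v' where c: "\<forall>j i l. \<bar>W' j i l\<bar> \<le> 1" "\<forall>j i. \<bar>v' j i\<bar> \<le> 1" "\<forall>x. network p' W' v' L x 0 = network p W v L x 0"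
      "\<forall>j i l. W' j i l \<noteq> 0 \<longrightarrow> j \<le> L \<and> i < w \<and> l < w" "\<forall>j i. v' j i \<noteq> 0 \<longrightarrow> j \<le> L \<and> i < w"
      "(\<Sum>j\<le>L. card {(i, l). W' j i l \<noteq> 0} + card {i. v' j i \<noteq> 0}) \<le> ?S"
      using network_compress[of p d L w ?S v W p', OF p(1,2) w v0 W1 v1 S p'] by blast
    let ?\<kappa> = "code W' v'"
    have nz: "{z. ?\<kappa> z \<noteq> 0} \<subseteq> (\<Union>j\<in>{..L}. (\<lambda>(i, l). (j, i, Suc l)) ` {(i, l). W' j i l \<noteq> 0} \<union> (\<lambda>i. (j, i, 0)) ` {i. v' j i \<noteq> 0})"
    proof
      fix z assume "z \<in> {z. ?\<kappa> z \<noteq> 0}"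
      moreover obtain j i l where z: "z = (j, i, l)" by (cases z) auto
      ultimately have "(case l of 0 \<Rightarrow> v' j i | Suc l \<Rightarrow> W' j i l) \<noteq> 0" by (auto simp: code_def)
      then show "z \<in> (\<Union>j\<in>{..L}. (\<lambda>(i, l). (j, i, Suc l)) ` {(i, l). W' j i l \<noteq> 0} \<union> (\<lambda>i. (j, i, 0)) ` {i. v' j i \<noteq> 0})"
      proof (cases l)
        case 0
        then have *: "v' j i \<noteq> 0" using \<open>(case l of 0 \<Rightarrow> v' j i | Suc l \<Rightarrow> W' j i l) \<noteq> 0\<close> by simp
        then have "(j, i, 0) \<in> (\<lambda>i. (j, i, 0)) ` {i. v' j i \<noteq> 0}" by (intro imageI) simp
        then show ?thesis using c(5) * unfolding z 0 by blast
      next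
        case (Suc l')
        then have *: "W' j i l' \<noteq> 0" using \<open>(case l of 0 \<Rightarrow> v' j i | Suc l \<Rightarrow> W' j i l) \<noteq> 0\<close> by simp
        then have "(j, i, Suc l') \<in> (\<lambda>(i, l). (j, i, Suc l)) ` {(i, l). W' j i l \<noteq> 0}"
          by (intro image_eqI[of _ _ "(i, l')"]) auto
        then show ?thesis using c(4) * unfolding z Suc by blast
      qed
    qed
    have fin: "finite {(i, l). W' j i l \<noteq> 0}" "finite {i. v' j i \<noteq> 0}" for j
    proof -
      have "finite ({..<w} \<times> {..<w})" by simp
      then show "finite {(i, l). W' j i l \<noteq> 0}" by (rule rev_finite_subset) (use c(4) in auto)
      have "finite {..<w}" by simp
      then show "finite {i. v' j i \<noteq> 0}" by (rule rev_finite_subset) (use c(5) in auto)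
    qed
    have "card {z. ?\<kappa> z \<noteq> 0} \<le> card (\<Union>j\<in>{..L}. (\<lambda>(i, l). (j, i, Suc l)) ` {(i, l). W' j i l \<noteq> 0} \<union> (\<lambda>i. (j, i, 0::nat)) ` {i. v' j i \<noteq> 0})"
      by (rule card_mono[OF _ nz]) (use fin in auto)
    also have "\<dots> \<le> (\<Sum>j\<le>L. card ((\<lambda>(i, l). (j, i, Suc l)) ` {(i, l). W' j i l \<noteq> 0} \<union> (\<lambda>i. (j, i, 0::nat)) ` {i. v' j i \<noteq> 0}))"
      by (rule card_UN_le) simp
    also have "\<dots> \<le> (\<Sum>j\<le>L. card {(i, l). W' j i l \<noteq> 0} + card {i. v' j i \<noteq> 0})"
      using fin by (intro sum_mono order_trans[OF card_Un_le] add_mono card_image_le) auto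
    finally have card: "card {z. ?\<kappa> z \<noteq> 0} \<le> ?S" using c(6) by linarith
    have rng: "\<lfloor>r / \<eta>\<rfloor> \<in> {- q..q}" if "\<bar>r\<bar> \<le> 1" for r
    proof -
      have "\<bar>r / \<eta>\<bar> \<le> 1 / \<eta>" using that \<eta> by (simp add: abs_divide divide_right_mono)
      also have "1 / \<eta> \<le> real_of_int q" unfolding q_def \<eta>_def by simp
      finally have "- real_of_int q \<le> r / \<eta>" "r / \<eta> \<le> real_of_int q" by linarith+
      then show ?thesis unfolding atLeastAtMost_iff by linarith
    qed
    have "range ?\<kappa> \<subseteq> {- q..q}"
    proof
      fix y assume "y \<in> range ?\<kappa>"
      then obtain j i l where "y = ?\<kappa> (j, i, l)" by auto
      then show "y \<in> {- q..q}" using rng c(1,2) by (cases l) (auto simp: code_def simp del: atLeastAtMost_iff)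
    qed
    moreover have "{z. ?\<kappa> z \<noteq> 0} \<subseteq> P" using nz c(4,5) unfolding P_def by fastforce
    ultimately show "\<exists>z. (\<forall>j i l. \<bar>fst z j i l\<bar> \<le> 1) \<and> (\<forall>j i. \<bar>snd z j i\<bar> \<le> 1) \<and> (\<forall>x. network p' (fst z) (snd z) L x 0 = f x 0) \<and>
      code (fst z) (snd z) \<in> ?K"
      using c(1,2,3) card f by (intro exI[of _ "(W', v')"]) simp
  qed
  from bchoice[OF this] obtain par where par: "\<forall>f\<in>?F. (\<forall>j i l. \<bar>fst (par f) j i l\<bar> \<le> 1) \<and> (\<forall>j i. \<bar>snd (par f) j i\<bar> \<le> 1) \<and>
    (\<forall>x. network p' (fst (par f)) (snd (par f)) L x 0 = f x 0) \<and> code (fst (par f)) (snd (par f)) \<in> ?K" by (elim exE)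
  define cd where "cd f = code (fst (par f)) (snd (par f))" for f
  define rep where "rep \<kappa> = (SOME f. f \<in> ?F \<and> cd f = \<kappa>)" for \<kappa>
  have rep: "rep (cd f) \<in> ?F \<and> cd (rep (cd f)) = cd f" if "f \<in> ?F" for f
    unfolding rep_def by (rule someI[of _ f]) (use that in simp)
  have V: "finite {- q..q}" "card {- q..q} = 2 * nat q + 1"
  proof -
    have "0 \<le> q" unfolding q_def using \<delta> w0 by (simp add: le_ceiling_iff less_le_trans[of _ 0])
    then show "card {- q..q} = 2 * nat q + 1" by simp
  qed simp
  note K = card_sparse_codes[OF finP(1,2) V(1), of ?S]
  have sub: "cd ` ?F \<subseteq> ?K" using par unfolding cd_def by blast
  have fin: "finite (cd ` ?F)" using sub K(1) by (rule finite_subset)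
  have "card (rep ` cd ` ?F) \<le> card (cd ` ?F)" by (rule card_image_le[OF fin])
  also have "\<dots> \<le> card ?K" by (rule card_mono[OF K(1) sub])
  also have "\<dots> \<le> (((L + 1) * w * (w + 1)) * (2 * nat q + 1)) ^ ?S" using K(2) unfolding finP(3) V(2) .
  finally have cardN: "card (rep ` cd ` ?F) \<le> (((L + 1) * w * (w + 1)) * (2 * nat q + 1)) ^ ?S" .
  have close: "\<bar>f x 0 - rep (cd f) x 0\<bar> \<le> \<delta>" if f: "f \<in> ?F" and x: "x \<in> cube d 0 1" for f x
  proof -
    let ?g = "rep (cd f)"
    have g: "?g \<in> ?F" "cd ?g = cd f" using rep[OF f] by auto
    have fl: "\<bar>r - r'\<bar> \<le> \<eta>" if "\<lfloor>r / \<eta>\<rfloor> = \<lfloor>r' / \<eta>\<rfloor>" for r r'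
    proof -
      have "\<bar>r / \<eta> - r' / \<eta>\<bar> \<le> 1" using that by linarith
      then show ?thesis using \<eta> by (simp add: abs_divide pos_divide_le_eq flip: diff_divide_distrib)
    qed
    have "\<bar>network p' (fst (par f)) (snd (par f)) L x 0 - network p' (fst (par ?g)) (snd (par ?g)) L x 0\<bar> \<le> \<eta> * (4 * real w) ^ (L + 1)"
    proof (rule network_lipschitz)
      show "p' l \<le> w" if "l \<le> L" for l using that w by (simp add: p'_def)
      show "\<bar>x i\<bar> \<le> 1" if "i < p' 0" for i using x that p' by (auto simp: cube_def PiE_iff)
      show "\<bar>fst (par f) j i l - fst (par ?g) j i l\<bar> \<le> \<eta>" for j i l
        using fun_cong[OF g(2), of "(j, i, Suc l)"] by (intro fl) (simp add: cd_def code_def)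
      show "\<bar>snd (par f) j i - snd (par ?g) j i\<bar> \<le> \<eta>" for j i
        using fun_cong[OF g(2), of "(j, i, 0)"] by (intro fl) (simp add: cd_def code_def)
    qed (use par f g(1) w p' in auto)
    moreover have "\<eta> * (4 * real w) ^ (L + 1) = \<delta>"
    proof -
      have "\<delta> / X * X = \<delta>" if "0 < X" for X using that by simp
      from this[OF w0] show ?thesis unfolding \<eta>_def .
    qed
    ultimately show ?thesis using par f g(1) by simp
  qed
  show ?thesis
  proof (intro exI[of _ "rep ` cd ` ?F"] conjI ballI)
    show "rep ` cd ` ?F \<subseteq> ?F" using rep by blast
    show "finite (rep ` cd ` ?F)" using fin by simp
    show "card (rep ` cd ` ?F) \<le> (((L + 1) * w * (w + 1)) * (2 * nat \<lceil>(4 * real w) ^ (L + 1) / \<delta>\<rceil> + 1)) ^ ?S"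
      using cardN unfolding q_def .
    show "\<exists>g\<in>rep ` cd ` ?F. \<forall>x\<in>cube d 0 1. \<bar>f x 0 - g x 0\<bar> \<le> \<delta>" if "f \<in> ?F" for f
      using close[OF that] that by blast
  qed
qed

section \<open>Risk bounds for estimators in a network class\<close>

lemma exp_minus_le: "0 \<le> u \<Longrightarrow> u \<le> 1 \<Longrightarrow> exp (- u) \<le> 1 - u / 2" for u :: real
proof -
  assume u: "0 \<le> u" "u \<le> 1"
  have "exp (- u) = 1 / exp u" by (simp add: exp_minus inverse_eq_divide)
  also have "\<dots> \<le> 1 / (1 + u)" using u by (intro divide_left_mono) (auto simp: exp_ge_add_one_self)
  also have "\<dots> \<le> 1 - u / 2"
  proof -
    have "0 \<le> u * (1 - u)" using u by simp
    then have "1 \<le> (1 - u / 2) * (1 + u)" by (simp add: algebra_simps)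
    then show ?thesis using u by (simp add: pos_divide_le_eq)
  qed
  finally show ?thesis .
qed

lemma exp_le_one_plus_double: "0 \<le> u \<Longrightarrow> u \<le> 1 \<Longrightarrow> exp u \<le> 1 + 2 * u" for u :: real
  using exp_bound[of u] mult_left_le[of u u] by (simp add: power2_eq_square)

lemma square_diff_le: "(a - c)\<^sup>2 \<le> 2 * (a - b)\<^sup>2 + 2 * (b - c)\<^sup>2" for a b c :: real
proof -
  have "2 * (a - b)\<^sup>2 + 2 * (b - c)\<^sup>2 - (a - c)\<^sup>2 = (a - 2 * b + c)\<^sup>2" by (simp add: power2_eq_square algebra_simps)
  then show ?thesis using zero_le_power2[of "a - 2 * b + c"] by linarith
qed

lemma square_le_of_abs: "\<bar>a\<bar> \<le> b \<Longrightarrow> a\<^sup>2 \<le> b\<^sup>2" for a b :: real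
  by (metis abs_ge_zero power2_abs power_mono)

lemma measurable_network:
  "(\<lambda>x. network p W v k x i) \<in> borel_measurable (cube_space d)" if "p 0 = d"
proof (induction k arbitrary: i)
  case 0
  have "(\<lambda>x. x j) \<in> borel_measurable (cube_space d)" if "j < d" for j
    unfolding cube_space_def using that
    by (intro measurable_compose[OF measurable_component_singleton] measurable_restrict_space1) auto
  then show ?case using \<open>p 0 = d\<close> by (cases "i < p 1") (auto simp: mat_vec_def)
next
  case (Suc k)
  have "(\<lambda>x. shifted_relu (p (k + 1)) (v (k + 1)) (network p W v k x) j) \<in> borel_measurable (cube_space d)" for j
    using Suc by (cases "j < p (k + 1)") (auto simp: shifted_relu_def)
  then show ?case by (cases "i < p (k + 2)") (auto simp: mat_vec_def)
qed

lemma network_class_measurable: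
  assumes "f \<in> network_class L p s F" "p 0 = d"
  shows "(\<lambda>x. f x 0) \<in> borel_measurable (cube_space d)"
  using assms measurable_network unfolding network_class_def by blast

lemma network_class_bound:
  assumes "f \<in> network_class L p s F" "p 0 = d" "0 < p (L + 1)" "x \<in> cube d 0 1"
  shows "\<bar>f x 0\<bar> \<le> F"
proof -
  have "\<bar>f x 0\<bar> \<le> sup_norm (p (L + 1)) (f x)"
    unfolding sup_norm_def using assms by (intro Max_ge) auto
  also have "\<dots> \<le> F" using assms unfolding network_class_def by blast
  finally show ?thesis .
qed

section \<open>Exponential moments of the observations\<close>

locale regression =
  fixes d n :: nat and P :: "(nat \<Rightarrow> real) measure" and f0 :: "(nat \<Rightarrow> real) \<Rightarrow> real" and F :: real
  assumes n: "0 < n" and P: "design_law d P" and f0 [measurable]: "f0 \<in> borel_measurable (cube_space d)"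
    and f0_bound: "\<And>x. x \<in> cube d 0 1 \<Longrightarrow> \<bar>f0 x\<bar> \<le> F" and F: "1 \<le> F"
begin

abbreviation "Obs \<equiv> observation_law d P f0"
abbreviation "Smp \<equiv> sample_law d P f0 n"

lemma sets_P [measurable_cong]: "sets P = sets (cube_space d)"
  using P by (simp add: design_law_def)

lemma space_P: "space P = cube d 0 1"
  using sets_eq_imp_space_eq[OF sets_P] by (simp add: space_cube_space)

sublocale P: prob_space P
  using P by (simp add: design_law_def)

sublocale N: prob_space std_normal
  by (rule prob_space_std_normal)

sublocale PN: pair_prob_space P std_normal ..

lemma obs_map [measurable]: "(\<lambda>(x, e). (x, f0 x + e)) \<in> P \<Otimes>\<^sub>M std_normal \<rightarrow>\<^sub>M cube_space d \<Otimes>\<^sub>M borel"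
  by measurable

sublocale Obs: prob_space Obs
  unfolding observation_law_def by (rule PN.prob_space_distr) (rule obs_map)

lemma sets_Obs [measurable_cong]: "sets Obs = sets (cube_space d \<Otimes>\<^sub>M borel)"
  by (simp add: observation_law_def)

lemma space_Obs: "space Obs = cube d 0 1 \<times> UNIV"
  by (simp add: observation_law_def space_pair_measure space_cube_space)

sublocale PiO: product_prob_space "\<lambda>_. Obs" "{..<n}"
  by unfold_locales

sublocale Smp: prob_space Smp
  unfolding sample_law_def by (intro prob_space_PiM Obs.prob_space_axioms)

lemma sets_Smp [measurable_cong]: "sets Smp = sets (sample_space d n)"
  unfolding sample_law_def sample_space_def by (intro sets_PiM_cong refl sets_Obs)

lemma space_Smp: "space Smp = space (sample_space d n)"
  by (rule sets_eq_imp_space_eq[OF sets_Smp])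

lemma Smp_nth: "z \<in> space Smp \<Longrightarrow> i < n \<Longrightarrow> fst (z i) \<in> cube d 0 1"
  unfolding sample_law_def by (force simp: space_PiM PiE_iff space_Obs)

lemma measurable_nth [measurable]: "i < n \<Longrightarrow> (\<lambda>z. z i) \<in> Smp \<rightarrow>\<^sub>M cube_space d \<Otimes>\<^sub>M borel"
  unfolding measurable_cong_sets[OF sets_Smp refl] sample_space_def
  by (rule measurable_component_singleton) simp

lemma nn_integral_Obs:
  assumes [measurable]: "h \<in> borel_measurable (cube_space d \<Otimes>\<^sub>M borel)"
  shows "(\<integral>\<^sup>+z. h z \<partial>Obs) = (\<integral>\<^sup>+x. \<integral>\<^sup>+e. h (x, f0 x + e) \<partial>std_normal \<partial>P)"
proof -
  have "(\<integral>\<^sup>+z. h z \<partial>Obs) = (\<integral>\<^sup>+w. h ((\<lambda>(x, e). (x, f0 x + e)) w) \<partial>(P \<Otimes>\<^sub>M std_normal))"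
    unfolding observation_law_def by (rule nn_integral_distr[OF obs_map]) simp
  also have "\<dots> = (\<integral>\<^sup>+x. \<integral>\<^sup>+e. h (x, f0 x + e) \<partial>std_normal \<partial>P)"
  proof -
    have "(\<lambda>w. h ((\<lambda>(x, e). (x, f0 x + e)) w)) \<in> borel_measurable (P \<Otimes>\<^sub>M std_normal)"
      by (rule measurable_compose[OF obs_map assms])
    from N.nn_integral_fst[OF this] show ?thesis by simp
  qed
  finally show ?thesis .
qed

lemma nn_integral_Obs_fst:
  assumes [measurable]: "h \<in> borel_measurable (cube_space d)"
  shows "(\<integral>\<^sup>+z. h (fst z) \<partial>Obs) = (\<integral>\<^sup>+x. h x \<partial>P)"
  by (subst nn_integral_Obs) (auto simp: N.emeasure_space_1)

lemma nn_integral_Smp_prod: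
  assumes [measurable]: "h \<in> borel_measurable (cube_space d \<Otimes>\<^sub>M borel)"
  shows "(\<integral>\<^sup>+z. (\<Prod>i<n. h (z i)) \<partial>Smp) = (\<integral>\<^sup>+z. h z \<partial>Obs) ^ n"
  unfolding sample_law_def using assms
  by (subst PiO.product_nn_integral_prod) (auto simp: measurable_cong_sets[OF sets_Obs refl])

text \<open>With \<open>Z j\<close> the exponential of the j-th sum, \<open>ln x \<le> x - 1\<close>
  at \<open>x = Z j / card J\<close> bounds every sum by the same variable: the average of all
  \<open>Z j\<close> plus \<open>ln (card J) - 1\<close>. Each \<open>Z j\<close> has mean at most
  1, and so has the average. Taking this variable in place of the maximum makes integrability
  immediate.\<close>

lemma exponential_bound:
  assumes J: "finite J" "J \<noteq> {}" and h: "\<And>j. j \<in> J \<Longrightarrow> h j \<in> borel_measurable (cube_space d \<Otimes>\<^sub>M borel)"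
    and e: "\<And>j. j \<in> J \<Longrightarrow> (\<integral>\<^sup>+z. ennreal (exp (h j z)) \<partial>Obs) \<le> 1"
  shows "\<exists>W. integrable Smp W \<and> (\<integral>z. W z \<partial>Smp) \<le> ln (real (card J)) \<and> (\<forall>z. \<forall>j\<in>J. (\<Sum>i<n. h j (z i)) \<le> W z)"
proof -
  define Z where "Z j z = exp (\<Sum>i<n. h j (z i))" for j and z :: "nat \<Rightarrow> (nat \<Rightarrow> real) \<times> real"
  have c: "0 < real (card J)" using J by (simp add: card_gt_0_iff)
  have Zm: "Z j \<in> borel_measurable Smp" if "j \<in> J" for j
    unfolding Z_def using h[OF that] by measurable
  have Z1: "(\<integral>\<^sup>+z. ennreal (Z j z) \<partial>Smp) \<le> 1" if j: "j \<in> J" for j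
  proof -
    note h[OF j, measurable]
    have "(\<integral>\<^sup>+z. ennreal (Z j z) \<partial>Smp) = (\<integral>\<^sup>+z. (\<Prod>i<n. ennreal (exp (h j (z i)))) \<partial>Smp)"
      unfolding Z_def by (simp add: exp_sum prod_ennreal)
    also have "\<dots> = (\<integral>\<^sup>+z. ennreal (exp (h j z)) \<partial>Obs) ^ n"
      by (rule nn_integral_Smp_prod) measurable
    also have "\<dots> \<le> 1" using e[OF j] by (rule power_le_one[rotated]) simp
    finally show ?thesis .
  qed
  have Zi: "integrable Smp (Z j)" if "j \<in> J" for j
    using Zm[OF that] Z1[OF that] by (intro integrableI_nonneg) (auto simp: Z_def intro: le_less_trans)
  have ZI: "(\<integral>z. Z j z \<partial>Smp) \<le> 1" if "j \<in> J" for j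
  proof -
    have "ennreal (\<integral>z. Z j z \<partial>Smp) = (\<integral>\<^sup>+z. ennreal (Z j z) \<partial>Smp)"
      by (rule nn_integral_eq_integral[symmetric, OF Zi[OF that]]) (simp add: Z_def)
    then have "ennreal (\<integral>z. Z j z \<partial>Smp) \<le> 1" using Z1[OF that] by (rule ord_eq_le_trans)
    then show ?thesis by (simp only: ennreal_le_1)
  qed
  define W where "W z = (\<Sum>j\<in>J. Z j z) / real (card J) + (ln (real (card J)) - 1)" for z
  have "integrable Smp W" unfolding W_def using Zi by simp
  moreover have "(\<integral>z. W z \<partial>Smp) \<le> ln (real (card J))"
  proof -
    have "(\<integral>z. W z \<partial>Smp) = (\<Sum>j\<in>J. \<integral>z. Z j z \<partial>Smp) / real (card J) + (ln (real (card J)) - 1)"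
      unfolding W_def using Zi by (simp add: Smp.prob_space)
    also have "(\<Sum>j\<in>J. \<integral>z. Z j z \<partial>Smp) \<le> (\<Sum>j\<in>J. 1)" by (intro sum_mono ZI)
    then have "(\<Sum>j\<in>J. \<integral>z. Z j z \<partial>Smp) / real (card J) \<le> 1" using c by (simp add: pos_divide_le_eq)
    finally show ?thesis by simp
  qed
  moreover have "(\<Sum>i<n. h j (z i)) \<le> W z" if j: "j \<in> J" for j z
  proof -
    have "ln (Z j z / real (card J)) \<le> Z j z / real (card J) - 1"
      using c by (intro ln_le_minus_one) (simp add: Z_def)
    also have "ln (Z j z / real (card J)) = (\<Sum>i<n. h j (z i)) - ln (real (card J))"
      using c by (simp add: ln_div Z_def)
    also have "Z j z \<le> (\<Sum>j\<in>J. Z j z)"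
      using J j by (intro member_le_sum) (auto simp: Z_def)
    then have "Z j z / real (card J) - 1 \<le> (\<Sum>j\<in>J. Z j z) / real (card J) - 1"
      using c by (simp add: divide_right_mono)
    finally show ?thesis by (simp add: W_def)
  qed
  ultimately show ?thesis by blast
qed

text \<open>The noise and the two empirical processes enter with a quadratic compensator, for which the
  exponential moments of a single observation are at most 1.\<close>

lemma exp_noise:
  assumes [measurable]: "g \<in> borel_measurable (cube_space d)"
  shows "(\<integral>\<^sup>+z. ennreal (exp (c * (snd z - f0 (fst z)) * g (fst z) - (c * g (fst z))\<^sup>2 / 2)) \<partial>Obs) \<le> 1"
proof -
  \<comment> \<open>Tilting the standard normal density by exp (a e - a^2/2) gives the normal
    density with mean a.\<close>
  have one: "(\<integral>\<^sup>+e. ennreal (exp (a * e - a\<^sup>2 / 2)) \<partial>std_normal) = 1" for a :: real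
  proof -
    have "(\<integral>\<^sup>+e. ennreal (exp (a * e - a\<^sup>2 / 2)) \<partial>std_normal)
        = (\<integral>\<^sup>+e. ennreal (std_normal_density e) * ennreal (exp (a * e - a\<^sup>2 / 2)) \<partial>lborel)"
      unfolding std_normal_def by (rule nn_integral_density) auto
    also have "\<dots> = (\<integral>\<^sup>+e. ennreal (normal_density a 1 e) \<partial>lborel)"
    proof (intro nn_integral_cong)
      fix e :: real
      have "std_normal_density e * exp (a * e - a\<^sup>2 / 2) = normal_density a 1 e"
        unfolding normal_density_def by (simp add: exp_add[symmetric] power2_eq_square field_simps)
      then show "ennreal (std_normal_density e) * ennreal (exp (a * e - a\<^sup>2 / 2)) = ennreal (normal_density a 1 e)"
        by (simp add: ennreal_mult'[symmetric])
    qed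
    also have "\<dots> = 1"
      using prob_space.emeasure_space_1[OF prob_space_normal_density[of 1 a]] by (simp add: emeasure_density)
    finally show ?thesis .
  qed
  have "(\<integral>\<^sup>+z. ennreal (exp (c * (snd z - f0 (fst z)) * g (fst z) - (c * g (fst z))\<^sup>2 / 2)) \<partial>Obs)
     = (\<integral>\<^sup>+x. \<integral>\<^sup>+e. ennreal (exp ((c * g x) * e - (c * g x)\<^sup>2 / 2)) \<partial>std_normal \<partial>P)"
    by (subst nn_integral_Obs) (auto simp: mult_ac)
  also have "\<dots> = 1" by (simp add: one P.emeasure_space_1)
  finally show ?thesis by simp
qed

text \<open>On [0, 1] one has exp (-u) \<le> 1 - u/2 and exp u \<le> 1 + 2 u, so the exponentials
  are bounded by affine functions of g, whose mean is known. Then 1 + x \<le> exp x at the mean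
  cancels the deterministic factor. This is why each distance is compared with twice the
  other.\<close>

lemma exp_population:
  assumes [measurable]: "g \<in> borel_measurable (cube_space d)" and B: "0 < B" "\<And>x. x \<in> cube d 0 1 \<Longrightarrow> 0 \<le> g x \<and> g x \<le> B"
  shows "(\<integral>\<^sup>+z. ennreal (exp (((\<integral>x. g x \<partial>P) - 2 * g (fst z)) / (2 * B))) \<partial>Obs) \<le> 1"
    and "(\<integral>\<^sup>+z. ennreal (exp ((g (fst z) - 2 * (\<integral>x. g x \<partial>P)) / B)) \<partial>Obs) \<le> 1"
proof -
  define m where "m = (\<integral>x. g x \<partial>P)"
  have gi: "integrable P g"
    by (rule P.integrable_const_bound[of _ B]) (use B in \<open>auto simp: space_P intro!: AE_I2\<close>)
  have m0: "0 \<le> m" unfolding m_def using B by (intro integral_nonneg_AE AE_I2) (auto simp: space_P)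
  have le1: "(\<integral>\<^sup>+x. ennreal (exp (r x)) \<partial>P) \<le> 1"
    if "\<And>x. x \<in> cube d 0 1 \<Longrightarrow> exp (r x) \<le> a * (1 + b * g x)" "a * (1 + b * m) \<le> 1" for r a b
  proof -
    have "(\<integral>\<^sup>+x. ennreal (exp (r x)) \<partial>P) \<le> (\<integral>\<^sup>+x. ennreal (a * (1 + b * g x)) \<partial>P)"
      using that(1) by (intro nn_integral_mono ennreal_leI) (auto simp: space_P)
    also have "\<dots> = ennreal (\<integral>x. a * (1 + b * g x) \<partial>P)"
    proof (rule nn_integral_eq_integral)
      show "AE x in P. 0 \<le> a * (1 + b * g x)"
        using that(1) by (intro AE_I2) (auto simp: space_P intro: order_trans[OF exp_ge_zero])
    qed (use gi in simp)
    also have "(\<integral>x. a * (1 + b * g x) \<partial>P) = a * (1 + b * m)"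
      using gi by (simp add: m_def P.prob_space)
    finally show ?thesis using that(2) by (meson ennreal_le_1 order_trans)
  qed
  have "(\<integral>\<^sup>+x. ennreal (exp ((m - 2 * g x) / (2 * B))) \<partial>P) \<le> 1"
  proof (rule le1[of _ "exp (m / (2 * B))" "- (1 / (2 * B))"])
    fix x assume "x \<in> cube d 0 1"
    then have "exp (- (g x / B)) \<le> 1 - (g x / B) / 2" using B by (intro exp_minus_le) auto
    then have "exp (m / (2 * B)) * exp (- (g x / B)) \<le> exp (m / (2 * B)) * (1 - (g x / B) / 2)" by (intro mult_left_mono) auto
    moreover have "exp ((m - 2 * g x) / (2 * B)) = exp (m / (2 * B)) * exp (- (g x / B))"
      using B by (simp add: exp_add[symmetric] diff_divide_distrib)
    ultimately show "exp ((m - 2 * g x) / (2 * B)) \<le> exp (m / (2 * B)) * (1 + - (1 / (2 * B)) * g x)" by simp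
  next
    have "1 + - (1 / (2 * B)) * m \<le> exp (- (m / (2 * B)))" using exp_ge_add_one_self[of "- (m / (2 * B))"] by simp
    then have "exp (m / (2 * B)) * (1 + - (1 / (2 * B)) * m) \<le> exp (m / (2 * B)) * exp (- (m / (2 * B)))" by (intro mult_left_mono) auto
    then show "exp (m / (2 * B)) * (1 + - (1 / (2 * B)) * m) \<le> 1" by (simp add: exp_add[symmetric])
  qed
  then show "(\<integral>\<^sup>+z. ennreal (exp (((\<integral>x. g x \<partial>P) - 2 * g (fst z)) / (2 * B))) \<partial>Obs) \<le> 1"
    by (subst nn_integral_Obs_fst[of "\<lambda>x. ennreal (exp (((\<integral>x. g x \<partial>P) - 2 * g x) / (2 * B)))"]) (auto simp: m_def)
  have "(\<integral>\<^sup>+x. ennreal (exp ((g x - 2 * m) / B)) \<partial>P) \<le> 1"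
  proof (rule le1[of _ "exp (- (2 * m / B))" "2 / B"])
    fix x assume "x \<in> cube d 0 1"
    then have "exp (g x / B) \<le> 1 + 2 * (g x / B)" using B by (intro exp_le_one_plus_double) auto
    then have "exp (- (2 * m / B)) * exp (g x / B) \<le> exp (- (2 * m / B)) * (1 + 2 * (g x / B))" by (intro mult_left_mono) auto
    moreover have "exp ((g x - 2 * m) / B) = exp (- (2 * m / B)) * exp (g x / B)"
      by (simp add: exp_add[symmetric] diff_divide_distrib)
    ultimately show "exp ((g x - 2 * m) / B) \<le> exp (- (2 * m / B)) * (1 + 2 / B * g x)" by simp
  next
    have "1 + 2 / B * m \<le> exp (2 * m / B)" using exp_ge_add_one_self[of "2 * m / B"] by simp
    then have "exp (- (2 * m / B)) * (1 + 2 / B * m) \<le> exp (- (2 * m / B)) * exp (2 * m / B)" by (intro mult_left_mono) auto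
    then show "exp (- (2 * m / B)) * (1 + 2 / B * m) \<le> 1" by (simp add: exp_add[symmetric])
  qed
  then show "(\<integral>\<^sup>+z. ennreal (exp ((g (fst z) - 2 * (\<integral>x. g x \<partial>P)) / B)) \<partial>Obs) \<le> 1"
    by (subst nn_integral_Obs_fst[of "\<lambda>x. ennreal (exp ((g x - 2 * (\<integral>x. g x \<partial>P)) / B))"]) (auto simp: m_def)
qed

lemma noise_second_moment:
  shows "integrable Obs (\<lambda>z. (snd z - f0 (fst z))\<^sup>2)" and "(\<integral>z. (snd z - f0 (fst z))\<^sup>2 \<partial>Obs) = 1"
proof -
  have one: "(\<integral>\<^sup>+e. ennreal (e\<^sup>2) \<partial>std_normal) = 1"
  proof -
    have "(\<integral>\<^sup>+e. ennreal (e\<^sup>2) \<partial>std_normal) = (\<integral>\<^sup>+e. ennreal (std_normal_density e * e\<^sup>2) \<partial>lborel)"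
      unfolding std_normal_def by (subst nn_integral_density) (auto simp: ennreal_mult')
    also have "\<dots> = ennreal (\<integral>e. std_normal_density e * e\<^sup>2 \<partial>lborel)"
      using std_normal_moment_even[of 1] by (intro nn_integral_eq_integral) (auto simp: has_bochner_integral_iff)
    also have "(\<integral>e. std_normal_density e * e\<^sup>2 \<partial>lborel) = 1"
      using std_normal_moment_even[of 1] by (simp add: has_bochner_integral_iff)
    finally show ?thesis by simp
  qed
  have nn: "(\<integral>\<^sup>+z. ennreal ((snd z - f0 (fst z))\<^sup>2) \<partial>Obs) = 1"
    by (subst nn_integral_Obs) (auto simp: one P.emeasure_space_1)
  have m: "(\<lambda>z. (snd z - f0 (fst z))\<^sup>2) \<in> borel_measurable Obs"
    unfolding measurable_cong_sets[OF sets_Obs refl] by measurable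
  show "integrable Obs (\<lambda>z. (snd z - f0 (fst z))\<^sup>2)" using m by (rule integrableI_nonneg) (auto simp: nn)
  have "(\<integral>z. (snd z - f0 (fst z))\<^sup>2 \<partial>Obs) = enn2real (\<integral>\<^sup>+z. ennreal ((snd z - f0 (fst z))\<^sup>2) \<partial>Obs)"
    using m by (intro integral_eq_nn_integral) auto
  then show "(\<integral>z. (snd z - f0 (fst z))\<^sup>2 \<partial>Obs) = 1" by (simp add: nn)
qed

end

lemma abs_two_diff_le: "\<bar>a\<bar> \<le> F \<Longrightarrow> \<bar>b\<bar> \<le> F \<Longrightarrow> \<bar>2 * y - a - b\<bar> \<le> 2 * (\<bar>y\<bar> + F)" for a b y F :: real
proof -
  assume "\<bar>a\<bar> \<le> F" "\<bar>b\<bar> \<le> F"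
  then have ab: "- F \<le> a" "a \<le> F" "- F \<le> b" "b \<le> F" by (simp_all add: abs_le_iff)
  have "2 * y - a - b \<le> 2 * (r + F) \<and> - (2 * y - a - b) \<le> 2 * (r + F)" if "y \<le> r" "- y \<le> r" for r
    using ab that by argo
  from this[OF abs_ge_self abs_ge_minus_self] show ?thesis by (simp add: abs_le_iff)
qed

section \<open>Empirical and population distances\<close>

context regression
begin

definition noise :: "sample \<Rightarrow> nat \<Rightarrow> real" where
  "noise z i = snd (z i) - f0 (fst (z i))"

definition emp_dist :: "((nat \<Rightarrow> real) \<Rightarrow> nat \<Rightarrow> real) \<Rightarrow> sample \<Rightarrow> real" where
  "emp_dist f z = (\<Sum>i<n. (f (fst (z i)) 0 - f0 (fst (z i)))\<^sup>2) / real n"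

definition noise_corr :: "((nat \<Rightarrow> real) \<Rightarrow> nat \<Rightarrow> real) \<Rightarrow> sample \<Rightarrow> real" where
  "noise_corr f z = (\<Sum>i<n. noise z i * (f (fst (z i)) 0 - f0 (fst (z i)))) / real n"

definition pop_dist :: "((nat \<Rightarrow> real) \<Rightarrow> nat \<Rightarrow> real) \<Rightarrow> real" where
  "pop_dist f = (\<integral>x. (f x 0 - f0 x)\<^sup>2 \<partial>P)"

text \<open>An upper bound for the average absolute noise, by 2 |e| \<le> 1 + e^2, with mean exactly
  1.\<close>

definition noise_level :: "sample \<Rightarrow> real" where
  "noise_level z = (\<Sum>i<n. (1 + (noise z i)\<^sup>2) / 2) / real n"

lemma n_pos: "0 < real n"
  using n by simp

text \<open>The last term does not depend on f, so it cancels in every difference of empirical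
  risks.\<close>

lemma empirical_risk_eq:
  "empirical_risk n z f = emp_dist f z - 2 * noise_corr f z + (\<Sum>i<n. (noise z i)\<^sup>2) / real n"
proof -
  have "(\<Sum>i<n. (snd (z i) - f (fst (z i)) 0)\<^sup>2) = (\<Sum>i<n. (f (fst (z i)) 0 - f0 (fst (z i)))\<^sup>2)
     - 2 * (\<Sum>i<n. noise z i * (f (fst (z i)) 0 - f0 (fst (z i)))) + (\<Sum>i<n. (noise z i)\<^sup>2)"
    unfolding sum_distrib_left sum_subtractf[symmetric] sum.distrib[symmetric]
    by (intro sum.cong refl) (simp add: noise_def power2_eq_square algebra_simps)
  then show ?thesis
    by (simp add: empirical_risk_def emp_dist_def noise_corr_def add_divide_distrib diff_divide_distrib)
qed

lemma integrable_Smp_nth: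
  fixes h :: "(nat \<Rightarrow> real) \<times> real \<Rightarrow> real"
  assumes "integrable Obs h" "i < n"
  shows "integrable Smp (\<lambda>z. h (z i))" and "(\<integral>z. h (z i) \<partial>Smp) = (\<integral>z. h z \<partial>Obs)"
proof -
  have D: "distr Smp Obs (\<lambda>z. z i) = Obs"
    unfolding sample_law_def using assms(2) by (intro distr_PiM_component Obs.prob_space_axioms) auto
  have m: "(\<lambda>z. z i) \<in> Smp \<rightarrow>\<^sub>M Obs"
    unfolding sample_law_def using assms(2) by (intro measurable_component_singleton) simp
  have hm: "h \<in> borel_measurable Obs" using assms(1) by auto
  show "integrable Smp (\<lambda>z. h (z i))"
    using integrable_distr_eq[OF m hm] assms(1) by (simp add: D)
  show "(\<integral>z. h (z i) \<partial>Smp) = (\<integral>z. h z \<partial>Obs)"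
    using integral_distr[OF m hm] by (simp add: D)
qed

lemma noise_level_integral: "integrable Smp noise_level" "(\<integral>z. noise_level z \<partial>Smp) = 1"
proof -
  note i = integrable_Smp_nth[OF noise_second_moment(1)]
  show "integrable Smp noise_level"
    unfolding noise_level_def noise_def using i(1) by (intro integrable_divide integrable_sum integrable_add) auto
  have "(\<integral>z. noise_level z \<partial>Smp) = (\<Sum>i<n. \<integral>z. (1 + (noise z i)\<^sup>2) / 2 \<partial>Smp) / real n"
    unfolding noise_level_def noise_def using i(1) by (subst integral_divide_zero, subst Bochner_Integration.integral_sum) auto
  also have "\<dots> = (\<Sum>i<n. 1) / real n"
    using i noise_second_moment(2) by (intro arg_cong2[where f = "(/)"] sum.cong refl) (simp add: noise_def Smp.prob_space)
  finally show "(\<integral>z. noise_level z \<partial>Smp) = 1" using n_pos by simp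
qed

lemma noise_corr_diff:
  assumes "\<And>i. i < n \<Longrightarrow> \<bar>f (fst (z i)) 0 - g (fst (z i)) 0\<bar> \<le> \<delta>"
  shows "\<bar>noise_corr f z\<bar> \<le> \<bar>noise_corr g z\<bar> + \<delta> * noise_level z"
proof -
  have "noise_corr f z - noise_corr g z = (\<Sum>i<n. noise z i * (f (fst (z i)) 0 - g (fst (z i)) 0)) / real n"
    unfolding noise_corr_def diff_divide_distrib[symmetric] sum_subtractf[symmetric]
    by (intro arg_cong2[where f = "(/)"] sum.cong refl) (simp add: algebra_simps)
  also have "\<bar>\<dots>\<bar> \<le> (\<Sum>i<n. ((1 + (noise z i)\<^sup>2) / 2) * \<delta>) / real n"
    unfolding abs_divide
  proof (intro frac_le order_trans[OF sum_abs sum_mono] sum_nonneg)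
    fix i assume i: "i \<in> {..<n}"
    have \<delta>: "0 \<le> \<delta>" using assms[of i] i by force
    then show "0 \<le> (1 + (noise z i)\<^sup>2) / 2 * \<delta>" by simp
    have "0 \<le> (1 - \<bar>noise z i\<bar>)\<^sup>2" by simp
    then have "\<bar>noise z i\<bar> \<le> (1 + (noise z i)\<^sup>2) / 2" by (simp add: power2_eq_square algebra_simps)
    then show "\<bar>noise z i * (f (fst (z i)) 0 - g (fst (z i)) 0)\<bar> \<le> (1 + (noise z i)\<^sup>2) / 2 * \<delta>"
      unfolding abs_mult using assms[of i] i \<delta> by (intro mult_mono) auto
  qed (use n_pos in auto)
  also have "\<dots> = \<delta> * noise_level z" unfolding noise_level_def by (simp add: sum_distrib_left mult_ac)
  finally show ?thesis by linarith
qed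

lemma emp_dist_diff:
  assumes "\<And>i. i < n \<Longrightarrow> \<bar>f (fst (z i)) 0 - g (fst (z i)) 0\<bar> \<le> \<delta>"
  shows "emp_dist f z \<le> 2 * \<delta>\<^sup>2 + 2 * emp_dist g z"
proof -
  have "(\<Sum>i<n. (f (fst (z i)) 0 - f0 (fst (z i)))\<^sup>2) \<le> (\<Sum>i<n. 2 * \<delta>\<^sup>2 + 2 * (g (fst (z i)) 0 - f0 (fst (z i)))\<^sup>2)"
  proof (rule sum_mono)
    fix i assume "i \<in> {..<n}"
    then have "(f (fst (z i)) 0 - g (fst (z i)) 0)\<^sup>2 \<le> \<delta>\<^sup>2" using assms[of i] by (intro square_le_of_abs) auto
    then show "(f (fst (z i)) 0 - f0 (fst (z i)))\<^sup>2 \<le> 2 * \<delta>\<^sup>2 + 2 * (g (fst (z i)) 0 - f0 (fst (z i)))\<^sup>2"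
      using square_diff_le[of "f (fst (z i)) 0" "f0 (fst (z i))" "g (fst (z i)) 0"] by linarith
  qed
  also have "\<dots> = real n * (2 * \<delta>\<^sup>2) + 2 * (\<Sum>i<n. (g (fst (z i)) 0 - f0 (fst (z i)))\<^sup>2)"
    by (simp add: sum.distrib sum_distrib_left)
  finally have "emp_dist f z \<le> (real n * (2 * \<delta>\<^sup>2) + 2 * (\<Sum>i<n. (g (fst (z i)) 0 - f0 (fst (z i)))\<^sup>2)) / real n"
    unfolding emp_dist_def using n_pos by (intro divide_right_mono) auto
  also have "\<dots> = 2 * \<delta>\<^sup>2 + 2 * emp_dist g z" unfolding emp_dist_def using n_pos by (simp add: add_divide_distrib)
  finally show ?thesis .
qed

lemma emp_dist_nonneg: "0 \<le> emp_dist f z"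
  by (auto simp: emp_dist_def intro!: sum_nonneg divide_nonneg_nonneg)

context
  fixes \<F> :: "((nat \<Rightarrow> real) \<Rightarrow> nat \<Rightarrow> real) set"
  assumes meas: "\<forall>f\<in>\<F>. (\<lambda>x. f x 0) \<in> borel_measurable (cube_space d)"
    and bound: "\<forall>f\<in>\<F>. \<forall>x\<in>cube d 0 1. \<bar>f x 0\<bar> \<le> F"
begin

lemma sq_bound: "f \<in> \<F> \<Longrightarrow> x \<in> cube d 0 1 \<Longrightarrow> (f x 0 - f0 x)\<^sup>2 \<le> 4 * F\<^sup>2"
proof -
  assume "f \<in> \<F>" "x \<in> cube d 0 1"
  then have "\<bar>f x 0 - f0 x\<bar> \<le> 2 * F" using bspec[OF bspec[OF bound], of f x] f0_bound[of x] by linarith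
  from square_le_of_abs[OF this] show ?thesis by (simp add: power_mult_distrib)
qed

lemma sq_measurable: "f \<in> \<F> \<Longrightarrow> (\<lambda>x. (f x 0 - f0 x)\<^sup>2) \<in> borel_measurable (cube_space d)"
  using meas f0 by (intro borel_measurable_power borel_measurable_diff) auto

lemma sq_integrable: "f \<in> \<F> \<Longrightarrow> integrable P (\<lambda>x. (f x 0 - f0 x)\<^sup>2)"
  by (rule P.integrable_const_bound[of _ "4 * F\<^sup>2"])
    (use sq_bound sq_measurable in \<open>auto simp: space_P measurable_cong_sets[OF sets_P refl] intro!: AE_I2\<close>)

lemma pop_dist_diff:
  assumes f: "f \<in> \<F>" and g: "g \<in> \<F>" and "\<And>x. x \<in> cube d 0 1 \<Longrightarrow> \<bar>f x 0 - g x 0\<bar> \<le> \<delta>"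
  shows "pop_dist f \<le> 2 * \<delta>\<^sup>2 + 2 * pop_dist g"
proof -
  have "pop_dist f \<le> (\<integral>x. 2 * \<delta>\<^sup>2 + 2 * (g x 0 - f0 x)\<^sup>2 \<partial>P)"
    unfolding pop_dist_def
  proof (rule integral_mono)
    fix x assume "x \<in> space P"
    then have "(f x 0 - g x 0)\<^sup>2 \<le> \<delta>\<^sup>2" using assms(3) by (intro square_le_of_abs) (simp add: space_P)
    then show "(f x 0 - f0 x)\<^sup>2 \<le> 2 * \<delta>\<^sup>2 + 2 * (g x 0 - f0 x)\<^sup>2"
      using square_diff_le[of "f x 0" "f0 x" "g x 0"] by linarith
  qed (use sq_integrable[OF f] sq_integrable[OF g] in auto)
  also have "\<dots> = 2 * \<delta>\<^sup>2 + 2 * pop_dist g"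
    using sq_integrable[OF g] by (simp add: pop_dist_def P.prob_space)
  finally show ?thesis .
qed

lemma emp_measurable: "f \<in> \<F> \<Longrightarrow> (\<lambda>z. empirical_risk n z f) \<in> borel_measurable Smp"
proof -
  assume "f \<in> \<F>"
  note bspec[OF meas this, measurable]
  have "(\<lambda>w. (snd w - f (fst w) 0)\<^sup>2) \<in> borel_measurable (cube_space d \<Otimes>\<^sub>M borel)" by measurable
  from measurable_compose[OF measurable_nth this]
  show "(\<lambda>z. empirical_risk n z f) \<in> borel_measurable Smp"
    unfolding empirical_risk_def by (intro borel_measurable_times borel_measurable_const borel_measurable_sum) auto
qed

text \<open>The two signs give the absolute value and the factor 2 under the logarithm. The tilt 1/4
  leaves a compensator with factor 1/32, and after multiplication by 4 this is an eighth of
  \<open>emp_dist\<close>.\<close>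

lemma noise_bound:
  assumes N: "N \<subseteq> \<F>" "finite N" "N \<noteq> {}"
  shows "\<exists>W. integrable Smp W \<and> (\<integral>z. W z \<partial>Smp) \<le> ln (2 * real (card N)) \<and>
    (\<forall>z. \<forall>g\<in>N. \<bar>noise_corr g z\<bar> \<le> 4 * (W z / real n) + emp_dist g z / 8)"
proof -
  define h where "h j w = (snd j / 4) * (snd w - f0 (fst w)) * (fst j (fst w) 0 - f0 (fst w)) - ((snd j / 4) * (fst j (fst w) 0 - f0 (fst w)))\<^sup>2 / 2"
    for j :: "((nat \<Rightarrow> real) \<Rightarrow> nat \<Rightarrow> real) \<times> real" and w :: "(nat \<Rightarrow> real) \<times> real"
  let ?J = "N \<times> {1, - 1 :: real}"
  have "\<exists>W. integrable Smp W \<and> (\<integral>z. W z \<partial>Smp) \<le> ln (real (card ?J)) \<and> (\<forall>z. \<forall>j\<in>?J. (\<Sum>i<n. h j (z i)) \<le> W z)"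
  proof (rule exponential_bound)
    fix j assume "j \<in> ?J"
    then have j: "fst j \<in> \<F>" using N by auto
    note bspec[OF meas j, measurable]
    show "h j \<in> borel_measurable (cube_space d \<Otimes>\<^sub>M borel)" unfolding h_def by measurable
    show "(\<integral>\<^sup>+z. ennreal (exp (h j z)) \<partial>Obs) \<le> 1"
      unfolding h_def by (rule exp_noise[of "\<lambda>x. fst j x 0 - f0 x"]) measurable
  qed (use N in auto)
  then obtain W where W: "integrable Smp W" "(\<integral>z. W z \<partial>Smp) \<le> ln (real (card ?J))" "\<forall>z. \<forall>j\<in>?J. (\<Sum>i<n. h j (z i)) \<le> W z" by blast
  have "\<bar>noise_corr g z\<bar> \<le> 4 * (W z / real n) + emp_dist g z / 8" if g: "g \<in> N" for g z
  proof -
    have "\<sigma> * noise_corr g z \<le> 4 * (W z / real n) + emp_dist g z / 8" if \<sigma>: "\<sigma> \<in> {1, - 1 :: real}" for \<sigma>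
    proof -
      have s2: "\<sigma> * \<sigma> = 1" using \<sigma> by auto
      have "(\<Sum>i<n. h (g, \<sigma>) (z i)) = (\<Sum>i<n. \<sigma> / 4 * (noise z i * (g (fst (z i)) 0 - f0 (fst (z i)))) - (g (fst (z i)) 0 - f0 (fst (z i)))\<^sup>2 / 32)"
      proof (intro sum.cong refl)
        fix i
        have sq: "(\<sigma> / 4 * y)\<^sup>2 / 2 = y\<^sup>2 / 32" for y :: real
        proof -
          have "(\<sigma> / 4 * y)\<^sup>2 / 2 = (\<sigma> * \<sigma>) * y\<^sup>2 / 32" by (simp add: power2_eq_square)
          then show ?thesis unfolding s2 by simp
        qed
        show "h (g, \<sigma>) (z i) = \<sigma> / 4 * (noise z i * (g (fst (z i)) 0 - f0 (fst (z i)))) - (g (fst (z i)) 0 - f0 (fst (z i)))\<^sup>2 / 32"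
          unfolding h_def fst_conv snd_conv sq noise_def by (simp add: mult_ac)
      qed
      also have "\<dots> = real n * (\<sigma> / 4 * noise_corr g z - emp_dist g z / 32)"
      proof -
        define A where "A = (\<Sum>i<n. noise z i * (g (fst (z i)) 0 - f0 (fst (z i))))"
        define B where "B = (\<Sum>i<n. (g (fst (z i)) 0 - f0 (fst (z i)))\<^sup>2)"
        have "(\<Sum>i<n. \<sigma> / 4 * (noise z i * (g (fst (z i)) 0 - f0 (fst (z i)))) - (g (fst (z i)) 0 - f0 (fst (z i)))\<^sup>2 / 32) = \<sigma> / 4 * A - B / 32"
          unfolding A_def B_def by (simp only: sum_subtractf sum_distrib_left sum_divide_distrib)
        also have "\<dots> = real n * (\<sigma> / 4 * (A / real n) - B / real n / 32)" using n_pos by (simp add: field_simps)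
        finally show ?thesis unfolding noise_corr_def emp_dist_def A_def B_def .
      qed
      finally have eq: "(\<Sum>i<n. h (g, \<sigma>) (z i)) = real n * (\<sigma> / 4 * noise_corr g z - emp_dist g z / 32)" .
      have "(g, \<sigma>) \<in> ?J" using g \<sigma> by blast
      with W(3) have "(\<Sum>i<n. h (g, \<sigma>) (z i)) \<le> W z" by blast
      then have "real n * (\<sigma> / 4 * noise_corr g z - emp_dist g z / 32) \<le> W z" unfolding eq .
      then have "\<sigma> / 4 * noise_corr g z - emp_dist g z / 32 \<le> W z / real n" using n_pos by (simp add: pos_le_divide_eq mult.commute)
      then show ?thesis by linarith
    qed
    from this[of 1] this[of "- 1"] show ?thesis by (simp add: abs_le_iff)
  qed
  moreover have "card ?J = 2 * card N" using N by (simp add: card_cartesian_product)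
  ultimately show ?thesis using W(1,2) by (intro exI[of _ W]) simp
qed

text \<open>An instance of \<open>exp_population\<close> with B = 4 F^2, the bound on the squared
  distance of two functions bounded by \<open>F\<close>.\<close>

lemma population_bound:
  assumes N: "N \<subseteq> \<F>" "finite N" "N \<noteq> {}"
  shows "\<exists>W. integrable Smp W \<and> (\<integral>z. W z \<partial>Smp) \<le> ln (real (card N)) \<and>
    (\<forall>z. \<forall>g\<in>N. pop_dist g \<le> 2 * emp_dist g z + 8 * F\<^sup>2 * (W z / real n))"
proof -
  define h where "h g w = (pop_dist g - 2 * (g (fst w) 0 - f0 (fst w))\<^sup>2) / (2 * (4 * F\<^sup>2))"
    for g :: "(nat \<Rightarrow> real) \<Rightarrow> nat \<Rightarrow> real" and w :: "(nat \<Rightarrow> real) \<times> real"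
  have F2: "0 < 4 * F\<^sup>2" using F by simp
  have "\<exists>W. integrable Smp W \<and> (\<integral>z. W z \<partial>Smp) \<le> ln (real (card N)) \<and> (\<forall>z. \<forall>j\<in>N. (\<Sum>i<n. h j (z i)) \<le> W z)"
  proof (rule exponential_bound)
    fix g assume "g \<in> N"
    then have g: "g \<in> \<F>" using N by auto
    note bspec[OF meas g, measurable]
    show "h g \<in> borel_measurable (cube_space d \<Otimes>\<^sub>M borel)" unfolding h_def by measurable
    show "(\<integral>\<^sup>+z. ennreal (exp (h g z)) \<partial>Obs) \<le> 1"
      unfolding h_def pop_dist_def using sq_bound[OF g]
      by (intro exp_population(1)[of "\<lambda>x. (g x 0 - f0 x)\<^sup>2", OF sq_measurable[OF g] F2]) auto
  qed (use N in auto)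
  then obtain W where W: "integrable Smp W" "(\<integral>z. W z \<partial>Smp) \<le> ln (real (card N))" "\<forall>z. \<forall>g\<in>N. (\<Sum>i<n. h g (z i)) \<le> W z" by blast
  have "pop_dist g \<le> 2 * emp_dist g z + 8 * F\<^sup>2 * (W z / real n)" if g: "g \<in> N" for g z
  proof -
    have "(\<Sum>i<n. h g (z i)) = real n * (pop_dist g - 2 * emp_dist g z) / (8 * F\<^sup>2)"
      using n_pos unfolding h_def emp_dist_def by (simp add: sum_subtractf right_diff_distrib flip: sum_distrib_left sum_divide_distrib)
    then have "real n * (pop_dist g - 2 * emp_dist g z) / (8 * F\<^sup>2) \<le> W z" using W(3) g by metis
    then have "pop_dist g - 2 * emp_dist g z \<le> 8 * F\<^sup>2 * W z / real n" using n_pos F2 by (simp add: field_simps)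
    then show ?thesis by simp
  qed
  then show ?thesis using W(1,2) by blast
qed

lemma empirical_bound:
  assumes N: "N \<subseteq> \<F>" "finite N" "N \<noteq> {}"
  shows "\<exists>W. integrable Smp W \<and> (\<integral>z. W z \<partial>Smp) \<le> ln (real (card N)) \<and>
    (\<forall>z. \<forall>g\<in>N. emp_dist g z \<le> 2 * pop_dist g + 4 * F\<^sup>2 * (W z / real n))"
proof -
  define h where "h g w = ((g (fst w) 0 - f0 (fst w))\<^sup>2 - 2 * pop_dist g) / (4 * F\<^sup>2)"
    for g :: "(nat \<Rightarrow> real) \<Rightarrow> nat \<Rightarrow> real" and w :: "(nat \<Rightarrow> real) \<times> real"
  have F2: "0 < 4 * F\<^sup>2" using F by simp
  have "\<exists>W. integrable Smp W \<and> (\<integral>z. W z \<partial>Smp) \<le> ln (real (card N)) \<and> (\<forall>z. \<forall>j\<in>N. (\<Sum>i<n. h j (z i)) \<le> W z)"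
  proof (rule exponential_bound)
    fix g assume "g \<in> N"
    then have g: "g \<in> \<F>" using N by auto
    note bspec[OF meas g, measurable]
    show "h g \<in> borel_measurable (cube_space d \<Otimes>\<^sub>M borel)" unfolding h_def by measurable
    show "(\<integral>\<^sup>+z. ennreal (exp (h g z)) \<partial>Obs) \<le> 1"
      unfolding h_def pop_dist_def using sq_bound[OF g]
      by (intro exp_population(2)[of "\<lambda>x. (g x 0 - f0 x)\<^sup>2", OF sq_measurable[OF g] F2]) auto
  qed (use N in auto)
  then obtain W where W: "integrable Smp W" "(\<integral>z. W z \<partial>Smp) \<le> ln (real (card N))" "\<forall>z. \<forall>g\<in>N. (\<Sum>i<n. h g (z i)) \<le> W z" by blast
  have "emp_dist g z \<le> 2 * pop_dist g + 4 * F\<^sup>2 * (W z / real n)" if g: "g \<in> N" for g z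
  proof -
    have "(\<Sum>i<n. h g (z i)) = real n * (emp_dist g z - 2 * pop_dist g) / (4 * F\<^sup>2)"
      using n_pos unfolding h_def emp_dist_def by (simp add: sum_subtractf right_diff_distrib flip: sum_distrib_left sum_divide_distrib)
    then have "real n * (emp_dist g z - 2 * pop_dist g) / (4 * F\<^sup>2) \<le> W z" using W(3) g by metis
    then have "emp_dist g z - 2 * pop_dist g \<le> 4 * F\<^sup>2 * W z / real n" using n_pos F2 by (simp add: field_simps)
    then show ?thesis by simp
  qed
  then show ?thesis using W(1,2) by blast
qed

lemma empirical_risk_nonneg: "0 \<le> empirical_risk n z f"
  by (auto simp: empirical_risk_def intro!: divide_nonneg_nonneg sum_nonneg)

text \<open>The union of nets with radii 1/(k + 1) is countable, and for a fixed sample the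
  empirical risk is continuous in the sup norm on the cube. So the infimum over the class equals
  that over a countable set.\<close>

lemma INF_empirical_risk_measurable:
  assumes nets: "\<And>\<delta>. 0 < \<delta> \<Longrightarrow> \<exists>N\<subseteq>\<F>. finite N \<and> (\<forall>f\<in>\<F>. \<exists>g\<in>N. \<forall>x\<in>cube d 0 1. \<bar>f x 0 - g x 0\<bar> \<le> \<delta>)" and ne: "\<F> \<noteq> {}"
  shows "(\<lambda>z. INF f\<in>\<F>. empirical_risk n z f) \<in> borel_measurable Smp"
proof -
  have "\<forall>k. \<exists>N. N \<subseteq> \<F> \<and> finite N \<and> (\<forall>f\<in>\<F>. \<exists>g\<in>N. \<forall>x\<in>cube d 0 1. \<bar>f x 0 - g x 0\<bar> \<le> 1 / real (Suc k))"
    using nets[of "1 / real (Suc k)" for k] by simp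
  from choice[OF this] obtain N where N: "\<forall>k. N k \<subseteq> \<F> \<and> finite (N k) \<and> (\<forall>f\<in>\<F>. \<exists>g\<in>N k. \<forall>x\<in>cube d 0 1. \<bar>f x 0 - g x 0\<bar> \<le> 1 / real (Suc k))"
    by (elim exE)
  define D where "D = (\<Union>k. N k)"
  have D: "D \<subseteq> \<F>" "countable D" using N by (auto simp: D_def intro: countable_finite)
  have Dne: "D \<noteq> {}" using N ne unfolding D_def by fastforce
  have bdd: "bdd_below ((\<lambda>f. empirical_risk n z f) ` A)" for z A
    by (rule bdd_belowI[of _ 0]) (auto intro: empirical_risk_nonneg)
  have eq: "(INF f\<in>\<F>. empirical_risk n z f) = (INF f\<in>D. empirical_risk n z f)" if z: "z \<in> space Smp" for z
  proof (rule antisym)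
    show "(INF f\<in>\<F>. empirical_risk n z f) \<le> (INF f\<in>D. empirical_risk n z f)"
      using Dne D(1) bdd by (intro cINF_superset_mono) auto
    show "(INF f\<in>D. empirical_risk n z f) \<le> (INF f\<in>\<F>. empirical_risk n z f)"
    proof (rule cINF_greatest[OF ne])
      fix f assume f: "f \<in> \<F>"
      \<comment> \<open>Lipschitz constant of the empirical risk at this sample, from (y - b)^2 - (y
        - a)^2 = (2 y - a - b) (a - b).\<close>
      define S where "S = (\<Sum>i<n. 2 * (\<bar>snd (z i)\<bar> + F)) / real n"
      have S: "0 \<le> S" using F by (auto simp: S_def intro!: divide_nonneg_nonneg sum_nonneg)
      have le: "(INF f\<in>D. empirical_risk n z f) \<le> empirical_risk n z f + S * (1 / real (Suc k))" for k
      proof -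
        obtain g where g: "g \<in> N k" "\<forall>x\<in>cube d 0 1. \<bar>f x 0 - g x 0\<bar> \<le> 1 / real (Suc k)" using N f by blast
        have gF: "g \<in> \<F>" using N g by blast
        have "(\<Sum>i<n. (snd (z i) - g (fst (z i)) 0)\<^sup>2) \<le> (\<Sum>i<n. (snd (z i) - f (fst (z i)) 0)\<^sup>2 + 2 * (\<bar>snd (z i)\<bar> + F) * (1 / real (Suc k)))"
        proof (rule sum_mono)
          fix i assume "i \<in> {..<n}"
          then have c: "fst (z i) \<in> cube d 0 1" using Smp_nth[OF z] by simp
          let ?y = "snd (z i)" and ?a = "f (fst (z i)) 0" and ?b = "g (fst (z i)) 0"
          have ab: "\<bar>?a\<bar> \<le> F" "\<bar>?b\<bar> \<le> F" "\<bar>?a - ?b\<bar> \<le> 1 / real (Suc k)" using bspec[OF bspec[OF bound f] c] bspec[OF bspec[OF bound gF] c] g(2) c by auto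
          have "(?y - ?b)\<^sup>2 - (?y - ?a)\<^sup>2 = (2 * ?y - ?a - ?b) * (?a - ?b)" by (simp add: power2_eq_square algebra_simps)
          also have "\<dots> \<le> \<bar>2 * ?y - ?a - ?b\<bar> * \<bar>?a - ?b\<bar>" unfolding abs_mult[symmetric] by simp
          also have "\<dots> \<le> (2 * (\<bar>?y\<bar> + F)) * (1 / real (Suc k))" 
          proof (rule mult_mono)
            show "\<bar>2 * ?y - ?a - ?b\<bar> \<le> 2 * (\<bar>?y\<bar> + F)" using ab(1,2) by (rule abs_two_diff_le)
          qed (use ab F in auto)
          finally show "(?y - ?b)\<^sup>2 \<le> (?y - ?a)\<^sup>2 + 2 * (\<bar>?y\<bar> + F) * (1 / real (Suc k))" by simp
        qed
        then have "empirical_risk n z g \<le> 1 / real n * (\<Sum>i<n. (snd (z i) - f (fst (z i)) 0)\<^sup>2 + 2 * (\<bar>snd (z i)\<bar> + F) * (1 / real (Suc k)))"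
          unfolding empirical_risk_def by (intro mult_left_mono) auto
        also have "\<dots> = empirical_risk n z f + S * (1 / real (Suc k))"
        proof -
          have "1 / real n * (\<Sum>i<n. A i + B i * c) = 1 / real n * (\<Sum>i<n. A i) + (\<Sum>i<n. B i) / real n * c" for A B c
            by (simp add: sum.distrib add_divide_distrib sum_distrib_right[symmetric])
          then show ?thesis unfolding empirical_risk_def S_def .
        qed
        finally have "empirical_risk n z g \<le> empirical_risk n z f + S * (1 / real (Suc k))" .
        moreover have "(INF f\<in>D. empirical_risk n z f) \<le> empirical_risk n z g"
          using g by (intro cINF_lower bdd) (auto simp: D_def)
        ultimately show ?thesis by linarith
      qed
      have "(\<lambda>k. empirical_risk n z f + S * (1 / real (Suc k))) \<longlonglongrightarrow> empirical_risk n z f + S * 0"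
        by (intro tendsto_add tendsto_mult tendsto_const LIMSEQ_Suc lim_1_over_n)
      from LIMSEQ_le_const[OF this] le show "(INF f\<in>D. empirical_risk n z f) \<le> empirical_risk n z f" by auto
    qed
  qed
  have "(\<lambda>z. INF f\<in>D. empirical_risk n z f) \<in> borel_measurable Smp"
    using D emp_measurable by (intro borel_measurable_cINF_real) auto
  then show ?thesis by (subst measurable_cong[OF eq])
qed

end

end

section \<open>The oracle inequality\<close>

context regression
begin

text \<open>Both bounds are shown for every sample, with dominating variables in place of the maxima
  of the three processes, and then integrated. Nets of all radii serve the measurability of the
  infimum, the single net \<open>N\<close> the estimates.\<close>

lemma oracle_inequality:
  assumes meas: "\<forall>f\<in>\<F>. (\<lambda>x. f x 0) \<in> borel_measurable (cube_space d)"
    and bound: "\<forall>f\<in>\<F>. \<forall>x\<in>cube d 0 1. \<bar>f x 0\<bar> \<le> F"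
    and nets: "\<And>\<delta>. 0 < \<delta> \<Longrightarrow> \<exists>N\<subseteq>\<F>. finite N \<and> (\<forall>f\<in>\<F>. \<exists>g\<in>N. \<forall>x\<in>cube d 0 1. \<bar>f x 0 - g x 0\<bar> \<le> \<delta>)"
    and N: "N \<subseteq> \<F>" "finite N" and \<delta>: "0 < \<delta>" and net: "\<forall>f\<in>\<F>. \<exists>g\<in>N. \<forall>x\<in>cube d 0 1. \<bar>f x 0 - g x 0\<bar> \<le> \<delta>"
    and fhat: "estimator d n \<F> fhat" and fs: "fs \<in> \<F>" "\<And>x. x \<in> cube d 0 1 \<Longrightarrow> \<bar>fs x 0 - f0 x\<bar> \<le> \<epsilon>"
  defines "T \<equiv> (256 + 16 * F\<^sup>2) * (ln (2 * real (card N)) / real n) + 26 * \<delta>\<^sup>2 + 64 * \<delta>"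
  shows "prediction_risk d P n fhat f0 \<le> 16 * delta_risk d P \<F> n fhat f0 + 24 * \<epsilon>\<^sup>2 + T" (is ?U)
    and "delta_risk d P \<F> n fhat f0 \<le> 12 * prediction_risk d P n fhat f0 + T" (is ?L)
proof -
  have Nne: "N \<noteq> {}" using net fs(1) by blast
  obtain W1 where W1: "integrable Smp W1" "(\<integral>z. W1 z \<partial>Smp) \<le> ln (2 * real (card N))"
    "\<forall>z. \<forall>g\<in>N. \<bar>noise_corr g z\<bar> \<le> 4 * (W1 z / real n) + emp_dist g z / 8"
    using noise_bound[OF meas bound N Nne] by blast
  obtain W2 where W2: "integrable Smp W2" "(\<integral>z. W2 z \<partial>Smp) \<le> ln (real (card N))"
    "\<forall>z. \<forall>g\<in>N. pop_dist g \<le> 2 * emp_dist g z + 8 * F\<^sup>2 * (W2 z / real n)"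
    using population_bound[OF meas bound N Nne] by blast
  obtain W3 where W3: "integrable Smp W3" "(\<integral>z. W3 z \<partial>Smp) \<le> ln (real (card N))"
    "\<forall>z. \<forall>g\<in>N. emp_dist g z \<le> 2 * pop_dist g + 4 * F\<^sup>2 * (W3 z / real n)"
    using empirical_bound[OF meas bound N Nne] by blast
  define V where "V z = (\<Sum>i<n. (noise z i)\<^sup>2) / real n" for z
  define I where "I z = (INF f\<in>\<F>. empirical_risk n z f)" for z
  define A where "A z = empirical_risk n z (fhat z) - I z" for z
  define R where "R z = pop_dist (fhat z)" for z
  have fF: "fhat z \<in> \<F>" if "z \<in> space Smp" for z
    using fhat that unfolding estimator_def space_Smp by blast
  have bdd: "bdd_below ((\<lambda>f. empirical_risk n z f) ` \<F>)" for z
    by (rule bdd_belowI[of _ 0]) (auto intro: empirical_risk_nonneg[OF meas bound])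
  \<comment> \<open>Passing between f and its neighbour in the net costs a factor 2 and
    \<open>2 * \<delta>\<^sup>2\<close>, so the share of the empirical distance in the noise bound
    grows from 1/8 to 1/4.\<close>
  have gn: "\<exists>g\<in>N. \<bar>noise_corr f z\<bar> \<le> 4 * (W1 z / real n) + emp_dist f z / 4 + \<delta>\<^sup>2 / 4 + \<delta> * noise_level z \<and>
    emp_dist f z \<le> 2 * \<delta>\<^sup>2 + 2 * emp_dist g z \<and> emp_dist g z \<le> 2 * \<delta>\<^sup>2 + 2 * emp_dist f z \<and>
    pop_dist f \<le> 2 * \<delta>\<^sup>2 + 2 * pop_dist g \<and> pop_dist g \<le> 2 * \<delta>\<^sup>2 + 2 * pop_dist f"
    if f: "f \<in> \<F>" and z: "z \<in> space Smp" for f z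
  proof -
    obtain g where g: "g \<in> N" "\<forall>x\<in>cube d 0 1. \<bar>f x 0 - g x 0\<bar> \<le> \<delta>" using net f by blast
    have gF: "g \<in> \<F>" using g N by blast
    have c: "\<bar>f (fst (z i)) 0 - g (fst (z i)) 0\<bar> \<le> \<delta>" "\<bar>g (fst (z i)) 0 - f (fst (z i)) 0\<bar> \<le> \<delta>" if "i < n" for i
      using g(2) Smp_nth[OF z that] by (auto simp: abs_minus_commute)
    have e: "emp_dist f z \<le> 2 * \<delta>\<^sup>2 + 2 * emp_dist g z" "emp_dist g z \<le> 2 * \<delta>\<^sup>2 + 2 * emp_dist f z"
      using c by (intro emp_dist_diff; simp)+
    have p: "pop_dist f \<le> 2 * \<delta>\<^sup>2 + 2 * pop_dist g" "pop_dist g \<le> 2 * \<delta>\<^sup>2 + 2 * pop_dist f"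
      using g(2) by (auto intro!: pop_dist_diff[OF meas bound] f gF simp: abs_minus_commute)
    have "\<bar>noise_corr f z\<bar> \<le> \<bar>noise_corr g z\<bar> + \<delta> * noise_level z" using c by (intro noise_corr_diff) auto
    also have "\<bar>noise_corr g z\<bar> \<le> 4 * (W1 z / real n) + emp_dist g z / 8" using W1(3) g(1) by blast
    finally have "\<bar>noise_corr f z\<bar> \<le> 4 * (W1 z / real n) + emp_dist f z / 4 + \<delta>\<^sup>2 / 4 + \<delta> * noise_level z" using e(2) by linarith
    then show ?thesis using g(1) e p by blast
  qed
  have pw1: "R z \<le> 16 * A z + 24 * \<epsilon>\<^sup>2 + 256 * (W1 z / real n) + 16 * F\<^sup>2 * (W2 z / real n) + 26 * \<delta>\<^sup>2 + 64 * (\<delta> * noise_level z)"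
    if z: "z \<in> space Smp" for z
  proof -
    obtain g where g: "g \<in> N" "\<bar>noise_corr (fhat z) z\<bar> \<le> 4 * (W1 z / real n) + emp_dist (fhat z) z / 4 + \<delta>\<^sup>2 / 4 + \<delta> * noise_level z"
      "emp_dist g z \<le> 2 * \<delta>\<^sup>2 + 2 * emp_dist (fhat z) z" "pop_dist (fhat z) \<le> 2 * \<delta>\<^sup>2 + 2 * pop_dist g"
      using gn[OF fF[OF z] z] by blast
    obtain g' where g': "\<bar>noise_corr fs z\<bar> \<le> 4 * (W1 z / real n) + emp_dist fs z / 4 + \<delta>\<^sup>2 / 4 + \<delta> * noise_level z"
      using gn[OF fs(1) z] by blast
    have "emp_dist fs z \<le> (\<Sum>i<n. \<epsilon>\<^sup>2) / real n" unfolding emp_dist_def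
      using fs(2) Smp_nth[OF z] n_pos by (intro divide_right_mono sum_mono square_le_of_abs) auto
    then have e: "emp_dist fs z \<le> \<epsilon>\<^sup>2" using n_pos by simp
    have "I z \<le> empirical_risk n z fs" unfolding I_def by (rule cINF_lower[OF bdd fs(1)])
    then have "emp_dist (fhat z) z - 2 * noise_corr (fhat z) z \<le> A z + (emp_dist fs z - 2 * noise_corr fs z)"
      unfolding A_def empirical_risk_eq by linarith
    \<comment> \<open>Twice the noise term takes half of the empirical distance of the estimator;
      the remaining half is then doubled.\<close>
    then have D: "emp_dist (fhat z) z \<le> 2 * A z + 3 * \<epsilon>\<^sup>2 + 32 * (W1 z / real n) + 2 * \<delta>\<^sup>2 + 8 * (\<delta> * noise_level z)"
      using g(2) g' e abs_ge_self[of "noise_corr (fhat z) z"] abs_ge_minus_self[of "noise_corr fs z"] by argo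
    \<comment> \<open>Three factors 2, for estimator to net, population to empirical, and net to
      estimator, turn \<open>2 * A z\<close> into \<open>16 * A z\<close>.\<close>
    have "pop_dist g \<le> 2 * emp_dist g z + 8 * F\<^sup>2 * (W2 z / real n)" using W2(3) g(1) by blast
    then show ?thesis unfolding R_def using D g(3,4) by argo
  qed
  have pw2: "A z \<le> 12 * R z + 16 * (W1 z / real n) + 12 * F\<^sup>2 * (W3 z / real n) + 16 * \<delta>\<^sup>2 + 4 * (\<delta> * noise_level z)"
    if z: "z \<in> space Smp" for z
  proof -
    obtain g where g: "g \<in> N" "\<bar>noise_corr (fhat z) z\<bar> \<le> 4 * (W1 z / real n) + emp_dist (fhat z) z / 4 + \<delta>\<^sup>2 / 4 + \<delta> * noise_level z"
      "emp_dist (fhat z) z \<le> 2 * \<delta>\<^sup>2 + 2 * emp_dist g z" "pop_dist g \<le> 2 * \<delta>\<^sup>2 + 2 * pop_dist (fhat z)"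
      using gn[OF fF[OF z] z] by blast
    \<comment> \<open>No f in the class falls below the pure noise \<open>V z\<close> by more than
      this: its noise term takes at most half of its nonnegative empirical distance, plus the stated
      remainder.\<close>
    have "V z - (8 * (W1 z / real n) + \<delta>\<^sup>2 / 2 + 2 * (\<delta> * noise_level z)) \<le> I z"
      unfolding I_def
    proof (rule cINF_greatest)
      show "\<F> \<noteq> {}" using fs(1) by blast
      fix f assume f: "f \<in> \<F>"
      have "\<bar>noise_corr f z\<bar> \<le> 4 * (W1 z / real n) + emp_dist f z / 4 + \<delta>\<^sup>2 / 4 + \<delta> * noise_level z" using gn[OF f z] by blast
      then show "V z - (8 * (W1 z / real n) + \<delta>\<^sup>2 / 2 + 2 * (\<delta> * noise_level z)) \<le> empirical_risk n z f"
        unfolding empirical_risk_eq V_def using emp_dist_nonneg[of f z] abs_ge_self[of "noise_corr f z"] by argo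
    qed
    then have "A z \<le> emp_dist (fhat z) z - 2 * noise_corr (fhat z) z + (8 * (W1 z / real n) + \<delta>\<^sup>2 / 2 + 2 * (\<delta> * noise_level z))"
      unfolding A_def empirical_risk_eq V_def by linarith
    moreover have "emp_dist g z \<le> 2 * pop_dist g + 4 * F\<^sup>2 * (W3 z / real n)" using W3(3) g(1) by blast
    \<comment> \<open>Here 12 is 3/2 times 8: the distance and half of it again from the noise,
      times three factors 2 for net, empirical to population, and net.\<close>
    ultimately show ?thesis
      unfolding R_def using g abs_ge_minus_self[of "noise_corr (fhat z) z"] by argo
  qed
  note fm = fhat[unfolded estimator_def, THEN conjunct2]
  have fm': "(\<lambda>(z, x). fhat z x 0) \<in> borel_measurable (Smp \<Otimes>\<^sub>M P)"
    using fm measurable_cong_sets[OF sets_pair_measure_cong[OF sets_Smp sets_P] refl] by blast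
  have Am: "A \<in> borel_measurable Smp"
  proof -
    have "(\<lambda>z. empirical_risk n z (fhat z)) \<in> borel_measurable Smp"
      unfolding empirical_risk_def
    proof (intro borel_measurable_times borel_measurable_const borel_measurable_sum)
      fix i assume "i \<in> {..<n}"
      then have i: "i < n" by simp
      have xi: "(\<lambda>z. fst (z i)) \<in> Smp \<rightarrow>\<^sub>M P"
        unfolding measurable_cong_sets[OF refl sets_P] by (rule measurable_compose[OF measurable_nth[OF i] measurable_fst])
      have "(\<lambda>z. (z, fst (z i))) \<in> Smp \<rightarrow>\<^sub>M Smp \<Otimes>\<^sub>M P" by (intro measurable_Pair measurable_ident_sets refl xi)
      from measurable_compose[OF this fm'] have "(\<lambda>z. fhat z (fst (z i)) 0) \<in> borel_measurable Smp" by simp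
      moreover have "(\<lambda>z. snd (z i)) \<in> borel_measurable Smp" by (rule measurable_compose[OF measurable_nth[OF i] measurable_snd])
      ultimately show "(\<lambda>z. (snd (z i) - fhat z (fst (z i)) 0)\<^sup>2) \<in> borel_measurable Smp" by simp
    qed
    moreover have "I \<in> borel_measurable Smp" unfolding I_def
      using fs(1) by (intro INF_empirical_risk_measurable[OF meas bound nets]) auto
    ultimately show ?thesis unfolding A_def by simp
  qed
  interpret SP: pair_prob_space Smp P ..
  have sqm: "(\<lambda>(z, x). (fhat z x 0 - f0 x)\<^sup>2) \<in> borel_measurable (Smp \<Otimes>\<^sub>M P)"
  proof -
    have "(\<lambda>w. f0 (snd w)) \<in> borel_measurable (Smp \<Otimes>\<^sub>M P)"
      by (rule measurable_compose[OF measurable_snd]) (use f0 in \<open>simp add: measurable_cong_sets[OF sets_P refl]\<close>)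
    with fm' show ?thesis by (simp add: case_prod_unfold)
  qed
  have sqi: "integrable (Smp \<Otimes>\<^sub>M P) (\<lambda>(z, x). (fhat z x 0 - f0 x)\<^sup>2)"
    by (rule SP.P.integrable_const_bound[of _ "4 * F\<^sup>2"])
      (use sqm sq_bound[OF meas bound fF] in \<open>auto simp: space_pair_measure space_P intro!: AE_I2\<close>)
  have Rint: "integrable Smp R" "(\<integral>z. R z \<partial>Smp) = prediction_risk d P n fhat f0"
    using SP.integrable_fst[OF sqi] SP.integral_fst[OF sqi]
    unfolding R_def pop_dist_def prediction_risk_def by simp_all
  have A0: "0 \<le> A z" if "z \<in> space Smp" for z
    unfolding A_def I_def using cINF_lower[OF bdd fF[OF that]] by simp
  define B1 where "B1 z = 24 * \<epsilon>\<^sup>2 + 256 * (W1 z / real n) + 16 * F\<^sup>2 * (W2 z / real n) + 26 * \<delta>\<^sup>2 + 64 * (\<delta> * noise_level z)" for z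
  define B2 where "B2 z = 16 * (W1 z / real n) + 12 * F\<^sup>2 * (W3 z / real n) + 16 * \<delta>\<^sup>2 + 4 * (\<delta> * noise_level z)" for z
  have B1: "integrable Smp B1" "(\<integral>z. B1 z \<partial>Smp) = 24 * \<epsilon>\<^sup>2 + 256 * ((\<integral>z. W1 z \<partial>Smp) / real n) + 16 * F\<^sup>2 * ((\<integral>z. W2 z \<partial>Smp) / real n) + 26 * \<delta>\<^sup>2 + 64 * \<delta>"
    unfolding B1_def using W1(1) W2(1) noise_level_integral by (simp_all add: Smp.prob_space)
  have B2: "integrable Smp B2" "(\<integral>z. B2 z \<partial>Smp) = 16 * ((\<integral>z. W1 z \<partial>Smp) / real n) + 12 * F\<^sup>2 * ((\<integral>z. W3 z \<partial>Smp) / real n) + 16 * \<delta>\<^sup>2 + 4 * \<delta>"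
    unfolding B2_def using W1(1) W3(1) noise_level_integral by (simp_all add: Smp.prob_space)
  \<comment> \<open>Integrability follows from \<open>0 \<le> A z\<close> and the pointwise upper
    bound just shown.\<close>
  have Ai: "integrable Smp A"
  proof (rule Bochner_Integration.integrable_bound[OF _ Am])
    show "integrable Smp (\<lambda>z. 12 * R z + B2 z)" using Rint(1) B2(1) by simp
    show "AE z in Smp. norm (A z) \<le> norm (12 * R z + B2 z)"
    proof (rule AE_I2)
      fix z assume z: "z \<in> space Smp"
      show "norm (A z) \<le> norm (12 * R z + B2 z)" using pw2[OF z] A0[OF z] unfolding B2_def by simp
    qed
  qed
  have delta: "(\<integral>z. A z \<partial>Smp) = delta_risk d P \<F> n fhat f0"
    unfolding A_def I_def delta_risk_def ..
  define \<Lambda> where "\<Lambda> = ln (2 * real (card N)) / real n"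
  have cN: "1 \<le> real (card N)" using N Nne by (simp add: Suc_leI card_gt_0_iff)
  have l1: "(\<integral>z. W1 z \<partial>Smp) / real n \<le> \<Lambda>" unfolding \<Lambda>_def using W1(2) n_pos by (intro divide_right_mono) auto
  have "ln (real (card N)) \<le> ln (2 * real (card N))" using cN by simp
  then have l2: "(\<integral>z. W2 z \<partial>Smp) / real n \<le> \<Lambda>" "(\<integral>z. W3 z \<partial>Smp) / real n \<le> \<Lambda>"
    unfolding \<Lambda>_def using W2(2) W3(2) n_pos by (auto intro!: divide_right_mono)
  have \<Lambda>0: "0 \<le> \<Lambda>" unfolding \<Lambda>_def using cN n_pos by simp
  have T: "T = 256 * \<Lambda> + 16 * F\<^sup>2 * \<Lambda> + 26 * \<delta>\<^sup>2 + 64 * \<delta>" unfolding T_def \<Lambda>_def by (simp only: distrib_right)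
  have "(\<integral>z. R z \<partial>Smp) \<le> (\<integral>z. 16 * A z + B1 z \<partial>Smp)"
  proof (rule integral_mono)
    fix z assume "z \<in> space Smp"
    then show "R z \<le> 16 * A z + B1 z" using pw1[of z] unfolding B1_def by linarith
  qed (use Rint Ai B1 in auto)
  also have "\<dots> = 16 * (\<integral>z. A z \<partial>Smp) + (\<integral>z. B1 z \<partial>Smp)" using Ai B1 by simp
  finally have u: "prediction_risk d P n fhat f0 \<le> 16 * delta_risk d P \<F> n fhat f0 + (\<integral>z. B1 z \<partial>Smp)"
    unfolding Rint(2) delta .
  have "16 * F\<^sup>2 * ((\<integral>z. W2 z \<partial>Smp) / real n) \<le> 16 * F\<^sup>2 * \<Lambda>" using l2 by (intro mult_left_mono) auto
  then show ?U using u l1 unfolding B1(2) T by linarith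
  have "(\<integral>z. A z \<partial>Smp) \<le> (\<integral>z. 12 * R z + B2 z \<partial>Smp)"
  proof (rule integral_mono)
    fix z assume "z \<in> space Smp"
    then show "A z \<le> 12 * R z + B2 z" using pw2[of z] unfolding B2_def by linarith
  qed (use Rint Ai B2 in auto)
  also have "\<dots> = 12 * (\<integral>z. R z \<partial>Smp) + (\<integral>z. B2 z \<partial>Smp)" using Rint B2 by simp
  finally have l: "delta_risk d P \<F> n fhat f0 \<le> 12 * prediction_risk d P n fhat f0 + (\<integral>z. B2 z \<partial>Smp)"
    unfolding Rint(2) delta .
  have "12 * F\<^sup>2 * ((\<integral>z. W3 z \<partial>Smp) / real n) \<le> 12 * F\<^sup>2 * \<Lambda>" using l2 by (intro mult_left_mono) auto
  also have "12 * F\<^sup>2 * \<Lambda> \<le> 16 * F\<^sup>2 * \<Lambda>" using \<Lambda>0 by (intro mult_right_mono) auto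
  finally have W3': "12 * F\<^sup>2 * ((\<integral>z. W3 z \<partial>Smp) / real n) \<le> 16 * F\<^sup>2 * \<Lambda>" .
  have "0 \<le> \<delta>\<^sup>2" by simp
  then have "(\<integral>z. B2 z \<partial>Smp) \<le> T" using W3' l1 \<Lambda>0 \<delta> unfolding B2(2) T by argo
  with l show ?L by linarith
qed

end

section \<open>Rates\<close>

locale composition_model =
  fixes q :: nat and d t :: "nat \<Rightarrow> nat" and \<beta> :: "nat \<Rightarrow> real" and F c1 c2 c3 c4 :: real
  assumes dq: "d (q + 1) = 1" and t: "\<forall>i\<le>q. 1 \<le> t i \<and> t i \<le> d i" and \<beta>: "\<forall>i\<le>q. 0 < \<beta> i"
    and c: "0 < c1" "0 < c2" "0 < c3" "0 < c4" and F: "1 \<le> F"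
begin

abbreviation "bs i \<equiv> beta_star q \<beta> i"
abbreviation "\<phi> n \<equiv> rate q t \<beta> n"

text \<open>The architecture hypotheses at a single \<open>n\<close>; later constants are uniform
  over all admissible architectures.\<close>

definition admissible :: "nat \<Rightarrow> nat \<Rightarrow> (nat \<Rightarrow> nat) \<Rightarrow> real \<Rightarrow> bool" where
  "admissible n L p s \<longleftrightarrow> 1 \<le> L \<and> p 0 = d 0 \<and> p (L + 1) = 1 \<and> (\<forall>i\<le>L + 1. 0 < p i) \<and>
     (\<Sum>i\<le>q. log 2 (max (4 * real (t i)) (4 * \<beta> i)) * log 2 (real n)) \<le> real L \<and>
     real L \<le> c1 * (real n * \<phi> n) \<and> real n * \<phi> n \<le> c2 * real (MIN i\<in>{1..L}. p i) \<and>
     c3 * (real n * \<phi> n * ln (real n)) \<le> s \<and> s \<le> c4 * (real n * \<phi> n * ln (real n))"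

lemma bs_pos: "i \<le> q \<Longrightarrow> 0 < bs i"
  using \<beta> by (auto simp: beta_star_def intro!: mult_pos_pos prod_pos)

lemma t_pos: "i \<le> q \<Longrightarrow> 1 \<le> real (t i)"
  using t by auto

lemma rate_ge: "i \<le> q \<Longrightarrow> real n powr (- (2 * bs i) / (2 * bs i + real (t i))) \<le> \<phi> n"
  unfolding rate_def by (intro Max_ge) auto

lemma rate_le_1:
  assumes "1 \<le> n"
  shows "\<phi> n \<le> 1"
  unfolding rate_def
proof (rule Max.boundedI)
  fix y assume "y \<in> (\<lambda>i. real n powr (- (2 * bs i) / (2 * bs i + real (t i)))) ` {..q}"
  then obtain i where i: "i \<in> {..q}" "y = real n powr (- (2 * bs i) / (2 * bs i + real (t i)))" by blast
  from i(1) have "- (2 * bs i) / (2 * bs i + real (t i)) \<le> 0"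
    using bs_pos[of i] t_pos[of i] by (auto simp: divide_simps)
  then show "y \<le> 1"
    unfolding i(2) using assms powr_mono[of _ 0 "real n"] by fastforce
qed auto

lemma inverse_le_rate:
  assumes "1 \<le> n"
  shows "1 / real n \<le> \<phi> n"
proof -
  have "1 / real n = real n powr (- 1)" using assms by (simp add: powr_minus_divide)
  also have "\<dots> \<le> real n powr (- (2 * bs 0) / (2 * bs 0 + real (t 0)))"
    using assms bs_pos[of 0] t_pos[of 0] by (intro powr_mono) (auto simp: divide_simps)
  finally show ?thesis using rate_ge[of 0 n] by simp
qed

lemma ln2_le_ln: "2 \<le> n \<Longrightarrow> ln 2 \<le> ln (real n)"
  by simp

text \<open>A single summand is already at least log 2 4 = 2 times \<open>log 2 (real n)\<close>.
  The factor 2 matches the two network layers per circuit layer.\<close>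

lemma depth_ge:
  assumes "2 \<le> n" "admissible n L p s"
  shows "2 * log 2 (real n) \<le> real L"
proof -
  let ?f = "\<lambda>i. log 2 (max (4 * real (t i)) (4 * \<beta> i)) * log 2 (real n)"
  have n: "0 \<le> log 2 (real n)" using assms by simp
  have two: "2 \<le> log 2 (max (4 * real (t i)) (4 * \<beta> i))" if "i \<le> q" for i
  proof -
    have "log 2 4 \<le> log 2 (max (4 * real (t i)) (4 * \<beta> i))"
      using t_pos[OF that] by (subst log_le_cancel_iff) auto
    moreover have "log 2 (4::real) = 2" using log_of_power_eq[of 4 2 2] by simp
    ultimately show ?thesis by simp
  qed
  have "2 * log 2 (real n) \<le> ?f 0" using n two[of 0] by (intro mult_right_mono) auto
  also have "\<dots> \<le> (\<Sum>i\<le>q. ?f i)"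
    using n two by (intro member_le_sum) (auto intro!: mult_nonneg_nonneg order_trans[OF _ two])
  also have "\<dots> \<le> real L" using assms(2) by (simp add: admissible_def)
  finally show ?thesis .
qed

text \<open>The dominant factor is (4 w)^(L + 1), from the inverse rounding width. With w and L
  polynomial in n, the logarithm is of order L ln n.\<close>

lemma log_cover_bound:
  assumes L: "1 \<le> L" and w: "1 \<le> w" and n: "2 \<le> n"
    and a: "ln (real w) \<le> a * ln (real n)" and b: "ln (real L) \<le> b * ln (real n)" "0 \<le> a" "0 \<le> b"
  shows "ln (real (((L + 1) * w * (w + 1)) * (2 * nat \<lceil>(4 * real w) ^ (L + 1) / (1 / real n)\<rceil> + 1)))
    \<le> (10 + b + 4 * a) * (real L * ln (real n))"
proof -
  let ?X = "(4 * real w) ^ (L + 1) / (1 / real n)" and ?l = "ln (real n)"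
  have X1: "1 \<le> (4 * real w) ^ (L + 1)" using w by (intro one_le_power) auto
  have X: "1 \<le> ?X" using mult_mono[OF X1, of 1 "real n"] n by simp
  have "real (2 * nat \<lceil>?X\<rceil> + 1) = 2 * of_int \<lceil>?X\<rceil> + 1" using X by simp
  also have "\<dots> \<le> 5 * ?X" using X of_int_ceiling_le_add_one[of ?X] by linarith
  finally have A: "real (2 * nat \<lceil>?X\<rceil> + 1) \<le> 5 * ?X" .
  have "real ((L + 1) * w * (w + 1)) = (real L + 1) * (real w * (real w + 1))" by (simp add: algebra_simps)
  also have "\<dots> \<le> (2 * real L) * (real w * (2 * real w))" using L w by (intro mult_mono) auto
  finally have B: "real ((L + 1) * w * (w + 1)) \<le> 4 * real L * real w ^ 2" by (simp add: power2_eq_square)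
  have le: "real (((L + 1) * w * (w + 1)) * (2 * nat \<lceil>?X\<rceil> + 1)) \<le> (4 * real L * real w ^ 2) * (5 * ?X)"
    unfolding of_nat_mult[of "(L + 1) * w * (w + 1)"] using A B by (intro mult_mono) auto
  have pos: "0 < real (((L + 1) * w * (w + 1)) * (2 * nat \<lceil>?X\<rceil> + 1))" using L w by (subst of_nat_0_less_iff) simp
  have "ln (real (((L + 1) * w * (w + 1)) * (2 * nat \<lceil>?X\<rceil> + 1))) \<le> ln ((4 * real L * real w ^ 2) * (5 * ?X))"
    using ln_mono[OF le pos] .
  also have "(4 * real L * real w ^ 2) * (5 * ?X) = 20 * (real L * (real w ^ 2 * ((4 * real w) ^ (L + 1) * real n)))" by simp
  also have "ln \<dots> = ln 20 + (ln (real L) + (2 * ln (real w) + (real (L + 1) * (ln 4 + ln (real w)) + ?l)))"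
    using L w n by (simp add: ln_mult_pos ln_realpow algebra_simps del: power_Suc)
  also have "\<dots> \<le> 5 * ?l + (b * ?l + (2 * (a * ?l) + (real (L + 1) * (2 * ?l + a * ?l) + ?l)))"
  proof -
    have "ln 20 \<le> ln ((2::real) ^ 5)" by simp
    also have "\<dots> = 5 * ln 2" by (subst ln_realpow) simp_all
    finally have "ln (20::real) \<le> 5 * ?l" using ln2_le_ln[OF n] by linarith
    moreover have "ln (4::real) \<le> 2 * ?l" using ln_realpow[of 2 2] ln2_le_ln[OF n] by simp
    ultimately show ?thesis using a b by (intro add_mono mult_left_mono) auto
  qed
  also have "\<dots> = (6 + b + 2 * a) * ?l + real (L + 1) * ((2 + a) * ?l)" by (simp add: algebra_simps)
  also have "\<dots> \<le> (6 + b + 2 * a) * (real L * ?l) + (2 * real L) * ((2 + a) * ?l)"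
    using L n b by (intro add_mono mult_left_mono mult_right_mono) auto
  also have "\<dots> = (10 + b + 4 * a) * (real L * ?l)" by (simp add: algebra_simps)
  finally show ?thesis .
qed

text \<open>The log covering number is at most s times a quantity of order L ln n. With s of order n
  \<phi> n ln n, division by n gives \<phi> n L (ln n)^2. At radius 1/n the discretisation terms of
  the oracle inequality are of order at most \<phi> n.\<close>

lemma entropy_bound:
  "\<exists>Ce\<ge>0. \<forall>n L p s. 2 \<le> n \<longrightarrow> admissible n L p s \<longrightarrow>
    (\<exists>N\<subseteq>network_class L p s F. finite N \<and>
      (\<forall>f\<in>network_class L p s F. \<exists>g\<in>N. \<forall>x\<in>cube (d 0) 0 1. \<bar>f x 0 - g x 0\<bar> \<le> 1 / real n) \<and>
      ln (2 * real (card N)) / real n \<le> Ce * (\<phi> n * real L * (ln (real n))\<^sup>2))"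
proof -
  define a where "a = ln (c4 + real (d 0) + 1) / ln 2 + 2"
  define b where "b = ln (c1 + 1) / ln 2 + 1"
  define D where "D = 10 + b + 4 * a"
  have a0: "0 \<le> a" and b0: "0 \<le> b" and D0: "0 \<le> D" using c by (auto simp: a_def b_def D_def)
  \<comment> \<open>Constants become multiples of ln n through ln 2 \<le> ln n, so that no small n
    has to be treated apart.\<close>
  have scale: "ln x \<le> (ln y / ln 2 + real m) * ln (real n)"
    if "0 < x" "x \<le> y * real n ^ m" "1 \<le> y" "2 \<le> n" for x y :: real and m n :: nat
  proof -
    have "ln x \<le> ln (y * real n ^ m)" using that by (intro ln_mono) auto
    also have "\<dots> = ln y / ln 2 * ln 2 + real m * ln (real n)" using that by (simp add: ln_mult_pos ln_realpow)
    also have "\<dots> \<le> ln y / ln 2 * ln (real n) + real m * ln (real n)"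
      using that by (intro add_right_mono mult_left_mono) auto
    finally show ?thesis by (simp add: algebra_simps)
  qed
  show ?thesis
  proof (intro exI[of _ "1 / ln 2 + c4 * D"] conjI allI impI)
    show "0 \<le> 1 / ln 2 + c4 * D" using c D0 by simp
    fix n L :: nat and p :: "nat \<Rightarrow> nat" and s :: real assume n: "2 \<le> n" and adm: "admissible n L p s"
    let ?S = "nat \<lfloor>s\<rfloor>" and ?l = "ln (real n)" and ?r = "\<phi> n * real L * (ln (real n))\<^sup>2"
    define w where "w = max (max ?S (d 0)) 1"
    have L: "1 \<le> L" and p: "p 0 = d 0" "p (L + 1) = 1" "\<And>i. i \<le> L + 1 \<Longrightarrow> 0 < p i"
      and Lu: "real L \<le> c1 * (real n * \<phi> n)" and su: "s \<le> c4 * (real n * \<phi> n * ?l)"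
      and sl: "c3 * (real n * \<phi> n * ?l) \<le> s"
      using adm by (auto simp: admissible_def)
    have n0: "0 < real n" using n by simp
    have l: "ln 2 \<le> ?l" "0 < ?l" "?l \<le> real n" using n ln_le_minus_one[of "real n"] by auto
    have \<phi>: "\<phi> n \<le> 1" "1 / real n \<le> \<phi> n" "0 < \<phi> n"
      using rate_le_1[of n] inverse_le_rate[of n] n by (auto intro: less_le_trans[of 0 "1 / real n"])
    have s0: "0 \<le> s" using sl c \<phi> l n0 by (meson mult_nonneg_nonneg less_imp_le order_trans)
    have s_le: "s \<le> c4 * real n ^ 2"
    proof -
      have "real n * \<phi> n * ?l \<le> real n * 1 * real n" using \<phi> l by (intro mult_mono) auto
      then show ?thesis using order_trans[OF su mult_left_mono[of _ _ c4]] c by (simp add: power2_eq_square)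
    qed
    have n2: "1 \<le> real n ^ 2" using n by (intro one_le_power) auto
    have "real w \<le> s + real (d 0) + 1" using s0 of_nat_floor[OF s0] by (auto simp: w_def)
    also have "\<dots> \<le> c4 * real n ^ 2 + real (d 0) * real n ^ 2 + 1 * real n ^ 2"
      using s_le n2 mult_left_mono[OF n2, of "real (d 0)"] by (intro add_mono) auto
    finally have "real w \<le> (c4 + real (d 0) + 1) * real n ^ 2" by (simp add: algebra_simps)
    then have lw: "ln (real w) \<le> a * ?l"
      using scale[of "real w" "c4 + real (d 0) + 1" n 2] n c by (simp add: a_def w_def)
    have "real L \<le> c1 * (real n * 1)"
      using order_trans[OF Lu mult_left_mono[of _ _ c1]] mult_left_mono[OF \<phi>(1), of "real n"] c by simp
    then have "real L \<le> (c1 + 1) * real n ^ 1" by (simp add: algebra_simps)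
    then have lL: "ln (real L) \<le> b * ?l" using scale[of "real L" "c1 + 1" n 1] n c L by (simp add: b_def)
    define B where "B = ((L + 1) * w * (w + 1)) * (2 * nat \<lceil>(4 * real w) ^ (L + 1) / (1 / real n)\<rceil> + 1)"
    have w1: "d 0 \<le> w" "?S \<le> w" "1 \<le> w" by (auto simp: w_def)
    have lB: "ln (real B) \<le> D * (real L * ?l)"
      unfolding B_def D_def by (rule log_cover_bound[OF L w1(3) n lw lL a0 b0])
    have B1: "1 \<le> B" using w1 by (auto simp: B_def)
    obtain N where N: "N \<subseteq> network_class L p s F" "finite N" "card N \<le> B ^ ?S"
      "\<forall>f\<in>network_class L p s F. \<exists>g\<in>N. \<forall>x\<in>cube (d 0) 0 1. \<bar>f x 0 - g x 0\<bar> \<le> 1 / real n"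
      using network_class_cover[of p "d 0" L "1 / real n" w s F] p w1 n0 unfolding B_def by auto
    have "ln (2 * real (card N)) \<le> ln 2 + real ?S * ln (real B)"
    proof (cases "card N = 0")
      \<comment> \<open>The left side is 0 by the convention \<open>ln 0 = 0\<close>.\<close>
      case True then show ?thesis using B1 by (simp only: True) simp
    next
      case False
      have "ln (2 * real (card N)) \<le> ln (2 * real B ^ ?S)"
        using False N(3) by (intro ln_mono) (auto simp flip: of_nat_power)
      also have "\<dots> = ln 2 + real ?S * ln (real B)" using B1 by (subst ln_mult_pos ln_realpow; simp)+
      finally show ?thesis .
    qed
    also have "\<dots> \<le> ln 2 + (c4 * (real n * \<phi> n * ?l)) * (D * (real L * ?l))"
      using lB B1 D0 order_trans[OF of_nat_floor[OF s0] su] order_trans[OF s0 su]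
      by (intro add_mono mult_mono order_refl) (assumption | simp)+
    finally have "ln (2 * real (card N)) / real n \<le> (ln 2 + (c4 * (real n * \<phi> n * ?l)) * (D * (real L * ?l))) / real n"
      using n0 by (intro divide_right_mono) auto
    also have "\<dots> = ln 2 * (1 / real n) + c4 * D * ?r" using n0 by (simp add: field_simps power2_eq_square)
    also have "ln 2 * (1 / real n) \<le> 1 / ln 2 * ?r"
    proof -
      have "ln 2 * (1 / real n) \<le> ln 2 * (\<phi> n * real L)" 
        using \<phi>(3) L mult_left_mono[of 1 "real L" "\<phi> n"] by (intro mult_left_mono order_trans[OF \<phi>(2)]) auto
      also have "\<dots> = 1 / ln 2 * (\<phi> n * real L * (ln 2)\<^sup>2)" by (simp add: power2_eq_square)
      also have "\<dots> \<le> 1 / ln 2 * ?r" using \<phi> l by (intro mult_left_mono power_mono) auto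
      finally show ?thesis .
    qed
    finally have "ln (2 * real (card N)) / real n \<le> (1 / ln 2 + c4 * D) * ?r" by (simp add: algebra_simps)
    then show "\<exists>N\<subseteq>network_class L p s F. finite N \<and>
      (\<forall>f\<in>network_class L p s F. \<exists>g\<in>N. \<forall>x\<in>cube (d 0) 0 1. \<bar>f x 0 - g x 0\<bar> \<le> 1 / real n) \<and>
      ln (2 * real (card N)) / real n \<le> (1 / ln 2 + c4 * D) * ?r"
      using N by (intro exI[of _ N]) simp
  qed
qed

text \<open>The circuits with all grid sizes equal to m + 1 give measurable functions bounded by
  \<open>F\<close> that converge to f on the cube as m grows.\<close>

lemma composition_class_regular:
  assumes K: "0 \<le> K" "K \<le> F" and f: "f \<in> composition_class q d t \<beta> K"
  shows "f \<in> borel_measurable (cube_space (d 0))" and "x \<in> cube (d 0) 0 1 \<Longrightarrow> \<bar>f x\<bar> \<le> F"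
proof -
  let ?e = "input_fun (d 0)"
  obtain k C where C: "1 \<le> C" and I: "\<forall>W (e :: nat \<Rightarrow> (nat \<Rightarrow> real) \<Rightarrow> real) K f. (\<forall>l\<le>q. 1 \<le> W l) \<longrightarrow> 0 \<le> K \<longrightarrow> K \<le> F \<longrightarrow>
    f \<in> composition_class q d t \<beta> K \<longrightarrow> (\<forall>j<d 0. \<forall>x. 0 \<le> e j x \<and> e j x \<le> 1) \<longrightarrow>
    (\<exists>v w. circuit (e ` {..<d 0}) k (C * (\<Sum>l\<le>q. real (W l) ^ (2 * t l))) {v, w} \<and>
      (\<forall>x. \<bar>v x - w x\<bar> \<le> F \<and> \<bar>v x - w x - f (\<lambda>j\<in>{..<d 0}. e j x)\<bar>
          \<le> C * (\<Sum>l\<le>q. real (W l) powr (- 2 * bs l))))"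
    using circuit_composition_class[OF dq t \<beta> F, where ?'a = "nat \<Rightarrow> real"] by (elim exE conjE)
  have e01: "\<forall>j<d 0. \<forall>x. 0 \<le> ?e j x \<and> ?e j x \<le> 1"
    by (auto simp: input_fun_def cube_def PiE_iff)
  have ex: "(\<lambda>j\<in>{..<d 0}. ?e j x) = x" if "x \<in> cube (d 0) 0 1" for x
    using that by (auto simp: input_fun_def cube_def PiE_iff extensional_def restrict_def)
  have em: "?e j \<in> borel_measurable (cube_space (d 0))" if "j < d 0" for j
  proof -
    have "(\<lambda>x. x j) \<in> borel_measurable (cube_space (d 0))"
      unfolding cube_space_def using that
      by (intro measurable_compose[OF measurable_component_singleton, of j]) (auto intro: measurable_restrict_space1)
    then show ?thesis
      by (subst measurable_cong[where g = "\<lambda>x. x j"]) (auto simp: input_fun_def space_cube_space)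
  qed
  have "\<exists>g. g \<in> borel_measurable (cube_space (d 0)) \<and> (\<forall>x. \<bar>g x\<bar> \<le> F) \<and>
      (\<forall>x\<in>cube (d 0) 0 1. \<bar>g x - f x\<bar> \<le> C * (\<Sum>l\<le>q. real (Suc m) powr (- 2 * bs l)))" for m
  proof -
    have "\<forall>l\<le>q. 1 \<le> Suc m" by simp
    from I[THEN spec, THEN spec, THEN spec, THEN spec, THEN mp, THEN mp, THEN mp, THEN mp, THEN mp, OF this K f e01]
    obtain v w where v: "circuit (?e ` {..<d 0}) k (C * (\<Sum>l\<le>q. real (Suc m) ^ (2 * t l))) {v, w}"
      and vw: "\<forall>x. \<bar>v x - w x\<bar> \<le> F \<and> \<bar>v x - w x - f (\<lambda>j\<in>{..<d 0}. ?e j x)\<bar>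
          \<le> C * (\<Sum>l\<le>q. real (Suc m) powr (- 2 * bs l))"
      by (elim exE conjE)
    have "v \<in> borel_measurable (cube_space (d 0))" "w \<in> borel_measurable (cube_space (d 0))"
      by (rule circuit_measurable[OF v], use em in force, simp)+
    then have "(\<lambda>x. v x - w x) \<in> borel_measurable (cube_space (d 0))" by (rule borel_measurable_diff)
    moreover have "\<bar>v x - w x - f x\<bar> \<le> C * (\<Sum>l\<le>q. real (Suc m) powr (- 2 * bs l))" if "x \<in> cube (d 0) 0 1" for x
      using vw[THEN spec, of x] ex[OF that] by simp
    ultimately show ?thesis using vw by (intro exI[of _ "\<lambda>x. v x - w x"]) simp
  qed
  then obtain g where gg: "\<forall>m. g m \<in> borel_measurable (cube_space (d 0)) \<and> (\<forall>x. \<bar>g m x\<bar> \<le> F) \<and>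
      (\<forall>x\<in>cube (d 0) 0 1. \<bar>g m x - f x\<bar> \<le> C * (\<Sum>l\<le>q. real (Suc m) powr (- 2 * bs l)))"
    by (rule choice[OF allI, THEN exE])
  have g: "\<And>m. g m \<in> borel_measurable (cube_space (d 0))" "\<And>m x. \<bar>g m x\<bar> \<le> F"
    "\<And>m x. x \<in> cube (d 0) 0 1 \<Longrightarrow> \<bar>g m x - f x\<bar> \<le> C * (\<Sum>l\<le>q. real (Suc m) powr (- 2 * bs l))"
    using gg by (auto simp only:)
  have "(\<lambda>m. real (Suc m) powr (- 2 * bs l)) \<longlonglongrightarrow> 0" if "l \<le> q" for l
    using bs_pos[OF that]
    by (intro tendsto_neg_powr filterlim_compose[OF filterlim_real_sequentially filterlim_Suc]) auto
  then have "(\<lambda>m. C * (\<Sum>l\<le>q. real (Suc m) powr (- 2 * bs l))) \<longlonglongrightarrow> C * (\<Sum>l\<le>q. 0)"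
    by (intro tendsto_intros) auto
  then have z: "(\<lambda>m. C * (\<Sum>l\<le>q. real (Suc m) powr (- 2 * bs l))) \<longlonglongrightarrow> 0" by simp
  have lim: "(\<lambda>m. g m x) \<longlonglongrightarrow> f x" if "x \<in> cube (d 0) 0 1" for x
  proof -
    have "(\<lambda>m. g m x - f x) \<longlonglongrightarrow> 0"
      by (rule tendsto_rabs_zero_cancel, rule tendsto_sandwich[OF _ _ tendsto_const z])
        (use g(3)[OF that] in auto)
    then show ?thesis by (simp add: LIM_zero_iff)
  qed
  show "f \<in> borel_measurable (cube_space (d 0))"
    by (rule borel_measurable_LIMSEQ_real[where u = g, OF _ g(1)]) (auto simp: space_cube_space lim)
  show "\<bar>f x\<bar> \<le> F" if "x \<in> cube (d 0) 0 1"
    using LIMSEQ_le_const2[OF tendsto_rabs[OF lim[OF that]]] g(2) by blast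
qed

end

section \<open>Fitting the circuit into the given architecture\<close>

lemma zero_in_network_class:
  assumes p: "\<And>i. i \<le> L + 1 \<Longrightarrow> 0 < p i" and s: "0 \<le> s" and F: "0 \<le> F"
  shows "\<exists>g\<in>network_class L p s F. \<forall>x. g x 0 = 0"
proof -
  let ?g = "network p (\<lambda>_ _ _. 0) (\<lambda>_ _. 0) L"
  have z: "?g x i = 0" if "i < p (L + 1)" for x i
    using that by (cases L) (auto simp: mat_vec_def)
  have norm: "sup_norm m y \<le> M" if "0 < m" "\<And>i. i < m \<Longrightarrow> \<bar>y i\<bar> \<le> M" for m y M
    unfolding sup_norm_def using that by (subst Max_le_iff) auto
  have mat: "mat_sup_norm m n (\<lambda>_ _. 0) = 0" if "0 < m" "0 < n" for m n
  proof -
    have "(\<lambda>(i, j). \<bar>0::real\<bar>) ` ({..<m} \<times> {..<n}) = {0}" using that by (auto simp: image_iff)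
    then show ?thesis by (simp add: mat_sup_norm_def)
  qed
  have "?g \<in> network_class L p s F"
    unfolding network_class_def
    by (intro CollectI exI[of _ "\<lambda>_ _ _. 0"] exI[of _ "\<lambda>_ _. 0"] conjI)
      (use p s F z mat in \<open>auto intro!: norm simp: mat_nnz_def vec_nnz_def\<close>)
  then show ?thesis using z p[of "L + 1"] by auto
qed

text \<open>W is the floor of y^(1/(2 \<tau>)), and rounding down a number that is at least 1 loses
  at most half of it.\<close>

lemma grid_size:
  assumes y: "1 \<le> y" and \<tau>: "1 \<le> \<tau>"
  shows "\<exists>W::nat. 1 \<le> W \<and> real W ^ (2 * \<tau>) \<le> y \<and> y powr (1 / (2 * real \<tau>)) / 2 \<le> real W"
proof -
  define x where "x = y powr (1 / (2 * real \<tau>))"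
  have x1: "1 \<le> x" unfolding x_def using y by (intro ge_one_powr_ge_zero) auto
  have "x ^ (2 * \<tau>) = x powr real (2 * \<tau>)" using x1 by (intro powr_realpow[symmetric]) simp
  also have "\<dots> = y" using y \<tau> by (simp add: x_def powr_powr)
  finally have xy: "x ^ (2 * \<tau>) = y" .
  have W1: "1 \<le> nat \<lfloor>x\<rfloor>" using x1 by (simp add: le_nat_iff)
  have W: "real (nat \<lfloor>x\<rfloor>) \<le> x" "x < real (nat \<lfloor>x\<rfloor>) + 1" using x1 by linarith+
  have "real (nat \<lfloor>x\<rfloor>) ^ (2 * \<tau>) \<le> y" using power_mono[OF W(1), of "2 * \<tau>"] by (simp add: xy)
  moreover have "x / 2 \<le> real (nat \<lfloor>x\<rfloor>)" using W W1 by linarith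
  ultimately show ?thesis using W1 unfolding x_def by blast
qed

context composition_model
begin

lemma rate_pos: "1 \<le> n \<Longrightarrow> 0 < \<phi> n"
  by (rule less_le_trans[OF _ inverse_le_rate]) auto

text \<open>The exponent is 1 plus that of the i-th term of the rate, and the rate is the maximum of
  these terms.\<close>

lemma powr_le_sample_rate:
  assumes "i \<le> q" "1 \<le> n"
  shows "real n powr (real (t i) / (2 * bs i + real (t i))) \<le> real n * \<phi> n"
proof -
  have "real (t i) / (2 * bs i + real (t i)) = 1 + - (2 * bs i) / (2 * bs i + real (t i))"
    using bs_pos[OF assms(1)] t_pos[OF assms(1)] by (simp add: field_simps)
  then have "real n powr (real (t i) / (2 * bs i + real (t i))) = real n * real n powr (- (2 * bs i) / (2 * bs i + real (t i)))"
    using assms(2) by (simp only: powr_add) simp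
  then show ?thesis using rate_ge[OF assms(1), of n] by (simp add: mult_left_mono)
qed

text \<open>Write b for \<open>bs l\<close>. With W^(2 t) of order n \<phi> n, the error is of order
  (n \<phi> n)^(-b/t). This power is decreasing, so n \<phi> n may be replaced by its lower bound
  n^(t/(2 b + t)), which leaves n^(-b/(2 b + t)), the square root of a term of the rate.\<close>

lemma level_error:
  assumes l: "l \<le> q" and n: "1 \<le> n" and c: "0 < c"
    and W: "(c * (real n * \<phi> n)) powr (1 / (2 * real (t l))) / 2 \<le> real W"
  shows "real W powr (- 2 * bs l) \<le> 2 powr (2 * bs l) * c powr (- bs l / real (t l)) * \<phi> n powr (1 / 2)"
proof -
  let ?T = "real n * \<phi> n" and ?b = "bs l" and ?t = "real (t l)"
  have b: "0 < ?b" and t: "1 \<le> ?t" using bs_pos t_pos l by auto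
  have n0: "0 < real n" using n by simp
  have \<phi>0: "0 < \<phi> n" by (rule rate_pos[OF n])
  have T: "0 < ?T" using \<phi>0 n0 by simp
  have "real W powr (- 2 * ?b) \<le> ((c * ?T) powr (1 / (2 * ?t)) / 2) powr (- 2 * ?b)"
    using W T c b n by (intro powr_mono2') auto
  also have "\<dots> = 2 powr (2 * ?b) * (c powr (- ?b / ?t) * ?T powr (- ?b / ?t))"
  proof -
    have "((c * ?T) powr (1 / (2 * ?t)) / 2) powr (- 2 * ?b)
      = (c * ?T) powr (1 / (2 * ?t) * (- 2 * ?b)) / 2 powr (- 2 * ?b)"
      by (simp add: powr_divide powr_powr)
    also have "1 / (2 * ?t) * (- 2 * ?b) = - ?b / ?t" by simp
    finally show ?thesis using c T by (simp add: powr_mult powr_minus divide_simps)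
  qed
  also have "?T powr (- ?b / ?t) \<le> \<phi> n powr (1 / 2)"
  proof -
    have "?T powr (- ?b / ?t) \<le> (real n powr (?t / (2 * ?b + ?t))) powr (- ?b / ?t)"
      using powr_le_sample_rate[OF l n] n0 b t by (intro powr_mono2') (auto simp: divide_nonpos_pos)
    also have "\<dots> = real n powr (- (2 * ?b) / (2 * ?b + ?t) * (1 / 2))"
    proof -
      have "?t / (2 * ?b + ?t) * (- ?b / ?t) = - (2 * ?b) / (2 * ?b + ?t) * (1 / 2)"
        using b t by (simp add: field_simps)
      then show ?thesis by (simp only: powr_powr)
    qed
    also have "\<dots> = (real n powr (- (2 * ?b) / (2 * ?b + ?t))) powr (1 / 2)" by (simp only: powr_powr)
    also have "\<dots> \<le> \<phi> n powr (1 / 2)" using rate_ge[OF l, of n] by (intro powr_mono2) auto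
    finally show ?thesis .
  qed
  finally show ?thesis using c by (simp add: mult_left_mono mult.assoc)
qed

text \<open>Collects the thresholds beyond which the circuit fits: width, sparsity and depth. The
  growth of n \<phi> n comes from x \<le> exp x at x = \<rho> ln n, where \<rho> is the exponent of
  \<open>powr_le_sample_rate\<close> at level 0.\<close>

lemma eventually_large:
  "\<exists>N0. \<forall>n\<ge>N0. 2 \<le> n \<and> A \<le> real n * \<phi> n \<and> B \<le> ln (real n) \<and> real k < log 2 (real n)"
proof -
  let ?\<rho> = "real (t 0) / (2 * bs 0 + real (t 0))"
  have \<rho>: "0 < ?\<rho>" using bs_pos[of 0] t_pos[of 0] by (auto intro!: divide_pos_pos)
  have "filterlim (\<lambda>n. ln (real n)) at_top sequentially"
    by (rule filterlim_compose[OF ln_at_top filterlim_real_sequentially])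
  then have "\<forall>\<^sub>F n in sequentially. 2 \<le> n \<and> max (max (A / ?\<rho>) B) (real k + 1) \<le> ln (real n)"
    unfolding filterlim_at_top by (intro eventually_conj eventually_ge_at_top) blast
  then obtain N0 where N0: "\<And>n. N0 \<le> n \<Longrightarrow> 2 \<le> n \<and> max (max (A / ?\<rho>) B) (real k + 1) \<le> ln (real n)"
    unfolding eventually_sequentially by blast
  have "A \<le> real n * \<phi> n \<and> real k < log 2 (real n)" if "N0 \<le> n" for n
  proof
    have n: "2 \<le> n" "A / ?\<rho> \<le> ln (real n)" "real k + 1 \<le> ln (real n)" using N0[OF that] by auto
    have "A \<le> ?\<rho> * ln (real n)" using n(2) \<rho> by (subst mult.commute) (simp only: pos_divide_le_eq)
    also have "\<dots> \<le> exp (?\<rho> * ln (real n))" using exp_ge_add_one_self[of "?\<rho> * ln (real n)"] by linarith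
    also have "\<dots> = real n powr ?\<rho>"
      using n(1) by (simp add: powr_def)
    also have "\<dots> \<le> real n * \<phi> n" using n(1) by (intro powr_le_sample_rate) auto
    finally show "A \<le> real n * \<phi> n" .
    have "ln (real n) * ln 2 \<le> ln (real n) * 1"
      using n(1) ln_le_minus_one[of "2::real"] by (intro mult_left_mono) auto
    then have "ln (real n) \<le> log 2 (real n)" by (simp add: log_def pos_le_divide_eq)
    then show "real k < log 2 (real n)" using n(3) by linarith
  qed
  then show ?thesis using N0 by (intro exI[of _ N0]) auto
qed

text \<open>For large n the circuit is fitted into the architecture. For the others the zero network
  has error at most \<open>F\<close>, and 1/N0 \<le> \<phi> n there turns this into a multiple of
  the rate.\<close>

lemma network_approximation:
  "\<exists>Ca\<ge>0. \<forall>n L p s K f. 2 \<le> n \<longrightarrow> admissible n L p s \<longrightarrow> 0 \<le> K \<longrightarrow> K \<le> F \<longrightarrow>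
    f \<in> composition_class q d t \<beta> K \<longrightarrow>
    (\<exists>g\<in>network_class L p s F. \<forall>x\<in>cube (d 0) 0 1. \<bar>g x 0 - f x\<bar> \<le> Ca * \<phi> n powr (1 / 2))"
proof -
  let ?e = "input_fun (d 0)"
  obtain k C where C: "1 \<le> C" and I: "\<forall>W (e :: nat \<Rightarrow> (nat \<Rightarrow> real) \<Rightarrow> real) K f. (\<forall>l\<le>q. 1 \<le> W l) \<longrightarrow> 0 \<le> K \<longrightarrow> K \<le> F \<longrightarrow>
    f \<in> composition_class q d t \<beta> K \<longrightarrow> (\<forall>j<d 0. \<forall>x. 0 \<le> e j x \<and> e j x \<le> 1) \<longrightarrow>
    (\<exists>v w. circuit (e ` {..<d 0}) k (C * (\<Sum>l\<le>q. real (W l) ^ (2 * t l))) {v, w} \<and>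
      (\<forall>x. \<bar>v x - w x\<bar> \<le> F \<and> \<bar>v x - w x - f (\<lambda>j\<in>{..<d 0}. e j x)\<bar>
          \<le> C * (\<Sum>l\<le>q. real (W l) powr (- 2 * bs l))))"
    using circuit_composition_class[OF dq t \<beta> F, where ?'a = "nat \<Rightarrow> real"] by (elim exE conjE)
  have e01: "\<forall>j<d 0. \<forall>x. 0 \<le> ?e j x \<and> ?e j x \<le> 1"
    by (auto simp: input_fun_def cube_def PiE_iff)
  have ex: "(\<lambda>j\<in>{..<d 0}. ?e j x) = x" if "x \<in> cube (d 0) 0 1" for x
    using that by (auto simp: input_fun_def cube_def PiE_iff extensional_def restrict_def)
  \<comment> \<open>Chosen so that the circuit costs at most A n \<phi> n with A = 1/(2 c2), which
    is half of the guaranteed width; the other half covers the summand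
    \<open>real (d 0) + 2\<close>.\<close>
  define c where "c = 1 / (2 * C * (real q + 1) * c2)"
  define A where "A = C * ((real q + 1) * c)"
  \<comment> \<open>All parameters together are at most Q n \<phi> n; once Q / c3 \<le> ln n, the
    logarithm in the sparsity covers them.\<close>
  define Q where "Q = 3 * A + 3 * real k * (real (d 0) + A) + 2 * c1 + 2"
  have c0: "0 < c" using C c by (simp add: c_def)
  have A: "A = 1 / (2 * c2)"
  proof -
    have "C \<noteq> 0" "c2 \<noteq> 0" "real q + 1 \<noteq> 0" using C c by auto
    then show ?thesis by (simp add: A_def c_def)
  qed
  have A0: "0 < A" using A c by simp
  define D where "D = C * (\<Sum>l\<le>q. 2 powr (2 * bs l) * c powr (- bs l / real (t l)))"
  have D0: "0 \<le> D" using C by (auto simp: D_def intro!: mult_nonneg_nonneg sum_nonneg)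
  obtain N0 where N0: "\<forall>n\<ge>N0. 2 \<le> n \<and> max (max (1 / c) 1) (2 * c2 * (real (d 0) + 2)) \<le> real n * \<phi> n \<and>
      Q / c3 \<le> ln (real n) \<and> real k < log 2 (real n)"
    using eventually_large[of "max (max (1 / c) 1) (2 * c2 * (real (d 0) + 2))" "Q / c3" k] by blast
  have small: "F \<le> (F * real N0 powr (1 / 2)) * \<phi> n powr (1 / 2)" if "1 \<le> n" "n \<le> N0" for n
  proof -
    have "1 = real n * (1 / real n)" using that by simp
    also have "\<dots> \<le> real N0 * \<phi> n" using that inverse_le_rate[OF that(1)] by (intro mult_mono) auto
    finally have "1 \<le> (real N0 * \<phi> n) powr (1 / 2)" by (intro ge_one_powr_ge_zero) auto
    also have "\<dots> = real N0 powr (1 / 2) * \<phi> n powr (1 / 2)"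
      using rate_pos[OF that(1)] by (simp add: powr_mult)
    finally show ?thesis using F mult_left_mono[of 1 _ F] by (simp add: mult.assoc)
  qed
  have large: "\<exists>g\<in>network_class L p s F. \<forall>x\<in>cube (d 0) 0 1. \<bar>g x 0 - f x\<bar> \<le> D * \<phi> n powr (1 / 2)"
    if n: "N0 \<le> n" and adm: "admissible n L p s" and K: "0 \<le> K" "K \<le> F" and f: "f \<in> composition_class q d t \<beta> K"
    for n L p s K f
  proof -
    let ?T = "real n * \<phi> n"
    have n2: "2 \<le> n" and T: "1 / c \<le> ?T" "1 \<le> ?T" "2 * c2 * (real (d 0) + 2) \<le> ?T"
      and Q: "Q / c3 \<le> ln (real n)" and k: "real k < log 2 (real n)" using N0[THEN spec, THEN mp, OF n] by simp_all
    have "1 \<le> c * ?T" using T(1) c0 by (simp add: field_simps)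
    then have "\<forall>l. \<exists>W::nat. l \<le> q \<longrightarrow> 1 \<le> W \<and> real W ^ (2 * t l) \<le> c * ?T \<and> (c * ?T) powr (1 / (2 * real (t l))) / 2 \<le> real W"
      using grid_size[of "c * ?T"] t by auto
    then obtain W where W: "\<forall>l. l \<le> q \<longrightarrow> (1::nat) \<le> W l \<and> real (W l) ^ (2 * t l) \<le> c * ?T \<and> (c * ?T) powr (1 / (2 * real (t l))) / 2 \<le> real (W l)"
      by (rule choice[THEN exE])
    have W1: "\<forall>l\<le>q. 1 \<le> W l" using W by simp
    let ?S = "C * (\<Sum>l\<le>q. real (W l) ^ (2 * t l))"
    from I[THEN spec, THEN spec, THEN spec, THEN spec, THEN mp, THEN mp, THEN mp, THEN mp, THEN mp, OF W1 K f e01]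
    obtain v w where v: "circuit (?e ` {..<d 0}) k ?S {v, w}"
      and vw: "\<forall>x. \<bar>v x - w x\<bar> \<le> F \<and> \<bar>v x - w x - f (\<lambda>j\<in>{..<d 0}. ?e j x)\<bar>
          \<le> C * (\<Sum>l\<le>q. real (W l) powr (- 2 * bs l))"
      by (elim exE conjE)
    have "?S \<le> C * (\<Sum>l\<le>q. c * ?T)" using W C by (intro mult_left_mono sum_mono) auto
    also have "\<dots> = A * ?T" by (simp add: A_def)
    finally have S: "?S \<le> A * ?T" .
    have L: "1 \<le> L" and p: "p 0 = d 0" "p (L + 1) = 1" "\<And>i. i \<le> L + 1 \<Longrightarrow> 0 < p i"
      and Lu: "real L \<le> c1 * ?T" and pm: "?T \<le> c2 * real (MIN i\<in>{1..L}. p i)"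
      and sl: "c3 * (?T * ln (real n)) \<le> s"
      using adm by (auto simp: admissible_def)
    have "real (2 * k) < real L" using depth_ge[OF n2 adm] k by simp
    then have kL: "2 * k < L" by linarith
    have width: "real (d 0) + ?S + 2 \<le> real (p i)" if "i \<in> {1..L}" for i
    proof -
      have "real (d 0) + 2 \<le> A * ?T" using T(3) c by (simp add: A field_simps)
      then have "real (d 0) + ?S + 2 \<le> 2 * (A * ?T)" using S by simp
      also have "\<dots> = ?T / c2" by (simp add: A)
      also have "\<dots> \<le> real (MIN i\<in>{1..L}. p i)" using pm c by (simp add: field_simps)
      also have "\<dots> \<le> real (p i)" using that by (intro of_nat_mono Min_le) auto
      finally show ?thesis .
    qed
    have "3 * ?S + 3 * real k * (real (d 0) + ?S) + 2 * real L + 2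
      \<le> 3 * (A * ?T) + 3 * real k * (real (d 0) * ?T + A * ?T) + 2 * (c1 * ?T) + 2 * ?T"
      using S Lu T(2) mult_left_mono[OF T(2), of "real (d 0)"] by (intro add_mono mult_left_mono) auto
    also have "\<dots> = Q * ?T" by (simp add: Q_def algebra_simps)
    also have "\<dots> \<le> (c3 * ln (real n)) * ?T" using Q c T(2) by (intro mult_right_mono) (auto simp: field_simps)
    also have "\<dots> \<le> s" using sl by (simp add: mult_ac)
    finally have sp: "3 * ?S + 3 * real k * (real (d 0) + ?S) + 2 * real L + 2 \<le> s" .
    have vF: "\<bar>v x - w x\<bar> \<le> F" for x using vw by simp
    obtain g where g: "g \<in> network_class L p s F" "\<forall>x\<in>cube (d 0) 0 1. g x 0 = v x - w x"
      using circuit_network_class[OF v p kL width vF sp] by blast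
    have "C * (\<Sum>l\<le>q. real (W l) powr (- 2 * bs l))
      \<le> C * (\<Sum>l\<le>q. 2 powr (2 * bs l) * c powr (- bs l / real (t l)) * \<phi> n powr (1 / 2))"
      using W C n2 by (intro mult_left_mono sum_mono level_error c0) auto
    also have "\<dots> = D * \<phi> n powr (1 / 2)" by (simp add: D_def sum_distrib_right mult.assoc)
    finally have e: "C * (\<Sum>l\<le>q. real (W l) powr (- 2 * bs l)) \<le> D * \<phi> n powr (1 / 2)" .
    have "\<bar>g x 0 - f x\<bar> \<le> D * \<phi> n powr (1 / 2)" if "x \<in> cube (d 0) 0 1" for x
      using order_trans[OF conjunct2[OF vw[THEN spec, of x]] e] g(2) that ex[OF that] by simp
    then show ?thesis using g(1) by blast
  qed
  show ?thesis
  proof (intro exI[of _ "D + F * real N0 powr (1 / 2)"] conjI allI impI)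
    show "0 \<le> D + F * real N0 powr (1 / 2)" using D0 F by simp
    fix n L :: nat and p :: "nat \<Rightarrow> nat" and s K :: real and f
    assume n: "2 \<le> n" and adm: "admissible n L p s" and K: "0 \<le> K" "K \<le> F" and f: "f \<in> composition_class q d t \<beta> K"
    show "\<exists>g\<in>network_class L p s F. \<forall>x\<in>cube (d 0) 0 1. \<bar>g x 0 - f x\<bar> \<le> (D + F * real N0 powr (1 / 2)) * \<phi> n powr (1 / 2)"
    proof (cases "N0 \<le> n")
      case True
      obtain g where g: "g \<in> network_class L p s F" "\<forall>x\<in>cube (d 0) 0 1. \<bar>g x 0 - f x\<bar> \<le> D * \<phi> n powr (1 / 2)"
        using large[OF True adm K f] by blast
      have "D * \<phi> n powr (1 / 2) \<le> (D + F * real N0 powr (1 / 2)) * \<phi> n powr (1 / 2)"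
        using F by (intro mult_right_mono) auto
      then show ?thesis using g order_trans by blast
    next
      case False
      have "0 \<le> c3 * (real n * \<phi> n * ln (real n))"
        using c n rate_pos[of n] by simp
      then have "0 \<le> s" using adm by (simp add: admissible_def)
      then obtain g where g: "g \<in> network_class L p s F" "\<forall>x. g x 0 = 0"
        using zero_in_network_class[of L p s F] adm F by (auto simp: admissible_def)
      have "\<bar>g x 0 - f x\<bar> \<le> (D + F * real N0 powr (1 / 2)) * \<phi> n powr (1 / 2)" if "x \<in> cube (d 0) 0 1" for x
      proof -
        have "\<bar>g x 0 - f x\<bar> \<le> (F * real N0 powr (1 / 2)) * \<phi> n powr (1 / 2)"
          using composition_class_regular(2)[OF K f that] small[of n] n False g(2) by simp
        also have "\<dots> \<le> (D + F * real N0 powr (1 / 2)) * \<phi> n powr (1 / 2)"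
          using D0 by (intro mult_right_mono) auto
        finally show ?thesis .
      qed
      then show ?thesis using g(1) by blast
    qed
  qed
qed

end

section \<open>Comparison of the two risks and the theorem\<close>

context composition_model
begin

text \<open>The oracle inequality with \<delta> = 1/n and \<epsilon> = Ca times the square root of
  \<phi> n. Every remainder is a multiple of \<phi> n or an entropy term, and \<phi> n is at most
  the full rate divided by (ln 2)^2, because 1 \<le> L and ln 2 \<le> ln n.\<close>

lemma risk_comparison:
  "\<exists>A>0. \<forall>n L p s K P f0 fhat. 2 \<le> n \<longrightarrow> admissible n L p s \<longrightarrow> 0 \<le> K \<longrightarrow> K \<le> F \<longrightarrow>
    design_law (d 0) P \<longrightarrow> f0 \<in> composition_class q d t \<beta> K \<longrightarrow>
    estimator (d 0) n (network_class L p s F) fhat \<longrightarrow>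
    prediction_risk (d 0) P n fhat f0 \<le> 16 * delta_risk (d 0) P (network_class L p s F) n fhat f0
      + A * (\<phi> n * real L * (ln (real n))\<^sup>2) \<and>
    delta_risk (d 0) P (network_class L p s F) n fhat f0 \<le> 12 * prediction_risk (d 0) P n fhat f0
      + A * (\<phi> n * real L * (ln (real n))\<^sup>2)"
proof -
  obtain Ce where Ce: "0 \<le> Ce" "\<forall>n L p s. 2 \<le> n \<longrightarrow> admissible n L p s \<longrightarrow>
    (\<exists>N\<subseteq>network_class L p s F. finite N \<and>
      (\<forall>f\<in>network_class L p s F. \<exists>g\<in>N. \<forall>x\<in>cube (d 0) 0 1. \<bar>f x 0 - g x 0\<bar> \<le> 1 / real n) \<and>
      ln (2 * real (card N)) / real n \<le> Ce * (\<phi> n * real L * (ln (real n))\<^sup>2))"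
    using entropy_bound by (elim exE conjE)
  obtain Ca where Ca: "0 \<le> Ca" "\<forall>n L p s K f. 2 \<le> n \<longrightarrow> admissible n L p s \<longrightarrow> 0 \<le> K \<longrightarrow> K \<le> F \<longrightarrow>
    f \<in> composition_class q d t \<beta> K \<longrightarrow>
    (\<exists>g\<in>network_class L p s F. \<forall>x\<in>cube (d 0) 0 1. \<bar>g x 0 - f x\<bar> \<le> Ca * \<phi> n powr (1 / 2))"
    using network_approximation by (elim exE conjE)
  \<comment> \<open>Here 90 = 26 + 64 collects the terms in \<delta>, as 1/n^2 and 1/n are at most
    \<phi> n.\<close>
  define B where "B = 24 * Ca\<^sup>2 + 90"
  define A where "A = (256 + 16 * F\<^sup>2) * Ce + B / (ln 2)\<^sup>2"
  have B0: "0 < B" by (simp add: B_def add_nonneg_pos)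
  have A0: "0 < A" unfolding A_def using Ce(1) B0 by (intro add_nonneg_pos mult_nonneg_nonneg) auto
  show ?thesis
  proof (intro exI[of _ A] conjI[OF A0] allI impI)
    fix n L :: nat and p :: "nat \<Rightarrow> nat" and s K :: real and P f0 fhat
    assume n: "2 \<le> n" and adm: "admissible n L p s" and K: "0 \<le> K" "K \<le> F" and P: "design_law (d 0) P"
      and f0: "f0 \<in> composition_class q d t \<beta> K" and fhat: "estimator (d 0) n (network_class L p s F) fhat"
    let ?FF = "network_class L p s F" and ?r = "\<phi> n * real L * (ln (real n))\<^sup>2"
    let ?R = "prediction_risk (d 0) P n fhat f0" and ?D = "delta_risk (d 0) P ?FF n fhat f0"
    have p: "p 0 = d 0" "p (L + 1) = 1" "\<And>i. i \<le> L + 1 \<Longrightarrow> 0 < p i" and L: "1 \<le> L"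
      using adm by (auto simp: admissible_def)
    interpret R: regression "d 0" n P f0 F
      using n P F composition_class_regular[OF K f0] by unfold_locales auto
    obtain N where N: "N \<subseteq> ?FF" "finite N"
      "\<forall>f\<in>?FF. \<exists>g\<in>N. \<forall>x\<in>cube (d 0) 0 1. \<bar>f x 0 - g x 0\<bar> \<le> 1 / real n"
      "ln (2 * real (card N)) / real n \<le> Ce * ?r"
      using Ce(2)[THEN spec, THEN spec, THEN spec, THEN spec, THEN mp, THEN mp, OF n adm] by (elim exE conjE)
    note approx = Ca(2)[THEN spec[of _ n], THEN spec[of _ L], THEN spec[of _ p], THEN spec[of _ s], THEN spec[of _ K],
        THEN spec[of _ f0], THEN mp, THEN mp, THEN mp, THEN mp, THEN mp, OF n adm K f0]
    obtain fs where fs: "fs \<in> ?FF" "\<forall>x\<in>cube (d 0) 0 1. \<bar>fs x 0 - f0 x\<bar> \<le> Ca * \<phi> n powr (1 / 2)"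
      using approx by (elim bexE)
    let ?T = "(256 + 16 * F\<^sup>2) * (ln (2 * real (card N)) / real n) + 26 * (1 / real n)\<^sup>2 + 64 * (1 / real n)"
    let ?\<epsilon> = "Ca * \<phi> n powr (1 / 2)"
    have nets: "\<exists>N\<subseteq>?FF. finite N \<and> (\<forall>f\<in>?FF. \<exists>g\<in>N. \<forall>x\<in>cube (d 0) 0 1. \<bar>f x 0 - g x 0\<bar> \<le> \<delta>)" if "0 < \<delta>" for \<delta>
      by (rule ex_forward[OF network_class_cover[of p "d 0" L \<delta> "max (max (nat \<lfloor>s\<rfloor>) (d 0)) 1" s F]])
        (use p that in \<open>simp_all only: max.cobounded1 max.cobounded2 max.coboundedI1, blast\<close>)
    have "\<forall>f\<in>?FF. (\<lambda>x. f x 0) \<in> borel_measurable (cube_space (d 0))"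
      using network_class_measurable p(1) by blast
    moreover have "\<forall>f\<in>?FF. \<forall>x\<in>cube (d 0) 0 1. \<bar>f x 0\<bar> \<le> F"
      using network_class_bound[of _ L p s F "d 0"] p by simp
    moreover have "0 < 1 / real n" using n by simp
    ultimately have ineq: "?R \<le> 16 * ?D + 24 * ?\<epsilon>\<^sup>2 + ?T" "?D \<le> 12 * ?R + ?T"
      using R.oracle_inequality[OF _ _ nets N(1,2) _ N(3) fhat fs(1), of ?\<epsilon>] fs(2) by auto
    have \<phi>: "0 < \<phi> n" "1 / real n \<le> \<phi> n" using rate_pos[of n] inverse_le_rate[of n] n by auto
    have \<phi>r: "\<phi> n \<le> ?r / (ln 2)\<^sup>2"
    proof -
      have "\<phi> n * 1 * (ln 2)\<^sup>2 \<le> ?r" using \<phi> L n ln2_le_ln[OF n] by (intro mult_mono power_mono) auto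
      then show ?thesis by (simp add: pos_le_divide_eq)
    qed
    have "(1 / real n)\<^sup>2 \<le> 1 / real n * 1" unfolding power2_eq_square using n by (intro mult_left_mono) auto
    then have "26 * (1 / real n)\<^sup>2 + 64 * (1 / real n) \<le> 90 * \<phi> n" using \<phi>(2) by linarith
    then have "24 * (Ca\<^sup>2 * \<phi> n) + (26 * (1 / real n)\<^sup>2 + 64 * (1 / real n)) \<le> B * \<phi> n"
      by (simp add: B_def algebra_simps)
    moreover have "?\<epsilon>\<^sup>2 = Ca\<^sup>2 * \<phi> n"
      using \<phi>(1) by (simp add: power_mult_distrib powr_half_sqrt)
    ultimately have "24 * ?\<epsilon>\<^sup>2 + (26 * (1 / real n)\<^sup>2 + 64 * (1 / real n)) \<le> B * \<phi> n"
      by (simp only:)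
    also have "\<dots> \<le> B * (?r / (ln 2)\<^sup>2)" using B0 \<phi>r by (intro mult_left_mono) auto
    finally have "24 * ?\<epsilon>\<^sup>2 + (26 * (1 / real n)\<^sup>2 + 64 * (1 / real n)) \<le> B / (ln 2)\<^sup>2 * ?r" by simp
    moreover have "(256 + 16 * F\<^sup>2) * (ln (2 * real (card N)) / real n) \<le> (256 + 16 * F\<^sup>2) * (Ce * ?r)"
      using N(4) by (intro mult_left_mono) auto
    moreover have "A * ?r = (256 + 16 * F\<^sup>2) * (Ce * ?r) + B / (ln 2)\<^sup>2 * ?r" by (simp add: A_def algebra_simps)
    ultimately have "24 * ?\<epsilon>\<^sup>2 + ?T \<le> A * ?r" by linarith
    moreover have "0 \<le> 24 * ?\<epsilon>\<^sup>2" by simp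
    ultimately show "?R \<le> 16 * ?D + A * ?r \<and> ?D \<le> 12 * ?R + A * ?r"
      using ineq by linarith
  qed
qed

end

theorem theorem1:
  fixes q :: nat and d t :: "nat \<Rightarrow> nat" and \<beta> :: "nat \<Rightarrow> real" and F c1 c2 c3 c4 :: real
  assumes "d (q + 1) = 1"
    and "\<forall>i\<le>q. 1 \<le> t i \<and> t i \<le> d i"
    and "\<forall>i\<le>q. 0 < \<beta> i"
    and "c1 > 0" and "c2 > 0" and "c3 > 0" and "c4 > 0"
  shows "\<exists>C>0. \<exists>C'>0. \<forall>(K::real) (L :: nat \<Rightarrow> nat) (p :: nat \<Rightarrow> nat \<Rightarrow> nat) (s :: nat \<Rightarrow> real).
    K > 0 \<longrightarrow>
    max K 1 \<le> F \<longrightarrow>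
    (\<forall>n\<ge>2. 1 \<le> L n \<and> p n 0 = d 0 \<and> p n (L n + 1) = 1 \<and> (\<forall>i\<le>L n + 1. 0 < p n i)) \<longrightarrow>
    (\<forall>n\<ge>2. (\<Sum>i\<le>q. log 2 (max (4 * real (t i)) (4 * \<beta> i)) * log 2 (real n)) \<le> real (L n) \<and>
       real (L n) \<le> c1 * (real n * rate q t \<beta> n)) \<longrightarrow>
    (\<forall>n\<ge>2. real n * rate q t \<beta> n \<le> c2 * real (MIN i\<in>{1..L n}. p n i)) \<longrightarrow>
    (\<forall>n\<ge>2. c3 * (real n * rate q t \<beta> n * ln (real n)) \<le> s n \<and>
       s n \<le> c4 * (real n * rate q t \<beta> n * ln (real n))) \<longrightarrow>
    (\<forall>n\<ge>2. \<forall>P f0 fhat.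
       design_law (d 0) P \<longrightarrow>
       f0 \<in> composition_class q d t \<beta> K \<longrightarrow>
       estimator (d 0) n (network_class (L n) (p n) (s n) F) fhat \<longrightarrow>
       (let \<Delta> = delta_risk (d 0) P (network_class (L n) (p n) (s n) F) n fhat f0;
            R = prediction_risk (d 0) P n fhat f0;
            r = rate q t \<beta> n * real (L n) * (ln (real n))\<^sup>2
        in (\<Delta> \<le> C * r \<longrightarrow> R \<le> C' * r) \<and>
           (\<Delta> \<ge> C * r \<longrightarrow> 1 / C' * \<Delta> \<le> R \<and> R \<le> C' * \<Delta>)))"
proof (cases "1 \<le> F")
  \<comment> \<open>For F < 1 the hypothesis \<open>max K 1 \<le> F\<close> fails for every
    \<open>K\<close>, so any constants will do.\<close>
  case False
  then show ?thesis by (intro exI[of _ "1::real"] conjI) auto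
next
  case True
  interpret composition_model q d t \<beta> F c1 c2 c3 c4
    using assms True by unfold_locales auto
  obtain A where A: "0 < A" "\<forall>n L p s K P f0 fhat. 2 \<le> n \<longrightarrow> admissible n L p s \<longrightarrow> 0 \<le> K \<longrightarrow> K \<le> F \<longrightarrow>
    design_law (d 0) P \<longrightarrow> f0 \<in> composition_class q d t \<beta> K \<longrightarrow>
    estimator (d 0) n (network_class L p s F) fhat \<longrightarrow>
    prediction_risk (d 0) P n fhat f0 \<le> 16 * delta_risk (d 0) P (network_class L p s F) n fhat f0
      + A * (\<phi> n * real L * (ln (real n))\<^sup>2) \<and>
    delta_risk (d 0) P (network_class L p s F) n fhat f0 \<le> 12 * prediction_risk (d 0) P n fhat f0
      + A * (\<phi> n * real L * (ln (real n))\<^sup>2)"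
    using risk_comparison by (elim exE conjE)
  show ?thesis
    unfolding Let_def
  \<comment> \<open>Below the threshold 2 A r the risk R is at most 32 A r + A r. Above it A r is at
    most half of D, the optimisation error, so D \<le> 12 R + D/2 yields D \<le> 24 R, and R \<le>
    16 D + D/2. The constant 33 A + 24 dominates all three factors.\<close>
  proof (rule exI[of _ "2 * A"], rule conjI, use A(1) in simp,
      rule exI[of _ "33 * A + 24"], rule conjI, use A(1) in simp, intro allI impI)
    fix K :: real and L :: "nat \<Rightarrow> nat" and p :: "nat \<Rightarrow> nat \<Rightarrow> nat" and s :: "nat \<Rightarrow> real" and n :: nat and P f0 fhat
    assume K: "K > 0" "max K 1 \<le> F"
      and arch: "\<forall>n\<ge>2. 1 \<le> L n \<and> p n 0 = d 0 \<and> p n (L n + 1) = 1 \<and> (\<forall>i\<le>L n + 1. 0 < p n i)"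
      and depth: "\<forall>n\<ge>2. (\<Sum>i\<le>q. log 2 (max (4 * real (t i)) (4 * \<beta> i)) * log 2 (real n)) \<le> real (L n) \<and>
        real (L n) \<le> c1 * (real n * \<phi> n)"
      and width: "\<forall>n\<ge>2. real n * \<phi> n \<le> c2 * real (MIN i\<in>{1..L n}. p n i)"
      and sparsity: "\<forall>n\<ge>2. c3 * (real n * \<phi> n * ln (real n)) \<le> s n \<and> s n \<le> c4 * (real n * \<phi> n * ln (real n))"
      and n: "2 \<le> n" and P: "design_law (d 0) P" and f0: "f0 \<in> composition_class q d t \<beta> K"
      and fhat: "estimator (d 0) n (network_class (L n) (p n) (s n) F) fhat"
    let ?D = "delta_risk (d 0) P (network_class (L n) (p n) (s n) F) n fhat f0"
    let ?R = "prediction_risk (d 0) P n fhat f0" and ?r = "\<phi> n * real (L n) * (ln (real n))\<^sup>2"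
    have adm: "admissible n (L n) (p n) (s n)"
      unfolding admissible_def using arch depth width sparsity n by simp
    have K': "0 \<le> K" "K \<le> F" using K by auto
    note bounds = A(2)[THEN spec, THEN spec, THEN spec, THEN spec, THEN spec, THEN spec, THEN spec, THEN spec,
      THEN mp, THEN mp, THEN mp, THEN mp, THEN mp, THEN mp, THEN mp, OF n adm K' P f0 fhat]
    have Ar: "0 \<le> A * ?r" using A(1) rate_pos[of n] n by simp
    have R: "?R \<le> 16 * ?D + A * ?r" and D: "?D \<le> 12 * ?R + A * ?r" using bounds by auto
    show "(?D \<le> 2 * A * ?r \<longrightarrow> ?R \<le> (33 * A + 24) * ?r) \<and>
      (2 * A * ?r \<le> ?D \<longrightarrow> 1 / (33 * A + 24) * ?D \<le> ?R \<and> ?R \<le> (33 * A + 24) * ?D)"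
    proof (intro conjI impI)
      assume "?D \<le> 2 * A * ?r"
      then have "?R \<le> 33 * (A * ?r)" using R by simp
      also have "\<dots> \<le> 33 * (A * ?r) + 24 * ?r" using rate_pos[of n] n by simp
      finally show "?R \<le> (33 * A + 24) * ?r" by (simp add: algebra_simps)
    next
      assume "2 * A * ?r \<le> ?D"
      then have D2: "2 * (A * ?r) \<le> ?D" by simp
      have D0: "0 \<le> ?D" using D2 Ar by linarith
      have "?D \<le> 24 * ?R" using D D2 by linarith
      also have "\<dots> \<le> (33 * A + 24) * ?R" using A(1) D0 calculation by (intro mult_right_mono) auto
      finally show "1 / (33 * A + 24) * ?D \<le> ?R" using A(1) by (simp add: pos_divide_le_eq mult.commute)
      have "?R \<le> 24 * ?D" using R D2 D0 by linarith
      also have "\<dots> \<le> (33 * A + 24) * ?D" using A(1) D0 by (intro mult_right_mono) auto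
      finally show "?R \<le> (33 * A + 24) * ?D" .
    qed
  qed
qed

end
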